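(* Let $\alpha,\beta,\alpha',\beta'$ be dimension vectors with $\alpha+\beta=\alpha'+\beta'$. Let $\mathcal{N}$ be the set of quadruples of dimension vectors $\lambda=(\alpha_1,\alpha_2,\beta_1,\beta_2)$ with $\alpha=\alpha_1+\alpha_2$, $\beta=\beta_1+\beta_2$, $\alpha'=\alpha_1+\beta_1$, $\beta'=\alpha_2+\beta_2$. Then $\delta_{\alpha',\beta'}\underline{m}_{\alpha,\beta}=\underline{m}\,\delta$, i.e. for all $f\in\mathcal{CF}^F_\alpha$ and $g\in\mathcal{CF}^F_\beta$, $$\delta_{\alpha',\beta'}(f*g)=\sum_{\lambda\in\mathcal{N}}q^{-\langle\alpha_1,\beta_2\rangle}\,(\underline{m}_{\alpha_1,\beta_1}\otimes\underline{m}_{\alpha_2,\beta_2})\Big(\tau_{23}\big(\delta_{\alpha_1,\alpha_2}(f)\otimes\delta_{\beta_1,\beta_2}(g)\big)\Big)$$ in $\mathcal{CF}^F_{\alpha'}\otimes\mathcal{CF}^F_{\beta'}$, where $\tau_{23}$ interchanges the second and third tensor factors.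
   Context: $k=\mathbb{F}_q$ is a finite field of characteristic $p$, $\mathbb{K}=\overline{\mathbb{F}}_q$, $l\neq p$ a prime. $Q=(Q_0,Q_1,s,t)$ is a finite quiver. For $\alpha\in\mathbb{N}Q_0$, $\mathbb{E}_\alpha=\bigoplus_{h\in Q_1}\mathrm{Hom}_{\mathbb{K}}(\mathbb{K}^{\alpha_{s(h)}},\mathbb{K}^{\alpha_{t(h)}})$ with action of $G_\alpha=\prod_{i}GL(\alpha_i,\mathbb{K})$ by $(g\cdot x)_h=g_{t(h)}x_hg_{s(h)}^{-1}$; a superscript $F$ denotes points fixed by the Frobenius $F$ ($q$-th power on coordinates), i.e. $\mathbb{F}_q$-points. $\mathcal{CF}^F_\alpha$ is the $\overline{\mathbb{Q}}_l$-space of $G_\alpha^F$-invariant functions $\mathbb{E}_\alpha^F\to\overline{\mathbb{Q}}_l$, and $\mathcal{CF}^F_\alpha\otimes\mathcal{CF}^F_\beta$ is identified with the $G^F_\alpha\times G^F_\beta$-invariant functions on $\mathbb{E}^F_\alpha\times\mathbb{E}^F_\beta$. $\langle\alpha,\beta\rangle=\sum_i\alpha_i\beta_i-\sum_h\alpha_{s(h)}\beta_{t(h)}$. For a map $\phi:X\to Y$ of finite sets, $\phi_!(f)(y)=\sum_{x\in\phi^{-1}(y)}f(x)$ and $\phi^*(g)=g\circ\phi$. Multiplication: $\mathbb{E}''$ is the set of pairs $(x,W)$, $x\in\mathbb{E}_{\alpha+\beta}$, $W\subset\mathbb{K}^{\alpha+\beta}$ an $x$-stable graded subspace of dimension vector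 $\beta$; $\mathbb{E}'$ is the set of $(x,W,\rho_1,\rho_2)$ with $(x,W)\in\mathbb{E}''$ and graded isomorphisms $\rho_1:\mathbb{K}^{\alpha+\beta}/W\cong\mathbb{K}^\alpha$, $\rho_2:W\cong\mathbb{K}^\beta$. In $\mathbb{E}_\alpha\times\mathbb{E}_\beta\xleftarrow{p_1}\mathbb{E}'\xrightarrow{p_2}\mathbb{E}''\xrightarrow{p_3}\mathbb{E}_{\alpha+\beta}$, $p_1$ transports the representations induced by $x$ on quotient and subspace via $\rho_1,\rho_2$, and $p_2,p_3$ are projections. On $F$-fixed points, $\underline{m}_{\alpha,\beta}=|G^F_\alpha\times G^F_\beta|^{-1}(p_3)_!(p_2)_!p_1^*$, and $f*g=\underline{m}_{\alpha,\beta}(f\otimes g)$. Comultiplication: with $W=\mathbb{K}^\beta\subset\mathbb{K}^{\alpha+\beta}=\mathbb{K}^\alpha\oplus\mathbb{K}^\beta$, let $F_{\alpha,\beta}\subset\mathbb{E}_{\alpha+\beta}$ be the set of $x$ stabilizing $W$, $i$ its inclusion, and $\kappa:F_{\alpha,\beta}\to\mathbb{E}_\alpha\times\mathbb{E}_\beta$, $x\mapsto$ (representation on $\mathbb{K}^{\alpha+\beta}/W$, representation on $W$). On $F$-fixed points, $\tilde\delta_{\alpha,\beta}=\kappa_!i^*$ and $\delta_{\alpha,\beta}=q^{-\sum_i\alpha_i\beta_i}\tilde\delta_{\alpha,\beta}:\mathcal{CF}^F_{\alpha+\beta}\to\mathcal{CF}^F_\alpha\otimes\mathcal{CF}^F_\beta$.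 *)

theory Defs
  imports
    "HOL-Library.Function_Algebras"
    "HOL-Algebra.Algebraic_Closure_Type"
    "Jordan_Normal_Form.VS_Connect"
    "Graph_Theory.Digraph"
    "Berlekamp_Zassenhaus.Finite_Field"
begin

section \<open>The coefficient field\<close>

text \<open>The ring \<open>\<int>\<^sub>l\<close> is the inverse limit of the rings \<open>\<int>/l\<^sup>n\<close>, whose elements are represented by
  integers in \<open>{0..<l\<^sup>n}\<close>; the prime \<open>l\<close> is the cardinality of the type parameter.\<close>

typedef 'l padic_int = "{f :: nat \<Rightarrow> int. \<forall>n. f n = f (Suc n) mod int CARD('l) ^ n}"
  morphisms padic_digits Abs_padic_int
  by (rule exI[of _ "\<lambda>_. 0"]) simp

setup_lifting type_definition_padic_int

lemma padic_digits_Suc: "padic_digits (x :: 'l padic_int) (Suc n) mod int CARD('l) ^ n = padic_digits x n"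
  using padic_digits[of x] unfolding mem_Collect_eq by metis

lemma padic_digits_mod:
  assumes "m \<le> n"
  shows "padic_digits (x :: 'l padic_int) n mod int CARD('l) ^ m = padic_digits x m"
  using assms
proof (induction n rule: dec_induct)
  case base
  show ?case
    by (metis padic_digits_Suc mod_mod_trivial)
next
  case (step n)
  have "padic_digits x (Suc n) mod int CARD('l) ^ m =
      padic_digits x (Suc n) mod int CARD('l) ^ n mod int CARD('l) ^ m"
    using step(1) by (intro mod_mod_cancel[symmetric] le_imp_power_dvd) auto
  then show ?case using step by (simp only: padic_digits_Suc)
qed

lemma padic_int_eqI:
  assumes "\<And>n. padic_digits x n = padic_digits y n"
  shows "x = y"
proof -
  have "padic_digits x = padic_digits y" using assms by (rule ext)
  then show ?thesis by (simp only: padic_digits_inject)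
qed

lemma mod_power_cancel: "a mod (l :: int) ^ (Suc n) mod l ^ n = a mod l ^ n"
  by (rule mod_mod_cancel) simp

instantiation padic_int :: (prime_card) comm_ring_1
begin

lift_definition zero_padic_int :: "'a padic_int" is "\<lambda>n. 0" by simp

lift_definition one_padic_int :: "'a padic_int" is "\<lambda>n. 1 mod int CARD('a) ^ n"
  by (simp only: mod_power_cancel)

lift_definition plus_padic_int :: "'a padic_int \<Rightarrow> 'a padic_int \<Rightarrow> 'a padic_int"
  is "\<lambda>f g n. (f n + g n) mod int CARD('a) ^ n"
  by (metis mod_add_eq mod_power_cancel)

lift_definition minus_padic_int :: "'a padic_int \<Rightarrow> 'a padic_int \<Rightarrow> 'a padic_int"
  is "\<lambda>f g n. (f n - g n) mod int CARD('a) ^ n"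
  by (metis mod_diff_eq mod_power_cancel)

lift_definition uminus_padic_int :: "'a padic_int \<Rightarrow> 'a padic_int"
  is "\<lambda>f n. (- f n) mod int CARD('a) ^ n"
  by (metis mod_minus_eq mod_power_cancel)

lift_definition times_padic_int :: "'a padic_int \<Rightarrow> 'a padic_int \<Rightarrow> 'a padic_int"
  is "\<lambda>f g n. (f n * g n) mod int CARD('a) ^ n"
  by (metis mod_mult_eq mod_power_cancel)

instance
proof
  fix a b c :: "'a padic_int"
  note digits = zero_padic_int.rep_eq one_padic_int.rep_eq plus_padic_int.rep_eq
    minus_padic_int.rep_eq uminus_padic_int.rep_eq times_padic_int.rep_eq
  show "a * b * c = a * (b * c)"
    by (rule padic_int_eqI) (simp add: digits mod_simps mult.assoc)
  show "a * b = b * a"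
    by (rule padic_int_eqI) (simp add: digits mod_simps mult.commute)
  show "1 * a = a"
    by (rule padic_int_eqI) (simp add: digits mod_simps padic_digits_mod)
  show "(a + b) * c = a * c + b * c"
    by (rule padic_int_eqI) (simp add: digits mod_simps distrib_right)
  show "a + b + c = a + (b + c)"
    by (rule padic_int_eqI) (simp add: digits mod_simps add.assoc)
  show "a + b = b + a"
    by (rule padic_int_eqI) (simp add: digits mod_simps add.commute)
  show "0 + a = a"
    by (rule padic_int_eqI) (simp add: digits mod_simps padic_digits_mod)
  show "- a + a = 0"
    by (rule padic_int_eqI) (simp add: digits mod_simps)
  show "a - b = a + - b"
    by (rule padic_int_eqI) (simp add: digits mod_simps)
  have "int CARD('a) > 1"
    using prime_card_int[where 'a = 'a] prime_gt_1_int by blast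
  then have "padic_digits (0 :: 'a padic_int) 1 \<noteq> padic_digits 1 1"
    by (simp add: digits)
  then show "(0 :: 'a padic_int) \<noteq> 1"
    by metis
qed

end

lemma padic_digits_eq_0_iff: "padic_digits (x :: 'l :: prime_card padic_int) n = 0 \<longleftrightarrow>
    int CARD('l) ^ n dvd padic_digits x (n + m)"
  by (metis le_add1 mod_0_imp_dvd dvd_imp_mod_0 padic_digits_mod)

instance padic_int :: (prime_card) idom
proof
  fix a b :: "'a padic_int"
  assume "a \<noteq> 0" "b \<noteq> 0"
  then obtain m n where mn: "padic_digits a m \<noteq> 0" "padic_digits b n \<noteq> 0"
    by (metis padic_digits_inject zero_padic_int.rep_eq ext)
  let ?l = "int CARD('a)"
  let ?a = "padic_digits a (m + n)" and ?b = "padic_digits b (n + m)"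
  have l: "prime_elem ?l" using prime_card_int by blast
  have nd: "\<not> ?l ^ m dvd ?a" "\<not> ?l ^ n dvd ?b"
    using mn padic_digits_eq_0_iff by blast+
  then have "?a \<noteq> 0" "?b \<noteq> 0" by auto
  have "\<not> ?l ^ (m + n) dvd ?a * ?b"
  proof
    assume "?l ^ (m + n) dvd ?a * ?b"
    then have "m + n \<le> multiplicity ?l (?a * ?b)"
      using \<open>?a \<noteq> 0\<close> \<open>?b \<noteq> 0\<close> l
      by (intro multiplicity_geI) (auto simp: prime_elem_not_unit)
    also have "\<dots> = multiplicity ?l ?a + multiplicity ?l ?b"
      using \<open>?a \<noteq> 0\<close> \<open>?b \<noteq> 0\<close> l by (simp add: prime_elem_multiplicity_mult_distrib)
    also have "\<dots> < m + n"
      using nd by (metis add_strict_mono multiplicity_dvd' not_le)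
    finally show False by simp
  qed
  then have "padic_digits (a * b) (m + n) \<noteq> 0"
    by (simp add: times_padic_int.rep_eq add.commute dvd_eq_mod_eq_0)
  then show "a * b \<noteq> 0" by (auto simp: zero_padic_int.rep_eq)
qed

instance padic_int :: (prime_card) ring_char_0
proof
  have digits: "padic_digits (of_nat k :: 'a padic_int) n = int k mod int CARD('a) ^ n" for k n
    by (induction k)
      (simp_all add: zero_padic_int.rep_eq plus_padic_int.rep_eq one_padic_int.rep_eq mod_simps)
  show "inj (of_nat :: nat \<Rightarrow> 'a padic_int)"
  proof (rule injI)
    fix j k :: nat
    assume eq: "(of_nat j :: 'a padic_int) = of_nat k"
    have l: "CARD('a) > 1"
      using prime_card[where 'a = 'a] prime_gt_1_nat by blast
    have "j + k < CARD('a) ^ (j + k)"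
      using l by (intro power_gt_expt) simp
    then have "int j < int CARD('a) ^ (j + k)" "int k < int CARD('a) ^ (j + k)"
      by (simp_all flip: of_nat_power)
    then show "j = k"
      using arg_cong[OF eq, of "\<lambda>x. padic_digits x (j + k)"] by (simp add: digits)
  qed
qed

instance fract :: ("{idom, ring_char_0}") field_char_0
proof
  show "inj (of_nat :: nat \<Rightarrow> 'a fract)"
    by (rule injI) (simp add: of_nat_fract eq_fract(1))
qed

type_synonym 'l qlbar = "'l padic_int fract alg_closure"


section \<open>Representations of a quiver\<close>

text \<open>A finite quiver is a finite directed multigraph \<open>Q\<close> with source map \<open>tail Q\<close> and target map
  \<open>head Q\<close>. Representations live over \<open>\<bbbK> = 'k alg_closure\<close>, where \<open>'k\<close> is the finite field \<open>\<bbbF>\<^sub>q\<close> and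
  \<open>q = CARD('k)\<close>. Families indexed by vertices or arrows, and functions on a set, are extensional,
  so that they are determined by their values on that set.\<close>

type_synonym ('h, 'k) rep = "'h \<Rightarrow> 'k alg_closure mat"

definition dim_vectors :: "('v, 'h) pre_digraph \<Rightarrow> ('v \<Rightarrow> nat) set" where
  "dim_vectors Q = {\<alpha>. \<forall>i. i \<notin> verts Q \<longrightarrow> \<alpha> i = 0}"

definition euler_form :: "('v, 'h) pre_digraph \<Rightarrow> ('v \<Rightarrow> nat) \<Rightarrow> ('v \<Rightarrow> nat) \<Rightarrow> int" where
  "euler_form Q \<alpha> \<beta> = (\<Sum>i\<in>verts Q. int (\<alpha> i) * int (\<beta> i))
     - (\<Sum>h\<in>arcs Q. int (\<alpha> (tail Q h)) * int (\<beta> (head Q h)))"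

definition rep_space :: "('v, 'h) pre_digraph \<Rightarrow> ('v \<Rightarrow> nat) \<Rightarrow> ('h, 'k :: field) rep set" where
  "rep_space Q \<alpha> = (\<Pi>\<^sub>E h\<in>arcs Q. carrier_mat (\<alpha> (head Q h)) (\<alpha> (tail Q h)))"

definition gl :: "('v, 'h) pre_digraph \<Rightarrow> ('v \<Rightarrow> nat) \<Rightarrow> ('v \<Rightarrow> 'k :: field alg_closure mat) set" where
  "gl Q \<alpha> = (\<Pi>\<^sub>E i\<in>verts Q. Units (ring_mat TYPE('k alg_closure) (\<alpha> i) ()))"

definition gl_act :: "('v, 'h) pre_digraph \<Rightarrow> ('v \<Rightarrow> nat) \<Rightarrow> ('v \<Rightarrow> 'k :: field alg_closure mat) \<Rightarrow>
    ('h, 'k) rep \<Rightarrow> ('h, 'k) rep" where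
  "gl_act Q \<alpha> g x = (\<lambda>h\<in>arcs Q. g (head Q h) * x h *
     inv\<^bsub>ring_mat TYPE('k alg_closure) (\<alpha> (tail Q h)) ()\<^esub> g (tail Q h))"

definition frob :: "'k :: {field, finite} alg_closure \<Rightarrow> 'k alg_closure" where
  "frob a = a ^ CARD('k)"

definition rep_space_F :: "('v, 'h) pre_digraph \<Rightarrow> ('v \<Rightarrow> nat) \<Rightarrow> ('h, 'k :: {field, finite}) rep set" where
  "rep_space_F Q \<alpha> = {x \<in> rep_space Q \<alpha>. \<forall>h\<in>arcs Q. map_mat frob (x h) = x h}"

definition gl_F :: "('v, 'h) pre_digraph \<Rightarrow> ('v \<Rightarrow> nat) \<Rightarrow>
    ('v \<Rightarrow> 'k :: {field, finite} alg_closure mat) set" where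
  "gl_F Q \<alpha> = {g \<in> gl Q \<alpha>. \<forall>i\<in>verts Q. map_mat frob (g i) = g i}"

definition CF :: "('v, 'h) pre_digraph \<Rightarrow> ('v \<Rightarrow> nat) \<Rightarrow> (('h, 'k :: {field, finite}) rep \<Rightarrow> 'c) set" where
  "CF Q \<alpha> = {f \<in> extensional (rep_space_F Q \<alpha>).
     \<forall>g\<in>gl_F Q \<alpha>. \<forall>x\<in>rep_space_F Q \<alpha>. f (gl_act Q \<alpha> g x) = f x}"


section \<open>Graded subspaces, quotients and induced representations\<close>

abbreviation kvec :: "nat \<Rightarrow> ('a :: field, 'a vec) module" where
  "kvec n \<equiv> module_vec TYPE('a) n"

definition graded_subspaces :: "('v, 'h) pre_digraph \<Rightarrow> ('v \<Rightarrow> nat) \<Rightarrow> ('v \<Rightarrow> nat) \<Rightarrow>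
    ('v \<Rightarrow> 'a :: field vec set) set" where
  "graded_subspaces Q \<gamma> \<beta> = {W \<in> extensional (verts Q). \<forall>i\<in>verts Q.
     VectorSpace.subspace class_ring (W i) (kvec (\<gamma> i)) \<and>
     vectorspace.dim class_ring ((kvec (\<gamma> i))\<lparr>carrier := W i\<rparr>) = \<beta> i}"

definition stabilizes :: "('v, 'h) pre_digraph \<Rightarrow> ('h \<Rightarrow> 'a :: field mat) \<Rightarrow> ('v \<Rightarrow> 'a vec set) \<Rightarrow> bool" where
  "stabilizes Q x W \<longleftrightarrow> (\<forall>h\<in>arcs Q. \<forall>v\<in>W (tail Q h). x h *\<^sub>v v \<in> W (head Q h))"

definition quot_module :: "('a, 'b) module \<Rightarrow> 'b set \<Rightarrow> ('a, 'b set) module" where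
  "quot_module V W = \<lparr>
     carrier = a_rcosets\<^bsub>V\<^esub> W,
     monoid.mult = undefined,
     one = undefined,
     zero = W,
     add = (\<lambda>A B. A <+>\<^bsub>V\<^esub> B),
     module.smult = (\<lambda>c A. \<Union>a\<in>A. W +>\<^bsub>V\<^esub> (c \<odot>\<^bsub>V\<^esub> a))\<rparr>"

definition lin_isos :: "('a :: field, 'b) module \<Rightarrow> ('a, 'c) module \<Rightarrow> ('b \<Rightarrow> 'c) set" where
  "lin_isos V U = {T \<in> extensional (carrier V). T \<in> module_hom class_ring V U \<and>
     bij_betw T (carrier V) (carrier U)}"

text \<open>The matrix, in the standard bases, of a linear map \<open>\<phi>\<close> from \<open>\<bbbK>\<^sup>n\<close> to \<open>\<bbbK>\<^sup>m\<close>.\<close>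

definition mat_of_map :: "nat \<Rightarrow> nat \<Rightarrow> ('a :: field vec \<Rightarrow> 'a vec) \<Rightarrow> 'a mat" where
  "mat_of_map n m \<phi> = mat m n (\<lambda>(r, c). \<phi> (unit_vec n c) $ r)"

text \<open>The representation induced by \<open>x\<close> on \<open>\<bbbK>\<^sup>\<gamma>/W\<close>, transported to \<open>\<bbbK>\<^sup>\<alpha>\<close> along \<open>\<rho>\<close>: the arrow \<open>h\<close> acts by
  \<open>\<rho>\<^sub>t\<^sub>(\<^sub>h\<^sub>) \<circ> x\<^sub>h \<circ> \<rho>\<^sub>s\<^sub>(\<^sub>h\<^sub>)\<inverse>\<close>, where \<open>x\<^sub>h\<close> sends the coset \<open>A\<close> to the union of the equal cosets \<open>x\<^sub>h a + W\<close>, \<open>a \<in> A\<close>.\<close>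

definition quot_rep :: "('v, 'h) pre_digraph \<Rightarrow> ('v \<Rightarrow> nat) \<Rightarrow> ('v \<Rightarrow> nat) \<Rightarrow> ('h \<Rightarrow> 'a :: field mat) \<Rightarrow>
    ('v \<Rightarrow> 'a vec set) \<Rightarrow> ('v \<Rightarrow> 'a vec set \<Rightarrow> 'a vec) \<Rightarrow> ('h \<Rightarrow> 'a mat)" where
  "quot_rep Q \<gamma> \<alpha> x W \<rho> = (\<lambda>h\<in>arcs Q. mat_of_map (\<alpha> (tail Q h)) (\<alpha> (head Q h))
     (\<lambda>u. \<rho> (head Q h) (\<Union>a\<in>the_inv_into (carrier (quot_module (kvec (\<gamma> (tail Q h))) (W (tail Q h))))
                                (\<rho> (tail Q h)) u.
        W (head Q h) +>\<^bsub>kvec (\<gamma> (head Q h))\<^esub> (x h *\<^sub>v a))))"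

definition sub_rep :: "('v, 'h) pre_digraph \<Rightarrow> ('v \<Rightarrow> nat) \<Rightarrow> ('h \<Rightarrow> 'a :: field mat) \<Rightarrow>
    ('v \<Rightarrow> 'a vec set) \<Rightarrow> ('v \<Rightarrow> 'a vec \<Rightarrow> 'a vec) \<Rightarrow> ('h \<Rightarrow> 'a mat)" where
  "sub_rep Q \<beta> x W \<rho> = (\<lambda>h\<in>arcs Q. mat_of_map (\<beta> (tail Q h)) (\<beta> (head Q h))
     (\<lambda>u. \<rho> (head Q h) (x h *\<^sub>v the_inv_into (W (tail Q h)) (\<rho> (tail Q h)) u)))"


section \<open>Functions on finite sets\<close>

definition push :: "'x set \<Rightarrow> 'y set \<Rightarrow> ('x \<Rightarrow> 'y) \<Rightarrow> ('x \<Rightarrow> 'c :: comm_monoid_add) \<Rightarrow> 'y \<Rightarrow> 'c" where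
  "push S T \<phi> f = (\<lambda>y\<in>T. \<Sum>x\<in>{x \<in> S. \<phi> x = y}. f x)"

definition pull :: "'x set \<Rightarrow> ('x \<Rightarrow> 'y) \<Rightarrow> ('y \<Rightarrow> 'c) \<Rightarrow> 'x \<Rightarrow> 'c" where
  "pull S \<phi> g = (\<lambda>x\<in>S. g (\<phi> x))"

text \<open>Tensor products of function spaces are identified with spaces of functions on products; under
  this identification \<open>T\<^sub>1 \<otimes> T\<^sub>2\<close> applies \<open>T\<^sub>1\<close> in the first and \<open>T\<^sub>2\<close> in the second variable.\<close>

definition tensor :: "('x \<Rightarrow> 'c :: times) \<Rightarrow> ('y \<Rightarrow> 'c) \<Rightarrow> 'x \<times> 'y \<Rightarrow> 'c" where
  "tensor f g = (\<lambda>(x, y). f x * g y)"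

definition tensor_op :: "(('x \<Rightarrow> 'c) \<Rightarrow> 'u \<Rightarrow> 'c) \<Rightarrow> (('y \<Rightarrow> 'c) \<Rightarrow> 'v \<Rightarrow> 'c) \<Rightarrow>
    ('x \<times> 'y \<Rightarrow> 'c) \<Rightarrow> 'u \<times> 'v \<Rightarrow> 'c" where
  "tensor_op T1 T2 \<Phi> = (\<lambda>(u, v). T1 (\<lambda>x. T2 (\<lambda>y. \<Phi> (x, y)) v) u)"

definition swap23 :: "(('x \<times> 'y) \<times> ('z \<times> 'w) \<Rightarrow> 'c) \<Rightarrow> ('x \<times> 'z) \<times> ('y \<times> 'w) \<Rightarrow> 'c" where
  "swap23 \<Phi> = (\<lambda>((x, z), (y, w)). \<Phi> ((x, y), (z, w)))"


section \<open>Multiplication\<close>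

text \<open>The correspondence is \<open>\<bbbE>\<^sub>\<alpha> \<times> \<bbbE>\<^sub>\<beta> \<leftarrow> E1 \<rightarrow> E2 \<rightarrow> \<bbbE>\<^sub>\<alpha>\<^sub>+\<^sub>\<beta>\<close> with maps \<open>p1\<close>, \<open>p2\<close>, \<open>p3\<close>; the suffix \<open>_F\<close> denotes
  Frobenius-fixed points.\<close>

definition E2 :: "('v, 'h) pre_digraph \<Rightarrow> ('v \<Rightarrow> nat) \<Rightarrow> ('v \<Rightarrow> nat) \<Rightarrow>
    (('h, 'k :: field) rep \<times> ('v \<Rightarrow> 'k alg_closure vec set)) set" where
  "E2 Q \<alpha> \<beta> = {(x, W). x \<in> rep_space Q (\<alpha> + \<beta>) \<and> W \<in> graded_subspaces Q (\<alpha> + \<beta>) \<beta> \<and> stabilizes Q x W}"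

definition E1 :: "('v, 'h) pre_digraph \<Rightarrow> ('v \<Rightarrow> nat) \<Rightarrow> ('v \<Rightarrow> nat) \<Rightarrow>
    (('h, 'k :: field) rep \<times> ('v \<Rightarrow> 'k alg_closure vec set) \<times>
     ('v \<Rightarrow> 'k alg_closure vec set \<Rightarrow> 'k alg_closure vec) \<times> ('v \<Rightarrow> 'k alg_closure vec \<Rightarrow> 'k alg_closure vec)) set" where
  "E1 Q \<alpha> \<beta> = {(x, W, \<rho>1, \<rho>2). (x, W) \<in> E2 Q \<alpha> \<beta> \<and>
     \<rho>1 \<in> (\<Pi>\<^sub>E i\<in>verts Q. lin_isos (quot_module (kvec ((\<alpha> + \<beta>) i)) (W i)) (kvec (\<alpha> i))) \<and>
     \<rho>2 \<in> (\<Pi>\<^sub>E i\<in>verts Q. lin_isos ((kvec ((\<alpha> + \<beta>) i))\<lparr>carrier := W i\<rparr>) (kvec (\<beta> i)))}"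

text \<open>Frobenius acts on vectors coordinatewise, on subspaces and cosets elementwise, and on a map \<open>\<rho>\<close> by
  conjugation; hence \<open>\<rho>\<close> is fixed iff it commutes with Frobenius.\<close>

definition E2_F :: "('v, 'h) pre_digraph \<Rightarrow> ('v \<Rightarrow> nat) \<Rightarrow> ('v \<Rightarrow> nat) \<Rightarrow>
    (('h, 'k :: {field, finite}) rep \<times> ('v \<Rightarrow> 'k alg_closure vec set)) set" where
  "E2_F Q \<alpha> \<beta> = {(x, W) \<in> E2 Q \<alpha> \<beta>. x \<in> rep_space_F Q (\<alpha> + \<beta>) \<and>
     (\<forall>i\<in>verts Q. map_vec frob ` W i = W i)}"

definition E1_F :: "('v, 'h) pre_digraph \<Rightarrow> ('v \<Rightarrow> nat) \<Rightarrow> ('v \<Rightarrow> nat) \<Rightarrow>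
    (('h, 'k :: {field, finite}) rep \<times> ('v \<Rightarrow> 'k alg_closure vec set) \<times>
     ('v \<Rightarrow> 'k alg_closure vec set \<Rightarrow> 'k alg_closure vec) \<times> ('v \<Rightarrow> 'k alg_closure vec \<Rightarrow> 'k alg_closure vec)) set" where
  "E1_F Q \<alpha> \<beta> = {(x, W, \<rho>1, \<rho>2) \<in> E1 Q \<alpha> \<beta>. (x, W) \<in> E2_F Q \<alpha> \<beta> \<and>
     (\<forall>i\<in>verts Q. \<forall>A\<in>carrier (quot_module (kvec ((\<alpha> + \<beta>) i)) (W i)).
        \<rho>1 i (map_vec frob ` A) = map_vec frob (\<rho>1 i A)) \<and>
     (\<forall>i\<in>verts Q. \<forall>w\<in>W i. \<rho>2 i (map_vec frob w) = map_vec frob (\<rho>2 i w))}"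

definition p1 :: "('v, 'h) pre_digraph \<Rightarrow> ('v \<Rightarrow> nat) \<Rightarrow> ('v \<Rightarrow> nat) \<Rightarrow>
    ('h, 'k :: field) rep \<times> ('v \<Rightarrow> 'k alg_closure vec set) \<times>
     ('v \<Rightarrow> 'k alg_closure vec set \<Rightarrow> 'k alg_closure vec) \<times> ('v \<Rightarrow> 'k alg_closure vec \<Rightarrow> 'k alg_closure vec) \<Rightarrow>
    ('h, 'k) rep \<times> ('h, 'k) rep" where
  "p1 Q \<alpha> \<beta> = (\<lambda>(x, W, \<rho>1, \<rho>2). (quot_rep Q (\<alpha> + \<beta>) \<alpha> x W \<rho>1, sub_rep Q \<beta> x W \<rho>2))"

definition p2 :: "'x \<times> 'w \<times> 'r \<times> 's \<Rightarrow> 'x \<times> 'w" where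
  "p2 = (\<lambda>(x, W, \<rho>1, \<rho>2). (x, W))"

definition p3 :: "'x \<times> 'w \<Rightarrow> 'x" where
  "p3 = (\<lambda>(x, W). x)"

definition mult_op :: "('v, 'h) pre_digraph \<Rightarrow> ('v \<Rightarrow> nat) \<Rightarrow> ('v \<Rightarrow> nat) \<Rightarrow>
    (('h, 'k :: {field, finite}) rep \<times> ('h, 'k) rep \<Rightarrow> 'c :: field) \<Rightarrow> ('h, 'k) rep \<Rightarrow> 'c" where
  "mult_op Q \<alpha> \<beta> \<Phi> = (\<lambda>x\<in>rep_space_F Q (\<alpha> + \<beta>).
     inverse (of_nat (card ((gl_F Q \<alpha> :: ('v \<Rightarrow> 'k alg_closure mat) set) \<times>
                            (gl_F Q \<beta> :: ('v \<Rightarrow> 'k alg_closure mat) set)))) *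
     push (E2_F Q \<alpha> \<beta>) (rep_space_F Q (\<alpha> + \<beta>)) p3
       (push (E1_F Q \<alpha> \<beta>) (E2_F Q \<alpha> \<beta>) p2 (pull (E1_F Q \<alpha> \<beta>) (p1 Q \<alpha> \<beta>) \<Phi>)) x)"

definition hall_mult :: "('v, 'h) pre_digraph \<Rightarrow> ('v \<Rightarrow> nat) \<Rightarrow> ('v \<Rightarrow> nat) \<Rightarrow>
    (('h, 'k :: {field, finite}) rep \<Rightarrow> 'c :: field) \<Rightarrow> (('h, 'k) rep \<Rightarrow> 'c) \<Rightarrow> ('h, 'k) rep \<Rightarrow> 'c" where
  "hall_mult Q \<alpha> \<beta> f g = mult_op Q \<alpha> \<beta> (tensor f g)"


section \<open>Comultiplication\<close>

text \<open>In \<open>\<bbbK>\<^sup>\<alpha> \<oplus> \<bbbK>\<^sup>\<beta>\<close> the coordinates of \<open>\<bbbK>\<^sup>\<alpha>\<close> come first. The quotient by \<open>W = \<bbbK>\<^sup>\<beta>\<close> is identified with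
  \<open>\<bbbK>\<^sup>\<alpha>\<close> by the first \<open>\<alpha>\<close> coordinates, which are constant on each coset of \<open>W\<close>.\<close>

definition std_subspace :: "('v, 'h) pre_digraph \<Rightarrow> ('v \<Rightarrow> nat) \<Rightarrow> ('v \<Rightarrow> nat) \<Rightarrow> 'v \<Rightarrow> 'a :: field vec set" where
  "std_subspace Q \<alpha> \<beta> = (\<lambda>i\<in>verts Q. {v \<in> carrier_vec (\<alpha> i + \<beta> i). vec_first v (\<alpha> i) = 0\<^sub>v (\<alpha> i)})"

definition std_quot_iso :: "('v, 'h) pre_digraph \<Rightarrow> ('v \<Rightarrow> nat) \<Rightarrow> ('v \<Rightarrow> nat) \<Rightarrow> 'v \<Rightarrow>
    'a :: field vec set \<Rightarrow> 'a vec" where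
  "std_quot_iso Q \<alpha> \<beta> = (\<lambda>i\<in>verts Q.
     \<lambda>A\<in>carrier (quot_module (kvec (\<alpha> i + \<beta> i)) (std_subspace Q \<alpha> \<beta> i)).
       the_elem ((\<lambda>v. vec_first v (\<alpha> i)) ` A))"

definition std_sub_iso :: "('v, 'h) pre_digraph \<Rightarrow> ('v \<Rightarrow> nat) \<Rightarrow> ('v \<Rightarrow> nat) \<Rightarrow> 'v \<Rightarrow>
    'a :: field vec \<Rightarrow> 'a vec" where
  "std_sub_iso Q \<alpha> \<beta> = (\<lambda>i\<in>verts Q. \<lambda>w\<in>std_subspace Q \<alpha> \<beta> i. vec_last w (\<beta> i))"

definition stab_reps :: "('v, 'h) pre_digraph \<Rightarrow> ('v \<Rightarrow> nat) \<Rightarrow> ('v \<Rightarrow> nat) \<Rightarrow> ('h, 'k :: field) rep set" where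
  "stab_reps Q \<alpha> \<beta> = {x \<in> rep_space Q (\<alpha> + \<beta>). stabilizes Q x (std_subspace Q \<alpha> \<beta>)}"

definition stab_reps_F :: "('v, 'h) pre_digraph \<Rightarrow> ('v \<Rightarrow> nat) \<Rightarrow> ('v \<Rightarrow> nat) \<Rightarrow>
    ('h, 'k :: {field, finite}) rep set" where
  "stab_reps_F Q \<alpha> \<beta> = stab_reps Q \<alpha> \<beta> \<inter> rep_space_F Q (\<alpha> + \<beta>)"

definition kappa :: "('v, 'h) pre_digraph \<Rightarrow> ('v \<Rightarrow> nat) \<Rightarrow> ('v \<Rightarrow> nat) \<Rightarrow> ('h, 'k :: field) rep \<Rightarrow>
    ('h, 'k) rep \<times> ('h, 'k) rep" where
  "kappa Q \<alpha> \<beta> x =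
     (quot_rep Q (\<alpha> + \<beta>) \<alpha> x (std_subspace Q \<alpha> \<beta>) (std_quot_iso Q \<alpha> \<beta>),
      sub_rep Q \<beta> x (std_subspace Q \<alpha> \<beta>) (std_sub_iso Q \<alpha> \<beta>))"

definition comult_tilde :: "('v, 'h) pre_digraph \<Rightarrow> ('v \<Rightarrow> nat) \<Rightarrow> ('v \<Rightarrow> nat) \<Rightarrow>
    (('h, 'k :: {field, finite}) rep \<Rightarrow> 'c :: field) \<Rightarrow> ('h, 'k) rep \<times> ('h, 'k) rep \<Rightarrow> 'c" where
  "comult_tilde Q \<alpha> \<beta> f = push (stab_reps_F Q \<alpha> \<beta>) (rep_space_F Q \<alpha> \<times> rep_space_F Q \<beta>) (kappa Q \<alpha> \<beta>)
     (pull (stab_reps_F Q \<alpha> \<beta>) (\<lambda>x. x) f)"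

definition comult :: "('v, 'h) pre_digraph \<Rightarrow> ('v \<Rightarrow> nat) \<Rightarrow> ('v \<Rightarrow> nat) \<Rightarrow>
    (('h, 'k :: {field, finite}) rep \<Rightarrow> 'c :: field) \<Rightarrow> ('h, 'k) rep \<times> ('h, 'k) rep \<Rightarrow> 'c" where
  "comult Q \<alpha> \<beta> f = (\<lambda>y\<in>rep_space_F Q \<alpha> \<times> rep_space_F Q \<beta>.
     of_nat CARD('k) powi (- (\<Sum>i\<in>verts Q. int (\<alpha> i) * int (\<beta> i))) * comult_tilde Q \<alpha> \<beta> f y)"


section \<open>The index set\<close>

definition refinements :: "('v, 'h) pre_digraph \<Rightarrow> ('v \<Rightarrow> nat) \<Rightarrow> ('v \<Rightarrow> nat) \<Rightarrow> ('v \<Rightarrow> nat) \<Rightarrow> ('v \<Rightarrow> nat) \<Rightarrow>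
    (('v \<Rightarrow> nat) \<times> ('v \<Rightarrow> nat) \<times> ('v \<Rightarrow> nat) \<times> ('v \<Rightarrow> nat)) set" where
  "refinements Q \<alpha> \<beta> \<alpha>' \<beta>' = {(\<alpha>1, \<alpha>2, \<beta>1, \<beta>2).
     \<alpha>1 \<in> dim_vectors Q \<and> \<alpha>2 \<in> dim_vectors Q \<and> \<beta>1 \<in> dim_vectors Q \<and> \<beta>2 \<in> dim_vectors Q \<and>
     \<alpha> = \<alpha>1 + \<alpha>2 \<and> \<beta> = \<beta>1 + \<beta>2 \<and> \<alpha>' = \<alpha>1 + \<beta>1 \<and> \<beta>' = \<alpha>2 + \<beta>2}"

end

theory Submission
  imports Defs
begin

text \<open>The idea is to write both operations as sums over matrices with entries in the finite field \<open>k\<close> with \<open>q\<close> elements,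
  and then to evaluate a sum over a finite group by splitting it into double cosets, as in Mackey's formula.

  For the translation, let \<open>\<gamma> = \<alpha> + \<beta>\<close> and let \<open>P\<close> be the parabolic subgroup of \<open>G = GL \<gamma>\<close> over \<open>k\<close> that stabilises the
  standard subspace of dimension \<open>\<beta>\<close>. A Frobenius-fixed representation is a family of matrices over \<open>k\<close>. A Frobenius-fixed
  graded subspace \<open>W\<close> of dimension \<open>\<beta>\<close> together with fixed identifications of \<open>W\<close> and of the quotient is the same as
  an element \<open>g\<close> of \<open>G\<close> up to left multiplication by the unipotent radical of \<open>P\<close>: the subspace is the kernel of the first
  \<open>\<alpha>\<close> coordinates of \<open>g\<close>, and the identifications are given by the first \<open>\<alpha>\<close> and the last \<open>\<beta>\<close> coordinates
  (\<open>Psi_surj\<close>, \<open>card_Psi_fibre\<close>). It is stable under \<open>x\<close> iff \<open>g x\<close> is block lower triangular, and then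
  the induced representations are the diagonal blocks of \<open>g x\<close> (\<open>stabilizes_iff\<close>, \<open>quot_rep_eq\<close>). Hence the product of \<open>f1\<close> and
  \<open>f2\<close> at \<open>x\<close> is the sum of \<open>f1 u * f2 v\<close> over all \<open>g\<close> with \<open>g x\<close> block lower triangular with diagonal blocks \<open>u, v\<close>,
  divided by the order of \<open>P\<close> (\<open>mult_op_eq_kmult\<close>). The coproduct at \<open>(u, v)\<close> is the normalised sum over
  all block lower triangular matrices with diagonal blocks \<open>u, v\<close> (\<open>comult_eq_kcomult\<close>).

  The coproduct of a product at \<open>(y1, y2)\<close> is therefore a double sum over \<open>x\<close> and \<open>g\<close>. For fixed \<open>g\<close>, call the inner sum
  \<open>H g\<close>. Multiplying \<open>g\<close> from the left by \<open>P\<close> does not change it, as \<open>f1\<close> and \<open>f2\<close> are invariant, and multiplying it from the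
  right by an element of the other parabolic subgroup \<open>P'\<close>, for \<open>\<alpha>' + \<beta>'\<close>, moves \<open>(y1, y2)\<close> by the Levi part of that element.
  The double cosets of \<open>P\<close> and \<open>P'\<close> are indexed by the refinements \<open>\<lambda> = (\<alpha>1, \<alpha>2, \<beta>1, \<beta>2)\<close>, with block permutation matrices
  \<open>w\<close> as representatives: Gaussian elimination shows that they cover the group (\<open>bruhat\<close>), and the rank of a block that they are
  disjoint (\<open>image_card_dcoset\<close>). So the sum over a double coset becomes a sum over the Levi group of \<open>P'\<close> of values
  of \<open>H\<close> at \<open>w\<close> (\<open>hsum_dcoset\<close>).

  It remains to compute \<open>H w\<close>. Cut the matrices into four strips of rows and of columns. Acting by \<open>w\<close> interchanges the two
  middle strips, and we need the matrices that are block lower triangular before and after. Given the diagonal blocks before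
  and after, exactly one block is free, with \<open>\<beta>2\<close> rows and \<open>\<alpha>1\<close> columns (\<open>Zfib_card\<close>, \<open>sum_reblock_fibre\<close>), and what is left
  is the combination of products and coproducts in the claim. The free blocks of the arrows
  contribute one part of the exponent of \<open>q\<close>. The other part comes from the group: an element of the double coset has
  \<open>\<bar>P(\<alpha>1,\<beta>1)\<bar> \<bar>P(\<alpha>2,\<beta>2)\<bar>\<close> times \<open>q\<close> to the power \<open>\<alpha>1 \<cdot> \<alpha>2 + \<beta>1 \<cdot> \<beta>2 + \<alpha>1 \<cdot> \<beta>2\<close> factorisations through \<open>w\<close>
  (\<open>card_dcoset_fibre\<close>). The two orders and the first two terms of the exponent are the normalising
  factors of products and coproducts, and the last term completes the exponent to \<open>- \<langle>\<alpha>1, \<beta>2\<rangle>\<close> (\<open>kcomult_kmult\<close>).\<close>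

section \<open>Blocks of matrices\<close>

text \<open>The block with \<open>r\<close> rows and \<open>c\<close> columns whose upper left corner is at \<open>(i, j)\<close>. Positions are absolute, so that
  blocks of blocks, and matrices cut into 2 or into 4 strips, are handled by the same constant.\<close>

definition blk :: "nat \<Rightarrow> nat \<Rightarrow> nat \<Rightarrow> nat \<Rightarrow> 'a mat \<Rightarrow> 'a mat" where
  "blk i j r c M = mat r c (\<lambda>(a, b). M $$ (i + a, j + b))"

lemma blk_carrier [simp, intro]: "blk i j r c M \<in> carrier_mat r c"
  by (simp add: blk_def)

lemma dim_blk [simp]: "dim_row (blk i j r c M) = r" "dim_col (blk i j r c M) = c"
  by (simp_all add: blk_def)

lemma index_blk [simp]: "a < r \<Longrightarrow> b < c \<Longrightarrow> blk i j r c M $$ (a, b) = M $$ (i + a, j + b)"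
  by (simp add: blk_def)

lemma blk_whole: "M \<in> carrier_mat r c \<Longrightarrow> blk 0 0 r c M = M"
  by (rule eq_matI) auto

lemma blk_blk:
  "i + r \<le> r' \<Longrightarrow> j + c \<le> c' \<Longrightarrow> blk i j r c (blk i' j' r' c' M) = blk (i' + i) (j' + j) r c M"
  by (rule eq_matI) (auto simp: add.assoc)

lemma blk_mult:
  fixes A B :: "'a :: semiring_0 mat"
  assumes A: "A \<in> carrier_mat m (p + q)" and B: "B \<in> carrier_mat (p + q) n"
    and "i + r \<le> m" "j + c \<le> n"
  shows "blk i j r c (A * B) = blk i 0 r p A * blk 0 j p c B + blk i p r q A * blk p j q c B"
proof (rule eq_matI)
  fix a b
  assume "a < dim_row (blk i 0 r p A * blk 0 j p c B + blk i p r q A * blk p j q c B)"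
    "b < dim_col (blk i 0 r p A * blk 0 j p c B + blk i p r q A * blk p j q c B)"
  then have ab: "a < r" "b < c" by auto
  have "blk i j r c (A * B) $$ (a, b) = (\<Sum>k<p + q. A $$ (i + a, k) * B $$ (k, j + b))"
    using assms ab by (auto simp: scalar_prod_def atLeast0LessThan)
  also have "\<dots> = (\<Sum>k<p. A $$ (i + a, k) * B $$ (k, j + b)) +
      (\<Sum>k<q. A $$ (i + a, p + k) * B $$ (p + k, j + b))"
    by (simp only: sum.nat_group[symmetric] lessThan_atLeast0 sum.atLeastLessThan_concat
        add_0 sum.atLeastLessThan_shift_0[of _ p "p + q"] flip: sum.atLeastLessThan_concat[of 0 p "p + q"])
      (simp add: sum.atLeastLessThan_concat[of 0 p "p + q", symmetric] sum.atLeastLessThan_shift_0[of _ p "p + q"])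
  also have "\<dots> = (blk i 0 r p A * blk 0 j p c B + blk i p r q A * blk p j q c B) $$ (a, b)"
    using assms ab by (auto simp: scalar_prod_def atLeast0LessThan)
  finally show "blk i j r c (A * B) $$ (a, b) =
    (blk i 0 r p A * blk 0 j p c B + blk i p r q A * blk p j q c B) $$ (a, b)" .
qed auto

lemma blk_mult_left:
  fixes A B :: "'a :: semiring_0 mat"
  assumes "A \<in> carrier_mat m p" "B \<in> carrier_mat p n" "i + r \<le> m"
  shows "blk i 0 r n (A * B) = blk i 0 r p A * B"
proof -
  have "blk i 0 r n (A * B) = blk i 0 r p A * blk 0 0 p n B + blk i p r 0 A * blk p 0 0 n B"
    using assms by (intro blk_mult[where m = m]) auto
  also have "blk i p r 0 A * blk p 0 0 n B = 0\<^sub>m r n"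
    by (rule eq_matI) (auto simp: scalar_prod_def)
  finally show ?thesis
    using assms by (simp add: blk_whole[OF assms(2)] right_add_zero_mat[OF mult_carrier_mat[of _ r p]])
qed

lemma mat_blk_eqI:
  assumes "M \<in> carrier_mat (r1 + r2) (c1 + c2)" "N \<in> carrier_mat (r1 + r2) (c1 + c2)"
    and "blk 0 0 r1 c1 M = blk 0 0 r1 c1 N" "blk 0 c1 r1 c2 M = blk 0 c1 r1 c2 N"
    and "blk r1 0 r2 c1 M = blk r1 0 r2 c1 N" "blk r1 c1 r2 c2 M = blk r1 c1 r2 c2 N"
  shows "M = N"
proof (rule eq_matI)
  fix i j assume "i < dim_row N" "j < dim_col N"
  then have ij: "i < r1 + r2" "j < c1 + c2" using assms by auto
  have E: "M $$ (i' + a, j' + b) = N $$ (i' + a, j' + b)"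
    if "a < r" "b < c" "blk i' j' r c M = blk i' j' r c N" for i' j' a b r c
    using that by (metis index_blk)
  show "M $$ (i, j) = N $$ (i, j)"
    using E[of i r1 j c1 0 0] E[of i r1 "j - c1" c2 0 c1] E[of "i - r1" r2 j c1 r1 0]
      E[of "i - r1" r2 "j - c1" c2 r1 c1] ij assms by (cases "i < r1"; cases "j < c1") auto
qed (use assms in auto)

lemma blk_four_block:
  assumes "A \<in> carrier_mat r1 c1" "B \<in> carrier_mat r1 c2"
    "C \<in> carrier_mat r2 c1" "D \<in> carrier_mat r2 c2"
  shows "blk 0 0 r1 c1 (four_block_mat A B C D) = A" "blk 0 c1 r1 c2 (four_block_mat A B C D) = B"
    "blk r1 0 r2 c1 (four_block_mat A B C D) = C" "blk r1 c1 r2 c2 (four_block_mat A B C D) = D"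
  using assms by (auto intro!: eq_matI)

lemma four_block_blk:
  assumes "M \<in> carrier_mat (r1 + r2) (c1 + c2)"
  shows "four_block_mat (blk 0 0 r1 c1 M) (blk 0 c1 r1 c2 M) (blk r1 0 r2 c1 M) (blk r1 c1 r2 c2 M) = M"
  using assms by (intro eq_matI) auto

lemma card_carrier_mat: "card (carrier_mat m n :: 'a :: finite mat set) = CARD('a) ^ (m * n)"
  and finite_carrier_mat: "finite (carrier_mat m n :: 'a :: finite mat set)"
proof -
  have "bij_betw (\<lambda>f. mat m n f) (({..<m} \<times> {..<n}) \<rightarrow>\<^sub>E UNIV) (carrier_mat m n :: 'a mat set)"
  proof (rule bij_betw_byWitness[where f' = "\<lambda>M. \<lambda>ij\<in>{..<m} \<times> {..<n}. M $$ ij"])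
    show "\<forall>f\<in>({..<m} \<times> {..<n}) \<rightarrow>\<^sub>E UNIV. (\<lambda>ij\<in>{..<m} \<times> {..<n}. (mat m n f :: 'a mat) $$ ij) = f"
      by (auto intro!: ext simp: PiE_def extensional_def)
  qed (auto intro!: eq_matI simp: extensional_def split: if_splits)
  from bij_betw_same_card[OF this] bij_betw_finite[OF this]
  show "card (carrier_mat m n :: 'a mat set) = CARD('a) ^ (m * n)" "finite (carrier_mat m n :: 'a mat set)"
    by (simp_all add: card_PiE finite_PiE)
qed

section \<open>The general linear group\<close>

definition GL :: "nat \<Rightarrow> 'a :: field mat set" where
  "GL n = {A \<in> carrier_mat n n. det A \<noteq> 0}"

lemma GL_carrier: "A \<in> GL n \<Longrightarrow> A \<in> carrier_mat n n" by (simp add: GL_def)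

lemma GL_mult [intro]: "A \<in> GL n \<Longrightarrow> B \<in> GL n \<Longrightarrow> A * B \<in> GL n"
  by (auto simp: GL_def det_mult)

lemma GL_one [simp, intro]: "1\<^sub>m n \<in> GL n" by (simp add: GL_def)

text \<open>The inverse as a total operation that does not mention the size, which leaves it usable inside families
  of matrices of varying size.\<close>

definition minv :: "'a :: field mat \<Rightarrow> 'a mat" where
  "minv A = (SOME B. B \<in> carrier_mat (dim_row A) (dim_row A) \<and> A * B = 1\<^sub>m (dim_row A) \<and> B * A = 1\<^sub>m (dim_row A))"

lemma GL_iff: "A \<in> GL n \<longleftrightarrow> A \<in> carrier_mat n n \<and> (\<exists>B\<in>carrier_mat n n. A * B = 1\<^sub>m n)"
proof
  assume "A \<in> GL n"
  then have A: "A \<in> carrier_mat n n" "det A \<noteq> 0" by (auto simp: GL_def)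
  with det_non_zero_imp_unit[OF this, of undefined]
  show "A \<in> carrier_mat n n \<and> (\<exists>B\<in>carrier_mat n n. A * B = 1\<^sub>m n)"
    by (auto simp: Units_def ring_mat_def)
next
  assume "A \<in> carrier_mat n n \<and> (\<exists>B\<in>carrier_mat n n. A * B = 1\<^sub>m n)"
  then obtain B where B: "A \<in> carrier_mat n n" "B \<in> carrier_mat n n" "A * B = 1\<^sub>m n" by auto
  then have "det A * det B = 1" by (metis det_mult det_one)
  with B show "A \<in> GL n" by (auto simp: GL_def)
qed

lemma minv:
  assumes "A \<in> GL n"
  shows "minv A \<in> carrier_mat n n" "A * minv A = 1\<^sub>m n" "minv A * A = 1\<^sub>m n" "minv A \<in> GL n"
proof -
  have A: "A \<in> carrier_mat n n" "dim_row A = n" using assms by (auto simp: GL_def)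
  obtain B where "B\<in>carrier_mat n n" "A * B = 1\<^sub>m n" using assms GL_iff by blast
  with A have "\<exists>B. B \<in> carrier_mat n n \<and> A * B = 1\<^sub>m n \<and> B * A = 1\<^sub>m n"
    using mat_mult_left_right_inverse by blast
  from someI_ex[OF this] A show *: "minv A \<in> carrier_mat n n" "A * minv A = 1\<^sub>m n" "minv A * A = 1\<^sub>m n"
    by (auto simp: minv_def)
  show "minv A \<in> GL n" using * A GL_iff by blast
qed

lemma minv_unique:
  assumes "A \<in> carrier_mat n n" "B \<in> carrier_mat n n" "A * B = 1\<^sub>m n"
  shows "minv A = B"
proof -
  have A: "A \<in> GL n" using assms GL_iff by blast
  have "minv A = minv A * (A * B)" using minv(1)[OF A] assms(3) by simp
  also have "\<dots> = (minv A * A) * B" using minv(1)[OF A] assms(1,2)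
    by (intro assoc_mult_mat[symmetric]) auto
  also have "\<dots> = B" using minv(3)[OF A] assms(2) by simp
  finally show ?thesis .
qed

lemma minv_mult:
  assumes A: "A \<in> GL n" and B: "B \<in> GL n"
  shows "minv (A * B) = minv B * minv A"
proof (rule minv_unique)
  note c = GL_carrier[OF A] GL_carrier[OF B] minv(1)[OF A] minv(1)[OF B]
  show "A * B \<in> carrier_mat n n" "minv B * minv A \<in> carrier_mat n n" using c by auto
  have "A * B * (minv B * minv A) = A * (B * (minv B * minv A))"
    using c by (intro assoc_mult_mat) auto
  also have "B * (minv B * minv A) = (B * minv B) * minv A"
    using c by (intro assoc_mult_mat[symmetric]) auto
  finally show "A * B * (minv B * minv A) = 1\<^sub>m n" using c minv(2)[OF A] minv(2)[OF B] by simp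
qed

lemma minv_minv: "A \<in> GL n \<Longrightarrow> minv (minv A) = A"
  by (rule minv_unique) (auto simp: minv GL_carrier)

lemma minv_one [simp]: "minv (1\<^sub>m n) = 1\<^sub>m n" by (rule minv_unique) auto

lemma GL_cancel_left:
  assumes "A \<in> GL n" "B \<in> carrier_mat n m"
  shows "minv A * (A * B) = B" "A * (minv A * B) = B"
  using assms minv[OF assms(1)] GL_carrier[OF assms(1)]
  by (simp_all add: assoc_mult_mat[of _ n n _ n _ m, symmetric])

lemma GL_cancel_right:
  assumes "A \<in> GL n" "B \<in> carrier_mat m n"
  shows "(B * A) * minv A = B" "(B * minv A) * A = B"
  using assms minv[OF assms(1)] GL_carrier[OF assms(1)]
  by (simp_all add: assoc_mult_mat[of _ m n _ n _ n])

lemma finite_GL: "finite (GL n :: 'a :: {field, finite} mat set)"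
  by (rule finite_subset[OF _ finite_carrier_mat[of n n]]) (auto simp: GL_def)

lemma card_GL_pos: "card (GL n :: 'a :: {field, finite} mat set) > 0"
  using finite_GL card_gt_0_iff GL_one by blast

lemma GL_four_block_lower:
  assumes "A \<in> GL a" "B \<in> GL b" "C \<in> carrier_mat b a"
  shows "four_block_mat A (0\<^sub>m a b) C B \<in> GL (a + b)"
  using assms det_four_block_mat_upper_right_zero[of A a "0\<^sub>m a b" b C B] by (auto simp: GL_def)

lemma GL_four_block_upper:
  assumes "A \<in> GL a" "B \<in> GL b" "C \<in> carrier_mat a b"
  shows "four_block_mat A C (0\<^sub>m b a) B \<in> GL (a + b)"
  using assms det_four_block_mat_lower_left_zero[of A a C b "0\<^sub>m b a" B] by (auto simp: GL_def)

section \<open>Block lower triangular matrices and parabolic subgroups\<close>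

text \<open>The representations that stabilise the span of the last coordinates are those whose matrices have a
  vanishing upper right block; the diagonal blocks are then the quotient and the subrepresentation.\<close>

definition Low :: "nat \<Rightarrow> nat \<Rightarrow> nat \<Rightarrow> nat \<Rightarrow> 'a :: zero mat set" where
  "Low r1 r2 c1 c2 = {M \<in> carrier_mat (r1 + r2) (c1 + c2). blk 0 c1 r1 c2 M = 0\<^sub>m r1 c2}"

abbreviation TL :: "nat \<Rightarrow> nat \<Rightarrow> 'a mat \<Rightarrow> 'a mat" where "TL r1 c1 \<equiv> blk 0 0 r1 c1"
abbreviation BR :: "nat \<Rightarrow> nat \<Rightarrow> nat \<Rightarrow> nat \<Rightarrow> 'a mat \<Rightarrow> 'a mat" where "BR r1 r2 c1 c2 \<equiv> blk r1 c1 r2 c2"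

text \<open>The parabolic subgroup, the stabiliser of the span of the last \<open>b\<close> coordinates.\<close>

definition Par :: "nat \<Rightarrow> nat \<Rightarrow> 'a :: field mat set" where
  "Par a b = Low a b a b \<inter> GL (a + b)"

lemma Low_carrier: "M \<in> Low r1 r2 c1 c2 \<Longrightarrow> M \<in> carrier_mat (r1 + r2) (c1 + c2)" by (simp add: Low_def)

lemma Low_mult:
  fixes A B :: "'a :: semiring_0 mat"
  assumes A: "A \<in> Low r1 r2 p q" and B: "B \<in> Low p q c1 c2"
  shows "A * B \<in> Low r1 r2 c1 c2" "TL r1 c1 (A * B) = TL r1 p A * TL p c1 B"
    "BR r1 r2 c1 c2 (A * B) = BR r1 r2 p q A * BR p q c1 c2 B"
proof -
  note c = Low_carrier[OF A] Low_carrier[OF B]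
  have z: "blk 0 p r1 q A = 0\<^sub>m r1 q" "blk 0 c1 p c2 B = 0\<^sub>m p c2" using A B by (auto simp: Low_def)
  note bm = blk_mult[OF c]
  show "A * B \<in> Low r1 r2 c1 c2"
    using c by (auto simp: Low_def bm z right_mult_zero_mat[of _ r1 p] left_mult_zero_mat[of _ q])
  show "TL r1 c1 (A * B) = TL r1 p A * TL p c1 B"
    by (subst bm) (auto simp: z left_mult_zero_mat[of _ q] right_add_zero_mat[of _ r1 c1])
  show "BR r1 r2 c1 c2 (A * B) = BR r1 r2 p q A * BR p q c1 c2 B"
    by (subst bm) (auto simp: z right_mult_zero_mat[of _ r2 p] left_add_zero_mat[of _ r2 c2])
qed

lemma four_block_Low:
  assumes "A \<in> carrier_mat r1 c1" "D \<in> carrier_mat r2 c2" "C \<in> carrier_mat r2 c1"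
  shows "four_block_mat A (0\<^sub>m r1 c2) C D \<in> Low r1 r2 c1 c2"
  using assms by (auto simp: Low_def blk_four_block[of A r1 c1 "0\<^sub>m r1 c2" c2 C r2 D])

lemma Low_four_block:
  assumes "M \<in> Low r1 r2 c1 c2"
  shows "M = four_block_mat (TL r1 c1 M) (0\<^sub>m r1 c2) (blk r1 0 r2 c1 M) (BR r1 r2 c1 c2 M)"
  using four_block_blk[OF Low_carrier[OF assms]] assms by (auto simp: Low_def)

lemma det_Low: "M \<in> Low a b a b \<Longrightarrow> det M = det (TL a a M) * det (BR a b a b M)"
  for M :: "'a :: idom mat"
  by (subst Low_four_block, assumption) (rule det_four_block_mat_upper_right_zero; auto)

lemma Par_iff: "M \<in> Par a b \<longleftrightarrow> M \<in> Low a b a b \<and> TL a a M \<in> GL a \<and> BR a b a b M \<in> GL b"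
  using det_Low[of M a b] by (auto simp: Par_def GL_def Low_carrier)

lemma Par_GL: "p \<in> Par a b \<Longrightarrow> p \<in> GL (a + b)" by (simp add: Par_def)

lemma TL_one: "TL a a (1\<^sub>m (a + b)) = 1\<^sub>m a" and BR_one: "BR a b a b (1\<^sub>m (a + b)) = 1\<^sub>m b"
  by (auto intro!: eq_matI)

lemma Par_minv:
  assumes "p \<in> Par a b"
  shows "minv p \<in> Par a b" "TL a a (minv p) = minv (TL a a p)" "BR a b a b (minv p) = minv (BR a b a b p)"
proof -
  have p: "p \<in> Low a b a b" "p \<in> GL (a + b)" "TL a a p \<in> GL a" "BR a b a b p \<in> GL b"
    using assms Par_iff Par_def by blast+
  note i = minv[OF p(2)]
  have "blk 0 a a b (p * minv p) = TL a a p * blk 0 a a b (minv p) + blk 0 a a b p * blk a a b b (minv p)"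
    using p i by (intro blk_mult[of _ "a + b" _ _ _ "a + b"]) (auto simp: GL_def)
  also have "blk 0 a a b p = 0\<^sub>m a b" using p by (simp add: Low_def)
  also have "blk 0 a a b (p * minv p) = 0\<^sub>m a b" using i by (auto intro!: eq_matI)
  finally have "TL a a p * blk 0 a a b (minv p) = 0\<^sub>m a b"
    by (simp add: left_mult_zero_mat[of _ b] right_add_zero_mat[OF mult_carrier_mat[of _ a a]])
  then have "minv (TL a a p) * (TL a a p * blk 0 a a b (minv p)) = 0\<^sub>m a b"
    using minv(1)[OF p(3)] by (auto simp: right_mult_zero_mat)
  then have "blk 0 a a b (minv p) = 0\<^sub>m a b"
    by (simp add: GL_cancel_left[OF p(3), of _ b])
  then have L: "minv p \<in> Low a b a b" using i by (simp add: Low_def)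
  then show "minv p \<in> Par a b" using i by (simp add: Par_def)
  note m = Low_mult[OF p(1) L]
  show "TL a a (minv p) = minv (TL a a p)" "BR a b a b (minv p) = minv (BR a b a b p)"
    using m(2,3) i(2) by (auto intro!: minv_unique[symmetric] simp: TL_one BR_one)
qed

lemma Par_mult [intro]: "p \<in> Par a b \<Longrightarrow> p' \<in> Par a b \<Longrightarrow> p * p' \<in> Par a b"
  using Low_mult(1)[of p a b a b p' a b] by (auto simp: Par_def)

text \<open>With fixed diagonal blocks, the lower left block is a free parameter.\<close>

lemma bij_betw_Low_fibre:
  assumes "u \<in> carrier_mat r1 c1" "v \<in> carrier_mat r2 c2"
  shows "bij_betw (\<lambda>e. four_block_mat u (0\<^sub>m r1 c2) e v) (carrier_mat r2 c1)
    {M \<in> Low r1 r2 c1 c2. TL r1 c1 M = u \<and> BR r1 r2 c1 c2 M = v}"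
proof (rule bij_betw_byWitness[where f' = "blk r1 0 r2 c1"])
  show "\<forall>e\<in>carrier_mat r2 c1. blk r1 0 r2 c1 (four_block_mat u (0\<^sub>m r1 c2) e v) = e"
    using assms by (auto intro!: blk_four_block)
  show "\<forall>M\<in>{M \<in> Low r1 r2 c1 c2. TL r1 c1 M = u \<and> BR r1 r2 c1 c2 M = v}.
       four_block_mat u (0\<^sub>m r1 c2) (blk r1 0 r2 c1 M) v = M"
    using Low_four_block by fastforce
  show "(\<lambda>e. four_block_mat u (0\<^sub>m r1 c2) e v) ` carrier_mat r2 c1
    \<subseteq> {M \<in> Low r1 r2 c1 c2. TL r1 c1 M = u \<and> BR r1 r2 c1 c2 M = v}"
    using assms by (auto intro!: four_block_Low simp: blk_four_block)
qed auto

lemma card_Low_fibre: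
  fixes u v :: "'a :: {zero, finite} mat"
  assumes "u \<in> carrier_mat r1 c1" "v \<in> carrier_mat r2 c2"
  shows "card {M \<in> Low r1 r2 c1 c2. TL r1 c1 M = u \<and> BR r1 r2 c1 c2 M = v} = CARD('a) ^ (r2 * c1)"
  using bij_betw_same_card[OF bij_betw_Low_fibre[OF assms]] by (simp add: card_carrier_mat)

text \<open>The device behind all counts below: a sum of values that depend only on \<open>f x\<close> is evaluated on the image
  as soon as all fibres of \<open>f\<close> have the same size.\<close>

lemma sum_by_fibres:
  fixes h :: "'b \<Rightarrow> 'c :: comm_semiring_1"
  assumes "finite S" "finite T" "\<And>x. x \<in> S \<Longrightarrow> f x \<in> T"
    and "\<And>y. y \<in> T \<Longrightarrow> card {x \<in> S. f x = y} = c"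
  shows "(\<Sum>x\<in>S. h (f x)) = of_nat c * (\<Sum>y\<in>T. h y)"
proof -
  have "(\<Sum>x\<in>S. h (f x)) = (\<Sum>y\<in>T. \<Sum>x\<in>{x \<in> S. f x = y}. h (f x))"
    using assms by (intro sum.group[symmetric]) auto
  also have "\<dots> = (\<Sum>y\<in>T. of_nat c * h y)"
    by (intro sum.cong) (auto simp: assms(4)[symmetric])
  finally show ?thesis by (simp add: sum_distrib_left)
qed

lemma card_by_fibres:
  assumes "finite S" "finite T" "\<And>x. x \<in> S \<Longrightarrow> f x \<in> T"
    and "\<And>y. y \<in> T \<Longrightarrow> card {x \<in> S. f x = y} = c"
  shows "card S = card T * c"
  using sum_by_fibres[OF assms, where h = "\<lambda>_. 1 :: nat"] by simp

lemma finite_Par: "finite (Par a b :: 'a :: {field, finite} mat set)"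
  using finite_GL[of "a + b"] by (auto simp: Par_def)

lemma card_Par:
  "card (Par a b :: 'a :: {field, finite} mat set) =
    card (GL a :: 'a mat set) * card (GL b :: 'a mat set) * CARD('a) ^ (a * b)"
proof -
  have "card (Par a b :: 'a mat set) = card ((GL a :: 'a mat set) \<times> (GL b :: 'a mat set)) * CARD('a) ^ (b * a)"
  proof (rule card_by_fibres[where f = "\<lambda>M. (TL a a M, BR a b a b M)"])
    fix y :: "'a mat \<times> 'a mat" assume "y \<in> GL a \<times> GL b"
    then obtain u v where y: "y = (u, v)" "u \<in> GL a" "v \<in> GL b" by auto
    then have "{M \<in> Par a b. (TL a a M, BR a b a b M) = y} = {M \<in> Low a b a b. TL a a M = u \<and> BR a b a b M = v}"
      by (auto simp: Par_iff)
    then show "card {M \<in> Par a b. (TL a a M, BR a b a b M) = y} = CARD('a) ^ (b * a)"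
      using y by (simp add: card_Low_fibre GL_carrier)
  qed (auto simp: Par_iff finite_GL finite_Par)
  then show ?thesis by (simp add: card_cartesian_product mult.commute)
qed

section \<open>Permutation matrices\<close>

text \<open>Row \<open>i\<close> of \<open>pmat n \<pi> * M\<close> is row \<open>\<pi> i\<close> of \<open>M\<close>; conjugation by it gives the matrix with entries \<open>(\<pi> i, \<pi> j)\<close>
  of \<open>M\<close>.\<close>

definition pmat :: "nat \<Rightarrow> (nat \<Rightarrow> nat) \<Rightarrow> 'a :: zero_neq_one mat" where
  "pmat n \<pi> = mat n n (\<lambda>(i, j). if j = \<pi> i then 1 else 0)"

lemma pmat_carrier [simp, intro]: "pmat n \<pi> \<in> carrier_mat n n" by (simp add: pmat_def)

lemma pmat_mult_index:
  fixes M :: "'a :: semiring_1 mat"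
  assumes "M \<in> carrier_mat n m" "\<And>i. i < n \<Longrightarrow> \<pi> i < n" "i < n" "j < m"
  shows "(pmat n \<pi> * M) $$ (i, j) = M $$ (\<pi> i, j)"
proof -
  have "(pmat n \<pi> * M) $$ (i, j) = (\<Sum>k\<in>{..<n}. (if k = \<pi> i then 1 else 0) * M $$ (k, j))"
    using assms by (auto simp: pmat_def scalar_prod_def atLeast0LessThan)
  also have "\<dots> = (\<Sum>k\<in>{..<n}. if k = \<pi> i then M $$ (\<pi> i, j) else 0)"
    by (intro sum.cong) auto
  finally show ?thesis using assms by simp
qed

lemma mult_pmat_index:
  fixes M :: "'a :: semiring_1 mat"
  assumes "M \<in> carrier_mat m n" "\<And>i. i < n \<Longrightarrow> \<pi> i < n" "\<And>i. i < n \<Longrightarrow> \<sigma> i < n"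
    "\<And>i. i < n \<Longrightarrow> \<pi> (\<sigma> i) = i" "\<And>i. i < n \<Longrightarrow> \<sigma> (\<pi> i) = i" "i < m" "j < n"
  shows "(M * pmat n \<sigma>) $$ (i, j) = M $$ (i, \<pi> j)"
proof -
  have "(M * pmat n \<sigma>) $$ (i, j) = (\<Sum>k\<in>{..<n}. M $$ (i, k) * (if j = \<sigma> k then 1 else 0))"
    using assms by (auto simp: pmat_def scalar_prod_def atLeast0LessThan)
  also have "\<dots> = (\<Sum>k\<in>{..<n}. if k = \<pi> j then M $$ (i, \<pi> j) else 0)"
    using assms by (intro sum.cong) auto
  finally show ?thesis using assms by simp
qed

lemma pmat_inverse:
  assumes "\<And>i. i < n \<Longrightarrow> \<pi> i < n" "\<And>i. i < n \<Longrightarrow> \<sigma> (\<pi> i) = i"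
  shows "pmat n \<pi> * pmat n \<sigma> = (1\<^sub>m n :: 'a :: semiring_1 mat)"
  by (rule eq_matI, subst pmat_mult_index[where m = n]) (auto simp: assms pmat_def one_mat_def)

lemma pmat_GL:
  assumes "\<And>i. i < n \<Longrightarrow> \<pi> i < n" "\<And>i. i < n \<Longrightarrow> \<sigma> i < n" "\<And>i. i < n \<Longrightarrow> \<sigma> (\<pi> i) = i"
  shows "(pmat n \<pi> :: 'a :: field mat) \<in> GL n"
  using pmat_inverse[of n \<pi> \<sigma>] assms unfolding GL_iff by auto

section \<open>Rank normal form\<close>

definition pid :: "nat \<Rightarrow> nat \<Rightarrow> nat \<Rightarrow> 'a :: zero_neq_one mat" where
  "pid m n r = mat m n (\<lambda>(i, j). if i = j \<and> j < r then 1 else 0)"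

lemma pid_carrier [simp, intro]: "pid m n r \<in> carrier_mat m n" by (simp add: pid_def)

lemma dim_pid [simp]: "dim_row (pid m n r) = m" "dim_col (pid m n r) = n" by (simp_all add: pid_def)

lemma zero_pid: "0\<^sub>m m n = pid m n 0" by (auto simp: pid_def)

lemma four_block_pid:
  "four_block_mat (1\<^sub>m 1) (0\<^sub>m 1 n) (0\<^sub>m m 1) (pid m n r) = pid (Suc m) (Suc n) (Suc r)"
  by (rule eq_matI) (auto simp: pid_def)

text \<open>Gaussian elimination with complete pivoting: move a nonzero entry \<open>s\<close> to the corner, and replace the
  remaining part by its Schur complement \<open>D\<close>, which is smaller. The factorisation of \<open>D\<close> is carried back by
  one lower and one upper block triangular factor.\<close>

lemma rank_normal_form:
  fixes M :: "'a :: field mat"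
  assumes "M \<in> carrier_mat m n"
  shows "\<exists>A\<in>GL m. \<exists>B\<in>GL n. \<exists>r\<le>min m n. M = A * pid m n r * B"
  using assms
proof (induction m arbitrary: n M)
  case 0
  then have "M = 1\<^sub>m 0 * pid 0 n 0 * 1\<^sub>m n" by (intro eq_matI) auto
  then show ?case by (metis GL_one le0)
next
  case (Suc m)
  show ?case
  proof (cases "M = 0\<^sub>m (Suc m) n")
    case True
    then have "M = 1\<^sub>m (Suc m) * pid (Suc m) n 0 * 1\<^sub>m n"
      by (simp add: zero_pid[symmetric] left_mult_one_mat[of _ "Suc m" n])
    then show ?thesis by (metis GL_one le0)
  next
    case False
    then obtain i0 j0 where ij: "i0 < Suc m" "j0 < n" "M $$ (i0, j0) \<noteq> 0"
      using Suc.prems by (metis carrier_matD eq_matI index_zero_mat)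
    then obtain n' where n: "n = Suc n'" by (cases n) auto
    define P :: "'a mat" where "P = pmat (Suc m) (transpose 0 i0)"
    define R :: "'a mat" where "R = pmat n (transpose 0 j0)"
    have P: "P \<in> GL (Suc m)"
      unfolding P_def using ij by (intro pmat_GL[where \<sigma> = "transpose 0 i0"]) (auto simp: transpose_def)
    have R: "R \<in> GL n"
      unfolding R_def using ij by (intro pmat_GL[where \<sigma> = "transpose 0 j0"]) (auto simp: transpose_def)
    define N where "N = P * M * R"
    have N: "N \<in> carrier_mat (1 + m) (1 + n')" using Suc.prems P R n by (auto simp: N_def GL_def)
    have "N $$ (0, 0) = (P * M) $$ (0, transpose 0 j0 0)"
      unfolding N_def R_def using Suc.prems P ij
      by (intro mult_pmat_index[where m = "Suc m"]) (auto simp: transpose_def GL_def)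
    also have "\<dots> = M $$ (i0, j0)"
      unfolding P_def using Suc.prems ij
      by (subst pmat_mult_index[where m = n]) (auto simp: transpose_def)
    finally have s: "N $$ (0, 0) \<noteq> 0" using ij by simp
    define s where "s = N $$ (0, 0)"
    define T where "T = blk 0 1 1 n' N"
    define C where "C = blk 1 0 m 1 N"
    define D where "D = blk 1 1 m n' N - (inverse s) \<cdot>\<^sub>m (C * T)"
    have c: "T \<in> carrier_mat 1 n'" "C \<in> carrier_mat m 1" "D \<in> carrier_mat m n'"
      by (auto simp: T_def C_def D_def)
    obtain A B r where AB: "A \<in> GL m" "B \<in> GL n'" "r \<le> min m n'" "D = A * pid m n' r * B"
      using Suc.IH[OF c(3)] by blast
    define L where "L = four_block_mat (s \<cdot>\<^sub>m 1\<^sub>m 1) (0\<^sub>m 1 m) C A"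
    define U where "U = four_block_mat (1\<^sub>m 1) (inverse s \<cdot>\<^sub>m T) (0\<^sub>m n' 1) B"
    have L: "L \<in> GL (1 + m)" unfolding L_def using c AB s
      by (intro GL_four_block_lower) (auto simp: GL_def s_def)
    have U: "U \<in> GL (1 + n')" unfolding U_def using c AB
      by (intro GL_four_block_upper) (auto simp: GL_def)
    have Ac: "A \<in> carrier_mat m m" "B \<in> carrier_mat n' n'" using AB by (auto simp: GL_def)
    have tl: "s \<cdot>\<^sub>m 1\<^sub>m 1 = blk 0 0 1 1 N" by (auto simp: s_def)
    have z: "0\<^sub>m 1 n' + T = T" using c by simp
    have d: "C * (inverse s \<cdot>\<^sub>m T) + A * pid m n' r * B = blk 1 1 m n' N"
    proof -
      have "C * (inverse s \<cdot>\<^sub>m T) = inverse s \<cdot>\<^sub>m (C * T)" using c by (intro mult_smult_distrib) auto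
      then show ?thesis unfolding AB(4)[symmetric] D_def using c by (intro eq_matI) auto
    qed
    have ss: "s \<cdot>\<^sub>m (inverse s \<cdot>\<^sub>m T) = T" using c s by (auto intro!: eq_matI simp: s_def)
    have "L * four_block_mat (1\<^sub>m 1) (0\<^sub>m 1 n') (0\<^sub>m m 1) (pid m n' r) =
      four_block_mat (s \<cdot>\<^sub>m 1\<^sub>m 1) (0\<^sub>m 1 n') C (A * pid m n' r)"
      unfolding L_def using c Ac
      by (subst mult_four_block_mat[of _ 1 1 _ m _ m _ _ 1 _ n'])
        (auto simp del: One_nat_def simp: left_mult_zero_mat[of _ m n'] left_mult_zero_mat[of _ m 1] left_mult_zero_mat[of A m m] right_mult_zero_mat[of _ m m] right_mult_zero_mat[of _ m 1]
          right_add_zero_mat[of _ m 1] left_add_zero_mat[of _ m n'])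
    then have "L * four_block_mat (1\<^sub>m 1) (0\<^sub>m 1 n') (0\<^sub>m m 1) (pid m n' r) * U =
      four_block_mat (s \<cdot>\<^sub>m 1\<^sub>m 1) (0\<^sub>m 1 n') C (A * pid m n' r) * U" by simp
    also have "\<dots> = four_block_mat (s \<cdot>\<^sub>m 1\<^sub>m 1) T C (C * (inverse s \<cdot>\<^sub>m T) + A * pid m n' r * B)"
      unfolding U_def using c Ac s
      by (subst mult_four_block_mat[of _ 1 1 _ n' _ m _ _ 1 _ n'])
        (auto simp del: One_nat_def simp: left_mult_zero_mat[of _ n' n'] left_mult_zero_mat[of _ n' 1] right_mult_zero_mat[of _ m n'] right_mult_zero_mat[of _ 1 n']
          right_add_zero_mat[of _ m 1] right_add_zero_mat[of _ 1 n'] ss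
          mult_smult_assoc_mat[of _ 1 1 _ n'])
    also have "\<dots> = four_block_mat (blk 0 0 1 1 N) T C (blk 1 1 m n' N)"
      unfolding d tl ..
    also have "\<dots> = N"
      unfolding T_def C_def by (rule four_block_blk[OF N])
    finally have N': "N = L * pid (Suc m) n (Suc r) * U" unfolding four_block_pid n ..
    have "M = minv P * (N * minv R)"
      unfolding N_def using GL_cancel_right(1)[OF R, of "P * M" "Suc m"] GL_cancel_left(1)[OF P Suc.prems]
        GL_carrier[OF P] Suc.prems by simp
    also have "\<dots> = (minv P * L) * pid (Suc m) n (Suc r) * (U * minv R)"
    proof -
      have "N * minv R = L * pid (Suc m) n (Suc r) * (U * minv R)" unfolding N'
        using L U minv(1)[OF R] n by (intro assoc_mult_mat[of _ "Suc m" n _ n _ n]) (auto simp: GL_def)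
      then have "minv P * (N * minv R) = minv P * (L * pid (Suc m) n (Suc r)) * (U * minv R)"
        using L U minv(1)[OF R] minv(1)[OF P] n
        by (simp, intro assoc_mult_mat[symmetric, of _ "Suc m" "Suc m" _ n _ n]) (auto simp: GL_def)
      also have "minv P * (L * pid (Suc m) n (Suc r)) = minv P * L * pid (Suc m) n (Suc r)"
        using L minv(1)[OF P] n
        by (intro assoc_mult_mat[symmetric, of _ "Suc m" "Suc m" _ "Suc m" _ n]) (auto simp: GL_def)
      finally show ?thesis .
    qed
    finally have "M = (minv P * L) * pid (Suc m) n (Suc r) * (U * minv R)" .
    then show ?thesis
      using L U P R AB minv(4) n by (intro bexI[of _ "minv P * L"] bexI[of _ "U * minv R"] exI[of _ "Suc r"]) auto
  qed
qed

section \<open>The size of the image as an invariant\<close>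

text \<open>Over a finite field the image of a matrix of rank \<open>r\<close> has \<open>q ^ r\<close> elements, so counting the image is as good
  an invariant as the rank.\<close>

definition image_card :: "'a :: semiring_0 mat \<Rightarrow> nat" where
  "image_card M = card ((*\<^sub>v) M ` carrier_vec (dim_col M))"

lemma GL_image: "A \<in> GL n \<Longrightarrow> (*\<^sub>v) A ` carrier_vec n = carrier_vec n"
proof safe
  fix v :: "'a vec" assume A: "A \<in> GL n" and v: "v \<in> carrier_vec n"
  note i = minv[OF A] GL_carrier[OF A]
  have "A *\<^sub>v (minv A *\<^sub>v v) = v" using i v by (simp add: assoc_mult_mat_vec[symmetric, of _ n n _ n])
  then show "v \<in> (*\<^sub>v) A ` carrier_vec n" using i v by (metis imageI mult_mat_vec_carrier)
qed (auto simp: GL_def)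

lemma image_card_mult:
  fixes M :: "'a :: {field, finite} mat"
  assumes A: "A \<in> GL m" and B: "B \<in> GL n" and M: "M \<in> carrier_mat m n"
  shows "image_card (A * M * B) = image_card M"
proof -
  note c = GL_carrier[OF A] GL_carrier[OF B] M
  have "(*\<^sub>v) (A * M * B) ` carrier_vec n = (*\<^sub>v) A ` (*\<^sub>v) M ` (*\<^sub>v) B ` carrier_vec n"
    unfolding image_image using c by (intro image_cong) (auto simp: assoc_mult_mat_vec[of _ m n _ n] assoc_mult_mat_vec[of _ m m _ n])
  also have "\<dots> = (*\<^sub>v) A ` (*\<^sub>v) M ` carrier_vec n" by (simp add: GL_image[OF B])
  also have "card \<dots> = card ((*\<^sub>v) M ` carrier_vec n)"
  proof (intro card_image inj_onI)
    fix x y assume "x \<in> (*\<^sub>v) M ` carrier_vec n" "y \<in> (*\<^sub>v) M ` carrier_vec n" "A *\<^sub>v x = A *\<^sub>v y"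
    then have xy: "x \<in> carrier_vec m" "y \<in> carrier_vec m" "minv A *\<^sub>v (A *\<^sub>v x) = minv A *\<^sub>v (A *\<^sub>v y)"
      using M by auto
    then show "x = y" using minv[OF A] c by (simp add: assoc_mult_mat_vec[symmetric, of _ m m _ m])
  qed
  finally show ?thesis using c by (simp add: image_card_def)
qed

lemma image_card_pid:
  assumes "r \<le> m" "r \<le> n"
  shows "image_card (pid m n r :: 'a :: {field, finite} mat) = CARD('a) ^ r"
proof -
  have ix: "(pid m n r *\<^sub>v v) $ i = (if i < r then v $ i else 0)" if "v \<in> carrier_vec n" "i < m" for i and v :: "'a vec"
  proof -
    have "(pid m n r *\<^sub>v v) $ i = (\<Sum>j\<in>{..<n}. (if i = j \<and> j < r then 1 else 0) * v $ j)"
      using that by (auto simp: pid_def scalar_prod_def atLeast0LessThan)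
    also have "\<dots> = (\<Sum>j\<in>{..<n}. if j = i then (if i < r then v $ i else 0) else 0)"
      by (intro sum.cong) auto
    finally show ?thesis using that assms by auto
  qed
  have "bij_betw (\<lambda>M. vec m (\<lambda>i. if i < r then M $$ (i, 0) else 0)) (carrier_mat r 1) ((*\<^sub>v) (pid m n r :: 'a mat) ` carrier_vec n)"
  proof (rule bij_betw_byWitness[where f' = "\<lambda>v. mat r 1 (\<lambda>(i, j). (v :: 'a vec) $ i)"])
    show "(\<lambda>M. vec m (\<lambda>i. if i < r then M $$ (i, 0) else 0)) ` carrier_mat r 1 \<subseteq> (*\<^sub>v) (pid m n r :: 'a mat) ` carrier_vec n"
    proof safe
      fix M :: "'a mat"
      have "vec m (\<lambda>i. if i < r then M $$ (i, 0) else 0) = pid m n r *\<^sub>v vec n (\<lambda>i. if i < r then M $$ (i, 0) else 0)"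
        using assms by (intro eq_vecI) (auto simp: ix simp del: index_mult_mat_vec(1))
      then show "vec m (\<lambda>i. if i < r then M $$ (i, 0) else 0) \<in> (*\<^sub>v) (pid m n r :: 'a mat) ` carrier_vec n" by auto
    qed
  qed (use assms in \<open>auto intro!: eq_matI eq_vecI simp: ix simp del: index_mult_mat_vec(1)\<close>)
  from bij_betw_same_card[OF this] show ?thesis
    by (simp add: image_card_def card_carrier_mat pid_def)
qed

section \<open>Bruhat decomposition for two maximal parabolic subgroups\<close>

text \<open>The coordinates fall into four segments of lengths \<open>a1, a2, b1, b2\<close>. Ordered in this way, position \<open>i\<close>
  belongs to the coordinate that has position \<open>shuffle a1 a2 b1 i\<close> when the two middle segments are
  interchanged, that is, in the order \<open>a1, b1, a2, b2\<close>.\<close>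

definition shuffle :: "nat \<Rightarrow> nat \<Rightarrow> nat \<Rightarrow> nat \<Rightarrow> nat" where
  "shuffle a1 a2 b1 i = (if i < a1 then i else if i < a1 + a2 then i + b1 else if i < a1 + a2 + b1 then i - a2 else i)"

lemma shuffle_less: "i < a1 + a2 + b1 + b2 \<Longrightarrow> shuffle a1 a2 b1 i < a1 + a2 + b1 + b2"
  by (auto simp: shuffle_def)

lemma shuffle_shuffle [simp]: "shuffle a1 a2 b1 (shuffle a1 b1 a2 i) = i"
  by (auto simp: shuffle_def)

text \<open>The double coset representatives: they compare the flag with parts \<open>a1 + a2, b1 + b2\<close> with the flag with
  parts \<open>a1 + b1, a2 + b2\<close>.\<close>

definition wmat :: "nat \<Rightarrow> nat \<Rightarrow> nat \<Rightarrow> nat \<Rightarrow> 'a :: zero_neq_one mat" where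
  "wmat a1 a2 b1 b2 = pmat (a1 + a2 + b1 + b2) (shuffle a1 a2 b1)"

lemma wmat_GL: "(wmat a1 a2 b1 b2 :: 'a :: field mat) \<in> GL (a1 + a2 + b1 + b2)"
  unfolding wmat_def
  by (rule pmat_GL[where \<sigma> = "shuffle a1 b1 a2"])
    (use shuffle_less[of _ a1 b1 a2 b2] shuffle_less[of _ a1 a2 b1 b2] in \<open>auto simp: ac_simps\<close>)

lemma minv_wmat: "minv (wmat a1 a2 b1 b2) = (wmat a1 b1 a2 b2 :: 'a :: field mat)"
  unfolding wmat_def
  by (rule minv_unique) (use shuffle_less[of _ a1 b1 a2 b2] shuffle_less[of _ a1 a2 b1 b2] in
    \<open>auto simp: ac_simps intro!: pmat_inverse\<close>)

text \<open>Only the first \<open>a\<close> rows of \<open>g\<close> matter for its class in \<open>Par a b\<close> on the left: row operations by \<open>GL a\<close> are free,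
  and the rows below are recovered from invertibility. On these rows, \<open>Par a' b'\<close> permits all column operations within
  the first \<open>a'\<close> and within the last \<open>b'\<close> columns, and adding columns of the right part to the left part. Bring
  the right part to rank normal form with its \<open>a2\<close> pivots in the last rows, use these to clear the left part of
  the pivot rows, and bring the rest of the left part to rank normal form. The right inverse \<open>R\<close> of \<open>T\<close> excludes a zero
  row, which forces the left rank to be \<open>a1 = a - a2\<close>.\<close>

lemma bruhat_top:
  fixes T :: "'a :: field mat"
  assumes T: "T \<in> carrier_mat a (a' + b')" and R: "R \<in> carrier_mat (a' + b') a" "T * R = 1\<^sub>m a"
  shows "\<exists>A\<in>GL a. \<exists>p\<in>Par a' b'. \<exists>a1 a2. a = a1 + a2 \<and> a1 \<le> a' \<and> a2 \<le> b' \<and>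
    T = A * blk 0 0 a (a' + b') (wmat a1 a2 (a' - a1) (b' - a2)) * p"
proof -
  \<comment> \<open>row operations by \<open>GL a\<close> and column operations by the parabolic subgroup\<close>
  define eqv :: "'a mat \<Rightarrow> 'a mat \<Rightarrow> bool" where "eqv T T' \<longleftrightarrow> (\<exists>A\<in>GL a. \<exists>p\<in>Par a' b'. T' = A * T * p)" for T T'
  have eqv_I: "eqv T (A * T * p)" if "A \<in> GL a" "p \<in> Par a' b'" for A T p using that by (auto simp: eqv_def)
  have trans: "eqv T T''" if "eqv T T'" "eqv T' T''" "T \<in> carrier_mat a (a' + b')" for T T' T''
  proof -
    obtain A p A' p' where *: "A \<in> GL a" "p \<in> Par a' b'" "T' = A * T * p" "A' \<in> GL a" "p' \<in> Par a' b'" "T'' = A' * T' * p'"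
      using \<open>eqv T T'\<close> \<open>eqv T' T''\<close> unfolding eqv_def by blast
    have c: "A \<in> carrier_mat a a" "A' \<in> carrier_mat a a" "p \<in> carrier_mat (a' + b') (a' + b')" "p' \<in> carrier_mat (a' + b') (a' + b')"
      using * by (auto simp: GL_def Par_def)
    have "T'' = A' * (A * T * p) * p'" using * by simp
    also have "A' * (A * T * p) = A' * (A * T) * p" using c that
      by (intro assoc_mult_mat[symmetric]) auto
    also have "A' * (A * T) = A' * A * T" using c that by (intro assoc_mult_mat[symmetric]) auto
    also have "A' * A * T * p * p' = A' * A * T * (p * p')" using c that by (intro assoc_mult_mat) auto
    finally show ?thesis using * by (auto simp: eqv_def)
  qed
  have dg: "four_block_mat A (0\<^sub>m a' b') C B \<in> Par a' b'" if "A \<in> GL a'" "B \<in> GL b'" "C \<in> carrier_mat b' a'" for A B C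
    using that by (auto simp: Par_iff GL_carrier four_block_Low blk_four_block[of A a' a' _ b' C b' B])
  have bm: "blk 0 0 a a' (Y * four_block_mat A (0\<^sub>m a' b') C B) = blk 0 0 a a' Y * A + blk 0 a' a b' Y * C"
    "blk 0 a' a b' (Y * four_block_mat A (0\<^sub>m a' b') C B) = blk 0 a' a b' Y * B"
    if "A \<in> carrier_mat a' a'" "B \<in> carrier_mat b' b'" "C \<in> carrier_mat b' a'" "Y \<in> carrier_mat a (a' + b')" for A B C Y
    using that by (simp_all add: blk_mult[of Y a a' b' _ "a' + b'"] blk_four_block[of A a' a' _ b' C b' B]
      right_mult_zero_mat[of _ a a'] left_add_zero_mat[OF mult_carrier_mat[of _ a b']])
  have lm: "blk 0 0 a a' (A * Y) = A * blk 0 0 a a' Y" "blk 0 a' a b' (A * Y) = A * blk 0 a' a b' Y"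
    if "A \<in> carrier_mat a a" "Y \<in> carrier_mat a (a' + b')" for A Y
    using that by (auto intro!: eq_matI simp: scalar_prod_def)
  \<comment> \<open>rank normal form of the right part; \<open>S\<close> moves its pivots to the last \<open>a2\<close> rows\<close>
  obtain A1 B1 a2 where 1: "A1 \<in> GL a" "B1 \<in> GL b'" "a2 \<le> min a b'" "blk 0 a' a b' T = A1 * pid a b' a2 * B1"
    using rank_normal_form[of "blk 0 a' a b' T" a b'] by auto
  define a1 where "a1 = a - a2"
  have a: "a = a1 + a2" "a2 \<le> b'" using 1 by (auto simp: a1_def)
  define S :: "'a mat" where "S = pmat a (\<lambda>i. if i < a1 then i + a2 else i - a1)"
  have S: "S \<in> GL a" unfolding S_def
    by (rule pmat_GL[where \<sigma> = "\<lambda>i. if i < a2 then i + a1 else i - a2"]) (auto simp: a)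
  define N :: "'a mat" where "N = mat a b' (\<lambda>(i, j). if i = a1 + j \<and> j < a2 then 1 else 0)"
  have SN: "S * pid a b' a2 = N"
    unfolding S_def N_def
    by (rule eq_matI, subst pmat_mult_index[where m = b']) (auto simp: pid_def a carrier_matD[OF pmat_carrier])
  define T1 where "T1 = (S * minv A1) * T * four_block_mat (1\<^sub>m a') (0\<^sub>m a' b') (0\<^sub>m b' a') (minv B1)"
  note c1 = GL_carrier[OF 1(1)] GL_carrier[OF 1(2)] GL_carrier[OF S] minv(1)[OF 1(1)] minv(1)[OF 1(2)]
  have T1c: "T1 \<in> carrier_mat a (a' + b')" using c1 T by (auto simp: T1_def)
  have e1: "eqv T T1" unfolding T1_def using 1 S by (intro eqv_I dg) (auto simp: minv)
  have T1r: "blk 0 a' a b' T1 = N"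
  proof -
    have "blk 0 a' a b' T1 = blk 0 a' a b' ((S * minv A1) * T) * minv B1"
      unfolding T1_def using c1 T by (intro bm) auto
    also have "blk 0 a' a b' ((S * minv A1) * T) = S * minv A1 * (A1 * pid a b' a2 * B1)"
      unfolding 1(4)[symmetric] using c1 T by (intro lm) auto
    also have "S * minv A1 * (A1 * pid a b' a2 * B1) = S * (minv A1 * (A1 * pid a b' a2 * B1))"
      using c1 by (intro assoc_mult_mat[of _ a a _ a _ b']) auto
    also have "A1 * pid a b' a2 * B1 = A1 * (pid a b' a2 * B1)"
      using c1 by (intro assoc_mult_mat[of _ a a _ b' _ b']) auto
    also have "minv A1 * (A1 * (pid a b' a2 * B1)) = pid a b' a2 * B1"
      using c1 by (intro GL_cancel_left(1)[OF 1(1)]) auto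
    also have "S * (pid a b' a2 * B1) * minv B1 = S * pid a b' a2 * B1 * minv B1"
      using c1 by (subst assoc_mult_mat[of S a a _ b' _ b']) auto
    also have "\<dots> = S * pid a b' a2" using c1 by (intro GL_cancel_right(1)[OF 1(2)]) auto
    finally show ?thesis by (simp add: SN)
  qed
  \<comment> \<open>\<open>C\<close> subtracts multiples of the pivot columns from the left part\<close>
  define C :: "'a mat" where "C = mat b' a' (\<lambda>(i, j). if i < a2 then - T1 $$ (a1 + i, j) else 0)"
  define T2 where "T2 = 1\<^sub>m a * T1 * four_block_mat (1\<^sub>m a') (0\<^sub>m a' b') C (1\<^sub>m b')"
  have C: "C \<in> carrier_mat b' a'" by (simp add: C_def)
  have T2c: "T2 \<in> carrier_mat a (a' + b')" using C T1c by (auto simp: T2_def)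
  have e2: "eqv T1 T2" unfolding T2_def using C by (intro eqv_I dg) auto
  have T2r: "blk 0 a' a b' T2 = N" unfolding T2_def using C T1c by (simp add: bm T1r N_def)
  have NC: "(N * C) $$ (i, j) = (if a1 \<le> i then C $$ (i - a1, j) else 0)" if "i < a" "j < a'" for i j
  proof -
    have "(N * C) $$ (i, j) = (\<Sum>k<b'. (if i = a1 + k \<and> k < a2 then 1 else 0) * C $$ (k, j))"
      using that C by (auto simp: N_def scalar_prod_def atLeast0LessThan)
    also have "\<dots> = (\<Sum>k<b'. if k = i - a1 then (if a1 \<le> i then C $$ (i - a1, j) else 0) else 0)"
      using that a by (intro sum.cong) auto
    also have "\<dots> = (if a1 \<le> i then C $$ (i - a1, j) else 0)" using that a by auto
    finally show ?thesis .
  qed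
  have T2z: "blk 0 0 a a' T2 $$ (i, j) = 0" if "a1 \<le> i" "i < a" "j < a'" for i j
  proof -
    have "blk 0 0 a a' T2 = blk 0 0 a a' T1 + N * C" unfolding T2_def using C T1c by (simp add: bm T1r)
    then have "blk 0 0 a a' T2 $$ (i, j) = T1 $$ (i, j) + (N * C) $$ (i, j)"
      using that C by (simp add: N_def del: index_mult_mat(1))
    also have "\<dots> = 0" using that a by (subst NC) (auto simp: C_def)
    finally show ?thesis .
  qed
  \<comment> \<open>rank normal form of the first \<open>a1\<close> rows of the left part; the pivot rows are left alone\<close>
  obtain A3 B3 r where 3: "A3 \<in> GL a1" "B3 \<in> GL a'" "r \<le> min a1 a'" "blk 0 0 a1 a' T2 = A3 * pid a1 a' r * B3"
    using rank_normal_form[of "blk 0 0 a1 a' T2" a1 a'] by auto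
  define D where "D = four_block_mat (minv A3) (0\<^sub>m a1 a2) (0\<^sub>m a2 a1) (1\<^sub>m a2)"
  note c3 = GL_carrier[OF 3(1)] GL_carrier[OF 3(2)] minv(1)[OF 3(1)] minv(1)[OF 3(2)]
  have D: "D \<in> GL a" unfolding D_def a using 3 by (intro GL_four_block_lower) (auto simp: minv)
  have Dc: "D \<in> carrier_mat (a1 + a2) (a1 + a2)" using D a by (auto simp: GL_def)
  have DT: "D * T2 \<in> carrier_mat a (a' + b')" using GL_carrier[OF D] T2c by (rule mult_carrier_mat)
  define T3 where "T3 = D * T2 * four_block_mat (minv B3) (0\<^sub>m a' b') (0\<^sub>m b' a') (1\<^sub>m b')"
  have T3c: "T3 \<in> carrier_mat a (a' + b')" using Dc T2c c3 a by (auto simp: T3_def)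
  have e3: "eqv T2 T3" unfolding T3_def using D 3 by (intro eqv_I dg) (auto simp: minv)
  have DY: "blk 0 0 a1 c (D * Y) = minv A3 * blk 0 0 a1 c Y" "blk a1 0 a2 c (D * Y) = blk a1 0 a2 c Y"
    if Y: "Y \<in> carrier_mat (a1 + a2) c" for Y c
  proof -
    note db = blk_four_block[of "minv A3" a1 a1 "0\<^sub>m a1 a2" a2 "0\<^sub>m a2 a1" a2 "1\<^sub>m a2", OF c3(3), simplified, folded D_def]
    show "blk 0 0 a1 c (D * Y) = minv A3 * blk 0 0 a1 c Y"
      using Dc Y c3 by (subst blk_mult[of _ "a1 + a2" a1 a2 _ c]) (auto simp: db left_mult_zero_mat[of _ a2 c]
        right_add_zero_mat[OF mult_carrier_mat[of _ a1 a1]])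
    show "blk a1 0 a2 c (D * Y) = blk a1 0 a2 c Y"
      using Dc Y c3 by (subst blk_mult[of _ "a1 + a2" a1 a2 _ c]) (auto simp: db left_mult_zero_mat[of _ a1 c])
  qed
  have rows: "M = M'" if "M \<in> carrier_mat (a1 + a2) c" "M' \<in> carrier_mat (a1 + a2) c"
    "blk 0 0 a1 c M = blk 0 0 a1 c M'" "blk a1 0 a2 c M = blk a1 0 a2 c M'" for M M' :: "'a mat" and c
    using that by (intro mat_blk_eqI[of M a1 a2 c 0 M']) (auto intro!: eq_matI)
  have T3r: "blk 0 a' a b' T3 = N"
  proof -
    have "blk 0 a' a b' T3 = blk 0 a' a b' (D * T2) * 1\<^sub>m b'"
      unfolding T3_def using c3(4) DT by (intro bm(2)) auto
    also have "\<dots> = blk 0 a' a b' (D * T2)" by (rule right_mult_one_mat[OF blk_carrier])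
    also have "\<dots> = D * N" unfolding T2r[symmetric] by (rule lm(2)[OF GL_carrier[OF D] T2c])
    also have "D * N = N"
    proof (rule rows)
      have N: "N \<in> carrier_mat (a1 + a2) b'" by (simp add: N_def a)
      then show "N \<in> carrier_mat (a1 + a2) b'" "D * N \<in> carrier_mat (a1 + a2) b'" using Dc by simp_all
      have z: "blk 0 0 a1 b' N = 0\<^sub>m a1 b'" by (rule eq_matI) (simp_all add: N_def a)
      show "blk 0 0 a1 b' (D * N) = blk 0 0 a1 b' N"
        unfolding DY(1)[OF N] z using c3(3) by (rule right_mult_zero_mat)
      show "blk a1 0 a2 b' (D * N) = blk a1 0 a2 b' N" by (rule DY(2)[OF N])
    qed
    finally show ?thesis .
  qed
  have T3l: "blk 0 0 a a' T3 = pid a a' r"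
  proof -
    define U where "U = blk 0 0 a a' T2"
    have U: "U \<in> carrier_mat (a1 + a2) a'" by (simp add: U_def a)
    have "blk 0 0 a a' T3 = blk 0 0 a a' (D * T2) * minv B3 + blk 0 a' a b' (D * T2) * 0\<^sub>m b' a'"
      unfolding T3_def using c3(4) DT by (intro bm(1)) auto
    also have "\<dots> = blk 0 0 a a' (D * T2) * minv B3"
      unfolding right_mult_zero_mat[OF blk_carrier]
      by (rule right_add_zero_mat[OF mult_carrier_mat[OF blk_carrier c3(4)]])
    also have "blk 0 0 a a' (D * T2) = D * U" unfolding U_def by (rule lm(1)[OF GL_carrier[OF D] T2c])
    also have "D * U * minv B3 = pid a a' r"
    proof (rule rows)
      have "blk 0 0 a1 a' U = A3 * (pid a1 a' r * B3)" unfolding U_def using 3 c3 a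
        by (subst blk_blk) (auto simp: assoc_mult_mat[of _ a1 a1 _ a' _ a'])
      then have "minv A3 * blk 0 0 a1 a' U = pid a1 a' r * B3"
        by (simp only: GL_cancel_left(1)[OF 3(1) mult_carrier_mat[OF pid_carrier c3(2)]])
      then have "blk 0 0 a1 a' (D * U * minv B3) = pid a1 a' r * B3 * minv B3"
        using U c3 Dc by (subst blk_mult_left[of _ "a1 + a2" a']) (auto simp: DY[OF U])
      also have "\<dots> = pid a1 a' r" by (intro GL_cancel_right(1)[OF 3(2)]) auto
      finally show "blk 0 0 a1 a' (D * U * minv B3) = blk 0 0 a1 a' (pid a a' r)"
        by (auto simp: pid_def a intro!: eq_matI)
      have "blk a1 0 a2 a' U = 0\<^sub>m a2 a'" unfolding U_def using a T2z by (intro eq_matI) auto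
      then have "blk a1 0 a2 a' (D * U * minv B3) = 0\<^sub>m a2 a'"
        using U c3 Dc by (subst blk_mult_left[of _ "a1 + a2" a']) (auto simp: DY[OF U] left_mult_zero_mat[of _ a' a'])
      then show "blk a1 0 a2 a' (D * U * minv B3) = blk a1 0 a2 a' (pid a a' r)"
        using 3 by (auto simp: pid_def a intro!: eq_matI)
    qed (use Dc U c3 a in auto)
    finally show ?thesis .
  qed
  \<comment> \<open>a zero row would contradict the existence of a right inverse\<close>
  have e: "eqv T T3" using e1 e2 e3 trans T T1c T2c by blast
  then obtain A p where Ap: "A \<in> GL a" "p \<in> Par a' b'" "T3 = A * T * p" by (auto simp: eqv_def)
  have "r = a1"
  proof (rule ccontr)
    assume "r \<noteq> a1"
    then have r: "r < a1" using 3 by auto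
    note pc = GL_carrier[OF Ap(1)] GL_carrier[OF Par_GL[OF Ap(2)]] minv(1)[OF Ap(1)] minv(1)[OF Par_GL[OF Ap(2)]]
    have T3z: "T3 $$ (r, j) = 0" if "j < a' + b'" for j
    proof (cases "j < a'")
      case True
      have "T3 $$ (r, j) = blk 0 0 a a' T3 $$ (r, j)" using True r a by simp
      then show ?thesis unfolding T3l using True r a by (simp add: pid_def)
    next
      case False
      have "T3 $$ (r, j) = blk 0 a' a b' T3 $$ (r, j - a')" using False r a that by simp
      then show ?thesis unfolding T3r using False r a that by (simp add: N_def)
    qed
    have "T3 * (minv p * R * minv A) = 1\<^sub>m a"
    proof -
      have "T3 * (minv p * R * minv A) = T3 * (minv p * R) * minv A"
        using pc R T3c by (intro assoc_mult_mat[symmetric]) auto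
      also have "T3 * (minv p * R) = A * T * (p * (minv p * R))"
        unfolding Ap(3) using pc R T by (intro assoc_mult_mat) auto
      also have "\<dots> = A * T * R" using R GL_cancel_left(2)[OF Par_GL[OF Ap(2)]] by simp
      also have "\<dots> = A * (T * R)" using pc R T by (intro assoc_mult_mat) auto
      also have "\<dots> * minv A = 1\<^sub>m a" using R minv(2)[OF Ap(1)] pc by simp
      finally show ?thesis .
    qed
    then have "(T3 * (minv p * R * minv A)) $$ (r, r) = 1" using r a by simp
    moreover have "(T3 * (minv p * R * minv A)) $$ (r, r) = 0"
      using r a pc T3c R T3z by (auto simp: scalar_prod_def)
    ultimately show False by simp
  qed
  with 3 have a1: "a1 \<le> a'" by simp
  have "T3 = blk 0 0 a (a' + b') (wmat a1 a2 (a' - a1) (b' - a2))"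
  proof (rule eq_matI)
    fix i j
    assume "i < dim_row (blk 0 0 a (a' + b') (wmat a1 a2 (a' - a1) (b' - a2)))"
      "j < dim_col (blk 0 0 a (a' + b') (wmat a1 a2 (a' - a1) (b' - a2)))"
    then have ij: "i < a1 + a2" "j < a' + b'" by (simp_all add: a)
    then show "T3 $$ (i, j) = blk 0 0 a (a' + b') (wmat a1 a2 (a' - a1) (b' - a2)) $$ (i, j)"
    proof (cases "j < a'")
      case True
      have "T3 $$ (i, j) = blk 0 0 a a' T3 $$ (i, j)" using True ij a by simp
      then show ?thesis unfolding T3l using True ij a a1 \<open>r = a1\<close>
        by (auto simp: pid_def wmat_def pmat_def shuffle_def)
    next
      case False
      have "T3 $$ (i, j) = blk 0 a' a b' T3 $$ (i, j - a')" using False ij a by simp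
      then show ?thesis unfolding T3r using False ij a a1
        by (auto simp: N_def wmat_def pmat_def shuffle_def)
    qed
  qed (use T3c a in auto)
  moreover have "T = minv A * T3 * minv p"
  proof -
    note pc = GL_carrier[OF Ap(1)] GL_carrier[OF Par_GL[OF Ap(2)]] minv(1)[OF Ap(1)] minv(1)[OF Par_GL[OF Ap(2)]]
    have "minv A * T3 = minv A * (A * (T * p))" unfolding Ap(3) using pc T by (subst assoc_mult_mat[of A a a T _ p]) auto
    also have "\<dots> = T * p" using pc T by (intro GL_cancel_left(1)[OF Ap(1)]) auto
    finally show ?thesis using GL_cancel_right(1)[OF Par_GL[OF Ap(2)] T] by simp
  qed
  ultimately show ?thesis using a a1 Ap minv(4)[OF Ap(1)] Par_minv(1)[OF Ap(2)] by blast
qed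

text \<open>The factor \<open>p\<close> is \<open>g * minv p' * minv w\<close>. Its first \<open>a\<close> rows are \<open>A\<close> followed by zeros, because \<open>bruhat_top\<close>
  puts the first \<open>a\<close> rows of \<open>g\<close> in the form of those of \<open>w\<close>; hence it is parabolic.\<close>

lemma bruhat:
  fixes g :: "'a :: field mat"
  assumes g: "g \<in> GL n" and n: "n = a + b" "n = a' + b'"
  obtains a1 a2 b1 b2 p p' where "a = a1 + a2" "b = b1 + b2" "a' = a1 + b1" "b' = a2 + b2"
    "p \<in> Par a b" "p' \<in> Par a' b'" "g = p * wmat a1 a2 b1 b2 * p'"
proof -
  note gc = GL_carrier[OF g] minv[OF g]
  have TR: "blk 0 0 a n g * blk 0 0 n a (minv g) = 1\<^sub>m a"
  proof -
    have "blk 0 0 a n g * blk 0 0 n a (minv g) = blk 0 0 a a (g * minv g)"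
      using gc(1,2) n by (intro eq_matI) (auto simp: scalar_prod_def)
    also have "\<dots> = blk 0 0 a a (1\<^sub>m n)" by (simp add: gc)
    finally show ?thesis using n by (auto intro!: eq_matI)
  qed
  obtain A p' a1 a2 where *: "A \<in> GL a" "p' \<in> Par a' b'" "a = a1 + a2" "a1 \<le> a'" "a2 \<le> b'"
    "blk 0 0 a n g = A * blk 0 0 a n (wmat a1 a2 (a' - a1) (b' - a2)) * p'"
    using bruhat_top[of "blk 0 0 a n g" a a' b' "blk 0 0 n a (minv g)"] TR n by auto
  define b1 b2 where "b1 = a' - a1" and "b2 = b' - a2"
  have s: "b = b1 + b2" "a' = a1 + b1" "b' = a2 + b2" using * n by (auto simp: b1_def b2_def)
  define w :: "'a mat" where "w = wmat a1 a2 b1 b2"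
  have w: "w \<in> GL n" using wmat_GL[of a1 a2 b1 b2] n * s by (simp add: w_def ac_simps)
  have p': "p' \<in> GL n" using Par_GL[OF *(2)] n by simp
  define p where "p = g * minv p' * minv w"
  have p: "p \<in> GL n" unfolding p_def by (intro GL_mult g minv(4) p' w)
  note c = gc GL_carrier[OF w] GL_carrier[OF p'] GL_carrier[OF *(1)] minv(1)[OF w] minv(1)[OF p'] GL_carrier[OF p]
  have e: "blk 0 0 a n p = A * blk 0 0 a n (1\<^sub>m n)"
  proof -
    have "blk 0 0 a n p = blk 0 0 a n g * minv p' * minv w" unfolding p_def
      using c n by (subst blk_mult_left[of "g * minv p'" n n], simp_all, subst blk_mult_left[of g n n]) auto
    also have "\<dots> = A * blk 0 0 a n w * p' * minv p' * minv w" using * by (simp add: w_def b1_def b2_def)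
    also have "A * blk 0 0 a n w * p' * minv p' = A * blk 0 0 a n w"
      using c by (intro GL_cancel_right(1)[OF p']) auto
    also have "A * blk 0 0 a n w * minv w = A * (blk 0 0 a n w * minv w)"
      using c by (intro assoc_mult_mat[of _ a a _ n]) auto
    also have "blk 0 0 a n w * minv w = blk 0 0 a n (w * minv w)" using c n by (simp add: blk_mult_left[of _ n n])
    also have "\<dots> = blk 0 0 a n (1\<^sub>m n)" by (simp add: minv[OF w])
    finally show ?thesis .
  qed
  have "blk 0 a a b p = blk 0 a a b (A * blk 0 0 a n (1\<^sub>m n))"
    unfolding e[symmetric] using n by (subst blk_blk) auto
  also have "\<dots> = 0\<^sub>m a b" using c n by (auto intro!: eq_matI simp: scalar_prod_def)
  finally have "blk 0 a a b p = 0\<^sub>m a b" .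
  then have "p \<in> Par a b" using p n by (simp add: Par_def Low_def GL_def)
  moreover have "g = p * w * p'"
  proof -
    have "p * w = g * minv p'" unfolding p_def using c by (intro GL_cancel_right(2)[OF w, of _ n]) auto
    moreover have "g * minv p' * p' = g" using c by (intro GL_cancel_right(2)[OF p', of _ n]) auto
    ultimately show ?thesis by simp
  qed
  ultimately show ?thesis using that[of a1 a2 b1 b2 p p'] * s by (auto simp: w_def)
qed

section \<open>Matrices that are block triangular in two orderings\<close>

text \<open>Conjugation by the permutation matrices, with rows and columns of possibly different segment lengths
  because the matrix of an arrow need not be square. It interchanges the two middle segments of rows and
  of columns.\<close>

definition reblock where
  "reblock r1 r2 s1 s2 c1 c2 d1 d2 x = wmat r1 r2 s1 s2 * x * minv (wmat c1 c2 d1 d2)"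

lemma reblock_carrier:
  assumes "x \<in> carrier_mat ((r1 + s1) + (r2 + s2)) ((c1 + d1) + (c2 + d2))"
  shows "reblock r1 r2 s1 s2 c1 c2 d1 d2 x \<in> carrier_mat ((r1 + r2) + (s1 + s2)) ((c1 + c2) + (d1 + d2))"
  unfolding reblock_def minv_wmat unfolding wmat_def carrier_mat_def pmat_def by auto

lemma reblock_index:
  fixes x :: "'a :: field mat"
  assumes x: "x \<in> carrier_mat ((r1 + s1) + (r2 + s2)) ((c1 + d1) + (c2 + d2))"
    and ij: "i < (r1 + r2) + (s1 + s2)" "j < (c1 + c2) + (d1 + d2)"
  shows "reblock r1 r2 s1 s2 c1 c2 d1 d2 x $$ (i, j) = x $$ (shuffle r1 r2 s1 i, shuffle c1 c2 d1 j)"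
proof -
  define m n where "m = r1 + r2 + s1 + s2" and "n = c1 + c2 + d1 + d2"
  have x: "x \<in> carrier_mat m n" and ij: "i < m" "j < n" using assms by (auto simp: m_def n_def ac_simps)
  have w: "wmat r1 r2 s1 s2 = (pmat m (shuffle r1 r2 s1) :: 'a mat)"
    "minv (wmat c1 c2 d1 d2) = (pmat n (shuffle c1 d1 c2) :: 'a mat)"
    unfolding minv_wmat unfolding wmat_def m_def n_def by (simp_all add: ac_simps)
  have s: "shuffle r1 r2 s1 i < m" if "i < m" for i using that unfolding m_def by (rule shuffle_less)
  have s': "shuffle c1 c2 d1 i < n" "shuffle c1 d1 c2 i < n" if "i < n" for i
    using that shuffle_less[of i c1 c2 d1 d2] shuffle_less[of i c1 d1 c2 d2] unfolding n_def by (simp_all add: ac_simps)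
  have "reblock r1 r2 s1 s2 c1 c2 d1 d2 x $$ (i, j) = (pmat m (shuffle r1 r2 s1) * x) $$ (i, shuffle c1 c2 d1 j)"
    unfolding reblock_def w using x ij s s' by (intro mult_pmat_index[of _ m] mult_carrier_mat[OF pmat_carrier x]) auto
  also have "\<dots> = x $$ (shuffle r1 r2 s1 i, shuffle c1 c2 d1 j)"
    using x ij s s' by (intro pmat_mult_index) auto
  finally show ?thesis .
qed

lemma reblock_reblock:
  fixes x :: "'a :: field mat"
  assumes x: "x \<in> carrier_mat ((r1 + s1) + (r2 + s2)) ((c1 + d1) + (c2 + d2))"
  shows "reblock r1 s1 r2 s2 c1 d1 c2 d2 (reblock r1 r2 s1 s2 c1 c2 d1 d2 x) = x"
proof (rule eq_matI)
  note c = reblock_carrier[OF x] and c' = reblock_carrier[OF reblock_carrier[OF x]]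
  fix i j assume "i < dim_row x" "j < dim_col x"
  then have ij: "i < (r1 + s1) + (r2 + s2)" "j < (c1 + d1) + (c2 + d2)" using x by auto
  have s: "shuffle r1 s1 r2 i < (r1 + r2) + (s1 + s2)" "shuffle c1 d1 c2 j < (c1 + c2) + (d1 + d2)"
    using shuffle_less[of i r1 s1 r2 s2] shuffle_less[of j c1 d1 c2 d2] ij by (simp_all add: ac_simps)
  show "reblock r1 s1 r2 s2 c1 d1 c2 d2 (reblock r1 r2 s1 s2 c1 c2 d1 d2 x) $$ (i, j) = x $$ (i, j)"
    by (simp add: reblock_index[OF c ij] reblock_index[OF x s])
qed (use x reblock_carrier[OF reblock_carrier[OF x]] in auto)

lemma blk_reblock:
  fixes x :: "'a :: field mat"
  assumes x: "x \<in> carrier_mat ((r1 + s1) + (r2 + s2)) ((c1 + d1) + (c2 + d2))"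
    and "i + r \<le> (r1 + r2) + (s1 + s2)" "j + c \<le> (c1 + c2) + (d1 + d2)"
    and "\<And>a. a < r \<Longrightarrow> shuffle r1 r2 s1 (i + a) = i' + a" "\<And>a. a < c \<Longrightarrow> shuffle c1 c2 d1 (j + a) = j' + a"
  shows "blk i j r c (reblock r1 r2 s1 s2 c1 c2 d1 d2 x) = blk i' j' r c x"
  by (rule eq_matI) (use assms in \<open>simp_all add: reblock_index[OF x]\<close>)

lemma shuffle_segment:
  "a < a1 \<Longrightarrow> shuffle a1 a2 b1 (0 + a) = 0 + a"
  "a < a2 \<Longrightarrow> shuffle a1 a2 b1 (a1 + a) = (a1 + b1) + a"
  "a < b1 \<Longrightarrow> shuffle a1 a2 b1 ((a1 + a2) + a) = a1 + a"
  "shuffle a1 a2 b1 ((a1 + a2 + b1) + a) = (a1 + b1 + a2) + a"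
  by (auto simp: shuffle_def)

lemma reblock_blocks:
  fixes x :: "'a :: field mat"
  assumes x: "x \<in> carrier_mat ((r1 + s1) + (r2 + s2)) ((c1 + d1) + (c2 + d2))"
  defines "y \<equiv> reblock r1 r2 s1 s2 c1 c2 d1 d2 x"
  shows
    "blk 0 0 r1 c1 y = blk 0 0 r1 c1 x" "blk 0 c1 r1 c2 y = blk 0 (c1 + d1) r1 c2 x"
    "blk 0 (c1 + c2) r1 d1 y = blk 0 c1 r1 d1 x" "blk 0 (c1 + c2 + d1) r1 d2 y = blk 0 (c1 + d1 + c2) r1 d2 x"
    "blk r1 0 r2 c1 y = blk (r1 + s1) 0 r2 c1 x" "blk r1 c1 r2 c2 y = blk (r1 + s1) (c1 + d1) r2 c2 x"
    "blk r1 (c1 + c2) r2 d1 y = blk (r1 + s1) c1 r2 d1 x" "blk r1 (c1 + c2 + d1) r2 d2 y = blk (r1 + s1) (c1 + d1 + c2) r2 d2 x"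
    "blk (r1 + r2) 0 s1 c1 y = blk r1 0 s1 c1 x" "blk (r1 + r2) c1 s1 c2 y = blk r1 (c1 + d1) s1 c2 x"
    "blk (r1 + r2) (c1 + c2) s1 d1 y = blk r1 c1 s1 d1 x" "blk (r1 + r2) (c1 + c2 + d1) s1 d2 y = blk r1 (c1 + d1 + c2) s1 d2 x"
    "blk (r1 + r2 + s1) 0 s2 c1 y = blk (r1 + s1 + r2) 0 s2 c1 x" "blk (r1 + r2 + s1) c1 s2 c2 y = blk (r1 + s1 + r2) (c1 + d1) s2 c2 x"
    "blk (r1 + r2 + s1) (c1 + c2) s2 d1 y = blk (r1 + s1 + r2) c1 s2 d1 x" "blk (r1 + r2 + s1) (c1 + c2 + d1) s2 d2 y = blk (r1 + s1 + r2) (c1 + d1 + c2) s2 d2 x"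
  unfolding y_def by (rule blk_reblock[OF x], linarith, linarith, (erule shuffle_segment | rule shuffle_segment), (erule shuffle_segment | rule shuffle_segment))+

text \<open>The matrices, in four strips of rows and columns, that are block triangular with diagonal blocks \<open>u\<close> and
  \<open>v\<close>, and that become block triangular also after the middle strips are interchanged. Both conditions
  together kill 7 of the 16 blocks.\<close>

definition Zfib where
  "Zfib r1 r2 s1 s2 c1 c2 d1 d2 u v = {x \<in> Low (r1 + s1) (r2 + s2) (c1 + d1) (c2 + d2).
     TL (r1 + s1) (c1 + d1) x = u \<and> BR (r1 + s1) (r2 + s2) (c1 + d1) (c2 + d2) x = v \<and>
     reblock r1 r2 s1 s2 c1 c2 d1 d2 x \<in> Low (r1 + r2) (s1 + s2) (c1 + c2) (d1 + d2)}"

lemma blk_zero: "i + r \<le> R \<Longrightarrow> j + c \<le> C \<Longrightarrow> blk i j r c (0\<^sub>m R C) = 0\<^sub>m r c"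
  by (rule eq_matI) auto

text \<open>Of the 9 surviving blocks, 3 form \<open>u\<close> and 3 form \<open>v\<close>; the diagonal blocks \<open>s\<close> and \<open>t\<close> after the interchange
  share their own diagonal blocks with \<open>u\<close> and \<open>v\<close>.\<close>

lemma Zfib_D:
  fixes x :: "'a :: field mat"
  assumes "x \<in> Zfib r1 r2 s1 s2 c1 c2 d1 d2 u v"
  defines "y \<equiv> reblock r1 r2 s1 s2 c1 c2 d1 d2 x"
  defines "s \<equiv> TL (r1 + r2) (c1 + c2) y" and "t \<equiv> BR (r1 + r2) (s1 + s2) (c1 + c2) (d1 + d2) y"
  shows "u \<in> Low r1 s1 c1 d1" "v \<in> Low r2 s2 c2 d2" "s \<in> Low r1 r2 c1 c2" "t \<in> Low s1 s2 d1 d2"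
    "TL r1 c1 s = TL r1 c1 u" "BR r1 r2 c1 c2 s = TL r2 c2 v"
    "TL s1 d1 t = BR r1 s1 c1 d1 u" "BR s1 s2 d1 d2 t = BR r2 s2 c2 d2 v"
proof -
  have x: "x \<in> carrier_mat ((r1 + s1) + (r2 + s2)) ((c1 + d1) + (c2 + d2))"
    and u: "u = TL (r1 + s1) (c1 + d1) x" and v: "v = BR (r1 + s1) (r2 + s2) (c1 + d1) (c2 + d2) x"
    and y: "y \<in> carrier_mat ((r1 + r2) + (s1 + s2)) ((c1 + c2) + (d1 + d2))"
    and zx: "blk 0 (c1 + d1) (r1 + s1) (c2 + d2) x = 0\<^sub>m (r1 + s1) (c2 + d2)"
    and zy: "blk 0 (c1 + c2) (r1 + r2) (d1 + d2) y = 0\<^sub>m (r1 + r2) (d1 + d2)"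
    using assms(1) by (auto simp: Zfib_def Low_def y_def)
  note rb = reblock_blocks[OF x, folded y_def]
  have X: "blk (0 + i) (c1 + d1 + j) r c x = 0\<^sub>m r c" if "i + r \<le> r1 + s1" "j + c \<le> c2 + d2" for i j r c
    unfolding blk_blk[OF that, symmetric] zx by (rule blk_zero[OF that])
  have Y: "blk (0 + i) (c1 + c2 + j) r c y = 0\<^sub>m r c" if "i + r \<le> r1 + r2" "j + c \<le> d1 + d2" for i j r c
    unfolding blk_blk[OF that, symmetric] zy by (rule blk_zero[OF that])
  show "u \<in> Low r1 s1 c1 d1" using Y[of 0 r1 0 d1] by (simp add: Low_def u blk_blk rb)
  show "v \<in> Low r2 s2 c2 d2" using Y[of r1 r2 d1 d2] by (simp add: Low_def v blk_blk rb)
  show "s \<in> Low r1 r2 c1 c2" using X[of 0 r1 0 c2] by (simp add: Low_def s_def blk_blk rb)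
  show "t \<in> Low s1 s2 d1 d2" using X[of r1 s1 c2 d2] by (simp add: Low_def t_def blk_blk rb)
  show "TL r1 c1 s = TL r1 c1 u" "BR r1 r2 c1 c2 s = TL r2 c2 v"
    "TL s1 d1 t = BR r1 s1 c1 d1 u" "BR s1 s2 d1 d2 t = BR r2 s2 c2 d2 v"
    by (simp_all add: s_def t_def u v blk_blk rb)
qed

text \<open>Given \<open>u\<close>, \<open>v\<close>, \<open>s\<close> and \<open>t\<close>, eight of the nine blocks are determined. The ninth, with rows in the last and columns in
  the first strip, is free.\<close>

lemma Zfib_card:
  fixes u v s t :: "'a :: {field, finite} mat"
  assumes u: "u \<in> Low r1 s1 c1 d1" and v: "v \<in> Low r2 s2 c2 d2"
    and s: "s \<in> Low r1 r2 c1 c2" and t: "t \<in> Low s1 s2 d1 d2"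
    and st: "TL r1 c1 s = TL r1 c1 u" "BR r1 r2 c1 c2 s = TL r2 c2 v"
    "TL s1 d1 t = BR r1 s1 c1 d1 u" "BR s1 s2 d1 d2 t = BR r2 s2 c2 d2 v"
  shows "card {x \<in> Zfib r1 r2 s1 s2 c1 c2 d1 d2 u v.
    TL (r1 + r2) (c1 + c2) (reblock r1 r2 s1 s2 c1 c2 d1 d2 x) = s \<and>
    BR (r1 + r2) (s1 + s2) (c1 + c2) (d1 + d2) (reblock r1 r2 s1 s2 c1 c2 d1 d2 x) = t} = CARD('a) ^ (s2 * c1)"
    (is "card ?S = _")
proof -
  define L where "L e = four_block_mat (blk r1 0 s1 c1 u) (0\<^sub>m s1 c2) e (blk r2 0 s2 c2 v)" for e
  define Y where "Y e = four_block_mat s (0\<^sub>m (r1 + r2) (d1 + d2)) (L e) t" for e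
  define fe where "fe e = reblock r1 s1 r2 s2 c1 d1 c2 d2 (Y e)" for e
  have c: "s \<in> carrier_mat (r1 + r2) (c1 + c2)" "t \<in> carrier_mat (s1 + s2) (d1 + d2)"
    using s t by (auto simp: Low_def)
  have L: "L e \<in> carrier_mat (s1 + s2) (c1 + c2)" "blk 0 0 s1 c1 (L e) = blk r1 0 s1 c1 u"
    "blk 0 c1 s1 c2 (L e) = 0\<^sub>m s1 c2" "blk s1 0 s2 c1 (L e) = e" "blk s1 c1 s2 c2 (L e) = blk r2 0 s2 c2 v"
    if "e \<in> carrier_mat s2 c1" for e
    unfolding L_def using that blk_four_block[of "blk r1 0 s1 c1 u" s1 c1 "0\<^sub>m s1 c2" c2 e s2 "blk r2 0 s2 c2 v"] by auto
  have Y: "Y e \<in> carrier_mat ((r1 + r2) + (s1 + s2)) ((c1 + c2) + (d1 + d2))"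
    "blk 0 0 (r1 + r2) (c1 + c2) (Y e) = s" "blk 0 (c1 + c2) (r1 + r2) (d1 + d2) (Y e) = 0\<^sub>m (r1 + r2) (d1 + d2)"
    "blk (r1 + r2) 0 (s1 + s2) (c1 + c2) (Y e) = L e" "blk (r1 + r2) (c1 + c2) (s1 + s2) (d1 + d2) (Y e) = t"
    if "e \<in> carrier_mat s2 c1" for e
    unfolding Y_def using that blk_four_block[of s "r1 + r2" "c1 + c2" "0\<^sub>m (r1 + r2) (d1 + d2)" "d1 + d2" "L e" "s1 + s2" t] L c by auto
  have bY: "blk i j r c (Y e) = blk i j r c s"
    if "e \<in> carrier_mat s2 c1" "i + r \<le> r1 + r2" "j + c \<le> c1 + c2" for e i j r c
    using that Y(2)[OF that(1)] blk_blk[of i r "r1 + r2" j c "c1 + c2" 0 0 "Y e"] by simp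
  have bY2: "blk i (c1 + c2 + j) r c (Y e) = 0\<^sub>m r c"
    if "e \<in> carrier_mat s2 c1" "i + r \<le> r1 + r2" "j + c \<le> d1 + d2" for e i j r c
    using that Y(3)[OF that(1)] blk_blk[of i r "r1 + r2" j c "d1 + d2" 0 "c1 + c2" "Y e"] blk_zero[of i r "r1 + r2" j c "d1 + d2"] by (metis add_0)
  have bY3: "blk (r1 + r2 + i) j r c (Y e) = blk i j r c (L e)"
    if "e \<in> carrier_mat s2 c1" "i + r \<le> s1 + s2" "j + c \<le> c1 + c2" for e i j r c
    using that Y(4)[OF that(1)] blk_blk[of i r "s1 + s2" j c "c1 + c2" "r1 + r2" 0 "Y e"] by simp
  have bY4: "blk (r1 + r2 + i) (c1 + c2 + j) r c (Y e) = blk i j r c t"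
    if "e \<in> carrier_mat s2 c1" "i + r \<le> s1 + s2" "j + c \<le> d1 + d2" for e i j r c
    using that Y(5)[OF that(1)] blk_blk[of i r "s1 + s2" j c "d1 + d2" "r1 + r2" "c1 + c2" "Y e"] by simp
  have rr: "reblock r1 r2 s1 s2 c1 c2 d1 d2 (fe e) = Y e" if "e \<in> carrier_mat s2 c1" for e
    unfolding fe_def by (rule reblock_reblock[OF Y(1)[OF that]])
  have fc: "fe e \<in> carrier_mat ((r1 + s1) + (r2 + s2)) ((c1 + d1) + (c2 + d2))" if "e \<in> carrier_mat s2 c1" for e
    unfolding fe_def by (rule reblock_carrier[OF Y(1)[OF that]])
  have z: "blk 0 c1 r1 d1 u = 0\<^sub>m r1 d1" "blk 0 c2 r2 d2 v = 0\<^sub>m r2 d2" "blk 0 c1 r1 c2 s = 0\<^sub>m r1 c2" "blk 0 d1 s1 d2 t = 0\<^sub>m s1 d2"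
    using u v s t by (auto simp: Low_def)
  have "bij_betw fe (carrier_mat s2 c1) ?S"
  proof (rule bij_betw_byWitness[where f' = "blk (r1 + s1 + r2) 0 s2 c1"])
    show "\<forall>e\<in>carrier_mat s2 c1. blk (r1 + s1 + r2) 0 s2 c1 (fe e) = e"
    proof
      fix e :: "'a mat" assume e: "e \<in> carrier_mat s2 c1"
      have "blk (r1 + s1 + r2) 0 s2 c1 (fe e) = blk (r1 + r2 + s1) 0 s2 c1 (Y e)"
        using reblock_blocks(13)[OF fc[OF e]] rr[OF e] by simp
      then show "blk (r1 + s1 + r2) 0 s2 c1 (fe e) = e" using bY3[OF e, of s1 s2 0 c1] L(4)[OF e] by simp
    qed
    show "\<forall>x\<in>?S. fe (blk (r1 + s1 + r2) 0 s2 c1 x) = x"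
    proof
      fix x assume x: "x \<in> ?S"
      define y where "y = reblock r1 r2 s1 s2 c1 c2 d1 d2 x"
      define e where "e = blk (r1 + s1 + r2) 0 s2 c1 x"
      have xc: "x \<in> carrier_mat ((r1 + s1) + (r2 + s2)) ((c1 + d1) + (c2 + d2))"
        and uv: "u = TL (r1 + s1) (c1 + d1) x" "v = BR (r1 + s1) (r2 + s2) (c1 + d1) (c2 + d2) x"
        and zx: "blk 0 (c1 + d1) (r1 + s1) (c2 + d2) x = 0\<^sub>m (r1 + s1) (c2 + d2)"
        using x by (auto simp: Zfib_def Low_def)
      have yL: "y \<in> Low (r1 + r2) (s1 + s2) (c1 + c2) (d1 + d2)" "TL (r1 + r2) (c1 + c2) y = s"
        "BR (r1 + r2) (s1 + s2) (c1 + c2) (d1 + d2) y = t"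
        using x by (auto simp: Zfib_def y_def)
      note rb = reblock_blocks[OF xc, folded y_def]
      have "blk (r1 + r2) 0 (s1 + s2) (c1 + c2) y = L e"
      proof (rule mat_blk_eqI)
        have e: "e \<in> carrier_mat s2 c1" by (simp add: e_def)
        show "L e \<in> carrier_mat (s1 + s2) (c1 + c2)" by (rule L(1)[OF e])
        have "blk r1 (c1 + d1) s1 c2 x = blk r1 0 s1 c2 (blk 0 (c1 + d1) (r1 + s1) (c2 + d2) x)"
          by (simp add: blk_blk)
        then have "blk r1 (c1 + d1) s1 c2 x = 0\<^sub>m s1 c2" unfolding zx by (simp add: blk_zero)
        then show "blk 0 c1 s1 c2 (blk (r1 + r2) 0 (s1 + s2) (c1 + c2) y) = blk 0 c1 s1 c2 (L e)"
          by (simp add: blk_blk rb L(3)[OF e])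
        show "blk 0 0 s1 c1 (blk (r1 + r2) 0 (s1 + s2) (c1 + c2) y) = blk 0 0 s1 c1 (L e)"
          "blk s1 0 s2 c1 (blk (r1 + r2) 0 (s1 + s2) (c1 + c2) y) = blk s1 0 s2 c1 (L e)"
          "blk s1 c1 s2 c2 (blk (r1 + r2) 0 (s1 + s2) (c1 + c2) y) = blk s1 c1 s2 c2 (L e)"
          unfolding L[OF e] by (simp_all add: blk_blk rb uv e_def)
      qed simp
      then have "y = Y e" using Low_four_block[OF yL(1)] unfolding Y_def yL by simp
      then show "fe (blk (r1 + s1 + r2) 0 s2 c1 x) = x"
        unfolding fe_def e_def[symmetric] by (simp add: y_def reblock_reblock[OF xc] flip: \<open>y = Y e\<close>)
    qed
    show "fe ` carrier_mat s2 c1 \<subseteq> ?S"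
    proof
      fix x assume "x \<in> fe ` carrier_mat s2 c1"
      then obtain e where e: "e \<in> carrier_mat s2 c1" "x = fe e" by auto
      have xc: "x \<in> carrier_mat ((r1 + s1) + (r2 + s2)) ((c1 + d1) + (c2 + d2))" using fc e by simp
      have xy: "reblock r1 r2 s1 s2 c1 c2 d1 d2 x = Y e" using rr e by simp
      note rb = reblock_blocks[OF xc, unfolded xy, symmetric]
      note b = bY[OF e(1)] bY2[OF e(1), of _ _ 0, simplified] bY2[OF e(1)] bY3[OF e(1), of 0, simplified] bY3[OF e(1)]
        bY4[OF e(1), of 0, simplified] bY4[OF e(1), of 0 _ 0, simplified] bY4[OF e(1), of _ _ 0, simplified] bY4[OF e(1)]
      have tl: "TL (r1 + s1) (c1 + d1) x = u"
        by (rule mat_blk_eqI[of _ r1 s1 c1 d1]) (use Low_carrier[OF u] st in \<open>simp_all add: blk_blk rb b z L[OF e(1)]\<close>)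
      have br: "BR (r1 + s1) (r2 + s2) (c1 + d1) (c2 + d2) x = v"
        by (rule mat_blk_eqI[of _ r2 s2 c2 d2]) (use Low_carrier[OF v] st in \<open>simp_all add: blk_blk rb b z L[OF e(1)]\<close>)
      have "blk 0 (c1 + d1) (r1 + s1) (c2 + d2) x = 0\<^sub>m (r1 + s1) (c2 + d2)"
        by (rule mat_blk_eqI[of _ r1 s1 c2 d2]) (simp_all add: blk_blk blk_zero rb b z L[OF e(1)])
      then have "x \<in> Low (r1 + s1) (r2 + s2) (c1 + d1) (c2 + d2)" using xc by (simp add: Low_def)
      moreover have "Y e \<in> Low (r1 + r2) (s1 + s2) (c1 + c2) (d1 + d2)" using Y[OF e(1)] by (simp add: Low_def)
      ultimately show "x \<in> ?S" using tl br Y[OF e(1)] by (simp add: Zfib_def xy)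
    qed
  qed auto
  from bij_betw_same_card[OF this] show ?thesis by (simp add: card_carrier_mat)
qed

lemma finite_Low: "finite (Low r1 r2 c1 c2 :: 'a :: {zero, finite} mat set)"
  by (rule finite_subset[OF _ finite_carrier_mat]) (auto simp: Low_def)

lemma finite_Zfib: "finite (Zfib r1 r2 s1 s2 c1 c2 d1 d2 u v :: 'a :: {field, finite} mat set)"
  by (rule finite_subset[OF _ finite_Low]) (auto simp: Zfib_def)

lemma card_Zfib:
  fixes u v :: "'a :: {field, finite} mat"
  assumes u: "u \<in> Low r1 s1 c1 d1" and v: "v \<in> Low r2 s2 c2 d2"
  shows "card (Zfib r1 r2 s1 s2 c1 c2 d1 d2 u v) = CARD('a) ^ (r2 * c1 + s2 * d1 + s2 * c1)"
proof -
  let ?S = "{s \<in> Low r1 r2 c1 c2. TL r1 c1 s = TL r1 c1 u \<and> BR r1 r2 c1 c2 s = TL r2 c2 v}"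
  let ?T = "{t \<in> Low s1 s2 d1 d2. TL s1 d1 t = BR r1 s1 c1 d1 u \<and> BR s1 s2 d1 d2 t = BR r2 s2 c2 d2 v}"
  let ?y = "reblock r1 r2 s1 s2 c1 c2 d1 d2"
  let ?f = "\<lambda>x. (TL (r1 + r2) (c1 + c2) (?y x), BR (r1 + r2) (s1 + s2) (c1 + c2) (d1 + d2) (?y x))"
  have "card (Zfib r1 r2 s1 s2 c1 c2 d1 d2 u v) = card (?S \<times> ?T) * CARD('a) ^ (s2 * c1)"
  proof (rule card_by_fibres[where f = ?f])
    fix y assume "y \<in> ?S \<times> ?T"
    then show "card {x \<in> Zfib r1 r2 s1 s2 c1 c2 d1 d2 u v. ?f x = y} = CARD('a) ^ (s2 * c1)"
      using Zfib_card[OF u v, of "fst y" "snd y"] by (cases y) auto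
  next
    fix x assume "x \<in> Zfib r1 r2 s1 s2 c1 c2 d1 d2 u v"
    from Zfib_D[OF this] show "?f x \<in> ?S \<times> ?T" by simp
  qed (auto simp: finite_Zfib finite_Low)
  then show ?thesis
    by (simp add: card_cartesian_product card_Low_fibre power_add)
qed

text \<open>The number of ways to write an element of the double coset of \<open>wmat a1 a2 b1 b2\<close> as \<open>p * w * p'\<close>. The exponent
  collects the unipotent parts of \<open>Par a1 b1\<close>, \<open>Par a2 b2\<close> and the three blocks that are free in
  \<open>Zfib\<close>. The type argument carries the field.\<close>

definition dcoset_stab :: "'a :: {field, finite} itself \<Rightarrow> nat \<Rightarrow> nat \<Rightarrow> nat \<Rightarrow> nat \<Rightarrow> nat" where
  "dcoset_stab T a1 a2 b1 b2 = card (GL a1 :: 'a mat set) * card (GL b1 :: 'a mat set) *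
     card (GL a2 :: 'a mat set) * card (GL b2 :: 'a mat set) *
     CARD('a) ^ (a1 * b1 + a2 * b2 + a1 * a2 + b1 * b2 + a1 * b2)"

text \<open>Invertibility of a member of \<open>Zfib\<close> only depends on \<open>u\<close> and \<open>v\<close>, so the intersection of a parabolic subgroup with the
  conjugate of another one fibres over \<open>Par a1 b1 \<times> Par a2 b2\<close>.\<close>

lemma card_Par_reblock:
  "card {r :: 'a mat. r \<in> Par (a1 + b1) (a2 + b2) \<and> reblock a1 a2 b1 b2 a1 a2 b1 b2 r \<in> Par (a1 + a2) (b1 + b2)} =
    dcoset_stab TYPE('a :: {field, finite}) a1 a2 b1 b2"
  (is "card ?R = _")
proof -
  let ?f = "\<lambda>r :: 'a mat. (TL (a1 + b1) (a1 + b1) r, BR (a1 + b1) (a2 + b2) (a1 + b1) (a2 + b2) r)"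
  have GLr: "reblock a1 a2 b1 b2 a1 a2 b1 b2 r \<in> GL (a1 + a2 + (b1 + b2))"
    if "r \<in> GL (a1 + b1 + (a2 + b2))" for r :: "'a mat"
  proof -
    have "r \<in> GL (a1 + a2 + b1 + b2)" using that by (simp add: ac_simps)
    then show ?thesis using wmat_GL[of a1 a2 b1 b2] minv(4)[OF wmat_GL[of a1 a2 b1 b2]]
      unfolding reblock_def by (metis GL_mult add.assoc)
  qed
  have Zeq: "{r \<in> ?R. ?f r = y} = Zfib a1 a2 b1 b2 a1 a2 b1 b2 (fst y) (snd y)" if "y \<in> Par a1 b1 \<times> Par a2 b2" for y
  proof (rule Set.set_eqI)
    fix x :: "'a mat"
    have "x \<in> ?R \<longleftrightarrow> x \<in> Par (a1 + b1) (a2 + b2) \<and> reblock a1 a2 b1 b2 a1 a2 b1 b2 x \<in> Low (a1 + a2) (b1 + b2) (a1 + a2) (b1 + b2)"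
      using GLr by (auto simp: Par_def)
    then show "x \<in> {r \<in> ?R. ?f r = y} \<longleftrightarrow> x \<in> Zfib a1 a2 b1 b2 a1 a2 b1 b2 (fst y) (snd y)"
      using Par_iff[of x "a1 + b1" "a2 + b2"] Par_GL[of "fst y" a1 b1] Par_GL[of "snd y" a2 b2] that
      by (cases y) (auto simp: Zfib_def)
  qed
  have "card ?R = card ((Par a1 b1 :: 'a mat set) \<times> (Par a2 b2 :: 'a mat set)) * CARD('a) ^ (a2 * a1 + b2 * b1 + b2 * a1)"
  proof (rule card_by_fibres[where f = ?f])
    fix y :: "'a mat \<times> 'a mat" assume y: "y \<in> Par a1 b1 \<times> Par a2 b2"
    then have "fst y \<in> Low a1 b1 a1 b1" "snd y \<in> Low a2 b2 a2 b2" by (auto simp: Par_def)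
    then show "card {r \<in> ?R. ?f r = y} = CARD('a) ^ (a2 * a1 + b2 * b1 + b2 * a1)"
      unfolding Zeq[OF y] by (rule card_Zfib)
  next
    fix r :: "'a mat" assume r: "r \<in> ?R"
    then have "r \<in> Zfib a1 a2 b1 b2 a1 a2 b1 b2 (TL (a1 + b1) (a1 + b1) r) (BR (a1 + b1) (a2 + b2) (a1 + b1) (a2 + b2) r)"
      by (auto simp: Zfib_def Par_def)
    from Zfib_D(1,2)[OF this] show "?f r \<in> Par a1 b1 \<times> Par a2 b2"
      using r Par_iff[of r "a1 + b1" "a2 + b2"] by (auto simp: Par_def)
  qed (auto simp: finite_Par)
  then show ?thesis
    by (simp add: card_cartesian_product card_Par dcoset_stab_def power_add mult.commute[of a2 a1]
      mult.commute[of b2 b1] mult.commute[of b2 a1] algebra_simps)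
qed

text \<open>The factorisations of \<open>g\<close> are a torsor under the intersection of \<open>Par (a1 + b1) (a2 + b2)\<close> with the conjugate of
  \<open>Par (a1 + a2) (b1 + b2)\<close> by \<open>w\<close>.\<close>

lemma card_dcoset_fibre:
  fixes g :: "'a :: {field, finite} mat"
  assumes p: "p \<in> Par (a1 + a2) (b1 + b2)" "p' \<in> Par (a1 + b1) (a2 + b2)" and g: "g = p * wmat a1 a2 b1 b2 * p'"
  shows "card {(r, r'). r \<in> Par (a1 + a2) (b1 + b2) \<and> r' \<in> Par (a1 + b1) (a2 + b2) \<and> r * wmat a1 a2 b1 b2 * r' = g} =
    dcoset_stab TYPE('a) a1 a2 b1 b2"
proof -
  define n where "n = a1 + a2 + b1 + b2"
  define w :: "'a mat" where "w = wmat a1 a2 b1 b2"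
  have w: "w \<in> GL n" unfolding w_def n_def by (rule wmat_GL)
  have n: "a1 + b1 + (a2 + b2) = n" "a1 + a2 + (b1 + b2) = n" by (auto simp: n_def)
  have PG: "x \<in> GL n" if "x \<in> Par (a1 + a2) (b1 + b2) \<or> x \<in> Par (a1 + b1) (a2 + b2)" for x :: "'a mat"
    using that Par_GL n by metis
  let ?S = "{(r, r'). r \<in> Par (a1 + a2) (b1 + b2) \<and> r' \<in> Par (a1 + b1) (a2 + b2) \<and> r * w * r' = g}"
  let ?R = "{r :: 'a mat. r \<in> Par (a1 + b1) (a2 + b2) \<and> reblock a1 a2 b1 b2 a1 a2 b1 b2 r \<in> Par (a1 + a2) (b1 + b2)}"
  have ga [simp]: "A * B * C = A * (B * C)" if "A \<in> GL n" "B \<in> GL n" "C \<in> GL n" for A B C :: "'a mat"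
    using that by (intro assoc_mult_mat[of _ n n _ n _ n]) (auto simp: GL_def)
  have gc [simp]: "A * minv A = 1\<^sub>m n" "minv A * A = 1\<^sub>m n" "A * 1\<^sub>m n = A" "1\<^sub>m n * A = A"
    "minv A \<in> GL n" "minv (minv A) = A" if "A \<in> GL n" for A :: "'a mat"
    using minv[OF that] GL_carrier[OF that] minv_minv[OF that] by simp_all
  have gc2 [simp]: "A * (minv A * B) = B" "minv A * (A * B) = B" "A * B \<in> GL n" "minv (A * B) = minv B * minv A"
    if "A \<in> GL n" "B \<in> GL n" for A B :: "'a mat"
    using GL_cancel_left[OF that(1) GL_carrier[OF that(2)]] minv_mult[OF that] GL_mult[OF that] by simp_all
  have rb: "reblock a1 a2 b1 b2 a1 a2 b1 b2 r = w * r * minv w" for r by (simp add: reblock_def w_def)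
  note G [simp] = PG[OF disjI1] PG[OF disjI2] w
  have pG [simp]: "p \<in> GL n" "p' \<in> GL n" using p G by blast+
  have "bij_betw (\<lambda>(r, r'). p' * minv r') ?S ?R"
  proof (rule bij_betw_byWitness[where f' = "\<lambda>x. (p * (w * x * minv w), minv x * p')"])
    have S: "p * (w * (p' * (minv r' * minv w))) = r" if "(r, r') \<in> ?S" for r r'
    proof -
      have r: "r \<in> GL n" "r' \<in> GL n" "r * w * r' = p * w * p'" using that G by (auto simp: g w_def)
      then have "p * (w * (p' * (minv r' * minv w))) = (p * w * p') * (minv r' * minv w)" by simp
      also have "\<dots> = r" unfolding r(3)[symmetric] using r(1,2) by simp
      finally show ?thesis .
    qed
    show "\<forall>y\<in>?S. (\<lambda>x. (p * (w * x * minv w), minv x * p')) (case y of (r, r') \<Rightarrow> p' * minv r') = y"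
    proof
      fix y assume "y \<in> ?S"
      then obtain r r' where r: "r \<in> Par (a1 + a2) (b1 + b2)" "r' \<in> Par (a1 + b1) (a2 + b2)" "r * w * r' = g" "y = (r, r')"
        by auto
      then have "(r, r') \<in> ?S" by simp
      from S[OF this] r(1,2,4)
      show "(\<lambda>x. (p * (w * x * minv w), minv x * p')) (case y of (r, r') \<Rightarrow> p' * minv r') = y" by simp
    qed
    show "\<forall>x\<in>?R. (case (p * (w * x * minv w), minv x * p') of (r, r') \<Rightarrow> p' * minv r') = x" by simp
    show "(\<lambda>(r, r'). p' * minv r') ` ?S \<subseteq> ?R"
    proof
      fix y assume "y \<in> (\<lambda>(r, r'). p' * minv r') ` ?S"
      then obtain r r' where r: "r \<in> Par (a1 + a2) (b1 + b2)" "r' \<in> Par (a1 + b1) (a2 + b2)" "r * w * r' = g" "y = p' * minv r'"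
        by auto
      then have y: "p' * minv r' \<in> Par (a1 + b1) (a2 + b2)" using p by (intro Par_mult Par_minv)
      have "(r, r') \<in> ?S" using r by simp
      from S[OF this] have "minv p * r = minv p * (p * (w * (p' * (minv r' * minv w))))" by simp
      also have "\<dots> = w * (p' * (minv r' * minv w))" using r(1,2) by simp
      finally have mp: "minv p * r = w * (p' * (minv r' * minv w))" .
      have "minv p * r \<in> Par (a1 + a2) (b1 + b2)" using p r by (intro Par_mult Par_minv)
      then have "w * (p' * (minv r' * minv w)) \<in> Par (a1 + a2) (b1 + b2)" by (simp only: mp)
      with y show "y \<in> ?R" using r(1,2,4) by (simp add: rb)
    qed
    show "(\<lambda>x. (p * (w * x * minv w), minv x * p')) ` ?R \<subseteq> ?S"
    proof
      fix y assume "y \<in> (\<lambda>x. (p * (w * x * minv w), minv x * p')) ` ?R"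
      then obtain x where x: "x \<in> Par (a1 + b1) (a2 + b2)" "reblock a1 a2 b1 b2 a1 a2 b1 b2 x \<in> Par (a1 + a2) (b1 + b2)"
        "y = (p * (w * x * minv w), minv x * p')" by blast
      have "p * (w * x * minv w) \<in> Par (a1 + a2) (b1 + b2)" using x(2) by (intro Par_mult[OF p(1)]) (simp only: rb)
      moreover have "minv x * p' \<in> Par (a1 + b1) (a2 + b2)" using x p by (intro Par_mult Par_minv)
      moreover have "p * (w * x * minv w) * w * (minv x * p') = g" using x(1) by (simp add: g w_def[symmetric])
      ultimately show "y \<in> ?S" using x(3) by simp
    qed
  qed
  from bij_betw_same_card[OF this] show ?thesis unfolding card_Par_reblock w_def .
qed

text \<open>Multiplication by the two parabolic subgroups changes the upper right block only by invertible factors, and for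
  \<open>wmat a1 a2 b1 b2\<close> this block has rank \<open>a2\<close>. Hence different representatives lie in different double cosets.\<close>

lemma image_card_dcoset:
  fixes p :: "'a :: {field, finite} mat"
  assumes p: "p \<in> Par (a1 + a2) (b1 + b2)" "p' \<in> Par (a1 + b1) (a2 + b2)"
  shows "image_card (blk 0 (a1 + b1) (a1 + a2) (a2 + b2) (p * wmat a1 a2 b1 b2 * p')) = CARD('a) ^ a2"
proof -
  define n where "n = a1 + a2 + b1 + b2"
  define w :: "'a mat" where "w = wmat a1 a2 b1 b2"
  have wc: "w \<in> carrier_mat n n" unfolding w_def n_def by (rule GL_carrier[OF wmat_GL])
  have n: "n = a1 + b1 + (a2 + b2)" "n = a1 + a2 + (b1 + b2)" by (auto simp: n_def)
  have pc: "p \<in> carrier_mat n n" "p' \<in> carrier_mat n n" using p by (auto simp: Par_def GL_def n)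
  define U where "U = blk 0 (a1 + b1) (a1 + a2) (a2 + b2) w"
  have Uc: "U \<in> carrier_mat (a1 + a2) (a2 + b2)" by (simp add: U_def)
  have "blk 0 (a1 + b1) (a1 + a2) (a2 + b2) (p * w * p') =
    blk 0 0 (a1 + a2) (a1 + b1) (p * w) * blk 0 (a1 + b1) (a1 + b1) (a2 + b2) p' +
    blk 0 (a1 + b1) (a1 + a2) (a2 + b2) (p * w) * BR (a1 + b1) (a2 + b2) (a1 + b1) (a2 + b2) p'"
    using pc wc by (intro blk_mult[of _ n _ _ _ n]) (auto simp: n)
  also have "blk 0 (a1 + b1) (a1 + b1) (a2 + b2) p' = 0\<^sub>m (a1 + b1) (a2 + b2)" using p by (auto simp: Par_def Low_def)
  also have "blk 0 0 (a1 + a2) (a1 + b1) (p * w) * 0\<^sub>m (a1 + b1) (a2 + b2) = 0\<^sub>m (a1 + a2) (a2 + b2)"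
    by (rule right_mult_zero_mat) simp
  also have "blk 0 (a1 + b1) (a1 + a2) (a2 + b2) (p * w) = TL (a1 + a2) (a1 + a2) p * U +
     blk 0 (a1 + a2) (a1 + a2) (b1 + b2) p * blk (a1 + a2) (a1 + b1) (b1 + b2) (a2 + b2) w"
    unfolding U_def using pc wc by (intro blk_mult[of _ n _ _ _ n]) (auto simp: n)
  also have "blk 0 (a1 + a2) (a1 + a2) (b1 + b2) p = 0\<^sub>m (a1 + a2) (b1 + b2)" using p by (auto simp: Par_def Low_def)
  also have "0\<^sub>m (a1 + a2) (b1 + b2) * blk (a1 + a2) (a1 + b1) (b1 + b2) (a2 + b2) w = 0\<^sub>m (a1 + a2) (a2 + b2)"
    by (rule left_mult_zero_mat) simp
  also have "TL (a1 + a2) (a1 + a2) p * U + 0\<^sub>m (a1 + a2) (a2 + b2) = TL (a1 + a2) (a1 + a2) p * U"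
    by (rule right_add_zero_mat[OF mult_carrier_mat[OF blk_carrier Uc]])
  also have "0\<^sub>m (a1 + a2) (a2 + b2) + TL (a1 + a2) (a1 + a2) p * U * BR (a1 + b1) (a2 + b2) (a1 + b1) (a2 + b2) p' =
    TL (a1 + a2) (a1 + a2) p * U * BR (a1 + b1) (a2 + b2) (a1 + b1) (a2 + b2) p'"
    by (rule left_add_zero_mat[OF mult_carrier_mat[OF mult_carrier_mat[OF blk_carrier Uc] blk_carrier]])
  finally have "image_card (blk 0 (a1 + b1) (a1 + a2) (a2 + b2) (p * w * p')) = image_card U"
    using image_card_mult[of "TL (a1 + a2) (a1 + a2) p" "a1 + a2" "BR (a1 + b1) (a2 + b2) (a1 + b1) (a2 + b2) p'" "a2 + b2" U] p
    by (simp add: Par_iff U_def)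
  also have "image_card U = CARD('a) ^ a2"
  proof -
    define S :: "'a mat" where "S = pmat (a1 + a2) (\<lambda>i. if i < a1 then i + a2 else i - a1)"
    have S: "S \<in> GL (a1 + a2)" unfolding S_def
      by (rule pmat_GL[where \<sigma> = "\<lambda>i. if i < a2 then i + a1 else i - a2"]) auto
    have "U = S * pid (a1 + a2) (a2 + b2) a2"
    proof (rule eq_matI)
      fix i j assume "i < dim_row (S * pid (a1 + a2) (a2 + b2) a2)" "j < dim_col (S * pid (a1 + a2) (a2 + b2) a2)"
      then have ij: "i < a1 + a2" "j < a2 + b2" by (auto simp: S_def pmat_def)
      have "(S * pid (a1 + a2) (a2 + b2) a2) $$ (i, j) = pid (a1 + a2) (a2 + b2) a2 $$ (if i < a1 then i + a2 else i - a1, j)"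
        unfolding S_def using ij by (intro pmat_mult_index) auto
      then show "U $$ (i, j) = (S * pid (a1 + a2) (a2 + b2) a2) $$ (i, j)"
        using ij by (auto simp: U_def w_def wmat_def pmat_def shuffle_def pid_def)
    qed (auto simp: U_def S_def pmat_def)
    then have "U = S * pid (a1 + a2) (a2 + b2) a2 * 1\<^sub>m (a2 + b2)" by (simp add: right_mult_one_mat[OF mult_carrier_mat[OF GL_carrier[OF S]]])
    then show ?thesis using image_card_mult[OF S GL_one pid_carrier] by (simp add: image_card_pid)
  qed
  finally show ?thesis by (simp add: w_def)
qed

section \<open>The operations over the finite field\<close>

text \<open>The letter \<open>m\<close> marks families of matrices over an arbitrary field. They are used over the finite field, where
  sums take place, and over its closure, where the subspaces live.\<close>

definition mreps :: "('v, 'h) pre_digraph \<Rightarrow> ('v \<Rightarrow> nat) \<Rightarrow> ('h \<Rightarrow> 'k mat) set" where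
  "mreps Q \<alpha> = (\<Pi>\<^sub>E h\<in>arcs Q. carrier_mat (\<alpha> (head Q h)) (\<alpha> (tail Q h)))"

definition mGL :: "('v, 'h) pre_digraph \<Rightarrow> ('v \<Rightarrow> nat) \<Rightarrow> ('v \<Rightarrow> 'k :: field mat) set" where
  "mGL Q \<alpha> = (\<Pi>\<^sub>E i\<in>verts Q. GL (\<alpha> i))"

definition mact :: "('v, 'h) pre_digraph \<Rightarrow> ('v \<Rightarrow> 'k :: field mat) \<Rightarrow> ('h \<Rightarrow> 'k mat) \<Rightarrow> ('h \<Rightarrow> 'k mat)" where
  "mact Q g x = (\<lambda>h\<in>arcs Q. g (head Q h) * x h * minv (g (tail Q h)))"

definition mLow :: "('v, 'h) pre_digraph \<Rightarrow> ('v \<Rightarrow> nat) \<Rightarrow> ('v \<Rightarrow> nat) \<Rightarrow> ('h \<Rightarrow> 'k :: zero mat) set" where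
  "mLow Q \<alpha> \<beta> = (\<Pi>\<^sub>E h\<in>arcs Q. Low (\<alpha> (head Q h)) (\<beta> (head Q h)) (\<alpha> (tail Q h)) (\<beta> (tail Q h)))"

definition mTL :: "('v, 'h) pre_digraph \<Rightarrow> ('v \<Rightarrow> nat) \<Rightarrow> ('h \<Rightarrow> 'k mat) \<Rightarrow> ('h \<Rightarrow> 'k mat)" where
  "mTL Q \<alpha> x = (\<lambda>h\<in>arcs Q. TL (\<alpha> (head Q h)) (\<alpha> (tail Q h)) (x h))"

definition mBR :: "('v, 'h) pre_digraph \<Rightarrow> ('v \<Rightarrow> nat) \<Rightarrow> ('v \<Rightarrow> nat) \<Rightarrow> ('h \<Rightarrow> 'k mat) \<Rightarrow> ('h \<Rightarrow> 'k mat)" where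
  "mBR Q \<alpha> \<beta> x = (\<lambda>h\<in>arcs Q. BR (\<alpha> (head Q h)) (\<beta> (head Q h)) (\<alpha> (tail Q h)) (\<beta> (tail Q h)) (x h))"

definition mPar :: "('v, 'h) pre_digraph \<Rightarrow> ('v \<Rightarrow> nat) \<Rightarrow> ('v \<Rightarrow> nat) \<Rightarrow> ('v \<Rightarrow> 'k :: field mat) set" where
  "mPar Q \<alpha> \<beta> = (\<Pi>\<^sub>E i\<in>verts Q. Par (\<alpha> i) (\<beta> i))"

definition gTL :: "('v, 'h) pre_digraph \<Rightarrow> ('v \<Rightarrow> nat) \<Rightarrow> ('v \<Rightarrow> 'k mat) \<Rightarrow> ('v \<Rightarrow> 'k mat)" where
  "gTL Q \<alpha> g = (\<lambda>i\<in>verts Q. TL (\<alpha> i) (\<alpha> i) (g i))"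

definition gBR :: "('v, 'h) pre_digraph \<Rightarrow> ('v \<Rightarrow> nat) \<Rightarrow> ('v \<Rightarrow> nat) \<Rightarrow> ('v \<Rightarrow> 'k mat) \<Rightarrow> ('v \<Rightarrow> 'k mat)" where
  "gBR Q \<alpha> \<beta> g = (\<lambda>i\<in>verts Q. BR (\<alpha> i) (\<beta> i) (\<alpha> i) (\<beta> i) (g i))"

definition mfib :: "('v, 'h) pre_digraph \<Rightarrow> ('v \<Rightarrow> nat) \<Rightarrow> ('v \<Rightarrow> nat) \<Rightarrow> ('h \<Rightarrow> 'k :: zero mat) \<Rightarrow> ('h \<Rightarrow> 'k mat) \<Rightarrow> ('h \<Rightarrow> 'k mat) set" where
  "mfib Q \<alpha> \<beta> u v = {x \<in> mLow Q \<alpha> \<beta>. mTL Q \<alpha> x = u \<and> mBR Q \<alpha> \<beta> x = v}"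

definition vdim :: "('v, 'h) pre_digraph \<Rightarrow> ('v \<Rightarrow> nat) \<Rightarrow> ('v \<Rightarrow> nat) \<Rightarrow> nat" where
  "vdim Q \<alpha> \<beta> = (\<Sum>i\<in>verts Q. \<alpha> i * \<beta> i)"

definition adim :: "('v, 'h) pre_digraph \<Rightarrow> ('v \<Rightarrow> nat) \<Rightarrow> ('v \<Rightarrow> nat) \<Rightarrow> nat" where
  "adim Q \<alpha> \<beta> = (\<Sum>h\<in>arcs Q. \<alpha> (tail Q h) * \<beta> (head Q h))"

text \<open>The product as a sum over group elements: \<open>g\<close> encodes the subspace spanned by the last \<open>\<beta>\<close> coordinates with respect to
  \<open>g\<close>, together with bases of subspace and quotient. Elements that differ by the unipotent radical encode
  the same data, which replaces the order of \<open>GL \<alpha> \<times> GL \<beta>\<close> in the normalisation by the order of the parabolic subgroup.\<close>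

definition kmult :: "('v, 'h) pre_digraph \<Rightarrow> ('v \<Rightarrow> nat) \<Rightarrow> ('v \<Rightarrow> nat) \<Rightarrow>
    (('h \<Rightarrow> 'k :: {field, finite} mat) \<Rightarrow> ('h \<Rightarrow> 'k mat) \<Rightarrow> 'c :: field) \<Rightarrow> ('h \<Rightarrow> 'k mat) \<Rightarrow> 'c" where
  "kmult Q \<alpha> \<beta> \<Phi> x = inverse (of_nat (card (mPar Q \<alpha> \<beta> :: ('v \<Rightarrow> 'k mat) set))) *
     (\<Sum>g\<in>{g \<in> mGL Q (\<alpha> + \<beta>). mact Q g x \<in> mLow Q \<alpha> \<beta>}. \<Phi> (mTL Q \<alpha> (mact Q g x)) (mBR Q \<alpha> \<beta> (mact Q g x)))"

definition kcomult :: "('v, 'h) pre_digraph \<Rightarrow> ('v \<Rightarrow> nat) \<Rightarrow> ('v \<Rightarrow> nat) \<Rightarrow>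
    (('h \<Rightarrow> 'k :: {field, finite} mat) \<Rightarrow> 'c :: field) \<Rightarrow> ('h \<Rightarrow> 'k mat) \<Rightarrow> ('h \<Rightarrow> 'k mat) \<Rightarrow> 'c" where
  "kcomult Q \<alpha> \<beta> f u v = inverse (of_nat (CARD('k) ^ vdim Q \<alpha> \<beta>)) * (\<Sum>x\<in>mfib Q \<alpha> \<beta> u v. f x)"

locale quiver =
  fixes Q :: "('v, 'h) pre_digraph"
  assumes Q: "fin_digraph Q"
begin

lemma finQ [simp]: "finite (verts Q)" "finite (arcs Q)"
  using fin_digraph.finite_verts[OF Q] fin_digraph.finite_arcs[OF Q] by auto

lemma headQ [simp]: "h \<in> arcs Q \<Longrightarrow> head Q h \<in> verts Q" and tailQ [simp]: "h \<in> arcs Q \<Longrightarrow> tail Q h \<in> verts Q"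
  using wf_digraph.head_in_verts wf_digraph.tail_in_verts Q fin_digraph_def by metis+

lemma finite_mGL: "finite (mGL Q \<alpha> :: ('v \<Rightarrow> 'k :: {field, finite} mat) set)"
  unfolding mGL_def by (intro finite_PiE finQ finite_GL)

lemma finite_mPar: "finite (mPar Q \<alpha> \<beta> :: ('v \<Rightarrow> 'k :: {field, finite} mat) set)"
  unfolding mPar_def by (intro finite_PiE finQ finite_Par)

lemma finite_mLow: "finite (mLow Q \<alpha> \<beta> :: ('h \<Rightarrow> 'k :: {field, finite} mat) set)"
  unfolding mLow_def by (intro finite_PiE finQ finite_Low)

lemma finite_mfib: "finite (mfib Q \<alpha> \<beta> u v :: ('h \<Rightarrow> 'k :: {field, finite} mat) set)"
  using finite_mLow by (rule finite_subset[rotated]) (auto simp: mfib_def)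

lemma mLow_mreps: "x \<in> mLow Q \<alpha> \<beta> \<Longrightarrow> x \<in> mreps Q (\<alpha> + \<beta>)"
  unfolding mLow_def mreps_def by (auto simp: PiE_def Pi_def Low_carrier)

lemma mTL_mreps: "mTL Q \<alpha> x \<in> mreps Q \<alpha>" and mBR_mreps: "mBR Q \<alpha> \<beta> x \<in> mreps Q \<beta>"
  unfolding mTL_def mBR_def mreps_def by auto

lemma card_mPar:
  "card (mPar Q \<alpha> \<beta> :: ('v \<Rightarrow> 'k :: {field, finite} mat) set) =
    card (mGL Q \<alpha> :: ('v \<Rightarrow> 'k mat) set) * card (mGL Q \<beta> :: ('v \<Rightarrow> 'k mat) set) * CARD('k) ^ vdim Q \<alpha> \<beta>"
  by (simp add: mPar_def mGL_def vdim_def card_PiE card_Par prod.distrib power_sum)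

lemma mPar_mGL: "p \<in> mPar Q \<alpha> \<beta> \<Longrightarrow> p \<in> mGL Q (\<alpha> + \<beta>)"
  unfolding mPar_def mGL_def by (auto simp: PiE_def Pi_def Par_GL)

lemma gTL_mGL: "p \<in> mPar Q \<alpha> \<beta> \<Longrightarrow> gTL Q \<alpha> p \<in> mGL Q \<alpha>" and gBR_mGL: "p \<in> mPar Q \<alpha> \<beta> \<Longrightarrow> gBR Q \<alpha> \<beta> p \<in> mGL Q \<beta>"
  unfolding mPar_def mGL_def gTL_def gBR_def by (auto simp: PiE_def Pi_def Par_iff)

lemma mact_closed: "g \<in> mGL Q \<gamma> \<Longrightarrow> x \<in> mreps Q \<gamma> \<Longrightarrow> mact Q g x \<in> mreps Q \<gamma>"
  unfolding mact_def mGL_def mreps_def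
  by (auto simp: PiE_def Pi_def intro!: mult_carrier_mat GL_carrier minv)

lemma mact_mact:
  assumes "g \<in> mGL Q \<gamma>" "k \<in> mGL Q \<gamma>" "x \<in> mreps Q \<gamma>"
  shows "mact Q g (mact Q k x) = mact Q (\<lambda>i\<in>verts Q. g i * k i) x"
proof
  fix h
  show "mact Q g (mact Q k x) h = mact Q (\<lambda>i\<in>verts Q. g i * k i) x h"
  proof (cases "h \<in> arcs Q")
    case True
    define m n where "m = \<gamma> (head Q h)" and "n = \<gamma> (tail Q h)"
    have G: "g (head Q h) \<in> GL m" "g (tail Q h) \<in> GL n" "k (head Q h) \<in> GL m" "k (tail Q h) \<in> GL n"
      and xh: "x h \<in> carrier_mat m n"
      using assms True by (auto simp: mGL_def mreps_def m_def n_def PiE_def Pi_def)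
    note c = G[THEN GL_carrier] minv(1)[OF G(2)] minv(1)[OF G(4)] xh
    have "g (head Q h) * (k (head Q h) * x h * minv (k (tail Q h))) * minv (g (tail Q h)) =
      g (head Q h) * (k (head Q h) * x h) * minv (k (tail Q h)) * minv (g (tail Q h))"
      using c by (subst assoc_mult_mat[of _ m m _ n _ n]) auto
    also have "\<dots> = g (head Q h) * (k (head Q h) * x h) * (minv (k (tail Q h)) * minv (g (tail Q h)))"
      using c by (intro assoc_mult_mat[of _ m n _ n _ n]) auto
    also have "g (head Q h) * (k (head Q h) * x h) = g (head Q h) * k (head Q h) * x h"
      using c by (intro assoc_mult_mat[symmetric, of _ m m _ m _ n]) auto
    finally show ?thesis using True by (simp add: mact_def minv_mult[OF G(2,4)])
  qed (simp add: mact_def)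
qed

lemma mact_minv:
  assumes "g \<in> mGL Q \<gamma>" "x \<in> mreps Q \<gamma>"
  shows "mact Q (\<lambda>i\<in>verts Q. minv (g i)) (mact Q g x) = x" "mact Q g (mact Q (\<lambda>i\<in>verts Q. minv (g i)) x) = x"
proof -
  have i: "(\<lambda>i\<in>verts Q. minv (g i)) \<in> mGL Q \<gamma>" using assms by (auto simp: mGL_def PiE_def Pi_def minv)
  have one: "mact Q (\<lambda>i\<in>verts Q. 1\<^sub>m (\<gamma> i)) x = x"
    using assms(2) by (auto simp: mact_def mreps_def PiE_def Pi_def extensional_def fun_eq_iff)
  have "(\<lambda>i\<in>verts Q. (\<lambda>i\<in>verts Q. minv (g i)) i * g i) = (\<lambda>i\<in>verts Q. 1\<^sub>m (\<gamma> i))"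
    "(\<lambda>i\<in>verts Q. g i * (\<lambda>i\<in>verts Q. minv (g i)) i) = (\<lambda>i\<in>verts Q. 1\<^sub>m (\<gamma> i))"
    using assms(1) by (auto simp: mGL_def PiE_def Pi_def minv intro!: restrict_ext)
  then show "mact Q (\<lambda>i\<in>verts Q. minv (g i)) (mact Q g x) = x" "mact Q g (mact Q (\<lambda>i\<in>verts Q. minv (g i)) x) = x"
    using mact_mact[OF i assms(1,2)] mact_mact[OF assms(1) i assms(2)] one by simp_all
qed

lemma minv_mPar: "g \<in> mPar Q \<alpha> \<beta> \<Longrightarrow> (\<lambda>i\<in>verts Q. minv (g i)) \<in> mPar Q \<alpha> \<beta>"
  by (auto simp: mPar_def PiE_def Pi_def Par_minv)

text \<open>The parabolic subgroup acts on block triangular representations, and through its Levi quotient on the diagonal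
  blocks.\<close>

lemma mact_mLow:
  assumes p: "p \<in> mPar Q \<alpha> \<beta>" and x: "x \<in> mLow Q \<alpha> \<beta>"
  shows "mact Q p x \<in> mLow Q \<alpha> \<beta>" "mTL Q \<alpha> (mact Q p x) = mact Q (gTL Q \<alpha> p) (mTL Q \<alpha> x)"
    "mBR Q \<alpha> \<beta> (mact Q p x) = mact Q (gBR Q \<alpha> \<beta> p) (mBR Q \<alpha> \<beta> x)"
proof -
  have *: "p (head Q h) * x h * minv (p (tail Q h)) \<in> Low (\<alpha> (head Q h)) (\<beta> (head Q h)) (\<alpha> (tail Q h)) (\<beta> (tail Q h))"
    "TL (\<alpha> (head Q h)) (\<alpha> (tail Q h)) (p (head Q h) * x h * minv (p (tail Q h))) =
      TL (\<alpha> (head Q h)) (\<alpha> (head Q h)) (p (head Q h)) * TL (\<alpha> (head Q h)) (\<alpha> (tail Q h)) (x h) *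
      minv (TL (\<alpha> (tail Q h)) (\<alpha> (tail Q h)) (p (tail Q h)))"
    "BR (\<alpha> (head Q h)) (\<beta> (head Q h)) (\<alpha> (tail Q h)) (\<beta> (tail Q h)) (p (head Q h) * x h * minv (p (tail Q h))) =
      BR (\<alpha> (head Q h)) (\<beta> (head Q h)) (\<alpha> (head Q h)) (\<beta> (head Q h)) (p (head Q h)) *
      BR (\<alpha> (head Q h)) (\<beta> (head Q h)) (\<alpha> (tail Q h)) (\<beta> (tail Q h)) (x h) *
      minv (BR (\<alpha> (tail Q h)) (\<beta> (tail Q h)) (\<alpha> (tail Q h)) (\<beta> (tail Q h)) (p (tail Q h)))"
    if h: "h \<in> arcs Q" for h
  proof -
    have P: "p (head Q h) \<in> Par (\<alpha> (head Q h)) (\<beta> (head Q h))" "p (tail Q h) \<in> Par (\<alpha> (tail Q h)) (\<beta> (tail Q h))"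
      and L: "x h \<in> Low (\<alpha> (head Q h)) (\<beta> (head Q h)) (\<alpha> (tail Q h)) (\<beta> (tail Q h))"
      using p x h by (auto simp: mPar_def mLow_def PiE_def Pi_def)
    have PL: "p (head Q h) \<in> Low (\<alpha> (head Q h)) (\<beta> (head Q h)) (\<alpha> (head Q h)) (\<beta> (head Q h))"
      "minv (p (tail Q h)) \<in> Low (\<alpha> (tail Q h)) (\<beta> (tail Q h)) (\<alpha> (tail Q h)) (\<beta> (tail Q h))"
      using P Par_minv(1)[OF P(2)] by (auto simp: Par_def)
    note 1 = Low_mult[OF PL(1) L] and 2 = Low_mult[OF Low_mult(1)[OF PL(1) L] PL(2)]
    show "p (head Q h) * x h * minv (p (tail Q h)) \<in> Low (\<alpha> (head Q h)) (\<beta> (head Q h)) (\<alpha> (tail Q h)) (\<beta> (tail Q h))"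
      by (rule 2)
    show "TL (\<alpha> (head Q h)) (\<alpha> (tail Q h)) (p (head Q h) * x h * minv (p (tail Q h))) =
      TL (\<alpha> (head Q h)) (\<alpha> (head Q h)) (p (head Q h)) * TL (\<alpha> (head Q h)) (\<alpha> (tail Q h)) (x h) *
      minv (TL (\<alpha> (tail Q h)) (\<alpha> (tail Q h)) (p (tail Q h)))"
      unfolding 2(2) 1(2) Par_minv(2)[OF P(2)] ..
    show "BR (\<alpha> (head Q h)) (\<beta> (head Q h)) (\<alpha> (tail Q h)) (\<beta> (tail Q h)) (p (head Q h) * x h * minv (p (tail Q h))) =
      BR (\<alpha> (head Q h)) (\<beta> (head Q h)) (\<alpha> (head Q h)) (\<beta> (head Q h)) (p (head Q h)) *
      BR (\<alpha> (head Q h)) (\<beta> (head Q h)) (\<alpha> (tail Q h)) (\<beta> (tail Q h)) (x h) *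
      minv (BR (\<alpha> (tail Q h)) (\<beta> (tail Q h)) (\<alpha> (tail Q h)) (\<beta> (tail Q h)) (p (tail Q h)))"
      unfolding 2(3) 1(3) Par_minv(3)[OF P(2)] ..
  qed
  show "mact Q p x \<in> mLow Q \<alpha> \<beta>" using *(1) by (auto simp: mact_def mLow_def)
  show "mTL Q \<alpha> (mact Q p x) = mact Q (gTL Q \<alpha> p) (mTL Q \<alpha> x)"
    "mBR Q \<alpha> \<beta> (mact Q p x) = mact Q (gBR Q \<alpha> \<beta> p) (mBR Q \<alpha> \<beta> x)"
    using *(2,3) by (auto simp: mact_def mTL_def mBR_def gTL_def gBR_def fun_eq_iff)
qed

lemma mact_mLow_iff:
  assumes "p \<in> mPar Q \<alpha> \<beta>" "x \<in> mreps Q (\<alpha> + \<beta>)"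
  shows "mact Q p x \<in> mLow Q \<alpha> \<beta> \<longleftrightarrow> x \<in> mLow Q \<alpha> \<beta>"
  using mact_mLow(1)[OF assms(1)] mact_mLow(1)[OF minv_mPar[OF assms(1)]]
    mact_minv(1)[OF mPar_mGL[OF assms(1)] assms(2)] by metis

lemma card_mPar_fibre:
  assumes "l \<in> mGL Q \<alpha> \<times> mGL Q \<beta>"
  shows "card {p \<in> mPar Q \<alpha> \<beta>. (gTL Q \<alpha> p, gBR Q \<alpha> \<beta> p) = (l :: ('v \<Rightarrow> 'k :: {field, finite} mat) \<times> _)} = CARD('k) ^ vdim Q \<alpha> \<beta>"
proof -
  obtain u v where l: "l = (u, v)" "u \<in> mGL Q \<alpha>" "v \<in> mGL Q \<beta>" using assms by auto
  have "{p \<in> mPar Q \<alpha> \<beta>. (gTL Q \<alpha> p, gBR Q \<alpha> \<beta> p) = l} =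
    PiE (verts Q) (\<lambda>i. {M \<in> Low (\<alpha> i) (\<beta> i) (\<alpha> i) (\<beta> i). TL (\<alpha> i) (\<alpha> i) M = u i \<and> BR (\<alpha> i) (\<beta> i) (\<alpha> i) (\<beta> i) M = v i})"
    using l(2,3) unfolding l(1)
    by (auto simp: mPar_def gTL_def gBR_def mGL_def PiE_def Pi_def extensional_def fun_eq_iff Par_iff)
  also have "card \<dots> = (\<Prod>i\<in>verts Q. CARD('k) ^ (\<beta> i * \<alpha> i))"
    unfolding card_PiE[OF finQ(1)] using l
    by (intro prod.cong refl card_Low_fibre) (auto simp: mGL_def PiE_def Pi_def GL_carrier)
  finally show ?thesis by (simp add: vdim_def power_sum mult.commute)
qed

definition wfam :: "('v \<Rightarrow> nat) \<Rightarrow> ('v \<Rightarrow> nat) \<Rightarrow> ('v \<Rightarrow> nat) \<Rightarrow> ('v \<Rightarrow> nat) \<Rightarrow> 'v \<Rightarrow> 'k :: field mat" where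
  "wfam \<alpha>1 \<alpha>2 \<beta>1 \<beta>2 = (\<lambda>i\<in>verts Q. wmat (\<alpha>1 i) (\<alpha>2 i) (\<beta>1 i) (\<beta>2 i))"

lemma wfam_mGL: "wfam \<alpha>1 \<alpha>2 \<beta>1 \<beta>2 \<in> mGL Q ((\<alpha>1 + \<alpha>2) + (\<beta>1 + \<beta>2))"
  using wmat_GL by (auto simp: wfam_def mGL_def add.assoc)

text \<open>The contribution of the double coset representative. Arrow by arrow, the summation domain is the set \<open>Zfib\<close>, and \<open>h\<close> sees
  only the diagonal blocks after the interchange. The free corner block has \<open>\<beta>2\<close> rows at the head and \<open>\<alpha>1\<close> columns at the
  tail of the arrow, which gives the arrow part of the Euler form.\<close>

lemma sum_reblock_fibre:
  fixes u v :: "'h \<Rightarrow> 'k :: {field, finite} mat" and h :: "_ \<Rightarrow> _ \<Rightarrow> 'c :: comm_semiring_1"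
  assumes u: "u \<in> mreps Q (\<alpha>1 + \<beta>1)" and v: "v \<in> mreps Q (\<alpha>2 + \<beta>2)"
  defines "y \<equiv> mact Q (wfam \<alpha>1 \<alpha>2 \<beta>1 \<beta>2)"
  shows "(\<Sum>x\<in>{x \<in> mfib Q (\<alpha>1 + \<beta>1) (\<alpha>2 + \<beta>2) u v. y x \<in> mLow Q (\<alpha>1 + \<alpha>2) (\<beta>1 + \<beta>2)}.
      h (mTL Q (\<alpha>1 + \<alpha>2) (y x)) (mBR Q (\<alpha>1 + \<alpha>2) (\<beta>1 + \<beta>2) (y x))) =
    (if u \<in> mLow Q \<alpha>1 \<beta>1 \<and> v \<in> mLow Q \<alpha>2 \<beta>2 then of_nat (CARD('k) ^ adim Q \<alpha>1 \<beta>2) *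
       (\<Sum>s\<in>mfib Q \<alpha>1 \<alpha>2 (mTL Q \<alpha>1 u) (mTL Q \<alpha>2 v). \<Sum>t\<in>mfib Q \<beta>1 \<beta>2 (mBR Q \<alpha>1 \<beta>1 u) (mBR Q \<alpha>2 \<beta>2 v). h s t)
     else 0)"
proof -
  define a1 a2 b1 b2 where "a1 = (\<lambda>h. \<alpha>1 (head Q h))" and "a2 = (\<lambda>h. \<alpha>2 (head Q h))"
    and "b1 = (\<lambda>h. \<beta>1 (head Q h))" and "b2 = (\<lambda>h. \<beta>2 (head Q h))"
  define c1 c2 d1 d2 where "c1 = (\<lambda>h. \<alpha>1 (tail Q h))" and "c2 = (\<lambda>h. \<alpha>2 (tail Q h))"
    and "d1 = (\<lambda>h. \<beta>1 (tail Q h))" and "d2 = (\<lambda>h. \<beta>2 (tail Q h))"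
  note ad = a1_def a2_def b1_def b2_def c1_def c2_def d1_def d2_def
  define rb where "rb h x = reblock (a1 h) (a2 h) (b1 h) (b2 h) (c1 h) (c2 h) (d1 h) (d2 h) (x :: 'k mat)" for h x
  define Z where "Z h = Zfib (a1 h) (a2 h) (b1 h) (b2 h) (c1 h) (c2 h) (d1 h) (d2 h) (u h) (v h)" for h
  have yx: "y x = (\<lambda>h\<in>arcs Q. rb h (x h))" for x
    by (auto simp: y_def mact_def wfam_def rb_def reblock_def ad fun_eq_iff)
  have ext: "u \<in> extensional (arcs Q)" "v \<in> extensional (arcs Q)" using u v by (auto simp: mreps_def PiE_def)
  have set_eq: "{x \<in> mfib Q (\<alpha>1 + \<beta>1) (\<alpha>2 + \<beta>2) u v. y x \<in> mLow Q (\<alpha>1 + \<alpha>2) (\<beta>1 + \<beta>2)} = PiE (arcs Q) Z" (is "?S = _")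
  proof (rule Set.set_eqI)
    fix x
    have "x \<in> ?S \<longleftrightarrow> x \<in> extensional (arcs Q) \<and> (\<forall>h\<in>arcs Q. x h \<in> Z h)"
      using ext unfolding yx
      by (auto simp: mfib_def mLow_def mTL_def mBR_def Z_def Zfib_def rb_def ad PiE_def Pi_def extensional_def fun_eq_iff)
    then show "x \<in> ?S \<longleftrightarrow> x \<in> PiE (arcs Q) Z" by (auto simp: PiE_def Pi_def)
  qed
  show ?thesis
  proof (cases "u \<in> mLow Q \<alpha>1 \<beta>1 \<and> v \<in> mLow Q \<alpha>2 \<beta>2")
    case False
    have "PiE (arcs Q) Z = {}"
    proof (rule ccontr)
      assume "PiE (arcs Q) Z \<noteq> {}"
      then obtain x where x: "x \<in> PiE (arcs Q) Z" by auto
      then have xZ: "x h \<in> Z h" if "h \<in> arcs Q" for h using that by auto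
      have "u h \<in> Low (a1 h) (b1 h) (c1 h) (d1 h)" "v h \<in> Low (a2 h) (b2 h) (c2 h) (d2 h)" if "h \<in> arcs Q" for h
        using Zfib_D(1,2)[OF xZ[OF that, unfolded Z_def]] by auto
      then have "u \<in> mLow Q \<alpha>1 \<beta>1 \<and> v \<in> mLow Q \<alpha>2 \<beta>2"
        using ext by (auto simp: mLow_def PiE_def Pi_def ad)
      then show False using False by simp
    qed
    then show ?thesis unfolding set_eq using False by auto
  next
    case True
    then have uv: "u h \<in> Low (a1 h) (b1 h) (c1 h) (d1 h)" "v h \<in> Low (a2 h) (b2 h) (c2 h) (d2 h)" if "h \<in> arcs Q" for h
      using that by (auto simp: mLow_def PiE_def Pi_def ad)
    define f where "f x = (mTL Q (\<alpha>1 + \<alpha>2) (y x), mBR Q (\<alpha>1 + \<alpha>2) (\<beta>1 + \<beta>2) (y x))" for x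
    define T where "T = mfib Q \<alpha>1 \<alpha>2 (mTL Q \<alpha>1 u) (mTL Q \<alpha>2 v) \<times> mfib Q \<beta>1 \<beta>2 (mBR Q \<alpha>1 \<beta>1 u) (mBR Q \<alpha>2 \<beta>2 v)"
    have Tmem: "(s, t) \<in> T \<longleftrightarrow> s \<in> extensional (arcs Q) \<and> t \<in> extensional (arcs Q) \<and> (\<forall>h\<in>arcs Q.
       s h \<in> Low (a1 h) (a2 h) (c1 h) (c2 h) \<and> t h \<in> Low (b1 h) (b2 h) (d1 h) (d2 h) \<and>
       TL (a1 h) (c1 h) (s h) = TL (a1 h) (c1 h) (u h) \<and> BR (a1 h) (a2 h) (c1 h) (c2 h) (s h) = TL (a2 h) (c2 h) (v h) \<and>
       TL (b1 h) (d1 h) (t h) = BR (a1 h) (b1 h) (c1 h) (d1 h) (u h) \<and>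
       BR (b1 h) (b2 h) (d1 h) (d2 h) (t h) = BR (a2 h) (b2 h) (c2 h) (d2 h) (v h))" for s t
      unfolding T_def mfib_def mLow_def mTL_def mBR_def ad
      by (auto simp: PiE_def Pi_def extensional_def fun_eq_iff)
    have fx: "f x = ((\<lambda>h\<in>arcs Q. TL (a1 h + a2 h) (c1 h + c2 h) (rb h (x h))),
        (\<lambda>h\<in>arcs Q. BR (a1 h + a2 h) (b1 h + b2 h) (c1 h + c2 h) (d1 h + d2 h) (rb h (x h))))" for x
      by (auto simp: f_def mTL_def mBR_def yx ad fun_eq_iff)
    have "(\<Sum>x\<in>PiE (arcs Q) Z. case_prod h (f x)) = of_nat (CARD('k) ^ adim Q \<alpha>1 \<beta>2) * (\<Sum>y\<in>T. case_prod h y)"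
    proof (rule sum_by_fibres)
      show "finite (PiE (arcs Q) Z)" by (auto simp: Z_def intro!: finite_PiE finite_Zfib)
      show "finite T" unfolding T_def by (intro finite_cartesian_product finite_mfib)
      show "f x \<in> T" if x: "x \<in> PiE (arcs Q) Z" for x
      proof -
        have "x h \<in> Z h" if "h \<in> arcs Q" for h using x that by auto
        from Zfib_D[OF this[unfolded Z_def]] show ?thesis unfolding fx Tmem by (auto simp: rb_def)
      qed
      fix st assume st: "st \<in> T"
      obtain s t where st': "st = (s, t)" by (cases st)
      have "{x \<in> PiE (arcs Q) Z. f x = st} = PiE (arcs Q) (\<lambda>h. {x \<in> Z h. TL (a1 h + a2 h) (c1 h + c2 h) (rb h x) = s h \<and>
        BR (a1 h + a2 h) (b1 h + b2 h) (c1 h + c2 h) (d1 h + d2 h) (rb h x) = t h})"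
        using st unfolding st' Tmem fx
        by (auto simp: PiE_def Pi_def extensional_def fun_eq_iff)
      also have "card \<dots> = (\<Prod>h\<in>arcs Q. CARD('k) ^ (b2 h * c1 h))"
      proof (subst card_PiE[OF finQ(2)], rule prod.cong[OF refl])
        fix h assume h: "h \<in> arcs Q"
        have "s h \<in> Low (a1 h) (a2 h) (c1 h) (c2 h)" "t h \<in> Low (b1 h) (b2 h) (d1 h) (d2 h)"
          "TL (a1 h) (c1 h) (s h) = TL (a1 h) (c1 h) (u h)" "BR (a1 h) (a2 h) (c1 h) (c2 h) (s h) = TL (a2 h) (c2 h) (v h)"
          "TL (b1 h) (d1 h) (t h) = BR (a1 h) (b1 h) (c1 h) (d1 h) (u h)"
          "BR (b1 h) (b2 h) (d1 h) (d2 h) (t h) = BR (a2 h) (b2 h) (c2 h) (d2 h) (v h)"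
          using st[unfolded st' Tmem] h by blast+
        from Zfib_card[OF uv(1)[OF h] uv(2)[OF h] this]
        show "card {x \<in> Z h. TL (a1 h + a2 h) (c1 h + c2 h) (rb h x) = s h \<and>
          BR (a1 h + a2 h) (b1 h + b2 h) (c1 h + c2 h) (d1 h + d2 h) (rb h x) = t h} = CARD('k) ^ (b2 h * c1 h)"
          unfolding Z_def rb_def .
      qed
      also have "(\<Prod>h\<in>arcs Q. CARD('k) ^ (b2 h * c1 h)) = CARD('k) ^ adim Q \<alpha>1 \<beta>2"
        by (simp only: adim_def power_sum b2_def c1_def mult.commute[of "\<alpha>1 _"])
      finally show "card {x \<in> PiE (arcs Q) Z. f x = st} = CARD('k) ^ adim Q \<alpha>1 \<beta>2" .
    qed
    then show ?thesis unfolding set_eq using True by (simp add: f_def T_def sum.cartesian_product)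
  qed
qed

text \<open>The coproduct of the product at \<open>(y1, y2)\<close> is a double sum over \<open>x\<close> and \<open>g\<close>; this is its inner sum when \<open>g\<close> is fixed.\<close>

definition hsum where
  "hsum \<alpha> \<beta> \<alpha>' \<beta>' f1 f2 y1 y2 g = (\<Sum>x\<in>{x \<in> mfib Q \<alpha>' \<beta>' y1 y2. mact Q g x \<in> mLow Q \<alpha> \<beta>}.
     f1 (mTL Q \<alpha> (mact Q g x)) * f2 (mBR Q \<alpha> \<beta> (mact Q g x)))"

definition minvariant :: "('v \<Rightarrow> nat) \<Rightarrow> (('h \<Rightarrow> 'k :: {field, finite} mat) \<Rightarrow> 'c) \<Rightarrow> bool" where
  "minvariant \<alpha> f \<longleftrightarrow> (\<forall>g\<in>mGL Q \<alpha>. \<forall>x\<in>mreps Q \<alpha>. f (mact Q g x) = f x)"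

text \<open>A parabolic factor on the left of \<open>g\<close> moves the diagonal blocks within their orbits, where the invariant functions do
  not change.\<close>

lemma hsum_left:
  fixes f1 f2 :: "('h \<Rightarrow> 'k :: {field, finite} mat) \<Rightarrow> 'c :: field"
  assumes f: "minvariant \<alpha> f1" "minvariant \<beta> f2" and \<gamma>: "\<alpha> + \<beta> = \<alpha>' + \<beta>'"
    and p: "p \<in> mPar Q \<alpha> \<beta>" and g: "g \<in> mGL Q (\<alpha> + \<beta>)"
  shows "hsum \<alpha> \<beta> \<alpha>' \<beta>' f1 f2 y1 y2 (\<lambda>i\<in>verts Q. p i * g i) = hsum \<alpha> \<beta> \<alpha>' \<beta>' f1 f2 y1 y2 g"
proof -
  have x: "x \<in> mreps Q (\<alpha> + \<beta>)" if "x \<in> mfib Q \<alpha>' \<beta>' y1 y2" for x :: "'h \<Rightarrow> 'k mat"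
    using that mLow_mreps[of x \<alpha>' \<beta>'] unfolding \<gamma> by (auto simp: mfib_def)
  have m: "mact Q (\<lambda>i\<in>verts Q. p i * g i) x = mact Q p (mact Q g x)" if "x \<in> mfib Q \<alpha>' \<beta>' y1 y2" for x
    using mact_mact[OF mPar_mGL[OF p] g x[OF that]] by simp
  have l: "mact Q p (mact Q g x) \<in> mLow Q \<alpha> \<beta> \<longleftrightarrow> mact Q g x \<in> mLow Q \<alpha> \<beta>" if "x \<in> mfib Q \<alpha>' \<beta>' y1 y2" for x
    using mact_mLow_iff[OF p mact_closed[OF g x[OF that]]] .
  show ?thesis unfolding hsum_def
  proof (rule sum.cong)
    show "{x \<in> mfib Q \<alpha>' \<beta>' y1 y2. mact Q (\<lambda>i\<in>verts Q. p i * g i) x \<in> mLow Q \<alpha> \<beta>} =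
      {x \<in> mfib Q \<alpha>' \<beta>' y1 y2. mact Q g x \<in> mLow Q \<alpha> \<beta>}" using m l by auto
    fix x assume "x \<in> {x \<in> mfib Q \<alpha>' \<beta>' y1 y2. mact Q g x \<in> mLow Q \<alpha> \<beta>}"
    then have "x \<in> mfib Q \<alpha>' \<beta>' y1 y2" "mact Q g x \<in> mLow Q \<alpha> \<beta>" by auto
    then show "f1 (mTL Q \<alpha> (mact Q (\<lambda>i\<in>verts Q. p i * g i) x)) * f2 (mBR Q \<alpha> \<beta> (mact Q (\<lambda>i\<in>verts Q. p i * g i) x)) =
      f1 (mTL Q \<alpha> (mact Q g x)) * f2 (mBR Q \<alpha> \<beta> (mact Q g x))"
      using f gTL_mGL[OF p] gBR_mGL[OF p] by (simp add: m mact_mLow[OF p] minvariant_def mTL_mreps mBR_mreps)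
  qed
qed

text \<open>A parabolic factor on the right is absorbed by the substitution \<open>x \<mapsto> p x\<close>, which moves the fibre over \<open>(y1, y2)\<close>
  by the Levi part of \<open>p\<close>.\<close>

lemma hsum_right:
  fixes f1 f2 :: "('h \<Rightarrow> 'k :: {field, finite} mat) \<Rightarrow> 'c :: field"
  assumes \<gamma>: "\<alpha> + \<beta> = \<alpha>' + \<beta>'" and y: "y1 \<in> mreps Q \<alpha>'" "y2 \<in> mreps Q \<beta>'"
    and p: "p \<in> mPar Q \<alpha>' \<beta>'" and g: "g \<in> mGL Q (\<alpha> + \<beta>)"
  shows "hsum \<alpha> \<beta> \<alpha>' \<beta>' f1 f2 y1 y2 (\<lambda>i\<in>verts Q. g i * p i) =
    hsum \<alpha> \<beta> \<alpha>' \<beta>' f1 f2 (mact Q (gTL Q \<alpha>' p) y1) (mact Q (gBR Q \<alpha>' \<beta>' p) y2) g"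
proof -
  let ?i = "\<lambda>i\<in>verts Q. minv (p i)"
  have x: "x \<in> mreps Q (\<alpha>' + \<beta>')" "x \<in> mLow Q \<alpha>' \<beta>'" "mTL Q \<alpha>' x = y1" "mBR Q \<alpha>' \<beta>' x = y2"
    if "x \<in> mfib Q \<alpha>' \<beta>' y1 y2" for x :: "'h \<Rightarrow> 'k mat" and y1 y2
    using that mLow_mreps[of x \<alpha>' \<beta>'] by (auto simp: mfib_def)
  note pG = mPar_mGL[OF p]
  have m: "mact Q (\<lambda>i\<in>verts Q. g i * p i) x = mact Q g (mact Q p x)" if "x \<in> mfib Q \<alpha>' \<beta>' y1 y2" for x
    using mact_mact[OF g[unfolded \<gamma>] pG x(1)[OF that]] by simp
  have gi: "gTL Q \<alpha>' ?i = (\<lambda>i\<in>verts Q. minv (gTL Q \<alpha>' p i))" "gBR Q \<alpha>' \<beta>' ?i = (\<lambda>i\<in>verts Q. minv (gBR Q \<alpha>' \<beta>' p i))"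
    using p by (auto simp: gTL_def gBR_def mPar_def PiE_def Pi_def Par_minv intro!: restrict_ext)
  show ?thesis unfolding hsum_def
  proof (rule sum.reindex_bij_witness[where i = "mact Q ?i" and j = "mact Q p"])
    fix a assume "a \<in> {x \<in> mfib Q \<alpha>' \<beta>' y1 y2. mact Q (\<lambda>i\<in>verts Q. g i * p i) x \<in> mLow Q \<alpha> \<beta>}"
    then have a: "a \<in> mfib Q \<alpha>' \<beta>' y1 y2" "mact Q g (mact Q p a) \<in> mLow Q \<alpha> \<beta>" using m by auto
    show "mact Q ?i (mact Q p a) = a" using mact_minv(1)[OF pG x(1)[OF a(1)]] .
    show "mact Q p a \<in> {x \<in> mfib Q \<alpha>' \<beta>' (mact Q (gTL Q \<alpha>' p) y1) (mact Q (gBR Q \<alpha>' \<beta>' p) y2). mact Q g x \<in> mLow Q \<alpha> \<beta>}"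
      using a mact_mLow[OF p x(2)[OF a(1)]] x(3,4)[OF a(1)] by (simp add: mfib_def)
    show "f1 (mTL Q \<alpha> (mact Q g (mact Q p a))) * f2 (mBR Q \<alpha> \<beta> (mact Q g (mact Q p a))) =
      f1 (mTL Q \<alpha> (mact Q (\<lambda>i\<in>verts Q. g i * p i) a)) * f2 (mBR Q \<alpha> \<beta> (mact Q (\<lambda>i\<in>verts Q. g i * p i) a))"
      by (simp add: m[OF a(1)])
  next
    fix b assume "b \<in> {x \<in> mfib Q \<alpha>' \<beta>' (mact Q (gTL Q \<alpha>' p) y1) (mact Q (gBR Q \<alpha>' \<beta>' p) y2). mact Q g x \<in> mLow Q \<alpha> \<beta>}"
    then have b: "b \<in> mfib Q \<alpha>' \<beta>' (mact Q (gTL Q \<alpha>' p) y1) (mact Q (gBR Q \<alpha>' \<beta>' p) y2)" "mact Q g b \<in> mLow Q \<alpha> \<beta>" by auto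
    show bb: "mact Q p (mact Q ?i b) = b" using mact_minv(2)[OF pG x(1)[OF b(1)]] .
    have f: "mact Q ?i b \<in> mfib Q \<alpha>' \<beta>' y1 y2"
      using mact_mLow[OF minv_mPar[OF p] x(2)[OF b(1)]] x(3,4)[OF b(1)]
        mact_minv(1)[OF gTL_mGL[OF p] y(1)] mact_minv(1)[OF gBR_mGL[OF p] y(2)] by (simp add: mfib_def gi)
    then show "mact Q ?i b \<in> {x \<in> mfib Q \<alpha>' \<beta>' y1 y2. mact Q (\<lambda>i\<in>verts Q. g i * p i) x \<in> mLow Q \<alpha> \<beta>}"
      using m[OF f] b(2) bb by simp
  qed
qed

end

context quiver begin

section \<open>Double cosets of families of parabolic subgroups\<close>

definition dcoset where
  "dcoset \<alpha>1 \<alpha>2 \<beta>1 \<beta>2 = {g. \<exists>p\<in>mPar Q (\<alpha>1 + \<alpha>2) (\<beta>1 + \<beta>2). \<exists>p'\<in>mPar Q (\<alpha>1 + \<beta>1) (\<alpha>2 + \<beta>2).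
     g = (\<lambda>i\<in>verts Q. p i * wfam \<alpha>1 \<alpha>2 \<beta>1 \<beta>2 i * p' i)}"

lemma dcoset_mGL:
  fixes g :: "'v \<Rightarrow> 'k :: field mat"
  assumes "g \<in> dcoset \<alpha>1 \<alpha>2 \<beta>1 \<beta>2" shows "g \<in> mGL Q ((\<alpha>1 + \<alpha>2) + (\<beta>1 + \<beta>2))"
proof -
  obtain p p' where p: "p \<in> mPar Q (\<alpha>1 + \<alpha>2) (\<beta>1 + \<beta>2)" "p' \<in> mPar Q (\<alpha>1 + \<beta>1) (\<alpha>2 + \<beta>2)"
    and g: "g = (\<lambda>i\<in>verts Q. p i * wfam \<alpha>1 \<alpha>2 \<beta>1 \<beta>2 i * p' i)"
    using assms by (auto simp: dcoset_def)
  have e: "(\<alpha>1 + \<beta>1) + (\<alpha>2 + \<beta>2) = (\<alpha>1 + \<alpha>2) + (\<beta>1 + \<beta>2)" by (simp add: ac_simps)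
  note m = mPar_mGL[OF p(1)] wfam_mGL[of \<alpha>1 \<alpha>2 \<beta>1 \<beta>2] mPar_mGL[OF p(2), unfolded e]
  have "p i * wfam \<alpha>1 \<alpha>2 \<beta>1 \<beta>2 i * p' i \<in> GL (((\<alpha>1 + \<alpha>2) + (\<beta>1 + \<beta>2)) i)" if "i \<in> verts Q" for i
    using m that by (intro GL_mult) (auto simp: mGL_def simp del: plus_fun_apply)
  then show ?thesis unfolding g mGL_def by auto
qed

lemma card_dcoset_fibre_fam:
  fixes g :: "'v \<Rightarrow> 'k :: {field, finite} mat"
  assumes "g \<in> dcoset \<alpha>1 \<alpha>2 \<beta>1 \<beta>2"
  shows "card {pp \<in> mPar Q (\<alpha>1 + \<alpha>2) (\<beta>1 + \<beta>2) \<times> mPar Q (\<alpha>1 + \<beta>1) (\<alpha>2 + \<beta>2).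
      (\<lambda>i\<in>verts Q. fst pp i * wfam \<alpha>1 \<alpha>2 \<beta>1 \<beta>2 i * snd pp i) = g} =
    (\<Prod>i\<in>verts Q. dcoset_stab TYPE('k) (\<alpha>1 i) (\<alpha>2 i) (\<beta>1 i) (\<beta>2 i))" (is "card ?S = _")
proof -
  obtain p p' where p: "p \<in> mPar Q (\<alpha>1 + \<alpha>2) (\<beta>1 + \<beta>2)" "p' \<in> mPar Q (\<alpha>1 + \<beta>1) (\<alpha>2 + \<beta>2)"
    and g: "g = (\<lambda>i\<in>verts Q. p i * wfam \<alpha>1 \<alpha>2 \<beta>1 \<beta>2 i * p' i)"
    using assms by (auto simp: dcoset_def)
  let ?F = "\<lambda>i. {(r, r'). r \<in> Par (\<alpha>1 i + \<alpha>2 i) (\<beta>1 i + \<beta>2 i) \<and> r' \<in> Par (\<alpha>1 i + \<beta>1 i) (\<alpha>2 i + \<beta>2 i) \<and>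
     r * wmat (\<alpha>1 i) (\<alpha>2 i) (\<beta>1 i) (\<beta>2 i) * r' = g i}"
  have "bij_betw (\<lambda>pp. \<lambda>i\<in>verts Q. (fst pp i, snd pp i)) ?S (PiE (verts Q) ?F)"
  proof (rule bij_betw_byWitness[where f' = "\<lambda>z. (\<lambda>i\<in>verts Q. fst (z i), \<lambda>i\<in>verts Q. snd (z i))"])
    show "\<forall>pp\<in>?S. (\<lambda>z. (\<lambda>i\<in>verts Q. fst (z i), \<lambda>i\<in>verts Q. snd (z i))) (\<lambda>i\<in>verts Q. (fst pp i, snd pp i)) = pp"
      by (auto simp: mPar_def PiE_def extensional_def fun_eq_iff)
    show "\<forall>z\<in>PiE (verts Q) ?F. (\<lambda>i\<in>verts Q. (fst ((\<lambda>i\<in>verts Q. fst (z i), \<lambda>i\<in>verts Q. snd (z i))) i,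
        snd ((\<lambda>i\<in>verts Q. fst (z i), \<lambda>i\<in>verts Q. snd (z i))) i)) = z"
      by (auto simp: PiE_def extensional_def fun_eq_iff)
    show "(\<lambda>pp. \<lambda>i\<in>verts Q. (fst pp i, snd pp i)) ` ?S \<subseteq> PiE (verts Q) ?F"
    proof
      fix z assume "z \<in> (\<lambda>pp. \<lambda>i\<in>verts Q. (fst pp i, snd pp i)) ` ?S"
      then obtain pp where pp: "pp \<in> ?S" "z = (\<lambda>i\<in>verts Q. (fst pp i, snd pp i))" by blast
      then have e: "fst pp i * wfam \<alpha>1 \<alpha>2 \<beta>1 \<beta>2 i * snd pp i = g i" if "i \<in> verts Q" for i
        using pp(1) that by (auto dest!: fun_cong[of _ _ i])
      have "z i \<in> ?F i" if i: "i \<in> verts Q" for i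
        using pp i e[OF i] by (auto simp: mPar_def PiE_def Pi_def wfam_def)
      then show "z \<in> PiE (verts Q) ?F" using pp(2) by auto
    qed
    show "(\<lambda>z. (\<lambda>i\<in>verts Q. fst (z i), \<lambda>i\<in>verts Q. snd (z i))) ` PiE (verts Q) ?F \<subseteq> ?S"
    proof
      fix pp assume "pp \<in> (\<lambda>z. (\<lambda>i\<in>verts Q. fst (z i), \<lambda>i\<in>verts Q. snd (z i))) ` PiE (verts Q) ?F"
      then obtain z where z: "z \<in> PiE (verts Q) ?F" "pp = (\<lambda>i\<in>verts Q. fst (z i), \<lambda>i\<in>verts Q. snd (z i))" by blast
      have zi: "fst (z i) \<in> Par (\<alpha>1 i + \<alpha>2 i) (\<beta>1 i + \<beta>2 i)" "snd (z i) \<in> Par (\<alpha>1 i + \<beta>1 i) (\<alpha>2 i + \<beta>2 i)"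
        "fst (z i) * wmat (\<alpha>1 i) (\<alpha>2 i) (\<beta>1 i) (\<beta>2 i) * snd (z i) = g i" if "i \<in> verts Q" for i
        using PiE_mem[OF z(1) that] by (auto split: prod.splits)
      have "g \<in> extensional (verts Q)" by (simp add: g)
      then have "(\<lambda>i\<in>verts Q. fst (z i) * wfam \<alpha>1 \<alpha>2 \<beta>1 \<beta>2 i * snd (z i)) = g"
        using zi(3) by (auto simp: wfam_def fun_eq_iff extensional_def)
      then show "pp \<in> ?S" using zi(1,2) z(2) by (auto simp: mPar_def cong: restrict_cong)
    qed
  qed
  from bij_betw_same_card[OF this] have "card ?S = (\<Prod>i\<in>verts Q. card (?F i))"
    unfolding card_PiE[OF finQ(1)] .
  also have "\<dots> = (\<Prod>i\<in>verts Q. dcoset_stab TYPE('k) (\<alpha>1 i) (\<alpha>2 i) (\<beta>1 i) (\<beta>2 i))"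
  proof (rule prod.cong[OF refl])
    fix i assume i: "i \<in> verts Q"
    show "card (?F i) = dcoset_stab TYPE('k) (\<alpha>1 i) (\<alpha>2 i) (\<beta>1 i) (\<beta>2 i)"
      by (rule card_dcoset_fibre[of "p i" _ _ _ _ "p' i"])
        (use p i in \<open>auto simp: g wfam_def mPar_def PiE_def Pi_def\<close>)
  qed
  finally show ?thesis .
qed

text \<open>Apply \<open>bruhat\<close> at every vertex. Outside the vertices the components are set to 0, as required of dimension vectors.\<close>

lemma dcoset_cover:
  fixes g :: "'v \<Rightarrow> 'k :: field mat"
  assumes d: "\<alpha> \<in> dim_vectors Q" "\<beta> \<in> dim_vectors Q" "\<alpha>' \<in> dim_vectors Q" "\<beta>' \<in> dim_vectors Q"
    and \<gamma>: "\<alpha> + \<beta> = \<alpha>' + \<beta>'" and g: "g \<in> mGL Q (\<alpha> + \<beta>)"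
  shows "\<exists>(\<alpha>1, \<alpha>2, \<beta>1, \<beta>2)\<in>refinements Q \<alpha> \<beta> \<alpha>' \<beta>'. g \<in> dcoset \<alpha>1 \<alpha>2 \<beta>1 \<beta>2"
proof -
  have "\<forall>i\<in>verts Q. \<exists>z :: nat \<times> nat \<times> nat \<times> nat \<times> 'k mat \<times> 'k mat. case z of (a1, a2, b1, b2, p, p') \<Rightarrow>
     \<alpha> i = a1 + a2 \<and> \<beta> i = b1 + b2 \<and> \<alpha>' i = a1 + b1 \<and> \<beta>' i = a2 + b2 \<and>
     p \<in> Par (\<alpha> i) (\<beta> i) \<and> p' \<in> Par (\<alpha>' i) (\<beta>' i) \<and> g i = p * wmat a1 a2 b1 b2 * p'"
  proof
    fix i assume "i \<in> verts Q"
    then have gi: "g i \<in> GL (\<alpha> i + \<beta> i)" using g by (auto simp: mGL_def)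
    have "\<alpha> i + \<beta> i = \<alpha>' i + \<beta>' i" using fun_cong[OF \<gamma>, of i] by simp
    from bruhat[OF gi refl this] obtain a1 a2 b1 b2 p p' where
      z: "\<alpha> i = a1 + a2" "\<beta> i = b1 + b2" "\<alpha>' i = a1 + b1" "\<beta>' i = a2 + b2"
        "p \<in> Par (\<alpha> i) (\<beta> i)" "p' \<in> Par (\<alpha>' i) (\<beta>' i)" "g i = p * wmat a1 a2 b1 b2 * p'" .
    show "\<exists>z :: nat \<times> nat \<times> nat \<times> nat \<times> 'k mat \<times> 'k mat. case z of (a1, a2, b1, b2, p, p') \<Rightarrow>
     \<alpha> i = a1 + a2 \<and> \<beta> i = b1 + b2 \<and> \<alpha>' i = a1 + b1 \<and> \<beta>' i = a2 + b2 \<and>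
     p \<in> Par (\<alpha> i) (\<beta> i) \<and> p' \<in> Par (\<alpha>' i) (\<beta>' i) \<and> g i = p * wmat a1 a2 b1 b2 * p'"
      using z by (intro exI[of _ "(a1, a2, b1, b2, p, p')"]) simp
  qed
  from bchoice[OF this] obtain Z :: "'v \<Rightarrow> nat \<times> nat \<times> nat \<times> nat \<times> 'k mat \<times> 'k mat" where
    Z: "\<forall>i\<in>verts Q. case Z i of (a1, a2, b1, b2, p, p') \<Rightarrow>
     \<alpha> i = a1 + a2 \<and> \<beta> i = b1 + b2 \<and> \<alpha>' i = a1 + b1 \<and> \<beta>' i = a2 + b2 \<and>
     p \<in> Par (\<alpha> i) (\<beta> i) \<and> p' \<in> Par (\<alpha>' i) (\<beta>' i) \<and> g i = p * wmat a1 a2 b1 b2 * p'" ..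
  define \<alpha>1 \<alpha>2 \<beta>1 \<beta>2 where "\<alpha>1 = (\<lambda>i. if i \<in> verts Q then fst (Z i) else 0)"
    and "\<alpha>2 = (\<lambda>i. if i \<in> verts Q then fst (snd (Z i)) else 0)"
    and "\<beta>1 = (\<lambda>i. if i \<in> verts Q then fst (snd (snd (Z i))) else 0)"
    and "\<beta>2 = (\<lambda>i. if i \<in> verts Q then fst (snd (snd (snd (Z i)))) else 0)"
  define p p' where "p = (\<lambda>i\<in>verts Q. fst (snd (snd (snd (snd (Z i))))))"
    and "p' = (\<lambda>i\<in>verts Q. snd (snd (snd (snd (snd (Z i))))))"
  have Z': "\<alpha> i = \<alpha>1 i + \<alpha>2 i" "\<beta> i = \<beta>1 i + \<beta>2 i" "\<alpha>' i = \<alpha>1 i + \<beta>1 i" "\<beta>' i = \<alpha>2 i + \<beta>2 i"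
    "p i \<in> Par (\<alpha> i) (\<beta> i)" "p' i \<in> Par (\<alpha>' i) (\<beta>' i)" "g i = p i * wmat (\<alpha>1 i) (\<alpha>2 i) (\<beta>1 i) (\<beta>2 i) * p' i"
    if "i \<in> verts Q" for i
    using bspec[OF Z that] that by (auto simp: \<alpha>1_def \<alpha>2_def \<beta>1_def \<beta>2_def p_def p'_def split: prod.splits)
  have eq: "\<alpha> = \<alpha>1 + \<alpha>2" "\<beta> = \<beta>1 + \<beta>2" "\<alpha>' = \<alpha>1 + \<beta>1" "\<beta>' = \<alpha>2 + \<beta>2"
  proof -
    have "\<alpha> i = (\<alpha>1 + \<alpha>2) i \<and> \<beta> i = (\<beta>1 + \<beta>2) i \<and> \<alpha>' i = (\<alpha>1 + \<beta>1) i \<and> \<beta>' i = (\<alpha>2 + \<beta>2) i" for i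
      using Z'(1-4)[of i] d by (cases "i \<in> verts Q") (auto simp: dim_vectors_def \<alpha>1_def \<alpha>2_def \<beta>1_def \<beta>2_def)
    then show "\<alpha> = \<alpha>1 + \<alpha>2" "\<beta> = \<beta>1 + \<beta>2" "\<alpha>' = \<alpha>1 + \<beta>1" "\<beta>' = \<alpha>2 + \<beta>2" by blast+
  qed
  have "(\<alpha>1, \<alpha>2, \<beta>1, \<beta>2) \<in> refinements Q \<alpha> \<beta> \<alpha>' \<beta>'"
    using eq by (auto simp: refinements_def dim_vectors_def \<alpha>1_def \<alpha>2_def \<beta>1_def \<beta>2_def)
  moreover have "g \<in> dcoset \<alpha>1 \<alpha>2 \<beta>1 \<beta>2"
    unfolding dcoset_def mem_Collect_eq
  proof (intro bexI)
    show "p \<in> mPar Q (\<alpha>1 + \<alpha>2) (\<beta>1 + \<beta>2)" unfolding eq[symmetric] mPar_def using Z'(5) by (auto simp: p_def)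
    show "p' \<in> mPar Q (\<alpha>1 + \<beta>1) (\<alpha>2 + \<beta>2)" unfolding eq[symmetric] mPar_def using Z'(6) by (auto simp: p'_def)
    have "g \<in> extensional (verts Q)" using g by (auto simp: mGL_def PiE_def)
    then show "g = (\<lambda>i\<in>verts Q. p i * wfam \<alpha>1 \<alpha>2 \<beta>1 \<beta>2 i * p' i)"
      using Z'(7) by (auto simp: wfam_def fun_eq_iff extensional_def)
  qed
  ultimately show ?thesis by blast
qed

text \<open>The image sizes of the upper right blocks determine \<open>\<alpha>2\<close>, and \<open>\<alpha>2\<close> determines the other three components.\<close>

lemma dcoset_disjoint:
  fixes g :: "'v \<Rightarrow> 'k :: {field, finite} mat"
  assumes l: "(\<alpha>1, \<alpha>2, \<beta>1, \<beta>2) \<in> refinements Q \<alpha> \<beta> \<alpha>' \<beta>'" "(\<mu>1, \<mu>2, \<nu>1, \<nu>2) \<in> refinements Q \<alpha> \<beta> \<alpha>' \<beta>'"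
    and g: "g \<in> dcoset \<alpha>1 \<alpha>2 \<beta>1 \<beta>2" "g \<in> dcoset \<mu>1 \<mu>2 \<nu>1 \<nu>2"
  shows "(\<alpha>1, \<alpha>2, \<beta>1, \<beta>2) = (\<mu>1, \<mu>2, \<nu>1, \<nu>2)"
proof -
  have image_card: "image_card (blk 0 (\<alpha>' i) (\<alpha> i) (\<beta>' i) (g i)) = CARD('k) ^ \<alpha>2 i"
    if r: "(\<alpha>1, \<alpha>2, \<beta>1, \<beta>2) \<in> refinements Q \<alpha> \<beta> \<alpha>' \<beta>'" "g \<in> dcoset \<alpha>1 \<alpha>2 \<beta>1 \<beta>2" "i \<in> verts Q"
    for \<alpha>1 \<alpha>2 \<beta>1 \<beta>2 i
  proof -
    obtain p p' where p: "p \<in> mPar Q (\<alpha>1 + \<alpha>2) (\<beta>1 + \<beta>2)" "p' \<in> mPar Q (\<alpha>1 + \<beta>1) (\<alpha>2 + \<beta>2)"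
      and g: "g = (\<lambda>i\<in>verts Q. p i * wfam \<alpha>1 \<alpha>2 \<beta>1 \<beta>2 i * p' i)"
      using r(2) unfolding dcoset_def by blast
    have "p i \<in> Par (\<alpha>1 i + \<alpha>2 i) (\<beta>1 i + \<beta>2 i)" "p' i \<in> Par (\<alpha>1 i + \<beta>1 i) (\<alpha>2 i + \<beta>2 i)"
      using p r(3) by (auto simp: mPar_def)
    from image_card_dcoset[OF this] show ?thesis using r(1,3) by (simp add: g wfam_def refinements_def)
  qed
  have q: "CARD('k) > 1"
    using card_mono[of UNIV "{0, 1 :: 'k}"] by simp
  have "\<alpha>2 i = \<mu>2 i" for i
  proof (cases "i \<in> verts Q")
    case True
    have "CARD('k) ^ \<alpha>2 i = CARD('k) ^ \<mu>2 i" using image_card[OF l(1) g(1) True] image_card[OF l(2) g(2) True] by simp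
    then show ?thesis using q by simp
  qed (use l in \<open>auto simp: refinements_def dim_vectors_def\<close>)
  then have 2: "\<alpha>2 = \<mu>2" by (rule ext)
  then show ?thesis using l by (auto simp: refinements_def)
qed

text \<open>A refinement is determined by \<open>\<alpha>1\<close>, which is bounded by \<open>\<alpha>\<close>.\<close>

lemma finite_refinements: "finite (refinements Q \<alpha> \<beta> \<alpha>' \<beta>')"
proof (rule inj_on_finite)
  show "inj_on (\<lambda>(\<alpha>1, \<alpha>2, \<beta>1, \<beta>2). restrict \<alpha>1 (verts Q)) (refinements Q \<alpha> \<beta> \<alpha>' \<beta>')"
  proof (rule inj_onI)
    fix x y assume xy: "x \<in> refinements Q \<alpha> \<beta> \<alpha>' \<beta>'" "y \<in> refinements Q \<alpha> \<beta> \<alpha>' \<beta>'"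
      "(case x of (\<alpha>1, \<alpha>2, \<beta>1, \<beta>2) \<Rightarrow> restrict \<alpha>1 (verts Q)) = (case y of (\<alpha>1, \<alpha>2, \<beta>1, \<beta>2) \<Rightarrow> restrict \<alpha>1 (verts Q))"
    obtain \<alpha>1 \<alpha>2 \<beta>1 \<beta>2 \<mu>1 \<mu>2 \<nu>1 \<nu>2 where x: "x = (\<alpha>1, \<alpha>2, \<beta>1, \<beta>2)" and y: "y = (\<mu>1, \<mu>2, \<nu>1, \<nu>2)"
      by (cases x, cases y)
    note l = xy(1,2)[unfolded x y]
    have e: "restrict \<alpha>1 (verts Q) = restrict \<mu>1 (verts Q)" using xy(3) by (simp add: x y)
    have "\<alpha>1 i = \<mu>1 i" for i
      using fun_cong[OF e, of i] l by (cases "i \<in> verts Q") (auto simp: refinements_def dim_vectors_def)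
    then have "\<alpha>1 = \<mu>1" by (rule ext)
    then show "x = y" using l unfolding x y by (auto simp: refinements_def)
  qed
  show "(\<lambda>(\<alpha>1, \<alpha>2, \<beta>1, \<beta>2). restrict \<alpha>1 (verts Q)) ` refinements Q \<alpha> \<beta> \<alpha>' \<beta>' \<subseteq> (\<Pi>\<^sub>E i\<in>verts Q. {..\<alpha> i})"
    by (auto simp: refinements_def)
  show "finite (\<Pi>\<^sub>E i\<in>verts Q. {..\<alpha> i})" by (intro finite_PiE) auto
qed

section \<open>The Mackey formula over the finite field\<close>

text \<open>Replace the sum over \<open>g\<close> by a sum over pairs \<open>(p, p')\<close> with \<open>g = p w p'\<close>, each \<open>g\<close> being hit \<open>N\<close> times. Then \<open>p\<close> disappears by
  \<open>hsum_left\<close>, and of \<open>p'\<close> only the Levi part is left by \<open>hsum_right\<close>.\<close>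

lemma hsum_dcoset:
  fixes f1 f2 :: "('h \<Rightarrow> 'k :: {field, finite} mat) \<Rightarrow> 'c :: field_char_0"
  assumes f: "minvariant (\<alpha>1 + \<alpha>2) f1" "minvariant (\<beta>1 + \<beta>2) f2"
    and y: "y1 \<in> mreps Q (\<alpha>1 + \<beta>1)" "y2 \<in> mreps Q (\<alpha>2 + \<beta>2)"
  defines "N \<equiv> \<Prod>i\<in>verts Q. dcoset_stab TYPE('k) (\<alpha>1 i) (\<alpha>2 i) (\<beta>1 i) (\<beta>2 i)"
    and "H \<equiv> hsum (\<alpha>1 + \<alpha>2) (\<beta>1 + \<beta>2) (\<alpha>1 + \<beta>1) (\<alpha>2 + \<beta>2) f1 f2"
  shows "of_nat N * (\<Sum>g\<in>dcoset \<alpha>1 \<alpha>2 \<beta>1 \<beta>2. H y1 y2 g) =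
    of_nat (card (mPar Q (\<alpha>1 + \<alpha>2) (\<beta>1 + \<beta>2) :: ('v \<Rightarrow> 'k mat) set) * CARD('k) ^ vdim Q (\<alpha>1 + \<beta>1) (\<alpha>2 + \<beta>2)) *
    (\<Sum>l1\<in>mGL Q (\<alpha>1 + \<beta>1). \<Sum>l2\<in>mGL Q (\<alpha>2 + \<beta>2).
       H (mact Q l1 y1) (mact Q l2 y2) (wfam \<alpha>1 \<alpha>2 \<beta>1 \<beta>2))"
proof -
  define w :: "'v \<Rightarrow> 'k mat" where "w = wfam \<alpha>1 \<alpha>2 \<beta>1 \<beta>2"
  define P where "P = (mPar Q (\<alpha>1 + \<alpha>2) (\<beta>1 + \<beta>2) :: ('v \<Rightarrow> 'k mat) set)"
  define P' where "P' = (mPar Q (\<alpha>1 + \<beta>1) (\<alpha>2 + \<beta>2) :: ('v \<Rightarrow> 'k mat) set)"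
  have \<gamma>: "(\<alpha>1 + \<alpha>2) + (\<beta>1 + \<beta>2) = (\<alpha>1 + \<beta>1) + (\<alpha>2 + \<beta>2)" by (simp add: ac_simps)
  have w: "w \<in> mGL Q ((\<alpha>1 + \<alpha>2) + (\<beta>1 + \<beta>2))" unfolding w_def by (rule wfam_mGL)
  have fin: "finite (dcoset \<alpha>1 \<alpha>2 \<beta>1 \<beta>2 :: ('v \<Rightarrow> 'k mat) set)"
    by (rule finite_subset[OF _ finite_mGL]) (use dcoset_mGL in blast)
  have "of_nat N * (\<Sum>g\<in>dcoset \<alpha>1 \<alpha>2 \<beta>1 \<beta>2. H y1 y2 g) =
    (\<Sum>pp\<in>P \<times> P'. H y1 y2 (\<lambda>i\<in>verts Q. fst pp i * w i * snd pp i))"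
  proof (rule sum_by_fibres[where f = "\<lambda>pp. \<lambda>i\<in>verts Q. fst pp i * w i * snd pp i" and h = "H y1 y2"
        and S = "P \<times> P'" and c = N, OF _ fin, symmetric])
    show "finite (P \<times> P')" unfolding P_def P'_def by (intro finite_cartesian_product finite_mPar)
    show "(\<lambda>i\<in>verts Q. fst pp i * w i * snd pp i) \<in> dcoset \<alpha>1 \<alpha>2 \<beta>1 \<beta>2" if "pp \<in> P \<times> P'" for pp
      using that unfolding P_def P'_def w_def dcoset_def mem_Collect_eq
      by (intro bexI[of _ "fst pp"] bexI[of _ "snd pp"] refl) auto
    show "card {pp \<in> P \<times> P'. (\<lambda>i\<in>verts Q. fst pp i * w i * snd pp i) = g} = N"
      if "g \<in> dcoset \<alpha>1 \<alpha>2 \<beta>1 \<beta>2" for g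
      using card_dcoset_fibre_fam[OF that] unfolding P_def P'_def w_def N_def .
  qed
  also have "\<dots> = (\<Sum>p\<in>P. \<Sum>p'\<in>P'. H y1 y2 (\<lambda>i\<in>verts Q. p i * w i * p' i))"
    by (simp add: sum.cartesian_product case_prod_beta)
  also have "\<dots> = (\<Sum>p\<in>P. \<Sum>p'\<in>P'. H (mact Q (gTL Q (\<alpha>1 + \<beta>1) p') y1) (mact Q (gBR Q (\<alpha>1 + \<beta>1) (\<alpha>2 + \<beta>2) p') y2) w)"
  proof (intro sum.cong refl)
    fix p p' assume p: "p \<in> P" "p' \<in> P'"
    note pG = mPar_mGL[OF p(1)[unfolded P_def]] mPar_mGL[OF p(2)[unfolded P'_def], folded \<gamma>]
    have wp: "(\<lambda>i\<in>verts Q. w i * p' i) \<in> mGL Q ((\<alpha>1 + \<alpha>2) + (\<beta>1 + \<beta>2))"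
      using w pG(2) by (auto simp: mGL_def simp del: plus_fun_apply)
    have "p i * w i * p' i = p i * (w i * p' i)" if "i \<in> verts Q" for i
    proof -
      define n where "n = ((\<alpha>1 + \<alpha>2) + (\<beta>1 + \<beta>2)) i"
      have "p i \<in> GL n" "w i \<in> GL n" "p' i \<in> GL n" using pG w that unfolding mGL_def n_def by auto
      then show ?thesis by (intro assoc_mult_mat[of _ n n _ n _ n] GL_carrier)
    qed
    then have "(\<lambda>i\<in>verts Q. p i * w i * p' i) = (\<lambda>i\<in>verts Q. p i * (\<lambda>i\<in>verts Q. w i * p' i) i)"
      by (auto intro!: restrict_ext)
    then have "H y1 y2 (\<lambda>i\<in>verts Q. p i * w i * p' i) = H y1 y2 (\<lambda>i\<in>verts Q. w i * p' i)"
      unfolding H_def using hsum_left[OF f \<gamma> p(1)[unfolded P_def] wp] by simp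
    also have "\<dots> = H (mact Q (gTL Q (\<alpha>1 + \<beta>1) p') y1) (mact Q (gBR Q (\<alpha>1 + \<beta>1) (\<alpha>2 + \<beta>2) p') y2) w"
      unfolding H_def using hsum_right[OF \<gamma> y p(2)[unfolded P'_def] w] .
    finally show "H y1 y2 (\<lambda>i\<in>verts Q. p i * w i * p' i) =
      H (mact Q (gTL Q (\<alpha>1 + \<beta>1) p') y1) (mact Q (gBR Q (\<alpha>1 + \<beta>1) (\<alpha>2 + \<beta>2) p') y2) w" .
  qed
  also have "\<dots> = of_nat (card P) * (\<Sum>p'\<in>P'. H (mact Q (gTL Q (\<alpha>1 + \<beta>1) p') y1) (mact Q (gBR Q (\<alpha>1 + \<beta>1) (\<alpha>2 + \<beta>2) p') y2) w)"
    by simp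
  also have "(\<Sum>p'\<in>P'. H (mact Q (gTL Q (\<alpha>1 + \<beta>1) p') y1) (mact Q (gBR Q (\<alpha>1 + \<beta>1) (\<alpha>2 + \<beta>2) p') y2) w) =
    (\<Sum>p'\<in>P'. (\<lambda>(l1, l2). H (mact Q l1 y1) (mact Q l2 y2) w) (gTL Q (\<alpha>1 + \<beta>1) p', gBR Q (\<alpha>1 + \<beta>1) (\<alpha>2 + \<beta>2) p'))"
    by simp
  also have "\<dots> = of_nat (CARD('k) ^ vdim Q (\<alpha>1 + \<beta>1) (\<alpha>2 + \<beta>2)) *
    (\<Sum>l\<in>mGL Q (\<alpha>1 + \<beta>1) \<times> mGL Q (\<alpha>2 + \<beta>2). (\<lambda>(l1, l2). H (mact Q l1 y1) (mact Q l2 y2) w) l)"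
  proof (rule sum_by_fibres[where f = "\<lambda>p'. (gTL Q (\<alpha>1 + \<beta>1) p', gBR Q (\<alpha>1 + \<beta>1) (\<alpha>2 + \<beta>2) p')" and S = P'
        and h = "\<lambda>(l1, l2). H (mact Q l1 y1) (mact Q l2 y2) w" and c = "CARD('k) ^ vdim Q (\<alpha>1 + \<beta>1) (\<alpha>2 + \<beta>2)"])
    show "finite P'" "finite ((mGL Q (\<alpha>1 + \<beta>1) :: ('v \<Rightarrow> 'k mat) set) \<times> (mGL Q (\<alpha>2 + \<beta>2) :: ('v \<Rightarrow> 'k mat) set))"
      unfolding P'_def by (intro finite_cartesian_product finite_mPar finite_mGL)+
    show "(gTL Q (\<alpha>1 + \<beta>1) p', gBR Q (\<alpha>1 + \<beta>1) (\<alpha>2 + \<beta>2) p') \<in> mGL Q (\<alpha>1 + \<beta>1) \<times> mGL Q (\<alpha>2 + \<beta>2)"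
      if "p' \<in> P'" for p'
      using that gTL_mGL gBR_mGL unfolding P'_def by blast
  qed (unfold P'_def, rule card_mPar_fibre)
  also have "(\<Sum>l\<in>mGL Q (\<alpha>1 + \<beta>1) \<times> mGL Q (\<alpha>2 + \<beta>2). (\<lambda>(l1, l2). H (mact Q l1 y1) (mact Q l2 y2) w) l) =
    (\<Sum>l1\<in>mGL Q (\<alpha>1 + \<beta>1). \<Sum>l2\<in>mGL Q (\<alpha>2 + \<beta>2). H (mact Q l1 y1) (mact Q l2 y2) w)"
    by (simp add: sum.cartesian_product)
  finally show ?thesis by (simp only: P_def w_def of_nat_mult mult.assoc)
qed

text \<open>Rewritten in terms of the normalising factors of the two products and two coproducts on the right-hand side of the
  Mackey formula, the number of factorisations leaves exactly the vertex part of the Euler form.\<close>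

lemma prod_dcoset_stab:
  "(\<Prod>i\<in>verts Q. dcoset_stab TYPE('k :: {field, finite}) (\<alpha>1 i) (\<alpha>2 i) (\<beta>1 i) (\<beta>2 i)) =
    card (mPar Q \<alpha>1 \<beta>1 :: ('v \<Rightarrow> 'k mat) set) * card (mPar Q \<alpha>2 \<beta>2 :: ('v \<Rightarrow> 'k mat) set) *
    CARD('k) ^ vdim Q \<alpha>1 \<alpha>2 * CARD('k) ^ vdim Q \<beta>1 \<beta>2 * CARD('k) ^ vdim Q \<alpha>1 \<beta>2"
proof -
  have "dcoset_stab TYPE('k) a1 a2 b1 b2 = card (Par a1 b1 :: 'k mat set) * card (Par a2 b2 :: 'k mat set) *
    CARD('k) ^ (a1 * a2) * CARD('k) ^ (b1 * b2) * CARD('k) ^ (a1 * b2)" for a1 a2 b1 b2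
    by (simp add: dcoset_stab_def card_Par power_add)
  then show ?thesis by (simp add: mPar_def card_PiE prod.distrib vdim_def power_sum)
qed

lemma card_mPar_nonzero: "card (mPar Q \<alpha> \<beta> :: ('v \<Rightarrow> 'k :: {field, finite} mat) set) \<noteq> 0"
proof -
  have "card (mGL Q \<alpha> :: ('v \<Rightarrow> 'k mat) set) \<noteq> 0" for \<alpha>
    using card_GL_pos[where 'a = 'k] by (simp add: mGL_def card_PiE)
  then show ?thesis by (simp add: card_mPar)
qed

text \<open>Sum over \<open>g\<close> first, split the group into double cosets, and evaluate each of them at its representative. The quotient of
  \<open>q ^ adim Q \<alpha>1 \<beta>2\<close>, from \<open>sum_reblock_fibre\<close>, by \<open>q ^ vdim Q \<alpha>1 \<beta>2\<close>, from \<open>prod_dcoset_stab\<close>, is the power of \<open>q\<close> in the claim.\<close>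

theorem kcomult_kmult:
  fixes f1 f2 :: "('h \<Rightarrow> 'k :: {field, finite} mat) \<Rightarrow> 'c :: field_char_0"
  assumes d: "\<alpha> \<in> dim_vectors Q" "\<beta> \<in> dim_vectors Q" "\<alpha>' \<in> dim_vectors Q" "\<beta>' \<in> dim_vectors Q"
    and \<gamma>: "\<alpha> + \<beta> = \<alpha>' + \<beta>'" and f: "minvariant \<alpha> f1" "minvariant \<beta> f2"
    and y: "y1 \<in> mreps Q \<alpha>'" "y2 \<in> mreps Q \<beta>'"
  shows "kcomult Q \<alpha>' \<beta>' (kmult Q \<alpha> \<beta> (\<lambda>u v. f1 u * f2 v)) y1 y2 =
    (\<Sum>(\<alpha>1, \<alpha>2, \<beta>1, \<beta>2)\<in>refinements Q \<alpha> \<beta> \<alpha>' \<beta>'.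
       of_nat CARD('k) powi (- euler_form Q \<alpha>1 \<beta>2) *
       kmult Q \<alpha>1 \<beta>1 (\<lambda>u1 u2. kmult Q \<alpha>2 \<beta>2 (\<lambda>v1 v2.
         kcomult Q \<alpha>1 \<alpha>2 f1 u1 v1 * kcomult Q \<beta>1 \<beta>2 f2 u2 v2) y2) y1)"
proof -
  define q where "q = (of_nat CARD('k) :: 'c)"
  have q: "q \<noteq> 0" by (simp add: q_def)
  define cP where "cP \<alpha> \<beta> = (of_nat (card (mPar Q \<alpha> \<beta> :: ('v \<Rightarrow> 'k mat) set)) :: 'c)" for \<alpha> \<beta>
  have cP: "cP \<alpha> \<beta> \<noteq> 0" for \<alpha> \<beta> by (simp add: cP_def card_mPar_nonzero)
  define H where "H = hsum \<alpha> \<beta> \<alpha>' \<beta>' f1 f2"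
  have "kcomult Q \<alpha>' \<beta>' (kmult Q \<alpha> \<beta> (\<lambda>u v. f1 u * f2 v)) y1 y2 =
    inverse (q ^ vdim Q \<alpha>' \<beta>') * inverse (cP \<alpha> \<beta>) *
    (\<Sum>x\<in>mfib Q \<alpha>' \<beta>' y1 y2. \<Sum>g\<in>{g \<in> mGL Q (\<alpha> + \<beta>). mact Q g x \<in> mLow Q \<alpha> \<beta>}.
       f1 (mTL Q \<alpha> (mact Q g x)) * f2 (mBR Q \<alpha> \<beta> (mact Q g x)))"
    unfolding kcomult_def kmult_def q_def cP_def by (simp add: sum_distrib_left mult.assoc)
  also have "(\<Sum>x\<in>mfib Q \<alpha>' \<beta>' y1 y2. \<Sum>g\<in>{g \<in> mGL Q (\<alpha> + \<beta>). mact Q g x \<in> mLow Q \<alpha> \<beta>}.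
       f1 (mTL Q \<alpha> (mact Q g x)) * f2 (mBR Q \<alpha> \<beta> (mact Q g x))) = (\<Sum>g\<in>mGL Q (\<alpha> + \<beta>). H y1 y2 g)"
    unfolding H_def hsum_def by (rule sum.swap_restrict[OF finite_mfib finite_mGL])
  also have "(\<Sum>g\<in>mGL Q (\<alpha> + \<beta>). H y1 y2 g) =
    (\<Sum>(\<alpha>1, \<alpha>2, \<beta>1, \<beta>2)\<in>refinements Q \<alpha> \<beta> \<alpha>' \<beta>'. \<Sum>g\<in>dcoset \<alpha>1 \<alpha>2 \<beta>1 \<beta>2. H y1 y2 g)"
  proof -
    define C where "C = (\<lambda>(\<alpha>1, \<alpha>2, \<beta>1, \<beta>2). dcoset \<alpha>1 \<alpha>2 \<beta>1 \<beta>2 :: ('v \<Rightarrow> 'k mat) set)"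
    have sub: "C l \<subseteq> mGL Q (\<alpha> + \<beta>)" if "l \<in> refinements Q \<alpha> \<beta> \<alpha>' \<beta>'" for l
      using that dcoset_mGL by (cases l) (auto simp: C_def refinements_def)
    have "mGL Q (\<alpha> + \<beta>) = (\<Union>l\<in>refinements Q \<alpha> \<beta> \<alpha>' \<beta>'. C l)"
    proof (intro subset_antisym subsetI)
      fix g :: "'v \<Rightarrow> 'k mat" assume "g \<in> mGL Q (\<alpha> + \<beta>)"
      from dcoset_cover[OF d \<gamma> this] obtain l where "l \<in> refinements Q \<alpha> \<beta> \<alpha>' \<beta>'"
        "case l of (\<alpha>1, \<alpha>2, \<beta>1, \<beta>2) \<Rightarrow> g \<in> dcoset \<alpha>1 \<alpha>2 \<beta>1 \<beta>2" by blast
      then show "g \<in> (\<Union>l\<in>refinements Q \<alpha> \<beta> \<alpha>' \<beta>'. C l)" by (cases l) (auto simp: C_def)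
    qed (use sub in blast)
    then have "(\<Sum>g\<in>mGL Q (\<alpha> + \<beta>). H y1 y2 g) = (\<Sum>g\<in>(\<Union>l\<in>refinements Q \<alpha> \<beta> \<alpha>' \<beta>'. C l). H y1 y2 g)" by simp
    also have "\<dots> = (\<Sum>l\<in>refinements Q \<alpha> \<beta> \<alpha>' \<beta>'. \<Sum>g\<in>C l. H y1 y2 g)"
    proof (rule sum.UNION_disjoint[OF finite_refinements])
      show "\<forall>l\<in>refinements Q \<alpha> \<beta> \<alpha>' \<beta>'. finite (C l)" using sub finite_mGL finite_subset by blast
      show "\<forall>l\<in>refinements Q \<alpha> \<beta> \<alpha>' \<beta>'. \<forall>m\<in>refinements Q \<alpha> \<beta> \<alpha>' \<beta>'. l \<noteq> m \<longrightarrow> C l \<inter> C m = {}"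
        unfolding C_def using dcoset_disjoint by fast
    qed
    also have "\<dots> = (\<Sum>(\<alpha>1, \<alpha>2, \<beta>1, \<beta>2)\<in>refinements Q \<alpha> \<beta> \<alpha>' \<beta>'. \<Sum>g\<in>dcoset \<alpha>1 \<alpha>2 \<beta>1 \<beta>2. H y1 y2 g)"
      by (intro sum.cong) (auto simp: C_def split: prod.splits)
    finally show ?thesis .
  qed
  also have "inverse (q ^ vdim Q \<alpha>' \<beta>') * inverse (cP \<alpha> \<beta>) * \<dots> =
    (\<Sum>(\<alpha>1, \<alpha>2, \<beta>1, \<beta>2)\<in>refinements Q \<alpha> \<beta> \<alpha>' \<beta>'.
      inverse (q ^ vdim Q \<alpha>' \<beta>') * inverse (cP \<alpha> \<beta>) * (\<Sum>g\<in>dcoset \<alpha>1 \<alpha>2 \<beta>1 \<beta>2. H y1 y2 g))"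
    by (simp add: sum_distrib_left case_prod_beta)
  also have "\<dots> = (\<Sum>(\<alpha>1, \<alpha>2, \<beta>1, \<beta>2)\<in>refinements Q \<alpha> \<beta> \<alpha>' \<beta>'.
       of_nat CARD('k) powi (- euler_form Q \<alpha>1 \<beta>2) *
       kmult Q \<alpha>1 \<beta>1 (\<lambda>u1 u2. kmult Q \<alpha>2 \<beta>2 (\<lambda>v1 v2.
         kcomult Q \<alpha>1 \<alpha>2 f1 u1 v1 * kcomult Q \<beta>1 \<beta>2 f2 u2 v2) y2) y1)"
  proof (intro sum.cong refl, clarify)
    fix \<alpha>1 \<alpha>2 \<beta>1 \<beta>2 assume l: "(\<alpha>1, \<alpha>2, \<beta>1, \<beta>2) \<in> refinements Q \<alpha> \<beta> \<alpha>' \<beta>'"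
    then have e: "\<alpha> = \<alpha>1 + \<alpha>2" "\<beta> = \<beta>1 + \<beta>2" "\<alpha>' = \<alpha>1 + \<beta>1" "\<beta>' = \<alpha>2 + \<beta>2" by (auto simp: refinements_def)
    define S where "S u v = (\<Sum>s\<in>mfib Q \<alpha>1 \<alpha>2 (mTL Q \<alpha>1 u) (mTL Q \<alpha>2 v).
      \<Sum>t\<in>mfib Q \<beta>1 \<beta>2 (mBR Q \<alpha>1 \<beta>1 u) (mBR Q \<alpha>2 \<beta>2 v). f1 s * f2 t)" for u v
    define A where "A = (\<Sum>l1\<in>{l1 \<in> mGL Q \<alpha>'. mact Q l1 y1 \<in> mLow Q \<alpha>1 \<beta>1}.
      \<Sum>l2\<in>{l2 \<in> mGL Q \<beta>'. mact Q l2 y2 \<in> mLow Q \<alpha>2 \<beta>2}. S (mact Q l1 y1) (mact Q l2 y2))"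
    \<comment> \<open>the number of factorisations of an element of the double coset, see \<open>prod_dcoset_stab\<close>\<close>
    define N :: 'c where "N = cP \<alpha>1 \<beta>1 * cP \<alpha>2 \<beta>2 * q ^ vdim Q \<alpha>1 \<alpha>2 * q ^ vdim Q \<beta>1 \<beta>2 * q ^ vdim Q \<alpha>1 \<beta>2"
    have N: "N \<noteq> 0" using q cP by (simp add: N_def)
    have "N * (\<Sum>g\<in>dcoset \<alpha>1 \<alpha>2 \<beta>1 \<beta>2. H y1 y2 g) = cP \<alpha> \<beta> * q ^ vdim Q \<alpha>' \<beta>' *
      (\<Sum>l1\<in>mGL Q \<alpha>'. \<Sum>l2\<in>mGL Q \<beta>'. H (mact Q l1 y1) (mact Q l2 y2) (wfam \<alpha>1 \<alpha>2 \<beta>1 \<beta>2))"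
      using hsum_dcoset[of \<alpha>1 \<alpha>2 f1 \<beta>1 \<beta>2 f2 y1 y2] f y
      unfolding prod_dcoset_stab H_def e N_def cP_def q_def by simp
    also have "(\<Sum>l1\<in>mGL Q \<alpha>'. \<Sum>l2\<in>mGL Q \<beta>'. H (mact Q l1 y1) (mact Q l2 y2) (wfam \<alpha>1 \<alpha>2 \<beta>1 \<beta>2)) =
      (\<Sum>l1\<in>mGL Q \<alpha>'. \<Sum>l2\<in>mGL Q \<beta>'.
        if mact Q l1 y1 \<in> mLow Q \<alpha>1 \<beta>1 \<and> mact Q l2 y2 \<in> mLow Q \<alpha>2 \<beta>2
        then q ^ adim Q \<alpha>1 \<beta>2 * S (mact Q l1 y1) (mact Q l2 y2) else 0)"
    proof (intro sum.cong refl)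
      fix l1 l2 :: "'v \<Rightarrow> 'k mat" assume "l1 \<in> mGL Q \<alpha>'" "l2 \<in> mGL Q \<beta>'"
      then have "mact Q l1 y1 \<in> mreps Q (\<alpha>1 + \<beta>1)" "mact Q l2 y2 \<in> mreps Q (\<alpha>2 + \<beta>2)"
        using mact_closed y unfolding e by blast+
      from sum_reblock_fibre[OF this, of "\<lambda>s t. f1 s * f2 t"]
      show "H (mact Q l1 y1) (mact Q l2 y2) (wfam \<alpha>1 \<alpha>2 \<beta>1 \<beta>2) =
        (if mact Q l1 y1 \<in> mLow Q \<alpha>1 \<beta>1 \<and> mact Q l2 y2 \<in> mLow Q \<alpha>2 \<beta>2
        then q ^ adim Q \<alpha>1 \<beta>2 * S (mact Q l1 y1) (mact Q l2 y2) else 0)"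
        unfolding H_def hsum_def e S_def q_def by simp
    qed
    also have "\<dots> = q ^ adim Q \<alpha>1 \<beta>2 * A"
      unfolding A_def sum_distrib_left
      by (simp add: sum.inter_filter finite_mGL if_distrib[of "sum _"] cong: if_cong)
        (intro sum.cong refl, auto)
    finally have main: "N * (\<Sum>g\<in>dcoset \<alpha>1 \<alpha>2 \<beta>1 \<beta>2. H y1 y2 g) = cP \<alpha> \<beta> * q ^ vdim Q \<alpha>' \<beta>' * (q ^ adim Q \<alpha>1 \<beta>2 * A)" .
    have rhs: "kmult Q \<alpha>1 \<beta>1 (\<lambda>u1 u2. kmult Q \<alpha>2 \<beta>2 (\<lambda>v1 v2.
         kcomult Q \<alpha>1 \<alpha>2 f1 u1 v1 * kcomult Q \<beta>1 \<beta>2 f2 u2 v2) y2) y1 =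
      inverse (cP \<alpha>1 \<beta>1) * inverse (cP \<alpha>2 \<beta>2) * inverse (q ^ vdim Q \<alpha>1 \<alpha>2) * inverse (q ^ vdim Q \<beta>1 \<beta>2) * A"
    proof -
      have "kcomult Q \<alpha>1 \<alpha>2 f1 (mTL Q \<alpha>1 u) (mTL Q \<alpha>2 v) * kcomult Q \<beta>1 \<beta>2 f2 (mBR Q \<alpha>1 \<beta>1 u) (mBR Q \<alpha>2 \<beta>2 v) =
        inverse (q ^ vdim Q \<alpha>1 \<alpha>2) * inverse (q ^ vdim Q \<beta>1 \<beta>2) * S u v" for u v
        unfolding kcomult_def S_def sum_product[symmetric] q_def by simp
      then show ?thesis
        unfolding kmult_def A_def e cP_def[symmetric] by (simp add: sum_distrib_left mult.assoc mult.left_commute)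
    qed
    have eu: "(of_nat CARD('k) :: 'c) powi (- euler_form Q \<alpha>1 \<beta>2) = q ^ adim Q \<alpha>1 \<beta>2 * inverse (q ^ vdim Q \<alpha>1 \<beta>2)"
    proof -
      have "- euler_form Q \<alpha>1 \<beta>2 = int (adim Q \<alpha>1 \<beta>2) - int (vdim Q \<alpha>1 \<beta>2)"
        by (simp add: euler_form_def adim_def vdim_def)
      then show ?thesis using q by (simp add: q_def[symmetric] power_int_diff divide_inverse)
    qed
    have "(\<Sum>g\<in>dcoset \<alpha>1 \<alpha>2 \<beta>1 \<beta>2. H y1 y2 g) = cP \<alpha> \<beta> * q ^ vdim Q \<alpha>' \<beta>' * (q ^ adim Q \<alpha>1 \<beta>2 * A) / N"
      using main N by (simp add: field_simps)
    then show "inverse (q ^ vdim Q \<alpha>' \<beta>') * inverse (cP \<alpha> \<beta>) * (\<Sum>g\<in>dcoset \<alpha>1 \<alpha>2 \<beta>1 \<beta>2. H y1 y2 g) =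
      of_nat CARD('k) powi (- euler_form Q \<alpha>1 \<beta>2) *
       kmult Q \<alpha>1 \<beta>1 (\<lambda>u1 u2. kmult Q \<alpha>2 \<beta>2 (\<lambda>v1 v2.
         kcomult Q \<alpha>1 \<alpha>2 f1 u1 v1 * kcomult Q \<beta>1 \<beta>2 f2 u2 v2) y2) y1"
      unfolding rhs eu using q cP by (simp add: N_def field_simps)
  qed
  finally show ?thesis .
qed

end

section \<open>The Frobenius map of the algebraic closure\<close>

text \<open>Multiplication by \<open>x \<noteq> 0\<close> permutes the nonzero elements; compare their products.\<close>

lemma finite_field_power_card:
  fixes x :: "'k :: {field, finite}"
  shows "x ^ CARD('k) = x"
proof (cases "x = 0")
  case False
  let ?U = "UNIV - {0 :: 'k}"
  have "bij_betw ((*) x) ?U ?U"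
    by (rule bij_betw_byWitness[where f' = "\<lambda>y. y / x"]) (use False in auto)
  then have "(\<Prod>y\<in>?U. y) = (\<Prod>y\<in>?U. x * y)" by (rule prod.reindex_bij_betw[symmetric])
  also have "\<dots> = x ^ card ?U * (\<Prod>y\<in>?U. y)" by (simp add: prod.distrib)
  finally have "x ^ card ?U = 1" by simp
  moreover have "CARD('k) = Suc (card ?U)" by (rule card.remove) simp_all
  ultimately show ?thesis by (simp only: power_Suc mult_1_right)
qed (simp add: zero_power)

lemma frob_to_ac [simp]: "frob (to_ac x) = to_ac (x :: 'k :: {field, finite})"
  by (simp add: frob_def finite_field_power_card flip: to_ac_power)

lemma poly_eq_if_degree_less:
  fixes p q :: "'a :: idom poly"
  assumes "finite A" "degree (p - q) < card A" "\<And>x. x \<in> A \<Longrightarrow> poly p x = poly q x"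
  shows "p = q"
proof (rule ccontr)
  assume "p \<noteq> q"
  then have "p - q \<noteq> 0" by simp
  then have "card A \<le> card {x. poly (p - q) x = 0}" using assms(3) by (intro card_mono poly_roots_finite) auto
  also have "\<dots> \<le> degree (p - q)" using card_poly_roots_bound[OF \<open>p - q \<noteq> 0\<close>] .
  finally show False using assms(2) by simp
qed

text \<open>The polynomial \<open>X^q - X\<close> has at most \<open>q\<close> roots, and the elements of the finite field are \<open>q\<close> of them.\<close>

lemma frob_eq_iff: "frob a = a \<longleftrightarrow> a \<in> range (to_ac :: 'k :: {field, finite} \<Rightarrow> _)"
proof
  assume a: "frob a = a"
  define p :: "'k alg_closure poly" where "p = monom 1 CARD('k) - monom 1 1"
  have q: "CARD('k) > 1" using card_mono[of UNIV "{0, 1 :: 'k}"] by simp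
  then have "coeff p CARD('k) \<noteq> 0" by (simp add: p_def)
  then have p: "p \<noteq> 0" by auto
  have "degree p \<le> CARD('k)" unfolding p_def
    using q by (intro degree_diff_le) (auto simp: degree_monom_eq)
  then have c: "card {x. poly p x = 0} \<le> CARD('k)" using card_poly_roots_bound[OF p] by linarith
  have "range (to_ac :: 'k \<Rightarrow> _) \<subseteq> {x. poly p x = 0}"
    using frob_to_ac by (auto simp: p_def poly_monom frob_def)
  moreover have "card (range (to_ac :: 'k \<Rightarrow> _)) = CARD('k)" by (rule card_image[OF inj_to_ac])
  ultimately have "range (to_ac :: 'k \<Rightarrow> _) = {x. poly p x = 0}"
    using c poly_roots_finite[OF p] by (intro card_seteq) auto
  then show "a \<in> range (to_ac :: 'k \<Rightarrow> _)" using a by (auto simp: p_def poly_monom frob_def)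
qed auto

text \<open>Additivity follows without reference to the characteristic: for \<open>y\<close> in the finite field, the polynomials
  \<open>(X + y)^q\<close> and \<open>X^q + y\<close> agree at the \<open>q\<close> points of the finite field, and their difference has degree less than \<open>q\<close>.
  So they are equal, and the same argument applies once more to \<open>(X + y)^q\<close> and \<open>X^q + y^q\<close> for arbitrary \<open>y\<close>.\<close>

lemma frob_add: "frob (x + y) = frob x + frob (y :: 'k :: {field, finite} alg_closure)"
proof -
  let ?q = "CARD('k)"
  have q: "?q > 0" by simp
  have dim: "degree ([:y, 1:] ^ ?q - (monom 1 ?q + [:c:])) < card (range (to_ac :: 'k \<Rightarrow> _))" for y c :: "'k alg_closure"
  proof -
    have d: "degree ([:y, 1:] ^ ?q) = ?q" by (simp add: degree_power_eq)
    then have "coeff ([:y, 1:] ^ ?q) ?q = 1" using lead_coeff_power[of "[:y, 1:]" ?q] by simp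
    moreover have "coeff [:c:] ?q = 0" using q by (cases ?q) auto
    ultimately have c0: "coeff ([:y, 1:] ^ ?q - (monom 1 ?q + [:c:])) ?q = 0" by simp
    have "degree ([:y, 1:] ^ ?q - (monom 1 ?q + [:c:])) \<le> ?q"
      using d by (intro degree_diff_le degree_add_le) (auto simp: degree_monom_eq)
    then have "degree ([:y, 1:] ^ ?q - (monom 1 ?q + [:c:])) < ?q"
      using c0 q by (metis leading_coeff_0_iff degree_0 le_neq_implies_less)
    then show ?thesis by (simp add: card_image[OF inj_to_ac])
  qed
  have P: "poly ([:y, 1:] ^ ?q) x = frob (x + y)" "poly (monom 1 ?q + [:c:]) x = frob x + c" for x y c :: "'k alg_closure"
    by (simp_all add: frob_def poly_monom add.commute)
  have 1: "frob (x + to_ac y) = frob x + to_ac y" for x and y :: 'k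
  proof -
    have "[:to_ac y, 1:] ^ ?q = monom 1 ?q + [:to_ac y:]"
    proof (rule poly_eq_if_degree_less[OF _ dim])
      fix x assume "x \<in> range (to_ac :: 'k \<Rightarrow> _)"
      then obtain z :: 'k where "x = to_ac z" by auto
      then show "poly ([:to_ac y, 1:] ^ ?q) x = poly (monom 1 ?q + [:to_ac y:]) x"
        unfolding P using frob_to_ac[of "z + y"] by simp
    qed simp
    from arg_cong[OF this, of "\<lambda>p. poly p x"] show ?thesis unfolding P .
  qed
  have "[:y, 1:] ^ ?q = monom 1 ?q + [:frob y:]"
  proof (rule poly_eq_if_degree_less[OF _ dim])
    fix x assume "x \<in> range (to_ac :: 'k \<Rightarrow> _)"
    then obtain z :: 'k where "x = to_ac z" by auto
    then show "poly ([:y, 1:] ^ ?q) x = poly (monom 1 ?q + [:frob y:]) x"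
      unfolding P using 1[of y z] by (simp add: add.commute)
  qed simp
  from arg_cong[OF this, of "\<lambda>p. poly p x"] show ?thesis unfolding P .
qed

lemma frob_mult: "frob (x * y) = frob x * frob y" by (simp add: frob_def power_mult_distrib)
lemma frob_0 [simp]: "frob 0 = 0" and frob_1 [simp]: "frob 1 = 1" by (simp_all add: frob_def)

lemma frob_eq_0_iff [simp]: "frob x = 0 \<longleftrightarrow> x = 0" by (simp add: frob_def)

lemma frob_inj: "frob x = frob y \<Longrightarrow> x = y"
  using frob_add[of "x - y" y] by simp

lemma frob_surj: "\<exists>y. frob y = (x :: 'k :: {field, finite} alg_closure)"
  using nth_root_exists[of "CARD('k)" x] by (auto simp: frob_def)

interpretation frob: semiring_hom "frob :: 'k :: {field, finite} alg_closure \<Rightarrow> _"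
  by unfold_locales (simp_all add: frob_add frob_mult)

interpretation to_ac: semiring_hom "to_ac :: 'k :: field \<Rightarrow> _"
  by unfold_locales simp_all

section \<open>Frobenius-fixed matrices\<close>

abbreviation Mac :: "'k :: field mat \<Rightarrow> 'k alg_closure mat" where "Mac \<equiv> map_mat to_ac"

lemma Mac_mult: "A \<in> carrier_mat m n \<Longrightarrow> B \<in> carrier_mat n r \<Longrightarrow> Mac (A * B) = Mac A * Mac B"
  by (rule to_ac.mat_hom_mult)

lemma Mac_inj: "Mac A = Mac B \<Longrightarrow> A = B"
  by (rule eq_matI) (auto simp: mat_eq_iff)

lemma map_frob_Mac [simp]: "map_mat frob (Mac A) = Mac (A :: 'k :: {field, finite} mat)"
  by (rule eq_matI) auto

lemma frob_fixed_mat: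
  assumes "M \<in> carrier_mat m n" "map_mat frob M = M"
  obtains A :: "'k :: {field, finite} mat" where "A \<in> carrier_mat m n" "M = Mac A"
proof
  show "map_mat of_ac M \<in> carrier_mat m n" using assms by auto
  show "M = Mac (map_mat of_ac M)"
  proof (rule eq_matI)
    fix i j assume "i < dim_row (Mac (map_mat of_ac M))" "j < dim_col (Mac (map_mat of_ac M))"
    then have ij: "i < dim_row M" "j < dim_col M" by auto
    then have "frob (M $$ (i, j)) = M $$ (i, j)" using assms(2) by (metis index_map_mat(1))
    then show "M $$ (i, j) = Mac (map_mat of_ac M) $$ (i, j)"
      using ij by (simp add: to_ac_of_ac frob_eq_iff)
  qed auto
qed

lemma det_Mac: "det (Mac A) = to_ac (det A)"
proof -
  interpret comm_ring_hom "to_ac :: 'a \<Rightarrow> _" by unfold_locales simp_all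
  show ?thesis by (rule hom_det)
qed

lemma Mac_GL: "Mac A \<in> GL n \<longleftrightarrow> A \<in> GL n" by (simp add: GL_def det_Mac)

lemma Mac_minv: "A \<in> GL n \<Longrightarrow> Mac (minv A) = minv (Mac A)"
proof (rule minv_unique[symmetric])
  assume A: "A \<in> GL n"
  show "Mac A \<in> carrier_mat n n" "Mac (minv A) \<in> carrier_mat n n" using GL_carrier[OF A] minv(1)[OF A] by auto
  have "Mac A * Mac (minv A) = Mac (A * minv A)"
    using GL_carrier[OF A] minv(1)[OF A] by (simp add: Mac_mult)
  then show "Mac A * Mac (minv A) = 1\<^sub>m n" by (simp add: minv(2)[OF A] to_ac.mat_hom_one)
qed

lemma Mac_blk: "i + r \<le> dim_row M \<Longrightarrow> j + c \<le> dim_col M \<Longrightarrow> blk i j r c (Mac M) = Mac (blk i j r c M)"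
  by (rule eq_matI) auto

lemma Mac_Low: "M \<in> carrier_mat (r1 + r2) (c1 + c2) \<Longrightarrow> Mac M \<in> Low r1 r2 c1 c2 \<longleftrightarrow> M \<in> Low r1 r2 c1 c2"
  by (auto simp: Low_def Mac_blk mat_eq_iff)

section \<open>Splitting vectors in two parts\<close>

lemma vec_first_append [simp]: "u \<in> carrier_vec a \<Longrightarrow> vec_first (u @\<^sub>v t) a = u"
  by (rule eq_vecI) (auto simp: vec_first_def)

lemma vec_last_append [simp]: "u \<in> carrier_vec a \<Longrightarrow> t \<in> carrier_vec b \<Longrightarrow> vec_last (u @\<^sub>v t) b = t"
  by (rule eq_vecI) (auto simp: vec_last_def)

lemma vec_first_add: "v \<in> carrier_vec n \<Longrightarrow> w \<in> carrier_vec n \<Longrightarrow> a \<le> n \<Longrightarrow> vec_first (v + w) a = vec_first v a + vec_first w a"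
  by (rule eq_vecI) (auto simp: vec_first_def)

lemma vec_first_smult: "v \<in> carrier_vec n \<Longrightarrow> a \<le> n \<Longrightarrow> vec_first (c \<cdot>\<^sub>v v) a = c \<cdot>\<^sub>v vec_first v a"
  by (rule eq_vecI) (auto simp: vec_first_def)

lemma vec_last_add: "v \<in> carrier_vec n \<Longrightarrow> w \<in> carrier_vec n \<Longrightarrow> b \<le> n \<Longrightarrow> vec_last (v + w) b = vec_last v b + vec_last w b"
  by (rule eq_vecI) (auto simp: vec_last_def)

lemma vec_last_smult: "v \<in> carrier_vec n \<Longrightarrow> b \<le> n \<Longrightarrow> vec_last (c \<cdot>\<^sub>v v) b = c \<cdot>\<^sub>v vec_last v b"
  by (rule eq_vecI) (auto simp: vec_last_def)

lemma mult_append_vec: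
  fixes M :: "'a :: comm_ring_1 mat"
  assumes M: "M \<in> carrier_mat (a + b) (c + d)" and u: "u \<in> carrier_vec c" and t: "t \<in> carrier_vec d"
  shows "vec_first (M *\<^sub>v (u @\<^sub>v t)) a = TL a c M *\<^sub>v u + blk 0 c a d M *\<^sub>v t"
    "vec_last (M *\<^sub>v (u @\<^sub>v t)) b = blk a 0 b c M *\<^sub>v u + BR a b c d M *\<^sub>v t"
proof -
  have r: "row M i = row (blk j 0 k c M) (i - j) @\<^sub>v row (blk j c k d M) (i - j)" if "j \<le> i" "i < j + k" "j + k \<le> a + b" for i j k
    using that M by (intro eq_vecI) auto
  show "vec_first (M *\<^sub>v (u @\<^sub>v t)) a = TL a c M *\<^sub>v u + blk 0 c a d M *\<^sub>v t"
  proof (rule eq_vecI)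
    fix i assume "i < dim_vec (TL a c M *\<^sub>v u + blk 0 c a d M *\<^sub>v t)"
    then have i: "i < a" by simp
    have "(M *\<^sub>v (u @\<^sub>v t)) $ i = row M i \<bullet> (u @\<^sub>v t)" using i M by simp
    also have "\<dots> = row (blk 0 0 a c M) i \<bullet> u + row (blk 0 c a d M) i \<bullet> t"
      using r[of 0 i a] i u t by (simp add: scalar_prod_append[of _ c _ d])
    finally show "vec_first (M *\<^sub>v (u @\<^sub>v t)) a $ i = (TL a c M *\<^sub>v u + blk 0 c a d M *\<^sub>v t) $ i"
      using i by (simp add: vec_first_def)
  qed simp
  show "vec_last (M *\<^sub>v (u @\<^sub>v t)) b = blk a 0 b c M *\<^sub>v u + BR a b c d M *\<^sub>v t"
  proof (rule eq_vecI)
    fix i assume "i < dim_vec (blk a 0 b c M *\<^sub>v u + BR a b c d M *\<^sub>v t)"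
    then have i: "i < b" by simp
    have "(M *\<^sub>v (u @\<^sub>v t)) $ (a + i) = row M (a + i) \<bullet> (u @\<^sub>v t)" using i M by simp
    also have "\<dots> = row (blk a 0 b c M) i \<bullet> u + row (blk a c b d M) i \<bullet> t"
      using r[of a "a + i" b] i u t by (simp add: scalar_prod_append[of _ c _ d])
    finally show "vec_last (M *\<^sub>v (u @\<^sub>v t)) b $ i = (blk a 0 b c M *\<^sub>v u + BR a b c d M *\<^sub>v t) $ i"
      using i M by (simp add: vec_last_def)
  qed simp
qed

lemma mult_unit_vec:
  fixes M :: "'a :: comm_ring_1 mat"
  shows "M \<in> carrier_mat m n \<Longrightarrow> i < m \<Longrightarrow> j < n \<Longrightarrow> (M *\<^sub>v unit_vec n j) $ i = M $$ (i, j)"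
  by simp

lemma mat_of_map_mult:
  fixes M :: "'a :: field mat"
  assumes "M \<in> carrier_mat m n" "\<And>j. j < n \<Longrightarrow> \<phi> (unit_vec n j) = M *\<^sub>v unit_vec n j"
  shows "mat_of_map n m \<phi> = M"
  using assms by (intro eq_matI) (auto simp: mat_of_map_def simp del: index_mult_mat_vec mult_mat_vec_def simp: mult_unit_vec)

text \<open>Induction over the truncations \<open>tr k\<close> of \<open>v\<close> to its first \<open>k\<close> entries.\<close>

lemma linear_mat_of_map:
  fixes \<phi> :: "'a :: field vec \<Rightarrow> 'a vec"
  assumes cl: "\<And>v. v \<in> carrier_vec n \<Longrightarrow> \<phi> v \<in> carrier_vec m"
    and add: "\<And>v w. v \<in> carrier_vec n \<Longrightarrow> w \<in> carrier_vec n \<Longrightarrow> \<phi> (v + w) = \<phi> v + \<phi> w"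
    and sm: "\<And>c v. v \<in> carrier_vec n \<Longrightarrow> \<phi> (c \<cdot>\<^sub>v v) = c \<cdot>\<^sub>v \<phi> v"
    and v: "v \<in> carrier_vec n"
  shows "\<phi> v = mat_of_map n m \<phi> *\<^sub>v v"
proof -
  define M where "M = mat_of_map n m \<phi>"
  have M: "M \<in> carrier_mat m n" by (simp add: M_def mat_of_map_def)
  have u: "\<phi> (unit_vec n j) = M *\<^sub>v unit_vec n j" if "j < n" for j
    using that cl[of "unit_vec n j"] by (intro eq_vecI) (auto simp: M_def mat_of_map_def)
  define tr where "tr k = vec n (\<lambda>i. if i < k then v $ i else 0)" for k
  have tr: "tr k \<in> carrier_vec n" for k by (simp add: tr_def)
  have "\<phi> (tr k) = M *\<^sub>v tr k" if "k \<le> n" for k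
    using that
  proof (induction k)
    case 0
    have t0: "tr 0 = 0 \<cdot>\<^sub>v tr 0" by (rule eq_vecI) (auto simp: tr_def)
    have "\<phi> (tr 0) = 0 \<cdot>\<^sub>v \<phi> (tr 0)" by (subst t0) (rule sm[OF tr])
    also have "\<dots> = 0 \<cdot>\<^sub>v (M *\<^sub>v tr 0)" using carrier_vecD[OF cl[OF tr]] M by (intro eq_vecI) auto
    also have "\<dots> = M *\<^sub>v tr 0" by (subst t0) (simp add: mult_mat_vec[OF M tr])
    finally show ?case .
  next
    case (Suc k)
    have t: "tr (Suc k) = tr k + v $ k \<cdot>\<^sub>v unit_vec n k" by (rule eq_vecI) (auto simp: tr_def less_Suc_eq unit_vec_def)
    have "\<phi> (tr (Suc k)) = M *\<^sub>v tr k + v $ k \<cdot>\<^sub>v (M *\<^sub>v unit_vec n k)"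
      using Suc u[of k] by (simp add: t add sm tr)
    also have "\<dots> = M *\<^sub>v tr (Suc k)"
      unfolding t using tr M by (simp add: mult_add_distrib_mat_vec mult_mat_vec)
    finally show ?case .
  qed
  from this[of n] have "\<phi> (tr n) = M *\<^sub>v tr n" by simp
  moreover have "tr n = v" using v by (intro eq_vecI) (auto simp: tr_def)
  ultimately show ?thesis by (simp add: M_def)
qed

section \<open>The subspace, quotient and isomorphisms given by an invertible matrix\<close>

lemma kvec_simps [simp]: "add (kvec n) = (+)" "zero (kvec n) = 0\<^sub>v n" "carrier (kvec n) = carrier_vec n" "module.smult (kvec n) = (\<cdot>\<^sub>v)"
  by (simp_all add: module_vec_simps)

lemma coset_kvec: "W +>\<^bsub>kvec n\<^esub> v = (\<lambda>w. w + v) ` W"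
  by (auto simp: a_r_coset_def')

lemma quot_module_kvec:
  "carrier (quot_module (kvec n) W) = (\<lambda>v. W +>\<^bsub>kvec n\<^esub> v) ` carrier_vec n"
  "add (quot_module (kvec n) W) A B = (\<Union>a\<in>A. \<Union>b\<in>B. {a + b})"
  "module.smult (quot_module (kvec n) W) c A = (\<Union>a\<in>A. W +>\<^bsub>kvec n\<^esub> (c \<cdot>\<^sub>v a))"
  by (auto simp: quot_module_def A_RCOSETS_def' set_add_def')

text \<open>The rows of \<open>G\<close> are coordinates. The subspace is the kernel of the first \<open>a\<close> of them, its cosets are the fibres of these, the
  first \<open>a\<close> coordinates identify the quotient with \<open>K ^ a\<close>, and the last \<open>b\<close> identify the subspace with \<open>K ^ b\<close>.\<close>

definition Wfib :: "nat \<Rightarrow> nat \<Rightarrow> 'a :: field mat \<Rightarrow> 'a vec \<Rightarrow> 'a vec set" where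
  "Wfib a b G z = {v \<in> carrier_vec (a + b). vec_first (G *\<^sub>v v) a = z}"

abbreviation Wg :: "nat \<Rightarrow> nat \<Rightarrow> 'a :: field mat \<Rightarrow> 'a vec set" where
  "Wg a b G \<equiv> Wfib a b G (0\<^sub>v a)"

definition rho1 :: "nat \<Rightarrow> nat \<Rightarrow> 'a :: field mat \<Rightarrow> 'a vec set \<Rightarrow> 'a vec" where
  "rho1 a b G = (\<lambda>A\<in>carrier (quot_module (kvec (a + b)) (Wg a b G)). the_elem ((\<lambda>v. vec_first (G *\<^sub>v v) a) ` A))"

definition rho2 :: "nat \<Rightarrow> nat \<Rightarrow> 'a :: field mat \<Rightarrow> 'a vec \<Rightarrow> 'a vec" where
  "rho2 a b G = (\<lambda>w\<in>Wg a b G. vec_last (G *\<^sub>v w) b)"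

locale GLdata =
  fixes a b :: nat and G :: "'a :: field mat"
  assumes G: "G \<in> GL (a + b)"
begin

lemma Gc: "G \<in> carrier_mat (a + b) (a + b)" using G by (rule GL_carrier)
lemma Gi: "minv G \<in> carrier_mat (a + b) (a + b)" using minv(1)[OF G] .

definition lift :: "'a vec \<Rightarrow> 'a vec \<Rightarrow> 'a vec" where "lift u t = minv G *\<^sub>v (u @\<^sub>v t)"

lemma lift:
  assumes "u \<in> carrier_vec a" "t \<in> carrier_vec b"
  shows "lift u t \<in> carrier_vec (a + b)" "G *\<^sub>v lift u t = u @\<^sub>v t"
    "vec_first (G *\<^sub>v lift u t) a = u" "vec_last (G *\<^sub>v lift u t) b = t"
proof -
  have c: "u @\<^sub>v t \<in> carrier_vec (a + b)" using assms by simp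
  show "lift u t \<in> carrier_vec (a + b)" unfolding lift_def using Gi c by (rule mult_mat_vec_carrier)
  show *: "G *\<^sub>v lift u t = u @\<^sub>v t"
    unfolding lift_def using assoc_mult_mat_vec[OF Gc Gi c] minv(2)[OF G] c by simp
  show "vec_first (G *\<^sub>v lift u t) a = u" "vec_last (G *\<^sub>v lift u t) b = t"
    unfolding * using assms by simp_all
qed

lemma G_inj:
  assumes v: "v \<in> carrier_vec (a + b)" and w: "w \<in> carrier_vec (a + b)"
    and "vec_first (G *\<^sub>v v) a = vec_first (G *\<^sub>v w) a" "vec_last (G *\<^sub>v v) b = vec_last (G *\<^sub>v w) b"
  shows "v = w"
proof -
  have "G *\<^sub>v v = G *\<^sub>v w"
    using vec_first_last_append[OF mult_mat_vec_carrier[OF Gc v]] vec_first_last_append[OF mult_mat_vec_carrier[OF Gc w]]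
    unfolding assms(3,4) by (rule trans[OF sym])
  then have "minv G *\<^sub>v (G *\<^sub>v v) = minv G *\<^sub>v (G *\<^sub>v w)" by simp
  then show ?thesis
    using assoc_mult_mat_vec[OF Gi Gc v] assoc_mult_mat_vec[OF Gi Gc w] minv(3)[OF G] v w by simp
qed

lemma first_add: "v \<in> carrier_vec (a + b) \<Longrightarrow> w \<in> carrier_vec (a + b) \<Longrightarrow>
    vec_first (G *\<^sub>v (v + w)) a = vec_first (G *\<^sub>v v) a + vec_first (G *\<^sub>v w) a"
  and last_add: "v \<in> carrier_vec (a + b) \<Longrightarrow> w \<in> carrier_vec (a + b) \<Longrightarrow>
    vec_last (G *\<^sub>v (v + w)) b = vec_last (G *\<^sub>v v) b + vec_last (G *\<^sub>v w) b"
  using Gc by (simp_all add: mult_add_distrib_mat_vec[of _ "a + b" "a + b"] vec_first_add[of _ "a + b"] vec_last_add[of _ "a + b"])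

lemma first_smult: "v \<in> carrier_vec (a + b) \<Longrightarrow> vec_first (G *\<^sub>v (c \<cdot>\<^sub>v v)) a = c \<cdot>\<^sub>v vec_first (G *\<^sub>v v) a"
  and last_smult: "v \<in> carrier_vec (a + b) \<Longrightarrow> vec_last (G *\<^sub>v (c \<cdot>\<^sub>v v)) b = c \<cdot>\<^sub>v vec_last (G *\<^sub>v v) b"
  using Gc by (simp_all add: mult_mat_vec[of _ "a + b" "a + b"] vec_first_smult[of _ "a + b"] vec_last_smult[of _ "a + b"])

lemma coset_Wg: "v \<in> carrier_vec (a + b) \<Longrightarrow> Wg a b G +>\<^bsub>kvec (a + b)\<^esub> v = Wfib a b G (vec_first (G *\<^sub>v v) a)"
proof
  assume v: "v \<in> carrier_vec (a + b)"
  show "Wg a b G +>\<^bsub>kvec (a + b)\<^esub> v \<subseteq> Wfib a b G (vec_first (G *\<^sub>v v) a)"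
    using v by (auto simp: coset_kvec Wfib_def first_add)
  show "Wfib a b G (vec_first (G *\<^sub>v v) a) \<subseteq> Wg a b G +>\<^bsub>kvec (a + b)\<^esub> v"
  proof
    fix u assume "u \<in> Wfib a b G (vec_first (G *\<^sub>v v) a)"
    then have u: "u \<in> carrier_vec (a + b)" "vec_first (G *\<^sub>v u) a = vec_first (G *\<^sub>v v) a" by (auto simp: Wfib_def)
    have "vec_first (G *\<^sub>v (u + (-1) \<cdot>\<^sub>v v)) a = 0\<^sub>v a"
      using u v by (simp add: first_add first_smult) (auto intro!: eq_vecI simp: vec_first_def)
    then have "u + (-1) \<cdot>\<^sub>v v \<in> Wg a b G" using u v by (simp add: Wfib_def)
    moreover have "u = (u + (-1) \<cdot>\<^sub>v v) + v" using u v by (intro eq_vecI) auto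
    ultimately show "u \<in> Wg a b G +>\<^bsub>kvec (a + b)\<^esub> v" unfolding coset_kvec by blast
  qed
qed

lemma quot_carrier: "carrier (quot_module (kvec (a + b)) (Wg a b G)) = Wfib a b G ` carrier_vec a"
proof -
  have "carrier (quot_module (kvec (a + b)) (Wg a b G)) = (\<lambda>v. Wfib a b G (vec_first (G *\<^sub>v v) a)) ` carrier_vec (a + b)"
    unfolding quot_module_kvec by (intro image_cong refl coset_Wg)
  also have "\<dots> = Wfib a b G ` (\<lambda>v. vec_first (G *\<^sub>v v) a) ` carrier_vec (a + b)" by (simp add: image_image)
  also have "(\<lambda>v. vec_first (G *\<^sub>v v) a) ` carrier_vec (a + b) = carrier_vec a"
  proof
    show "carrier_vec a \<subseteq> (\<lambda>v. vec_first (G *\<^sub>v v) a) ` carrier_vec (a + b)"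
    proof
      fix u :: "'a vec" assume u: "u \<in> carrier_vec a"
      then show "u \<in> (\<lambda>v. vec_first (G *\<^sub>v v) a) ` carrier_vec (a + b)"
        using lift(1,3)[OF u zero_carrier_vec[of b]] by (metis imageI)
    qed
  qed auto
  finally show ?thesis .
qed

lemma Wfib_nonempty: "z \<in> carrier_vec a \<Longrightarrow> Wfib a b G z \<noteq> {}"
  using lift(1,3)[of z "0\<^sub>v b"] by (auto simp: Wfib_def)

lemma rho1_Wfib: "z \<in> carrier_vec a \<Longrightarrow> rho1 a b G (Wfib a b G z) = z"
proof -
  assume z: "z \<in> carrier_vec a"
  have "(\<lambda>v. vec_first (G *\<^sub>v v) a) ` Wfib a b G z = {z}"
    using Wfib_nonempty[OF z] by (auto simp: Wfib_def)
  then show ?thesis using z by (simp add: rho1_def quot_carrier)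
qed

lemma quot_add: "z \<in> carrier_vec a \<Longrightarrow> z' \<in> carrier_vec a \<Longrightarrow>
  add (quot_module (kvec (a + b)) (Wg a b G)) (Wfib a b G z) (Wfib a b G z') = Wfib a b G (z + z')"
proof -
  assume z: "z \<in> carrier_vec a" "z' \<in> carrier_vec a"
  have "Wfib a b G (z + z') \<subseteq> (\<Union>u\<in>Wfib a b G z. \<Union>v\<in>Wfib a b G z'. {u + v})"
  proof
    fix u assume "u \<in> Wfib a b G (z + z')"
    then have u: "u \<in> carrier_vec (a + b)" "vec_first (G *\<^sub>v u) a = z + z'" by (auto simp: Wfib_def)
    obtain v where v: "v \<in> Wfib a b G z'" using Wfib_nonempty z by blast
    then have v': "v \<in> carrier_vec (a + b)" "vec_first (G *\<^sub>v v) a = z'" by (auto simp: Wfib_def)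
    have "vec_first (G *\<^sub>v (u + (-1) \<cdot>\<^sub>v v)) a = z"
      using u v' z by (simp add: first_add first_smult) (auto intro!: eq_vecI)
    then have "u + (-1) \<cdot>\<^sub>v v \<in> Wfib a b G z" using u v' by (simp add: Wfib_def)
    moreover have "u = (u + (-1) \<cdot>\<^sub>v v) + v" using u v' by (intro eq_vecI) auto
    ultimately show "u \<in> (\<Union>u\<in>Wfib a b G z. \<Union>v\<in>Wfib a b G z'. {u + v})" using v by blast
  qed
  then show ?thesis unfolding quot_module_kvec by (auto simp: Wfib_def first_add)
qed

lemma quot_smult: "z \<in> carrier_vec a \<Longrightarrow>
  module.smult (quot_module (kvec (a + b)) (Wg a b G)) c (Wfib a b G z) = Wfib a b G (c \<cdot>\<^sub>v z)"
proof -
  assume z: "z \<in> carrier_vec a"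
  have "Wg a b G +>\<^bsub>kvec (a + b)\<^esub> (c \<cdot>\<^sub>v v) = Wfib a b G (c \<cdot>\<^sub>v z)" if "v \<in> Wfib a b G z" for v
    using that by (subst coset_Wg) (auto simp: Wfib_def first_smult)
  then show ?thesis unfolding quot_module_kvec using Wfib_nonempty[OF z] by auto
qed

lemma rho1_iso: "rho1 a b G \<in> lin_isos (quot_module (kvec (a + b)) (Wg a b G)) (kvec a)"
proof -
  let ?V = "quot_module (kvec (a + b)) (Wg a b G)"
  have "bij_betw (rho1 a b G) (carrier ?V) (carrier_vec a)"
    by (rule bij_betw_byWitness[where f' = "Wfib a b G"]) (auto simp: quot_carrier rho1_Wfib)
  moreover have "rho1 a b G \<in> module_hom class_ring ?V (kvec a)"
    unfolding module_hom_def by (auto simp: quot_carrier rho1_Wfib quot_add quot_smult)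
  ultimately show ?thesis by (auto simp: lin_isos_def rho1_def)
qed

lemma rho2_lift: "t \<in> carrier_vec b \<Longrightarrow> lift (0\<^sub>v a) t \<in> Wg a b G" "t \<in> carrier_vec b \<Longrightarrow> rho2 a b G (lift (0\<^sub>v a) t) = t"
  using lift[of "0\<^sub>v a" t] by (auto simp: rho2_def Wfib_def)

lemma rho2_closed: "w \<in> Wg a b G \<Longrightarrow> rho2 a b G w \<in> carrier_vec b"
  by (simp add: rho2_def)

lemma lift_rho2:
  assumes w: "w \<in> Wg a b G"
  shows "lift (0\<^sub>v a) (rho2 a b G w) = w"
proof (rule G_inj)
  note l = lift[OF zero_carrier_vec rho2_closed[OF w]]
  show "lift (0\<^sub>v a) (rho2 a b G w) \<in> carrier_vec (a + b)" by (rule l)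
  show "w \<in> carrier_vec (a + b)" using w by (simp add: Wfib_def)
  show "vec_first (G *\<^sub>v lift (0\<^sub>v a) (rho2 a b G w)) a = vec_first (G *\<^sub>v w) a"
    unfolding l(3) using w by (simp add: Wfib_def)
  show "vec_last (G *\<^sub>v lift (0\<^sub>v a) (rho2 a b G w)) b = vec_last (G *\<^sub>v w) b"
    unfolding l(4) using w by (simp add: rho2_def)
qed

lemma Wg_subspace: "VectorSpace.subspace class_ring (Wg a b G) (kvec (a + b))"
proof -
  have "vec_first (G *\<^sub>v 0\<^sub>v (a + b)) a = 0\<^sub>v a" using Gc by (intro eq_vecI) (auto simp: vec_first_def scalar_prod_def)
  then show ?thesis unfolding subspace_def submodule_def
    using vec_vs vec_module by (auto simp: Wfib_def first_add first_smult class_field_def)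
qed

lemma rho2_bij: "bij_betw (rho2 a b G) (Wg a b G) (carrier_vec b)"
  by (rule bij_betw_byWitness[where f' = "lift (0\<^sub>v a)"]) (auto simp: rho2_lift lift_rho2 rho2_closed)

lemma rho2_iso: "rho2 a b G \<in> lin_isos ((kvec (a + b))\<lparr>carrier := Wg a b G\<rparr>) (kvec b)"
proof -
  have "rho2 a b G \<in> module_hom class_ring ((kvec (a + b))\<lparr>carrier := Wg a b G\<rparr>) (kvec b)"
    unfolding module_hom_def by (auto simp: rho2_def Wfib_def first_add first_smult last_add last_smult)
  then show ?thesis using rho2_bij by (auto simp: lin_isos_def rho2_def)
qed

text \<open>The map \<open>lift (0\<^sub>v a)\<close> is a linear bijection from \<open>K ^ b\<close>.\<close>

lemma Wg_dim: "vectorspace.dim class_ring ((kvec (a + b))\<lparr>carrier := Wg a b G\<rparr>) = b"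
proof -
  interpret V: vec_space "TYPE('a)" b .
  let ?W = "(kvec (a + b))\<lparr>carrier := Wg a b G\<rparr>"
  have W: "vectorspace class_ring ?W" by (rule vectorspace.subspace_is_vs[OF vec_vs Wg_subspace])
  interpret L: linear_map class_ring "kvec b" ?W "lift (0\<^sub>v a)"
  proof (unfold linear_map_def mod_hom_def mod_hom_axioms_def, intro conjI)
    show "lift (0\<^sub>v a) \<in> module_hom class_ring (kvec b) ?W"
    proof -
      have "0\<^sub>v a @\<^sub>v (t + t') = (0\<^sub>v a @\<^sub>v t) + (0\<^sub>v a @\<^sub>v (t' :: 'a vec))" if "t \<in> carrier_vec b" "t' \<in> carrier_vec b" for t t'
        using that by (intro eq_vecI) auto
      moreover have "0\<^sub>v a @\<^sub>v (c \<cdot>\<^sub>v t) = c \<cdot>\<^sub>v (0\<^sub>v a @\<^sub>v (t :: 'a vec))" if "t \<in> carrier_vec b" for t c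
        using that by (intro eq_vecI) auto
      ultimately show ?thesis using Gi unfolding module_hom_def
        by (auto simp: rho2_lift(1)[unfolded lift_def] lift_def mult_add_distrib_mat_vec[of _ "a + b" "a + b"] mult_mat_vec[of _ "a + b" "a + b"])
    qed
  qed (use W vec_vs vectorspace_def in auto)
  have "V.dim = vectorspace.dim class_ring ?W"
  proof (rule L.dim_eq)
    show "V.fin_dim" by (rule V.fin_dim)
    show "inj_on (lift (0\<^sub>v a)) (carrier (kvec b))" by (rule inj_on_inverseI[of _ "rho2 a b G"]) (simp add: rho2_lift)
    show "lift (0\<^sub>v a) ` carrier (kvec b) = carrier ?W"
      using rho2_lift(1) lift_rho2 rho2_bij by (auto simp: bij_betw_def image_iff) (metis imageI)
  qed
  then show ?thesis using V.dim_is_n by simp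
qed

end

lemma mat_eqI_mult_vec:
  fixes A B :: "'a :: comm_ring_1 mat"
  assumes "A \<in> carrier_mat m n" "B \<in> carrier_mat m n" "\<And>v. v \<in> carrier_vec n \<Longrightarrow> A *\<^sub>v v = B *\<^sub>v v"
  shows "A = B"
proof (rule eq_matI)
  fix i j assume "i < dim_row B" "j < dim_col B"
  then have ij: "i < m" "j < n" using assms by auto
  have "(A *\<^sub>v unit_vec n j) $ i = (B *\<^sub>v unit_vec n j) $ i" using assms(3)[of "unit_vec n j"] by simp
  then show "A $$ (i, j) = B $$ (i, j)" using ij assms(1,2) mult_unit_vec by metis
qed (use assms in auto)

section \<open>Frobenius on vectors\<close>

lemma map_frob_Mac_vec:
  "A \<in> carrier_mat m n \<Longrightarrow> v \<in> carrier_vec n \<Longrightarrow> map_vec frob (Mac (A :: 'k :: {field, finite} mat) *\<^sub>v v) = Mac A *\<^sub>v map_vec frob v"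
  using frob.mult_mat_vec_hom[of "Mac A" m n v] by simp

lemma vec_first_map: "a \<le> dim_vec v \<Longrightarrow> vec_first (map_vec f v) a = map_vec f (vec_first v a)"
  by (rule eq_vecI) (auto simp: vec_first_def)

lemma vec_last_map: "b \<le> dim_vec v \<Longrightarrow> vec_last (map_vec f v) b = map_vec f (vec_last v b)"
  by (rule eq_vecI) (auto simp: vec_last_def)

lemma map_frob_inj: "map_vec frob v = map_vec frob (w :: 'k :: {field, finite} alg_closure vec) \<Longrightarrow> v = w"
proof (rule eq_vecI)
  assume e: "map_vec frob v = map_vec frob w"
  show d: "dim_vec v = dim_vec w" using arg_cong[OF e, of dim_vec] by simp
  fix i assume "i < dim_vec w"
  then have "frob (v $ i) = frob (w $ i)" using arg_cong[OF e, of "\<lambda>x. vec_index x i"] d by simp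
  then show "v $ i = w $ i" by (rule frob_inj)
qed

lemma map_frob_surj:
  assumes "u \<in> carrier_vec n"
  obtains v :: "'k :: {field, finite} alg_closure vec" where "v \<in> carrier_vec n" "u = map_vec frob v"
proof
  let ?v = "vec n (\<lambda>i. SOME y. frob y = (u :: 'k alg_closure vec) $ i)"
  show "?v \<in> carrier_vec n" by simp
  have "frob (SOME y. frob y = u $ i) = u $ i" for i using someI_ex[OF frob_surj] .
  then show "u = map_vec frob ?v" using assms by (intro eq_vecI) auto
qed

lemma map_frob_add: "v \<in> carrier_vec n \<Longrightarrow> w \<in> carrier_vec n \<Longrightarrow> map_vec frob (v + w) = map_vec frob v + map_vec frob (w :: 'k :: {field, finite} alg_closure vec)"
  by (rule eq_vecI) (auto simp: frob_add)

lemma map_frob_Wfib: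
  fixes g :: "'k :: {field, finite} mat"
  assumes g: "g \<in> carrier_mat (a + b) (a + b)" and z: "z \<in> carrier_vec a"
  shows "map_vec frob ` Wfib a b (Mac g) z = Wfib a b (Mac g) (map_vec frob z)"
proof -
  have *: "vec_first (Mac g *\<^sub>v map_vec frob v) a = map_vec frob (vec_first (Mac g *\<^sub>v v) a)" if "v \<in> carrier_vec (a + b)" for v
    using g that by (subst map_frob_Mac_vec[symmetric, OF g]) (auto simp: vec_first_map)
  show ?thesis
  proof (intro subset_antisym subsetI)
    fix u assume "u \<in> map_vec frob ` Wfib a b (Mac g) z"
    then show "u \<in> Wfib a b (Mac g) (map_vec frob z)" by (auto simp: Wfib_def *)
  next
    fix u assume u: "u \<in> Wfib a b (Mac g) (map_vec frob z)"
    then obtain v where v: "v \<in> carrier_vec (a + b)" "u = map_vec frob v" using map_frob_surj[of u "a + b"] by (auto simp: Wfib_def)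
    then have "map_vec frob (vec_first (Mac g *\<^sub>v v) a) = map_vec frob z" using u by (simp add: Wfib_def *)
    then show "u \<in> map_vec frob ` Wfib a b (Mac g) z" using v by (auto simp: Wfib_def dest: map_frob_inj)
  qed
qed

section \<open>Frobenius-fixed data at one vertex\<close>

text \<open>The triples of a subspace and two isomorphisms that occur, vertex by vertex, in a point of \<open>E1_F\<close>.\<close>

definition locdata :: "nat \<Rightarrow> nat \<Rightarrow> ('k :: {field, finite} alg_closure vec set \<times> ('k alg_closure vec set \<Rightarrow> 'k alg_closure vec) \<times> ('k alg_closure vec \<Rightarrow> 'k alg_closure vec)) set" where
  "locdata a b = {(W, \<rho>1, \<rho>2). VectorSpace.subspace class_ring W (kvec (a + b)) \<and>
     vectorspace.dim class_ring ((kvec (a + b))\<lparr>carrier := W\<rparr>) = b \<and>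
     \<rho>1 \<in> lin_isos (quot_module (kvec (a + b)) W) (kvec a) \<and>
     \<rho>2 \<in> lin_isos ((kvec (a + b))\<lparr>carrier := W\<rparr>) (kvec b) \<and> map_vec frob ` W = W \<and>
     (\<forall>A\<in>carrier (quot_module (kvec (a + b)) W). \<rho>1 (map_vec frob ` A) = map_vec frob (\<rho>1 A)) \<and>
     (\<forall>w\<in>W. \<rho>2 (map_vec frob w) = map_vec frob (\<rho>2 w))}"

definition Psi :: "nat \<Rightarrow> nat \<Rightarrow> 'k :: {field, finite} mat \<Rightarrow>
    'k alg_closure vec set \<times> ('k alg_closure vec set \<Rightarrow> 'k alg_closure vec) \<times> ('k alg_closure vec \<Rightarrow> 'k alg_closure vec)" where
  "Psi a b g = (Wg a b (Mac g), rho1 a b (Mac g), rho2 a b (Mac g))"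

lemma Psi_locdata:
  fixes g :: "'k :: {field, finite} mat"
  assumes g: "g \<in> GL (a + b)"
  shows "Psi a b g \<in> locdata a b"
proof -
  interpret D: GLdata a b "Mac g" by unfold_locales (simp add: Mac_GL g)
  note gc = GL_carrier[OF g]
  have W: "map_vec frob ` Wg a b (Mac g) = Wg a b (Mac g)"
    using map_frob_Wfib[OF gc zero_carrier_vec] by (simp add: frob.vec_hom_zero)
  have r1: "rho1 a b (Mac g) (map_vec frob ` A) = map_vec frob (rho1 a b (Mac g) A)"
    if A: "A \<in> carrier (quot_module (kvec (a + b)) (Wg a b (Mac g)))" for A
  proof -
    obtain z where z: "z \<in> carrier_vec a" "A = Wfib a b (Mac g) z" using A unfolding D.quot_carrier by blast
    then show ?thesis using map_frob_Wfib[OF gc z(1)] by (simp add: D.rho1_Wfib)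
  qed
  have r2: "rho2 a b (Mac g) (map_vec frob w) = map_vec frob (rho2 a b (Mac g) w)" if w: "w \<in> Wg a b (Mac g)" for w
  proof -
    have "map_vec frob w \<in> Wg a b (Mac g)" using W w by blast
    moreover have "Mac g *\<^sub>v map_vec frob w = map_vec frob (Mac g *\<^sub>v w)"
      using w by (intro map_frob_Mac_vec[symmetric, OF gc]) (simp add: Wfib_def)
    ultimately show ?thesis using w gc by (simp add: rho2_def vec_last_map)
  qed
  show ?thesis
    unfolding locdata_def Psi_def using D.Wg_subspace D.Wg_dim D.rho1_iso D.rho2_iso W r1 r2 by simp
qed

text \<open>A matrix over the small field that is surjective over the closure has full rank, since its rank normal form over the small
  field remains one over the closure.\<close>

lemma right_inverse_exists:
  fixes M :: "'k :: field mat"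
  assumes M: "M \<in> carrier_mat a n" and s: "\<And>z. z \<in> carrier_vec a \<Longrightarrow> \<exists>v\<in>carrier_vec n. Mac M *\<^sub>v v = z"
  shows "\<exists>S\<in>carrier_mat n a. M * S = 1\<^sub>m a"
proof -
  obtain P R r where PR: "P \<in> GL a" "R \<in> GL n" "r \<le> min a n" "M = P * pid a n r * R"
    using rank_normal_form[OF M] by blast
  note c = GL_carrier[OF PR(1)] GL_carrier[OF PR(2)] minv(1)[OF PR(1)] minv(1)[OF PR(2)]
  \<comment> \<open>otherwise the unit vector with index \<open>r\<close> is missing in the image of the normal form\<close>
  have "r = a"
  proof (rule ccontr)
    assume "r \<noteq> a"
    then have r: "r < a" using PR by auto
    obtain v where v: "v \<in> carrier_vec n" "Mac M *\<^sub>v v = Mac P *\<^sub>v unit_vec a r"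
      using s[of "Mac P *\<^sub>v unit_vec a r"] c by auto
    define x where "x = Mac R *\<^sub>v v"
    have x: "x \<in> carrier_vec n" using c v by (simp add: x_def)
    have MM: "Mac M = Mac P * (Mac (pid a n r) * Mac R)"
    proof -
      have "M = P * (pid a n r * R)" unfolding PR(4) using c by (intro assoc_mult_mat[of _ a a _ n _ n]) auto
      then show ?thesis by (simp only: Mac_mult[OF c(1) mult_carrier_mat[OF pid_carrier c(2)]] Mac_mult[OF pid_carrier c(2)])
    qed
    have "Mac M *\<^sub>v v = Mac P *\<^sub>v (Mac (pid a n r) *\<^sub>v x)"
    proof -
      have k: "Mac P \<in> carrier_mat a a" "Mac (pid a n r) \<in> carrier_mat a n" "Mac R \<in> carrier_mat n n"
        using c pid_carrier by (simp_all only: map_carrier_mat)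
      show ?thesis unfolding MM x_def
        by (simp only: assoc_mult_mat_vec[OF k(1) mult_carrier_mat[OF k(2,3)] v(1)] assoc_mult_mat_vec[OF k(2,3) v(1)])
    qed
    then have "minv (Mac P) *\<^sub>v (Mac P *\<^sub>v (Mac (pid a n r) *\<^sub>v x)) = minv (Mac P) *\<^sub>v (Mac P *\<^sub>v unit_vec a r)"
      using v by simp
    moreover have "minv (Mac P) *\<^sub>v (Mac P *\<^sub>v y) = y" if "y \<in> carrier_vec a" for y
      using minv[of "Mac P" a] PR(1) that c by (simp add: Mac_GL assoc_mult_mat_vec[symmetric, of _ a a _ a])
    moreover have "Mac (pid a n r) *\<^sub>v x \<in> carrier_vec a" by (rule mult_mat_vec_carrier[OF _ x]) simp
    ultimately have "Mac (pid a n r) *\<^sub>v x = unit_vec a r" by simp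
    then have "(Mac (pid a n r) *\<^sub>v x) $ r = 1" using r by simp
    moreover have "(Mac (pid a n r) *\<^sub>v x) $ r = 0" using r x by (auto simp: scalar_prod_def pid_def intro!: sum.neutral)
    ultimately show False by simp
  qed
  then have an: "a \<le> n" using PR by simp
  have pp: "pid a n a * pid n a a = (1\<^sub>m a :: 'k mat)"
  proof (rule eq_matI)
    fix i j assume "i < dim_row (1\<^sub>m a :: 'k mat)" "j < dim_col (1\<^sub>m a :: 'k mat)"
    then have ij: "i < a" "j < a" by auto
    have "(pid a n a * pid n a a :: 'k mat) $$ (i, j) = (\<Sum>k<n. (if i = k \<and> k < a then 1 else 0) * (if k = j \<and> j < a then 1 else 0))"
      using ij by (simp add: pid_def scalar_prod_def lessThan_atLeast0)
    also have "\<dots> = (\<Sum>k<n. if k = i then (if i = j then 1 else 0) else 0)"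
      using ij by (intro sum.cong) auto
    also have "\<dots> = 1\<^sub>m a $$ (i, j)" using ij an by simp
    finally show "(pid a n a * pid n a a :: 'k mat) $$ (i, j) = 1\<^sub>m a $$ (i, j)" .
  qed auto
  define S where "S = minv R * (pid n a a * minv P)"
  have S: "S \<in> carrier_mat n a" unfolding S_def by (rule mult_carrier_mat[OF c(4) mult_carrier_mat[OF pid_carrier c(3)]])
  have "M * S = P * pid a n a * (R * S)"
    unfolding PR(4) \<open>r = a\<close> by (rule assoc_mult_mat[OF mult_carrier_mat[OF c(1) pid_carrier] c(2) S])
  also have "R * S = pid n a a * minv P"
    unfolding S_def by (rule GL_cancel_left(2)[OF PR(2) mult_carrier_mat[OF pid_carrier c(3)]])
  also have "P * pid a n a * (pid n a a * minv P) = P * (pid a n a * (pid n a a * minv P))"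
    by (rule assoc_mult_mat[OF c(1) pid_carrier mult_carrier_mat[OF pid_carrier c(3)]])
  also have "pid a n a * (pid n a a * minv P) = pid a n a * pid n a a * minv P"
    by (rule assoc_mult_mat[OF pid_carrier pid_carrier c(3), symmetric])
  also have "P * \<dots> = 1\<^sub>m a" unfolding pp left_mult_one_mat[OF c(3)] by (rule minv(2)[OF PR(1)])
  finally show ?thesis using S by blast
qed

lemma map_frob_unit [simp]: "map_vec frob (unit_vec n i) = (unit_vec n i :: 'k :: {field, finite} alg_closure vec)"
  by (rule eq_vecI) (auto simp: unit_vec_def)

text \<open>The matrix of a linear map commuting with Frobenius has fixed entries, because the standard basis is fixed.\<close>

lemma frob_equivariant_matrix:
  fixes \<phi> :: "'k :: {field, finite} alg_closure vec \<Rightarrow> 'k alg_closure vec"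
  assumes cl: "\<And>v. v \<in> carrier_vec n \<Longrightarrow> \<phi> v \<in> carrier_vec m"
    and add: "\<And>v w. v \<in> carrier_vec n \<Longrightarrow> w \<in> carrier_vec n \<Longrightarrow> \<phi> (v + w) = \<phi> v + \<phi> w"
    and sm: "\<And>c v. v \<in> carrier_vec n \<Longrightarrow> \<phi> (c \<cdot>\<^sub>v v) = c \<cdot>\<^sub>v \<phi> v"
    and fr: "\<And>v. v \<in> carrier_vec n \<Longrightarrow> \<phi> (map_vec frob v) = map_vec frob (\<phi> v)"
  shows "\<exists>M\<in>carrier_mat m n. \<forall>v\<in>carrier_vec n. \<phi> v = Mac M *\<^sub>v v"
proof -
  let ?B = "mat_of_map n m \<phi>"
  have "map_mat frob ?B = ?B"
  proof (rule eq_matI)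
    fix i j assume "i < dim_row ?B" "j < dim_col ?B"
    then have ij: "i < m" "j < n" by (auto simp: mat_of_map_def)
    have "frob (\<phi> (unit_vec n j) $ i) = \<phi> (unit_vec n j) $ i"
      using arg_cong[OF fr[of "unit_vec n j"], of "\<lambda>v. vec_index v i"] carrier_vecD[OF cl[of "unit_vec n j"]] ij by simp
    then show "map_mat frob ?B $$ (i, j) = ?B $$ (i, j)" using ij by (simp add: mat_of_map_def)
  qed (auto simp: mat_of_map_def)
  then obtain M where "M \<in> carrier_mat m n" "?B = Mac M"
    using frob_fixed_mat[of ?B m n] by (auto simp: mat_of_map_def)
  then show ?thesis using linear_mat_of_map[OF cl add sm] by auto
qed

lemma subspace_cosets:
  fixes W :: "'a :: field vec set"
  assumes W: "VectorSpace.subspace class_ring W (kvec n)"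
  shows "W \<subseteq> carrier_vec n" "0\<^sub>v n \<in> W" "W +>\<^bsub>kvec n\<^esub> 0\<^sub>v n = W"
    "v \<in> W \<Longrightarrow> W +>\<^bsub>kvec n\<^esub> v = W"
    "v \<in> carrier_vec n \<Longrightarrow> W +>\<^bsub>kvec n\<^esub> v = W \<Longrightarrow> v \<in> W"
    "v \<in> carrier_vec n \<Longrightarrow> v' \<in> carrier_vec n \<Longrightarrow>
      add (quot_module (kvec n) W) (W +>\<^bsub>kvec n\<^esub> v) (W +>\<^bsub>kvec n\<^esub> v') = W +>\<^bsub>kvec n\<^esub> (v + v')"
    "v \<in> carrier_vec n \<Longrightarrow> module.smult (quot_module (kvec n) W) c (W +>\<^bsub>kvec n\<^esub> v) = W +>\<^bsub>kvec n\<^esub> (c \<cdot>\<^sub>v v)"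
proof -
  have sm: "submodule class_ring W (kvec n)" using W by (simp add: subspace_def)
  show sub: "W \<subseteq> carrier_vec n" using submodule.subset[OF sm] by simp
  show z: "0\<^sub>v n \<in> W" using submodule.zero_closed[OF sm] by simp
  have ac: "v + w \<in> W" if "v \<in> W" "w \<in> W" for v w using submodule.m_closed[OF sm that] by simp
  have sc: "c \<cdot>\<^sub>v w \<in> W" if "w \<in> W" for c w using submodule.smult_closed[OF sm _ that, of c] by simp
  have c: "w \<in> carrier_vec n" if "w \<in> W" for w using sub that by blast
  show co: "W +>\<^bsub>kvec n\<^esub> v = W" if v: "v \<in> W" for v
  proof (intro subset_antisym subsetI)
    fix w assume w: "w \<in> W"
    have "w = (w + (-1) \<cdot>\<^sub>v v) + v" using c[OF v] c[OF w] by (intro eq_vecI) auto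
    then show "w \<in> W +>\<^bsub>kvec n\<^esub> v" unfolding coset_kvec using ac[OF w sc[OF v]] by blast
  qed (use ac v in \<open>auto simp: coset_kvec\<close>)
  show "W +>\<^bsub>kvec n\<^esub> 0\<^sub>v n = W" by (rule co[OF z])
  show "v \<in> W" if "v \<in> carrier_vec n" "W +>\<^bsub>kvec n\<^esub> v = W" for v
  proof -
    have "v = 0\<^sub>v n + v" using that by simp
    then have "v \<in> W +>\<^bsub>kvec n\<^esub> v" unfolding coset_kvec using z by blast
    then show ?thesis using that(2) by simp
  qed
  show "add (quot_module (kvec n) W) (W +>\<^bsub>kvec n\<^esub> v) (W +>\<^bsub>kvec n\<^esub> v') = W +>\<^bsub>kvec n\<^esub> (v + v')"
    if v: "v \<in> carrier_vec n" "v' \<in> carrier_vec n" for v v'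
    unfolding quot_module_kvec
  proof (intro subset_antisym subsetI)
    fix x assume "x \<in> (\<Union>a\<in>W +>\<^bsub>kvec n\<^esub> v. \<Union>b\<in>W +>\<^bsub>kvec n\<^esub> v'. {a + b})"
    then obtain w w' where w: "w \<in> W" "w' \<in> W" "x = (w + v) + (w' + v')" by (auto simp: coset_kvec)
    have "x = (w + w') + (v + v')" unfolding w(3) using c[OF w(1)] c[OF w(2)] v by (intro eq_vecI) auto
    then show "x \<in> W +>\<^bsub>kvec n\<^esub> (v + v')" unfolding coset_kvec using ac[OF w(1,2)] by blast
  next
    fix x assume "x \<in> W +>\<^bsub>kvec n\<^esub> (v + v')"
    then obtain w where w: "w \<in> W" "x = w + (v + v')" by (auto simp: coset_kvec)
    have "x = (w + v) + (0\<^sub>v n + v')" unfolding w(2) using c[OF w(1)] v by (intro eq_vecI) auto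
    then show "x \<in> (\<Union>a\<in>W +>\<^bsub>kvec n\<^esub> v. \<Union>b\<in>W +>\<^bsub>kvec n\<^esub> v'. {a + b})"
      unfolding coset_kvec using w(1) z by blast
  qed
  show "module.smult (quot_module (kvec n) W) d (W +>\<^bsub>kvec n\<^esub> v) = W +>\<^bsub>kvec n\<^esub> (d \<cdot>\<^sub>v v)"
    if v: "v \<in> carrier_vec n" for v d
  proof -
    have e: "W +>\<^bsub>kvec n\<^esub> (d \<cdot>\<^sub>v (w + v)) = W +>\<^bsub>kvec n\<^esub> (d \<cdot>\<^sub>v v)" if w: "w \<in> W" for w
    proof (intro subset_antisym subsetI)
      fix x assume "x \<in> W +>\<^bsub>kvec n\<^esub> (d \<cdot>\<^sub>v (w + v))"
      then obtain w' where w': "w' \<in> W" "x = w' + d \<cdot>\<^sub>v (w + v)" by (auto simp: coset_kvec)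
      have "x = (w' + d \<cdot>\<^sub>v w) + d \<cdot>\<^sub>v v" unfolding w'(2) using c[OF w] c[OF w'(1)] v by (intro eq_vecI) (auto simp: algebra_simps)
      then show "x \<in> W +>\<^bsub>kvec n\<^esub> (d \<cdot>\<^sub>v v)" unfolding coset_kvec using ac[OF w'(1) sc[OF w]] by blast
    next
      fix x assume "x \<in> W +>\<^bsub>kvec n\<^esub> (d \<cdot>\<^sub>v v)"
      then obtain w' where w': "w' \<in> W" "x = w' + d \<cdot>\<^sub>v v" by (auto simp: coset_kvec)
      have "x = (w' + (- d) \<cdot>\<^sub>v w) + d \<cdot>\<^sub>v (w + v)" unfolding w'(2) using c[OF w] c[OF w'(1)] v by (intro eq_vecI) (auto simp: algebra_simps)
      then show "x \<in> W +>\<^bsub>kvec n\<^esub> (d \<cdot>\<^sub>v (w + v))" unfolding coset_kvec using ac[OF w'(1) sc[OF w]] by blast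
    qed
    have "module.smult (quot_module (kvec n) W) d (W +>\<^bsub>kvec n\<^esub> v) = (\<Union>w\<in>W. W +>\<^bsub>kvec n\<^esub> (d \<cdot>\<^sub>v (w + v)))"
      unfolding quot_module_kvec by (simp add: coset_kvec)
    also have "\<dots> = (\<Union>w\<in>W. W +>\<^bsub>kvec n\<^esub> (d \<cdot>\<^sub>v v))" by (intro SUP_cong refl e)
    also have "\<dots> = W +>\<^bsub>kvec n\<^esub> (d \<cdot>\<^sub>v v)" using z by auto
    finally show ?thesis .
  qed
qed

text \<open>The projection \<open>K ^ n \<rightarrow> K ^ n / W \<rightarrow> K ^ a\<close> and the inclusion \<open>K ^ b \<rightarrow> W \<subseteq> K ^ n\<close> commute with Frobenius, hence have matrices \<open>B\<close> and \<open>A\<close> over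
  the small field. A right inverse \<open>S\<close> of \<open>B\<close> over the small field splits the sequence, and \<open>g\<close> is the inverse of the matrix with columns \<open>S\<close> and \<open>A\<close>.\<close>

lemma Psi_surj:
  fixes W :: "'k :: {field, finite} alg_closure vec set"
  assumes L: "(W, \<rho>1, \<rho>2) \<in> locdata a b"
  shows "\<exists>g\<in>GL (a + b). (W, \<rho>1, \<rho>2) = Psi a b g"
proof -
  define n where "n = a + b"
  have W: "VectorSpace.subspace class_ring W (kvec n)"
    and r1: "\<rho>1 \<in> lin_isos (quot_module (kvec n) W) (kvec a)"
    and r2: "\<rho>2 \<in> lin_isos ((kvec n)\<lparr>carrier := W\<rparr>) (kvec b)"
    and WF: "map_vec frob ` W = W"
    and r1F: "\<And>A. A \<in> carrier (quot_module (kvec n) W) \<Longrightarrow> \<rho>1 (map_vec frob ` A) = map_vec frob (\<rho>1 A)"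
    and r2F: "\<And>w. w \<in> W \<Longrightarrow> \<rho>2 (map_vec frob w) = map_vec frob (\<rho>2 w)"
    using L by (auto simp: locdata_def n_def)
  note co = subspace_cosets[OF W]
  let ?V = "quot_module (kvec n) W"
  define cs where "cs v = W +>\<^bsub>kvec n\<^esub> v" for v
  have csV: "cs v \<in> carrier ?V" if "v \<in> carrier_vec n" for v
    using that unfolding cs_def quot_module_kvec by blast
  have r1b: "bij_betw \<rho>1 (carrier ?V) (carrier_vec a)" and r1h: "\<rho>1 \<in> module_hom class_ring ?V (kvec a)"
    and r1e: "\<rho>1 \<in> extensional (carrier ?V)" using r1 by (auto simp: lin_isos_def)
  have r2b: "bij_betw \<rho>2 W (carrier_vec b)" and r2h: "\<rho>2 \<in> module_hom class_ring ((kvec n)\<lparr>carrier := W\<rparr>) (kvec b)"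
    and r2e: "\<rho>2 \<in> extensional W" using r2 by (auto simp: lin_isos_def)
  \<comment> \<open>\<open>\<phi>\<close> is the projection, composed with \<open>\<rho>1\<close>\<close>
  define \<phi> where "\<phi> v = \<rho>1 (cs v)" for v
  have \<phi>c: "\<phi> v \<in> carrier_vec a" if "v \<in> carrier_vec n" for v
    using bij_betwE[OF r1b] csV[OF that] by (simp add: \<phi>_def)
  have "\<exists>B\<in>carrier_mat a n. \<forall>v\<in>carrier_vec n. \<phi> v = Mac B *\<^sub>v v"
  proof (rule frob_equivariant_matrix[OF \<phi>c])
    fix v w :: "'k alg_closure vec" and c assume v: "v \<in> carrier_vec n" and w: "w \<in> carrier_vec n"
    show "\<phi> (v + w) = \<phi> v + \<phi> w"
      using module_hom_add[OF r1h csV[OF v] csV[OF w]] co(6)[OF v w] by (simp add: \<phi>_def cs_def)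
    show "\<phi> (c \<cdot>\<^sub>v v) = c \<cdot>\<^sub>v \<phi> v"
      using module_hom_smult[OF r1h _ csV[OF v], of c] co(7)[OF v, of c] by (simp add: \<phi>_def cs_def)
    have "map_vec frob ` cs v = (\<lambda>w. w + map_vec frob v) ` map_vec frob ` W"
      unfolding cs_def coset_kvec image_image using co(1) v by (intro image_cong refl map_frob_add) auto
    then have "map_vec frob ` cs v = cs (map_vec frob v)" by (simp only: WF cs_def coset_kvec)
    then show "\<phi> (map_vec frob v) = map_vec frob (\<phi> v)" using r1F[OF csV[OF v]] by (simp add: \<phi>_def)
  qed
  then obtain B where B: "B \<in> carrier_mat a n" "\<And>v. v \<in> carrier_vec n \<Longrightarrow> \<phi> v = Mac B *\<^sub>v v" by blast
  have \<phi>0: "\<phi> (0\<^sub>v n) = 0\<^sub>v a" using B by (simp add: B(2)) (auto intro!: eq_vecI simp: scalar_prod_def)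
  have \<phi>W: "\<phi> w = 0\<^sub>v a" if "w \<in> W" for w
    using \<phi>0 co(3) co(4)[OF that] by (simp add: \<phi>_def cs_def)
  have W\<phi>: "v \<in> W" if v: "v \<in> carrier_vec n" "\<phi> v = 0\<^sub>v a" for v
  proof -
    have "cs v = cs (0\<^sub>v n)"
      using inj_onD[OF bij_betw_imp_inj_on[OF r1b] _ csV[OF v(1)] csV[OF zero_carrier_vec]] v(2) \<phi>0 by (simp add: \<phi>_def)
    then show ?thesis using co(3) co(5)[OF v(1)] by (simp add: cs_def)
  qed
  have surj: "\<exists>v\<in>carrier_vec n. Mac B *\<^sub>v v = z" if z: "z \<in> carrier_vec a" for z
  proof -
    have "z \<in> \<rho>1 ` carrier ?V" using z bij_betw_imp_surj_on[OF r1b] by simp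
    then obtain A where A: "A \<in> carrier ?V" "\<rho>1 A = z" by blast
    then obtain v where v: "v \<in> carrier_vec n" "A = cs v" unfolding quot_module_kvec cs_def by blast
    then show ?thesis using A B(2)[OF v(1)] by (auto simp: \<phi>_def)
  qed
  obtain S where S: "S \<in> carrier_mat n a" "B * S = 1\<^sub>m a" using right_inverse_exists[OF B(1) surj] by blast
  \<comment> \<open>\<open>\<psi>\<close> is the inverse of \<open>\<rho>2\<close>, composed with the inclusion\<close>
  define \<psi> where "\<psi> = the_inv_into W \<rho>2"
  have \<psi>: "\<psi> t \<in> W" "\<rho>2 (\<psi> t) = t" if "t \<in> carrier_vec b" for t
    unfolding \<psi>_def using that r2b by (auto intro!: the_inv_into_into f_the_inv_into_f simp: bij_betw_def)
  have \<psi>2: "\<psi> t = w" if "w \<in> W" "\<rho>2 w = t" for w t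
    unfolding \<psi>_def using that r2b by (auto intro!: the_inv_into_f_eq simp: bij_betw_def)
  have \<rho>2c: "\<rho>2 w \<in> carrier_vec b" if "w \<in> W" for w using bij_betwE[OF r2b] that by blast
  have sm: "submodule class_ring W (kvec n)" using W by (simp add: subspace_def)
  have "\<exists>A\<in>carrier_mat n b. \<forall>t\<in>carrier_vec b. \<psi> t = Mac A *\<^sub>v t"
  proof (rule frob_equivariant_matrix)
    fix v w :: "'k alg_closure vec" and c assume v: "v \<in> carrier_vec b" and w: "w \<in> carrier_vec b"
    show "\<psi> v \<in> carrier_vec n" using \<psi>(1)[OF v] co(1) by blast
    show "\<psi> (v + w) = \<psi> v + \<psi> w"
    proof (rule \<psi>2)
      show "\<psi> v + \<psi> w \<in> W" using submodule.m_closed[OF sm \<psi>(1)[OF v] \<psi>(1)[OF w]] by simp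
      show "\<rho>2 (\<psi> v + \<psi> w) = v + w" using module_hom_add[OF r2h, of "\<psi> v" "\<psi> w"] \<psi>[OF v] \<psi>[OF w] by simp
    qed
    show "\<psi> (c \<cdot>\<^sub>v v) = c \<cdot>\<^sub>v \<psi> v"
    proof (rule \<psi>2)
      show "c \<cdot>\<^sub>v \<psi> v \<in> W" using submodule.smult_closed[OF sm _ \<psi>(1)[OF v], of c] by simp
      show "\<rho>2 (c \<cdot>\<^sub>v \<psi> v) = c \<cdot>\<^sub>v v" using module_hom_smult[OF r2h, of c "\<psi> v"] \<psi>[OF v] by simp
    qed
    show "\<psi> (map_vec frob v) = map_vec frob (\<psi> v)"
    proof (rule \<psi>2)
      show "map_vec frob (\<psi> v) \<in> W" using imageI[OF \<psi>(1)[OF v], of "map_vec frob"] unfolding WF .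
      show "\<rho>2 (map_vec frob (\<psi> v)) = map_vec frob v" unfolding r2F[OF \<psi>(1)[OF v]] \<psi>(2)[OF v] ..
    qed
  qed
  then obtain A where A: "A \<in> carrier_mat n b" "\<And>t. t \<in> carrier_vec b \<Longrightarrow> \<psi> t = Mac A *\<^sub>v t" by blast
  \<comment> \<open>the columns of \<open>M\<close> are a basis adapted to \<open>W\<close>\<close>
  define M where "M = mat n n (\<lambda>(i, j). if j < a then S $$ (i, j) else A $$ (i, j - a))"
  have M: "M \<in> carrier_mat (n + 0) (a + b)" by (simp add: M_def n_def)
  have Mb: "TL n a M = S" "blk 0 a n b M = A" using S A by (auto simp: M_def n_def intro!: eq_matI)
  have MacM: "Mac M *\<^sub>v (u @\<^sub>v t) = Mac S *\<^sub>v u + \<psi> t" if "u \<in> carrier_vec a" "t \<in> carrier_vec b" for u t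
  proof -
    have "vec_first (Mac M *\<^sub>v (u @\<^sub>v t)) n = TL n a (Mac M) *\<^sub>v u + blk 0 a n b (Mac M) *\<^sub>v t"
      using M that by (intro mult_append_vec(1)[where b = 0]) auto
    also have "\<dots> = Mac S *\<^sub>v u + \<psi> t"
      using carrier_matD[OF M] that by (simp add: Mac_blk Mb A(2))
    also have "vec_first (Mac M *\<^sub>v (u @\<^sub>v t)) n = Mac M *\<^sub>v (u @\<^sub>v t)"
      using M by (intro eq_vecI) (auto simp: vec_first_def)
    finally show ?thesis .
  qed
  have \<psi>c: "\<psi> t \<in> carrier_vec n" if "t \<in> carrier_vec b" for t using \<psi>(1)[OF that] co(1) by blast
  have \<phi>M: "\<phi> (Mac S *\<^sub>v u + \<psi> t) = u" if "u \<in> carrier_vec a" "t \<in> carrier_vec b" for u t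
  proof -
    have c2: "Mac B \<in> carrier_mat a n" "Mac S \<in> carrier_mat n a" using S(1) B(1) by simp_all
    note c = mult_mat_vec_carrier[OF c2(2) that(1)] c2
    have "\<phi> (Mac S *\<^sub>v u + \<psi> t) = Mac B *\<^sub>v (Mac S *\<^sub>v u) + Mac B *\<^sub>v \<psi> t"
      unfolding B(2)[OF add_carrier_vec[OF c(1) \<psi>c[OF that(2)]]]
      by (rule mult_add_distrib_mat_vec[OF c(2,1) \<psi>c[OF that(2)]])
    also have "Mac B *\<^sub>v \<psi> t = 0\<^sub>v a" using B(2)[OF \<psi>c[OF that(2)]] \<phi>W[OF \<psi>(1)[OF that(2)]] by simp
    also have "Mac B *\<^sub>v (Mac S *\<^sub>v u) = Mac (B * S) *\<^sub>v u"
      unfolding Mac_mult[OF B(1) S(1)] by (rule assoc_mult_mat_vec[OF c2 that(1), symmetric])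
    also have "\<dots> = u" using that by (simp add: S(2) to_ac.mat_hom_one)
    finally show ?thesis using that by simp
  qed
  have Mn: "M \<in> carrier_mat n n" using M by (simp add: n_def)
  have MG: "Mac M \<in> GL n"
  proof -
    have "v = 0\<^sub>v n" if v: "v \<in> carrier_vec n" "Mac M *\<^sub>v v = 0\<^sub>v n" for v
    proof -
      define u t where "u = vec_first v a" and "t = vec_last v b"
      have ut: "u \<in> carrier_vec a" "t \<in> carrier_vec b" "v = u @\<^sub>v t"
        using v(1) by (auto simp: u_def t_def n_def)
      then have e: "Mac S *\<^sub>v u + \<psi> t = 0\<^sub>v n" using v(2) MacM by simp
      then have u0: "u = 0\<^sub>v a" using \<phi>M[OF ut(1,2)] \<phi>0 by simp
      have "Mac S *\<^sub>v 0\<^sub>v a = 0\<^sub>v n" using S by (intro eq_vecI) (auto simp: scalar_prod_def)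
      then have "\<psi> t = 0\<^sub>v n" using e \<psi>c[OF ut(2)] by (simp add: u0)
      moreover have "\<psi> (0\<^sub>v b) = 0\<^sub>v n" using A by (simp add: A(2)) (auto intro!: eq_vecI simp: scalar_prod_def)
      ultimately have "t = 0\<^sub>v b" using \<psi>(2)[OF ut(2)] \<psi>(2)[OF zero_carrier_vec] by metis
      then show ?thesis using ut(3) u0 by (auto simp: n_def intro!: eq_vecI)
    qed
    then have "det (Mac M) \<noteq> 0" using det_0_iff_vec_prod_zero_field[of "Mac M" n] Mn by auto
    then show ?thesis using Mn by (simp add: GL_def)
  qed
  define g where "g = minv M"
  have MGk: "M \<in> GL n" using MG by (simp add: Mac_GL)
  have g: "g \<in> GL (a + b)" "Mac g = minv (Mac M)" using minv(4)[OF MGk] Mac_minv[OF MGk] by (simp_all add: g_def n_def)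
  interpret D: GLdata a b "Mac g" by unfold_locales (simp only: Mac_GL g(1))
  have key: "vec_first (Mac g *\<^sub>v v) a = \<phi> v" "v = Mac S *\<^sub>v vec_first (Mac g *\<^sub>v v) a + \<psi> (vec_last (Mac g *\<^sub>v v) b)"
    if v: "v \<in> carrier_vec n" for v
  proof -
    define x where "x = Mac g *\<^sub>v v"
    have x: "x \<in> carrier_vec (a + b)" unfolding x_def using D.Gc v by (auto simp: n_def)
    have "Mac M *\<^sub>v x = v"
      unfolding x_def g using minv[OF MG] v Mn by (simp add: assoc_mult_mat_vec[symmetric, of _ n n _ n])
    moreover have "Mac M *\<^sub>v x = Mac S *\<^sub>v vec_first x a + \<psi> (vec_last x b)"
      using MacM[of "vec_first x a" "vec_last x b"] x by simp
    ultimately show "v = Mac S *\<^sub>v vec_first (Mac g *\<^sub>v v) a + \<psi> (vec_last (Mac g *\<^sub>v v) b)"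
      by (simp add: x_def)
    then show "vec_first (Mac g *\<^sub>v v) a = \<phi> v"
      using \<phi>M[of "vec_first x a" "vec_last x b"] by (simp add: x_def)
  qed
  have Weq: "W = Wg a b (Mac g)"
    using key(1) \<phi>W W\<phi> co(1) by (auto simp: Wfib_def n_def)
  have r1eq: "\<rho>1 = rho1 a b (Mac g)"
  proof (rule extensionalityI[OF r1e])
    show "rho1 a b (Mac g) \<in> extensional (carrier ?V)" by (simp add: rho1_def Weq[symmetric] n_def)
    fix C assume "C \<in> carrier ?V"
    then obtain v where v: "v \<in> carrier_vec n" "C = cs v" unfolding quot_module_kvec cs_def by blast
    have "C = Wfib a b (Mac g) (vec_first (Mac g *\<^sub>v v) a)"
      using D.coset_Wg[of v] v by (simp add: cs_def Weq[symmetric] n_def)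
    then have "rho1 a b (Mac g) C = vec_first (Mac g *\<^sub>v v) a" using D.rho1_Wfib by simp
    then show "\<rho>1 C = rho1 a b (Mac g) C" using key(1)[OF v(1)] v(2) by (simp only: \<phi>_def)
  qed
  have r2eq: "\<rho>2 = rho2 a b (Mac g)"
  proof (rule extensionalityI[OF r2e])
    show "rho2 a b (Mac g) \<in> extensional W" by (simp add: rho2_def Weq[symmetric])
    fix w assume w: "w \<in> W"
    then have wc: "w \<in> carrier_vec n" using co(1) by blast
    have "Mac S *\<^sub>v 0\<^sub>v a = 0\<^sub>v n" using S by (intro eq_vecI) (auto simp: scalar_prod_def)
    moreover have "\<psi> (vec_last (Mac g *\<^sub>v w) b) \<in> carrier_vec n" by (intro \<psi>c) simp
    ultimately have "w = \<psi> (vec_last (Mac g *\<^sub>v w) b)"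
      using key(2)[OF wc] key(1)[OF wc] \<phi>W[OF w] by simp
    then have "\<rho>2 w = vec_last (Mac g *\<^sub>v w) b" using \<psi>(2)[of "vec_last (Mac g *\<^sub>v w) b"] by simp
    then show "\<rho>2 w = rho2 a b (Mac g) w" using w by (simp add: rho2_def Weq[symmetric])
  qed
  show ?thesis using g(1) Weq r1eq r2eq by (auto simp: Psi_def)
qed

text \<open>Two matrices with the same data have the same coordinates modulo \<open>W\<close> and on \<open>W\<close>, so they differ by a unipotent lower block
  triangular factor.\<close>

lemma Psi_eqD:
  fixes g h :: "'k :: {field, finite} mat"
  assumes g: "g \<in> GL (a + b)" and h: "h \<in> GL (a + b)" and e: "Psi a b h = Psi a b g"
  shows "h * minv g \<in> Low a b a b" "TL a a (h * minv g) = 1\<^sub>m a" "BR a b a b (h * minv g) = 1\<^sub>m b"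
proof -
  interpret D: GLdata a b "Mac g" by unfold_locales (simp add: Mac_GL g)
  interpret E: GLdata a b "Mac h" by unfold_locales (simp add: Mac_GL h)
  let ?l = "h * minv g"
  have l: "?l \<in> carrier_mat (a + b) (a + b)" using GL_carrier[OF h] minv(1)[OF g] by auto
  have eW: "Wg a b (Mac h) = Wg a b (Mac g)" and e1: "rho1 a b (Mac h) = rho1 a b (Mac g)" and e2: "rho2 a b (Mac h) = rho2 a b (Mac g)"
    using e by (auto simp: Psi_def)
  have L: "Mac ?l *\<^sub>v (u @\<^sub>v t) = Mac h *\<^sub>v D.lift u t" if "u \<in> carrier_vec a" "t \<in> carrier_vec b" for u t
    unfolding D.lift_def Mac_mult[OF GL_carrier[OF h] minv(1)[OF g]] Mac_minv[OF g]
    using E.Gc D.Gi that by (intro assoc_mult_mat_vec) auto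
  have first: "vec_first (Mac ?l *\<^sub>v (u @\<^sub>v t)) a = u" if ut: "u \<in> carrier_vec a" "t \<in> carrier_vec b" for u t
  proof -
    note v = D.lift[OF ut]
    have "Wfib a b (Mac h) (vec_first (Mac h *\<^sub>v D.lift u t) a) = Wfib a b (Mac g) u"
      using D.coset_Wg[OF v(1), unfolded v(3)] E.coset_Wg[OF v(1), unfolded eW] by simp
    then have "rho1 a b (Mac h) (Wfib a b (Mac h) (vec_first (Mac h *\<^sub>v D.lift u t) a)) = rho1 a b (Mac g) (Wfib a b (Mac g) u)"
      by (simp add: e1)
    then show ?thesis using ut by (simp add: D.rho1_Wfib E.rho1_Wfib L)
  qed
  have last: "vec_last (Mac ?l *\<^sub>v (0\<^sub>v a @\<^sub>v t)) b = t" if t: "t \<in> carrier_vec b" for t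
  proof -
    note v = D.rho2_lift[OF t]
    have "rho2 a b (Mac h) (D.lift (0\<^sub>v a) t) = t" using v(2) by (simp add: e2)
    then show ?thesis using v(1) t by (simp add: L rho2_def eW)
  qed
  have Ml: "Mac ?l \<in> carrier_mat (a + b) (a + b)" using l by simp
  note m = mult_append_vec[OF Ml]
  have 0: "Y *\<^sub>v 0\<^sub>v d = 0\<^sub>v c" if "Y \<in> carrier_mat c d" for Y :: "'k alg_closure mat" and c d
    using that by (intro eq_vecI) (auto simp: scalar_prod_def)
  have zm: "0\<^sub>m a b *\<^sub>v t = 0\<^sub>v a" if "t \<in> carrier_vec b" for t :: "'k alg_closure vec"
    using that by (intro eq_vecI) (auto simp: scalar_prod_def)
  have "TL a a (Mac ?l) = 1\<^sub>m a"
  proof (rule mat_eqI_mult_vec[of _ a a])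
    fix u :: "'k alg_closure vec" assume u: "u \<in> carrier_vec a"
    show "TL a a (Mac ?l) *\<^sub>v u = 1\<^sub>m a *\<^sub>v u"
      using first[OF u zero_carrier_vec[of b]] m(1)[OF u zero_carrier_vec[of b]] u 0[of "blk 0 a a b (Mac ?l)" a b]
        right_zero_vec[OF mult_mat_vec_carrier[OF blk_carrier[of 0 0 a a "Mac ?l"] u]] by simp
  qed auto
  then have "Mac (TL a a ?l) = Mac (1\<^sub>m a)"
    unfolding to_ac.mat_hom_one using l by (subst Mac_blk[symmetric]) auto
  then show "TL a a ?l = 1\<^sub>m a" by (rule Mac_inj)
  have "blk 0 a a b (Mac ?l) = 0\<^sub>m a b"
  proof (rule mat_eqI_mult_vec[of _ a b])
    fix t :: "'k alg_closure vec" assume t: "t \<in> carrier_vec b"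
    show "blk 0 a a b (Mac ?l) *\<^sub>v t = 0\<^sub>m a b *\<^sub>v t"
      using first[OF zero_carrier_vec[of a] t] m(1)[OF zero_carrier_vec[of a] t] t 0[of "TL a a (Mac ?l)" a a] 0[of "TL a a (Mac ?l)" a a]
        left_zero_vec[OF mult_mat_vec_carrier[OF blk_carrier[of 0 a a b "Mac ?l"] t]] zm[OF t] by simp
  qed auto
  moreover have "Mac (0\<^sub>m a b) = 0\<^sub>m a b" by (rule eq_matI) auto
  ultimately have "Mac (blk 0 a a b ?l) = Mac (0\<^sub>m a b)" using l by (subst Mac_blk[symmetric]) auto
  then have "blk 0 a a b ?l = 0\<^sub>m a b" by (rule Mac_inj)
  then show "?l \<in> Low a b a b" using l by (simp add: Low_def)
  have "BR a b a b (Mac ?l) = 1\<^sub>m b"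
  proof (rule mat_eqI_mult_vec[of _ b b])
    fix t :: "'k alg_closure vec" assume t: "t \<in> carrier_vec b"
    show "BR a b a b (Mac ?l) *\<^sub>v t = 1\<^sub>m b *\<^sub>v t"
      using last[OF t] m(2)[OF zero_carrier_vec[of a] t] t 0[of "blk a 0 b a (Mac ?l)" b a]
        left_zero_vec[OF mult_mat_vec_carrier[OF blk_carrier[of a a b b "Mac ?l"] t]] by simp
  qed auto
  then have "Mac (BR a b a b ?l) = Mac (1\<^sub>m b)"
    unfolding to_ac.mat_hom_one using l by (subst Mac_blk[symmetric]) auto
  then show "BR a b a b ?l = 1\<^sub>m b" by (rule Mac_inj)
qed

lemma Psi_unipotent:
  fixes g l :: "'k :: {field, finite} mat"
  assumes g: "g \<in> GL (a + b)" and l: "l \<in> Low a b a b" "TL a a l = 1\<^sub>m a" "BR a b a b l = 1\<^sub>m b"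
  shows "l * g \<in> GL (a + b)" "Psi a b (l * g) = Psi a b g"
proof -
  have "l \<in> Par a b" using l by (simp add: Par_iff)
  then show h: "l * g \<in> GL (a + b)" using g Par_GL by blast
  interpret D: GLdata a b "Mac g" by unfold_locales (simp add: Mac_GL g)
  interpret E: GLdata a b "Mac (l * g)" by unfold_locales (use h in \<open>simp add: Mac_GL\<close>)
  have lc: "l \<in> carrier_mat (a + b) (a + b)" using l by (simp add: Low_def)
  then have Ml: "Mac l \<in> carrier_mat (a + b) (a + b)" by simp
  have bl: "TL a a (Mac l) = 1\<^sub>m a" "BR a b a b (Mac l) = 1\<^sub>m b" "blk 0 a a b (Mac l) = 0\<^sub>m a b"
    using l lc by (auto simp: Mac_blk to_ac.mat_hom_one Low_def intro!: eq_matI)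
  have L: "Mac (l * g) *\<^sub>v v = Mac l *\<^sub>v (vec_first (Mac g *\<^sub>v v) a @\<^sub>v vec_last (Mac g *\<^sub>v v) b)"
    if v: "v \<in> carrier_vec (a + b)" for v
  proof -
    have "vec_first (Mac g *\<^sub>v v) a @\<^sub>v vec_last (Mac g *\<^sub>v v) b = Mac g *\<^sub>v v"
      using mult_mat_vec_carrier[OF D.Gc v] by simp
    then show ?thesis unfolding Mac_mult[OF lc GL_carrier[OF g]] using assoc_mult_mat_vec[OF Ml D.Gc v] by simp
  qed
  have first: "vec_first (Mac (l * g) *\<^sub>v v) a = vec_first (Mac g *\<^sub>v v) a" if v: "v \<in> carrier_vec (a + b)" for v
    unfolding L[OF v] by (subst mult_append_vec(1)[OF Ml]) (auto simp: bl)
  have W: "Wfib a b (Mac (l * g)) = Wfib a b (Mac g)"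
    using first by (auto simp: Wfib_def fun_eq_iff)
  have r1: "rho1 a b (Mac (l * g)) = rho1 a b (Mac g)"
  proof (rule extensionalityI)
    let ?C = "carrier (quot_module (kvec (a + b)) (Wg a b (Mac g)))"
    show "rho1 a b (Mac (l * g)) \<in> extensional ?C" "rho1 a b (Mac g) \<in> extensional ?C"
      by (simp_all add: rho1_def W)
    fix A assume "A \<in> ?C"
    then obtain z where "z \<in> carrier_vec a" "A = Wfib a b (Mac g) z" unfolding D.quot_carrier by blast
    then show "rho1 a b (Mac (l * g)) A = rho1 a b (Mac g) A"
      using D.rho1_Wfib[of z] E.rho1_Wfib[of z] by (simp add: W)
  qed
  have r2: "rho2 a b (Mac (l * g)) = rho2 a b (Mac g)"
  proof (rule extensionalityI)
    show "rho2 a b (Mac (l * g)) \<in> extensional (Wg a b (Mac g))" "rho2 a b (Mac g) \<in> extensional (Wg a b (Mac g))"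
      by (simp_all add: rho2_def W)
    fix w assume w: "w \<in> Wg a b (Mac g)"
    then have w': "w \<in> carrier_vec (a + b)" "vec_first (Mac g *\<^sub>v w) a = 0\<^sub>v a" by (auto simp: Wfib_def)
    have "blk a 0 b a (Mac l) *\<^sub>v 0\<^sub>v a = 0\<^sub>v b" by (intro eq_vecI) (auto simp: scalar_prod_def)
    then have "vec_last (Mac (l * g) *\<^sub>v w) b = vec_last (Mac g *\<^sub>v w) b"
      unfolding L[OF w'(1)] by (subst mult_append_vec(2)[OF Ml]) (auto simp: bl w'(2))
    then show "rho2 a b (Mac (l * g)) w = rho2 a b (Mac g) w" using w by (simp add: rho2_def W)
  qed
  show "Psi a b (l * g) = Psi a b g" by (simp add: Psi_def W r1 r2)
qed

text \<open>The unipotent radical acts simply transitively on each fibre; its order is that of its lower left block.\<close>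

lemma card_Psi_fibre:
  fixes d :: "'k :: {field, finite} alg_closure vec set \<times> _"
  assumes d: "d \<in> locdata a b"
  shows "card {h \<in> GL (a + b). Psi a b h = d} = CARD('k) ^ (a * b)"
proof -
  obtain g where g: "g \<in> GL (a + b)" "d = Psi a b g" using Psi_surj d by (cases d) blast
  let ?U = "{l :: 'k mat. l \<in> Low a b a b \<and> TL a a l = 1\<^sub>m a \<and> BR a b a b l = 1\<^sub>m b}"
  have "bij_betw (\<lambda>l. l * g) ?U {h \<in> GL (a + b). Psi a b h = d}"
  proof (rule bij_betw_byWitness[where f' = "\<lambda>h. h * minv g"])
    show "\<forall>l\<in>?U. l * g * minv g = l" using GL_cancel_right(1)[OF g(1)] by (auto simp: Low_def)
    show "\<forall>h\<in>{h \<in> GL (a + b). Psi a b h = d}. h * minv g * g = h"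
      using GL_cancel_right(2)[OF g(1)] GL_carrier by blast
    show "(\<lambda>l. l * g) ` ?U \<subseteq> {h \<in> GL (a + b). Psi a b h = d}" using Psi_unipotent[OF g(1)] g(2) by auto
    show "(\<lambda>h. h * minv g) ` {h \<in> GL (a + b). Psi a b h = d} \<subseteq> ?U" using Psi_eqD[OF g(1)] g(2) by auto
  qed
  from bij_betw_same_card[OF this]
  show ?thesis using card_Low_fibre[of "1\<^sub>m a :: 'k mat" a a "1\<^sub>m b" b b] by (simp add: mult.commute)
qed

section \<open>Finiteness of the set of Frobenius-stable subspaces\<close>

text \<open>The span of the Frobenius-fixed vectors of \<open>W\<close>, generated one summand at a time to give an induction principle.\<close>

inductive_set fixed_span :: "'k :: {field, finite} alg_closure vec set \<Rightarrow> nat \<Rightarrow> 'k alg_closure vec set"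
  for W n where
  zero: "0\<^sub>v n \<in> fixed_span W n"
| add: "u \<in> fixed_span W n \<Longrightarrow> e \<in> W \<Longrightarrow> map_vec frob e = e \<Longrightarrow> u + c \<cdot>\<^sub>v e \<in> fixed_span W n"

lemma fixed_span_carrier: "u \<in> fixed_span W n \<Longrightarrow> W \<subseteq> carrier_vec n \<Longrightarrow> u \<in> carrier_vec n"
  by (induction rule: fixed_span.induct) auto

lemma fixed_span_smult: "u \<in> fixed_span W n \<Longrightarrow> W \<subseteq> carrier_vec n \<Longrightarrow> d \<cdot>\<^sub>v u \<in> fixed_span W n"
proof (induction rule: fixed_span.induct)
  case zero
  have "d \<cdot>\<^sub>v 0\<^sub>v n = (0\<^sub>v n :: 'a alg_closure vec)" by (rule eq_vecI) auto
  then show ?case using fixed_span.zero[of n W] by simp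
next
  case (add u e c)
  have "d \<cdot>\<^sub>v (u + c \<cdot>\<^sub>v e) = d \<cdot>\<^sub>v u + (d * c) \<cdot>\<^sub>v e"
    using add fixed_span_carrier[OF add.hyps(1) add.prems] by (intro eq_vecI) (auto simp: algebra_simps)
  then show ?case using fixed_span.add[OF add.IH[OF add.prems] add.hyps(2,3), of "d * c"] by simp
qed

lemma artin_schreier_root: "\<exists>y. y - frob y = (c :: 'k :: {field, finite} alg_closure)"
proof -
  let ?q = "CARD('k)"
  have q: "?q > 1" using card_mono[of UNIV "{0, 1 :: 'k}"] by simp
  define p :: "'k alg_closure poly" where "p = [:- c, 1:] - monom 1 ?q"
  have "coeff p ?q \<noteq> 0" using q by (cases ?q) (auto simp: p_def coeff_pCons split: nat.splits)
  then have "degree p \<ge> ?q" by (rule le_degree)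
  then have "degree p > 0" using q by simp
  from alg_closed_imp_poly_has_root[OF this] obtain y where "poly p y = 0" by blast
  then show ?thesis by (intro exI[of _ y]) (simp add: p_def poly_monom frob_def algebra_simps)
qed

lemma map_frob_smult: "map_vec frob (c \<cdot>\<^sub>v v) = frob c \<cdot>\<^sub>v map_vec frob (v :: 'k :: {field, finite} alg_closure vec)"
  by (rule eq_vecI) (auto simp: frob_mult)

text \<open>Lang's theorem for the additive group: the equation \<open>y - y^q = c\<close> is solvable, and it suffices to solve it for the coefficients.\<close>

lemma fixed_span_lang:
  "v \<in> fixed_span W n \<Longrightarrow> W \<subseteq> carrier_vec n \<Longrightarrow> \<exists>x\<in>fixed_span W n. x + (-1) \<cdot>\<^sub>v map_vec frob x = v"
proof (induction rule: fixed_span.induct)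
  case zero
  have "0\<^sub>v n + (-1) \<cdot>\<^sub>v map_vec frob (0\<^sub>v n) = (0\<^sub>v n :: 'a alg_closure vec)" by (rule eq_vecI) auto
  then show ?case using fixed_span.zero by blast
next
  case (add u e c)
  obtain x where x: "x \<in> fixed_span W n" "x + (-1) \<cdot>\<^sub>v map_vec frob x = u" using add by blast
  obtain y where y: "y - frob y = c" using artin_schreier_root by blast
  have c: "x \<in> carrier_vec n" "e \<in> carrier_vec n" using fixed_span_carrier[OF x(1)] add by auto
  have "(x + y \<cdot>\<^sub>v e) + (-1) \<cdot>\<^sub>v map_vec frob (x + y \<cdot>\<^sub>v e) =
    (x + y \<cdot>\<^sub>v e) + (-1) \<cdot>\<^sub>v (map_vec frob x + frob y \<cdot>\<^sub>v e)"
    using c add.hyps(3) by (simp add: map_frob_add[of _ n] map_frob_smult)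
  also have "\<dots> = (x + (-1) \<cdot>\<^sub>v map_vec frob x) + (y - frob y) \<cdot>\<^sub>v e"
    using c by (intro eq_vecI) (auto simp: algebra_simps)
  finally have "(x + y \<cdot>\<^sub>v e) + (-1) \<cdot>\<^sub>v map_vec frob (x + y \<cdot>\<^sub>v e) = u + c \<cdot>\<^sub>v e" by (simp only: x(2) y)
  then show ?case using fixed_span.add[OF x(1) add.hyps(2,3), of y] by blast
qed

text \<open>Galois descent, by induction on the number of nonzero entries. Scale \<open>w \<in> W\<close> to a vector \<open>w'\<close> with an entry 1. Then \<open>w' - F w'\<close>
  has smaller support, so it lies in the span of the fixed vectors and can be written there as \<open>x - F x\<close>. The
  vector \<open>w' - x\<close> is fixed, and \<open>w'\<close> lies in the span.\<close>

lemma frob_stable_eq_fixed_span: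
  assumes W: "VectorSpace.subspace class_ring W (kvec n)" and F: "map_vec frob ` W = W"
  shows "W = fixed_span W n"
proof -
  have sm: "submodule class_ring W (kvec n)" using W by (simp add: subspace_def)
  note sub = subspace_cosets(1)[OF W]
  have ac: "v + w \<in> W" if "v \<in> W" "w \<in> W" for v w using submodule.m_closed[OF sm that] by simp
  have sc: "c \<cdot>\<^sub>v w \<in> W" if "w \<in> W" for c w using submodule.smult_closed[OF sm _ that, of c] by simp
  have "fixed_span W n \<subseteq> W"
  proof
    fix u assume "u \<in> fixed_span W n"
    then show "u \<in> W" by induction (auto intro: ac sc subspace_cosets(2)[OF W])
  qed
  moreover have "w \<in> fixed_span W n" if "w \<in> W" for w
    using that
  proof (induction "card {i. i < n \<and> vec_index w i \<noteq> 0}" arbitrary: w rule: less_induct)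
    case less
    have wc: "w \<in> carrier_vec n" using less.prems sub by blast
    show ?case
    proof (cases "w = 0\<^sub>v n")
      case False
      then obtain j where j: "j < n" "vec_index w j \<noteq> 0" using wc by (metis carrier_vecD eq_vecI index_zero_vec(1) index_zero_vec(2))
      define w' where "w' = inverse (vec_index w j) \<cdot>\<^sub>v w"
      define v where "v = w' + (-1) \<cdot>\<^sub>v map_vec frob w'"
      have w'W: "w' \<in> W" unfolding w'_def by (rule sc[OF less.prems])
      then have w'c: "w' \<in> carrier_vec n" using sub by blast
      have FwW: "map_vec frob w' \<in> W" using imageI[OF w'W, of "map_vec frob"] unfolding F .
      have vW: "v \<in> W" unfolding v_def by (rule ac[OF w'W sc[OF FwW]])
      have vi: "vec_index v i = vec_index w' i - frob (vec_index w' i)" if "i < n" for i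
        using that w'c by (simp add: v_def)
      have w'i: "vec_index w' i = inverse (vec_index w j) * vec_index w i" if "i < n" for i
        using that wc by (simp add: w'_def)
      have "{i. i < n \<and> vec_index v i \<noteq> 0} \<subset> {i. i < n \<and> vec_index w i \<noteq> 0}"
      proof
        show "{i. i < n \<and> vec_index v i \<noteq> 0} \<subseteq> {i. i < n \<and> vec_index w i \<noteq> 0}"
          using vi w'i by auto
        have "vec_index v j = 0" using j by (simp add: vi w'i)
        then show "{i. i < n \<and> vec_index v i \<noteq> 0} \<noteq> {i. i < n \<and> vec_index w i \<noteq> 0}" using j by blast
      qed
      then have "card {i. i < n \<and> vec_index v i \<noteq> 0} < card {i. i < n \<and> vec_index w i \<noteq> 0}"
        by (intro psubset_card_mono) auto
      then have "v \<in> fixed_span W n" using less.hyps vW by blast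
      then obtain x where x: "x \<in> fixed_span W n" "x + (-1) \<cdot>\<^sub>v map_vec frob x = v" using fixed_span_lang sub by blast
      have xW: "x \<in> W" using x(1) \<open>fixed_span W n \<subseteq> W\<close> by blast
      then have xc: "x \<in> carrier_vec n" using sub by blast
      define e where "e = w' + (-1) \<cdot>\<^sub>v x"
      have eW: "e \<in> W" unfolding e_def by (rule ac[OF w'W sc[OF xW]])
      have "map_vec frob e = e"
      proof (rule eq_vecI)
        fix i assume "i < dim_vec e"
        then have i: "i < n" using xc by (simp add: e_def)
        have "vec_index (x + (-1) \<cdot>\<^sub>v map_vec frob x) i = vec_index v i" using x(2) by simp
        then have "vec_index x i - frob (vec_index x i) = vec_index w' i - frob (vec_index w' i)"
          using i xc by (simp add: vi)
        moreover have "frob (vec_index w' i - vec_index x i) = frob (vec_index w' i) - frob (vec_index x i)"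
          using frob_add[of "vec_index w' i - vec_index x i" "vec_index x i"] by simp
        ultimately show "vec_index (map_vec frob e) i = vec_index e i"
          using i xc w'c by (simp add: e_def) (simp add: algebra_simps)
      qed simp
      then have "x + 1 \<cdot>\<^sub>v e \<in> fixed_span W n" by (rule fixed_span.add[OF x(1) eW])
      moreover have "x + 1 \<cdot>\<^sub>v e = w'" using xc w'c by (intro eq_vecI) (auto simp: e_def)
      ultimately have "vec_index w j \<cdot>\<^sub>v w' \<in> fixed_span W n" using fixed_span_smult sub by metis
      moreover have "vec_index w j \<cdot>\<^sub>v w' = w" using j wc by (intro eq_vecI) (auto simp: w'_def)
      ultimately show ?thesis by simp
    qed (simp add: fixed_span.zero)
  qed
  ultimately show ?thesis by blast
qed

text \<open>Without finiteness the sums over Frobenius-fixed points would be 0 by convention. A stable subspace is determined by its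
  fixed vectors, of which there are at most \<open>q ^ n\<close>.\<close>

lemma finite_frob_stable:
  "finite {W :: 'k :: {field, finite} alg_closure vec set. VectorSpace.subspace class_ring W (kvec n) \<and> map_vec frob ` W = W}"
  (is "finite ?S")
proof (rule inj_on_finite)
  let ?fix = "{v :: 'k alg_closure vec. v \<in> carrier_vec n \<and> map_vec frob v = v}"
  show "(\<lambda>W. W \<inter> ?fix) ` ?S \<subseteq> Pow ?fix" by auto
  show "finite (Pow ?fix)"
  proof -
    have "?fix \<subseteq> (\<lambda>M. col (Mac M) 0) ` carrier_mat n 1"
    proof
      fix v :: "'k alg_closure vec" assume v: "v \<in> ?fix"
      define A where "A = mat n 1 (\<lambda>(i, j). vec_index v i)"
      have "map_mat frob A = A"
      proof (rule eq_matI)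
        fix i j assume "i < dim_row A" "j < dim_col A"
        then have i: "i < n" "j < 1" by (auto simp: A_def)
        have vc: "v \<in> carrier_vec n" and vf: "map_vec frob v = v" using v by auto
        have "frob (vec_index v i) = vec_index (map_vec frob v) i" using i vc by simp
        also have "\<dots> = vec_index v i" unfolding vf ..
        finally show "map_mat frob A $$ (i, j) = A $$ (i, j)" using i by (simp add: A_def)
      qed auto
      then obtain M where "M \<in> carrier_mat n 1" "A = Mac M" using frob_fixed_mat[of A n 1] by (auto simp: A_def)
      moreover have "v = col A 0" using v by (intro eq_vecI) (auto simp: A_def)
      ultimately show "v \<in> (\<lambda>M. col (Mac M) 0) ` carrier_mat n 1" by auto
    qed
    moreover have "finite ((\<lambda>M. col (Mac M) 0) ` (carrier_mat n 1 :: 'k mat set))" by (intro finite_imageI finite_carrier_mat)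
    ultimately have "finite ?fix" by (rule finite_subset)
    then show ?thesis by simp
  qed
  have *: "fixed_span W n = fixed_span (W \<inter> ?fix) n" if "W \<subseteq> carrier_vec n" for W
  proof (intro subset_antisym subsetI)
    fix u assume "u \<in> fixed_span W n"
    then show "u \<in> fixed_span (W \<inter> ?fix) n" by induction (use that in \<open>auto intro: fixed_span.intros\<close>)
  next
    fix u assume "u \<in> fixed_span (W \<inter> ?fix) n"
    then show "u \<in> fixed_span W n" by induction (auto intro: fixed_span.intros)
  qed
  show "inj_on (\<lambda>W. W \<inter> ?fix) ?S"
  proof (rule inj_onI)
    fix W W' assume W: "W \<in> ?S" "W' \<in> ?S" and eq: "W \<inter> ?fix = W' \<inter> ?fix"
    have sp: "V = fixed_span (V \<inter> ?fix) n" if V: "V \<in> ?S" for V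
    proof -
      have s: "VectorSpace.subspace class_ring V (kvec n)" and F: "map_vec frob ` V = V" using V by simp_all
      have "V = fixed_span V n" by (rule frob_stable_eq_fixed_span[OF s F])
      also have "\<dots> = fixed_span (V \<inter> ?fix) n" by (rule *[OF subspace_cosets(1)[OF s]])
      finally show ?thesis .
    qed
    have "W = fixed_span (W \<inter> ?fix) n" by (rule sp[OF W(1)])
    also have "\<dots> = fixed_span (W' \<inter> ?fix) n" by (rule arg_cong[OF eq, of "\<lambda>V. fixed_span V n"])
    also have "\<dots> = W'" by (rule sp[OF W(2), symmetric])
    finally show "W = W'" .
  qed
qed

section \<open>The maps induced by an arrow on quotient and subspace\<close>

text \<open>The matrix \<open>x\<close> of an arrow, with invertible matrices \<open>H\<close> at its tail and \<open>G\<close> at its head. Its matrix \<open>y\<close> in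
  the new coordinates shows whether the arrow respects the subspaces, and its diagonal blocks are the induced maps.\<close>

locale GLarrow = G: GLdata r1 r2 G + H: GLdata c1 c2 H
  for r1 r2 c1 c2 :: nat and G H :: "'a :: field mat" +
  fixes x :: "'a mat"
  assumes x: "x \<in> carrier_mat (r1 + r2) (c1 + c2)"
begin

definition y where "y = G * x * minv H"

lemma y: "y \<in> carrier_mat (r1 + r2) (c1 + c2)"
  unfolding y_def by (rule mult_carrier_mat[OF mult_carrier_mat[OF G.Gc x] H.Gi])

lemma G_x: "v \<in> carrier_vec (c1 + c2) \<Longrightarrow> G *\<^sub>v (x *\<^sub>v v) = y *\<^sub>v (H *\<^sub>v v)"
proof -
  assume v: "v \<in> carrier_vec (c1 + c2)"
  have "y *\<^sub>v (H *\<^sub>v v) = (y * H) *\<^sub>v v" by (rule assoc_mult_mat_vec[OF y H.Gc v, symmetric])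
  also have "y * H = G * x" unfolding y_def by (rule GL_cancel_right(2)[OF H.G mult_carrier_mat[OF G.Gc x]])
  also have "(G * x) *\<^sub>v v = G *\<^sub>v (x *\<^sub>v v)" by (rule assoc_mult_mat_vec[OF G.Gc x v])
  finally show ?thesis by simp
qed

lemma xv: "v \<in> carrier_vec (c1 + c2) \<Longrightarrow> x *\<^sub>v v \<in> carrier_vec (r1 + r2)" using x by (rule mult_mat_vec_carrier)

lemma zero_mult: "Y \<in> carrier_mat m n \<Longrightarrow> Y *\<^sub>v 0\<^sub>v n = 0\<^sub>v m" for Y :: "'a mat"
  by (intro eq_vecI) (auto simp: scalar_prod_def)

lemma first_Low:
  assumes L: "y \<in> Low r1 r2 c1 c2" and v: "v \<in> carrier_vec (c1 + c2)"
  shows "vec_first (G *\<^sub>v (x *\<^sub>v v)) r1 = TL r1 c1 y *\<^sub>v vec_first (H *\<^sub>v v) c1"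
proof -
  let ?u = "vec_first (H *\<^sub>v v) c1" and ?t = "vec_last (H *\<^sub>v v) c2"
  have s: "H *\<^sub>v v = ?u @\<^sub>v ?t" using mult_mat_vec_carrier[OF H.Gc v] by simp
  have "vec_first (G *\<^sub>v (x *\<^sub>v v)) r1 = vec_first (y *\<^sub>v (?u @\<^sub>v ?t)) r1" using G_x[OF v] s by simp
  also have "\<dots> = TL r1 c1 y *\<^sub>v ?u + blk 0 c1 r1 c2 y *\<^sub>v ?t"
    by (rule mult_append_vec(1)[OF y]) simp_all
  also have "blk 0 c1 r1 c2 y *\<^sub>v ?t = 0\<^sub>v r1" using L by (auto simp: Low_def scalar_prod_def intro!: eq_vecI)
  finally show ?thesis using right_zero_vec[OF mult_mat_vec_carrier[OF blk_carrier, of ?u c1 0 0 r1 y]] by simp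
qed

lemma stable_iff: "(\<forall>v\<in>Wg c1 c2 H. x *\<^sub>v v \<in> Wg r1 r2 G) \<longleftrightarrow> y \<in> Low r1 r2 c1 c2"
proof
  assume s: "\<forall>v\<in>Wg c1 c2 H. x *\<^sub>v v \<in> Wg r1 r2 G"
  have "blk 0 c1 r1 c2 y = 0\<^sub>m r1 c2"
  proof (rule mat_eqI_mult_vec[of _ r1 c2])
    fix t :: "'a vec" assume t: "t \<in> carrier_vec c2"
    note v = H.rho2_lift(1)[OF t] H.lift(1,2)[OF zero_carrier_vec t]
    have "0\<^sub>v r1 = vec_first (y *\<^sub>v (0\<^sub>v c1 @\<^sub>v t)) r1"
      using bspec[OF s v(1)] G_x[OF v(2)] by (simp add: Wfib_def v(3))
    also have "\<dots> = TL r1 c1 y *\<^sub>v 0\<^sub>v c1 + blk 0 c1 r1 c2 y *\<^sub>v t"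
      by (rule mult_append_vec(1)[OF y zero_carrier_vec t])
    also have "\<dots> = blk 0 c1 r1 c2 y *\<^sub>v t"
      unfolding zero_mult[OF blk_carrier] by (rule left_zero_vec[OF mult_mat_vec_carrier[OF blk_carrier t]])
    finally have "blk 0 c1 r1 c2 y *\<^sub>v t = 0\<^sub>v r1" ..
    moreover have "0\<^sub>m r1 c2 *\<^sub>v t = 0\<^sub>v r1" using t by (intro eq_vecI) (auto simp: scalar_prod_def)
    ultimately show "blk 0 c1 r1 c2 y *\<^sub>v t = 0\<^sub>m r1 c2 *\<^sub>v t" by simp
  qed auto
  then show "y \<in> Low r1 r2 c1 c2" using y by (simp add: Low_def)
next
  assume L: "y \<in> Low r1 r2 c1 c2"
  show "\<forall>v\<in>Wg c1 c2 H. x *\<^sub>v v \<in> Wg r1 r2 G"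
  proof
    fix v assume "v \<in> Wg c1 c2 H"
    then have v: "v \<in> carrier_vec (c1 + c2)" "vec_first (H *\<^sub>v v) c1 = 0\<^sub>v c1" by (auto simp: Wfib_def)
    have "vec_first (G *\<^sub>v (x *\<^sub>v v)) r1 = TL r1 c1 y *\<^sub>v vec_first (H *\<^sub>v v) c1"
      by (rule first_Low[OF L v(1)])
    then show "x *\<^sub>v v \<in> Wg r1 r2 G" using xv[OF v(1)] by (simp add: Wfib_def v(2) zero_mult[of _ r1])
  qed
qed

lemma quot_arrow:
  assumes L: "y \<in> Low r1 r2 c1 c2" and u: "u \<in> carrier_vec c1"
  shows "rho1 r1 r2 G (\<Union>w\<in>the_inv_into (carrier (quot_module (kvec (c1 + c2)) (Wg c1 c2 H))) (rho1 c1 c2 H) u.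
    Wg r1 r2 G +>\<^bsub>kvec (r1 + r2)\<^esub> (x *\<^sub>v w)) = TL r1 c1 y *\<^sub>v u"
proof -
  have "the_inv_into (carrier (quot_module (kvec (c1 + c2)) (Wg c1 c2 H))) (rho1 c1 c2 H) u = Wfib c1 c2 H u"
  proof (rule the_inv_into_f_eq)
    show "inj_on (rho1 c1 c2 H) (carrier (quot_module (kvec (c1 + c2)) (Wg c1 c2 H)))"
      using H.rho1_iso by (auto simp: lin_isos_def bij_betw_def)
  qed (use u in \<open>auto simp: H.rho1_Wfib H.quot_carrier\<close>)
  moreover have "Wg r1 r2 G +>\<^bsub>kvec (r1 + r2)\<^esub> (x *\<^sub>v w) = Wfib r1 r2 G (TL r1 c1 y *\<^sub>v u)" if "w \<in> Wfib c1 c2 H u" for w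
    using that first_Low[OF L, of w] by (subst G.coset_Wg) (auto simp: Wfib_def xv)
  ultimately have "(\<Union>w\<in>the_inv_into (carrier (quot_module (kvec (c1 + c2)) (Wg c1 c2 H))) (rho1 c1 c2 H) u.
    Wg r1 r2 G +>\<^bsub>kvec (r1 + r2)\<^esub> (x *\<^sub>v w)) = Wfib r1 r2 G (TL r1 c1 y *\<^sub>v u)"
    using H.Wfib_nonempty[OF u] by auto
  then show ?thesis using G.rho1_Wfib[OF mult_mat_vec_carrier[OF blk_carrier u]] by simp
qed

lemma sub_arrow:
  assumes L: "y \<in> Low r1 r2 c1 c2" and t: "t \<in> carrier_vec c2"
  shows "rho2 r1 r2 G (x *\<^sub>v the_inv_into (Wg c1 c2 H) (rho2 c1 c2 H) t) = BR r1 r2 c1 c2 y *\<^sub>v t"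
proof -
  note v = H.rho2_lift[OF t] H.lift(1,2)[OF zero_carrier_vec t]
  have "the_inv_into (Wg c1 c2 H) (rho2 c1 c2 H) t = H.lift (0\<^sub>v c1) t"
    using H.rho2_bij v by (intro the_inv_into_f_eq) (auto simp: bij_betw_def)
  moreover have "x *\<^sub>v H.lift (0\<^sub>v c1) t \<in> Wg r1 r2 G" using L v(1) stable_iff by blast
  moreover have "vec_last (G *\<^sub>v (x *\<^sub>v H.lift (0\<^sub>v c1) t)) r2 = BR r1 r2 c1 c2 y *\<^sub>v t"
  proof -
    have "vec_last (y *\<^sub>v (0\<^sub>v c1 @\<^sub>v t)) r2 = blk r1 0 r2 c1 y *\<^sub>v 0\<^sub>v c1 + BR r1 r2 c1 c2 y *\<^sub>v t"
      by (rule mult_append_vec(2)[OF y zero_carrier_vec t])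
    also have "\<dots> = BR r1 r2 c1 c2 y *\<^sub>v t"
      unfolding zero_mult[OF blk_carrier] by (rule left_zero_vec[OF mult_mat_vec_carrier[OF blk_carrier t]])
    finally show ?thesis by (simp add: G_x[OF v(3)] v(4))
  qed
  ultimately show ?thesis by (simp add: rho2_def)
qed

end

section \<open>The comultiplication in terms of matrices over the finite field\<close>

lemma rep_space_mreps: "rep_space Q \<alpha> = mreps Q \<alpha>"
  by (simp add: rep_space_def mreps_def)

lemma ring_mat_Units: "Units (ring_mat TYPE('a :: field) n b) = GL n"
proof (intro subset_antisym subsetI)
  fix A :: "'a mat" assume "A \<in> Units (ring_mat TYPE('a) n b)"
  then show "A \<in> GL n" using unit_imp_det_non_zero[of A n b] by (auto simp: GL_def Units_def ring_mat_simps)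
next
  fix A :: "'a mat" assume "A \<in> GL n"
  then show "A \<in> Units (ring_mat TYPE('a) n b)" using det_non_zero_imp_unit[of A n b] by (auto simp: GL_def)
qed

lemma ring_mat_inv:
  fixes A :: "'a :: field mat"
  assumes A: "A \<in> GL n"
  shows "inv\<^bsub>ring_mat TYPE('a) n b\<^esub> A = minv A"
proof -
  interpret R: ring "ring_mat TYPE('a) n b" by (rule ring_mat)
  have U: "A \<in> Units (ring_mat TYPE('a) n b)" using A by (simp add: ring_mat_Units)
  have "A * inv\<^bsub>ring_mat TYPE('a) n b\<^esub> A = 1\<^sub>m n" using R.Units_r_inv[OF U] by (simp add: ring_mat_simps)
  moreover have "inv\<^bsub>ring_mat TYPE('a) n b\<^esub> A \<in> carrier_mat n n" using R.Units_inv_closed[OF U] by (simp add: ring_mat_simps)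
  ultimately show ?thesis using minv_unique[OF GL_carrier[OF A]] by simp
qed

definition Mrep :: "('v, 'h) pre_digraph \<Rightarrow> ('h \<Rightarrow> 'k :: field mat) \<Rightarrow> ('h, 'k) rep" where
  "Mrep Q x = (\<lambda>h\<in>arcs Q. Mac (x h))"

definition Mfam :: "('v, 'h) pre_digraph \<Rightarrow> ('v \<Rightarrow> 'k :: field mat) \<Rightarrow> ('v \<Rightarrow> 'k alg_closure mat)" where
  "Mfam Q g = (\<lambda>i\<in>verts Q. Mac (g i))"

text \<open>Collects the descent of single matrices, \<open>frob_fixed_mat\<close>, over an index set; it serves representations and group elements.\<close>

lemma frob_fixed_family:
  fixes f :: "'i \<Rightarrow> 'k :: {field, finite} alg_closure mat"
  assumes f: "f \<in> (\<Pi>\<^sub>E i\<in>I. carrier_mat (r i) (c i))" and F: "\<forall>i\<in>I. map_mat frob (f i) = f i"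
  obtains x :: "'i \<Rightarrow> 'k mat" where "x \<in> (\<Pi>\<^sub>E i\<in>I. carrier_mat (r i) (c i))" "f = (\<lambda>i\<in>I. Mac (x i))"
proof -
  have "\<forall>i\<in>I. \<exists>A :: 'k mat. A \<in> carrier_mat (r i) (c i) \<and> f i = Mac A"
  proof
    fix i assume i: "i \<in> I"
    then show "\<exists>A :: 'k mat. A \<in> carrier_mat (r i) (c i) \<and> f i = Mac A"
      using f F frob_fixed_mat[of "f i" "r i" "c i"] by (metis PiE_mem)
  qed
  from bchoice[OF this] obtain x :: "'i \<Rightarrow> 'k mat" where x: "\<forall>i\<in>I. x i \<in> carrier_mat (r i) (c i) \<and> f i = Mac (x i)" ..
  show ?thesis
  proof (rule that)
    show "restrict x I \<in> (\<Pi>\<^sub>E i\<in>I. carrier_mat (r i) (c i))" using x by auto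
    show "f = (\<lambda>i\<in>I. Mac (restrict x I i))" using f x by (auto simp: PiE_def extensional_def fun_eq_iff)
  qed
qed

context quiver
begin

lemma Mrep_bij: "bij_betw (Mrep Q) (mreps Q \<alpha>) (rep_space_F Q \<alpha> :: ('h, 'k :: {field, finite}) rep set)"
proof (rule bij_betw_imageI)
  show "inj_on (Mrep Q) (mreps Q \<alpha> :: ('h \<Rightarrow> 'k mat) set)"
  proof (rule inj_onI)
    fix x y :: "'h \<Rightarrow> 'k mat" assume xy: "x \<in> mreps Q \<alpha>" "y \<in> mreps Q \<alpha>" "Mrep Q x = Mrep Q y"
    have "Mac (x h) = Mac (y h)" if "h \<in> arcs Q" for h using fun_cong[OF xy(3), of h] that by (simp add: Mrep_def)
    then have "x h = y h" if "h \<in> arcs Q" for h using Mac_inj that by blast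
    then show "x = y" using xy(1,2) unfolding mreps_def by (intro PiE_ext)
  qed
  show "Mrep Q ` mreps Q \<alpha> = (rep_space_F Q \<alpha> :: ('h, 'k) rep set)"
  proof (intro subset_antisym subsetI)
    fix z :: "('h, 'k) rep" assume "z \<in> Mrep Q ` mreps Q \<alpha>"
    then obtain x where x: "x \<in> mreps Q \<alpha>" "z = Mrep Q x" by blast
    have "Mac (x h) \<in> carrier_mat (\<alpha> (head Q h)) (\<alpha> (tail Q h))" if "h \<in> arcs Q" for h
      using PiE_mem[OF x(1)[unfolded mreps_def] that] by simp
    then show "z \<in> rep_space_F Q \<alpha>" unfolding x(2) by (auto simp: rep_space_F_def rep_space_def Mrep_def)
  next
    fix z :: "('h, 'k) rep" assume "z \<in> rep_space_F Q \<alpha>"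
    then have z: "z \<in> (\<Pi>\<^sub>E h\<in>arcs Q. carrier_mat (\<alpha> (head Q h)) (\<alpha> (tail Q h)))" "\<forall>h\<in>arcs Q. map_mat frob (z h) = z h"
      by (auto simp: rep_space_F_def rep_space_def)
    obtain x :: "'h \<Rightarrow> 'k mat" where "x \<in> (\<Pi>\<^sub>E h\<in>arcs Q. carrier_mat (\<alpha> (head Q h)) (\<alpha> (tail Q h)))" "z = (\<lambda>i\<in>arcs Q. Mac (x i))"
      using frob_fixed_family[OF z] by blast
    then show "z \<in> Mrep Q ` mreps Q \<alpha>" by (auto simp: mreps_def Mrep_def)
  qed
qed

lemma Mrep_mem: "x \<in> mreps Q \<alpha> \<Longrightarrow> Mrep Q x \<in> rep_space_F Q \<alpha>" for x :: "'h \<Rightarrow> 'k :: {field, finite} mat"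
  using bij_betwE[OF Mrep_bij] by blast

lemma Mrep_eq_iff: "x \<in> mreps Q \<alpha> \<Longrightarrow> y \<in> mreps Q \<alpha> \<Longrightarrow> Mrep Q x = Mrep Q y \<longleftrightarrow> x = y" for x y :: "'h \<Rightarrow> 'k :: {field, finite} mat"
  using inj_on_eq_iff[OF bij_betw_imp_inj_on[OF Mrep_bij]] by blast

lemma Mrep_mreps: "x \<in> mreps Q \<alpha> \<Longrightarrow> Mrep Q x \<in> mreps Q \<alpha>" for x :: "'h \<Rightarrow> 'k :: {field, finite} mat"
  using Mrep_mem[of x \<alpha>] by (simp add: rep_space_F_def rep_space_mreps)

lemma gl_mGL: "gl Q \<alpha> = mGL Q \<alpha>" by (simp add: gl_def mGL_def ring_mat_Units)

lemma Mfam_bij: "bij_betw (Mfam Q) (mGL Q \<alpha>) (gl_F Q \<alpha> :: ('v \<Rightarrow> 'k :: {field, finite} alg_closure mat) set)"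
proof (rule bij_betw_imageI)
  show "inj_on (Mfam Q) (mGL Q \<alpha> :: ('v \<Rightarrow> 'k mat) set)"
  proof (rule inj_onI)
    fix x y :: "'v \<Rightarrow> 'k mat" assume xy: "x \<in> mGL Q \<alpha>" "y \<in> mGL Q \<alpha>" "Mfam Q x = Mfam Q y"
    have "Mac (x h) = Mac (y h)" if "h \<in> verts Q" for h using fun_cong[OF xy(3), of h] that by (simp add: Mfam_def)
    then have "x h = y h" if "h \<in> verts Q" for h using Mac_inj that by blast
    then show "x = y" using xy(1,2) unfolding mGL_def by (intro PiE_ext)
  qed
  show "Mfam Q ` mGL Q \<alpha> = (gl_F Q \<alpha> :: ('v \<Rightarrow> 'k alg_closure mat) set)"
  proof (intro subset_antisym subsetI)
    fix z :: "'v \<Rightarrow> 'k alg_closure mat" assume "z \<in> Mfam Q ` mGL Q \<alpha>"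
    then show "z \<in> gl_F Q \<alpha>" by (auto simp: gl_F_def gl_mGL Mfam_def mGL_def Mac_GL)
  next
    fix z :: "'v \<Rightarrow> 'k alg_closure mat" assume "z \<in> gl_F Q \<alpha>"
    then have z: "z \<in> mGL Q \<alpha>" "\<forall>i\<in>verts Q. map_mat frob (z i) = z i" by (auto simp: gl_F_def gl_mGL)
    have z1: "z \<in> (\<Pi>\<^sub>E i\<in>verts Q. carrier_mat (\<alpha> i) (\<alpha> i))" using z(1) by (auto simp: mGL_def PiE_def Pi_def GL_carrier)
    obtain x :: "'v \<Rightarrow> 'k mat" where x: "x \<in> (\<Pi>\<^sub>E i\<in>verts Q. carrier_mat (\<alpha> i) (\<alpha> i))" "z = (\<lambda>i\<in>verts Q. Mac (x i))"
      using frob_fixed_family[OF z1 z(2)] by blast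
    have "x i \<in> GL (\<alpha> i)" if "i \<in> verts Q" for i
      using z(1) that unfolding x(2) mGL_def by (auto simp: Mac_GL PiE_def Pi_def)
    then have "x \<in> mGL Q \<alpha>" using x(1) by (auto simp: mGL_def PiE_def)
    then show "z \<in> Mfam Q ` mGL Q \<alpha>" using x(2) by (auto simp: Mfam_def)
  qed
qed

lemma card_gl_F: "card (gl_F Q \<alpha> :: ('v \<Rightarrow> 'k :: {field, finite} alg_closure mat) set) = card (mGL Q \<alpha> :: ('v \<Rightarrow> 'k mat) set)"
  using bij_betw_same_card[OF Mfam_bij] by metis

lemma Mfam_mGL: "g \<in> mGL Q \<alpha> \<Longrightarrow> Mfam Q g \<in> mGL Q \<alpha>" for g :: "'v \<Rightarrow> 'k :: {field, finite} mat"
  by (auto simp: Mfam_def mGL_def Mac_GL)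

lemma mact_Mrep:
  fixes g :: "'v \<Rightarrow> 'k :: {field, finite} mat"
  assumes g: "g \<in> mGL Q \<gamma>" and x: "x \<in> mreps Q \<gamma>"
  shows "mact Q (Mfam Q g) (Mrep Q x) = Mrep Q (mact Q g x)"
proof
  fix h
  show "mact Q (Mfam Q g) (Mrep Q x) h = Mrep Q (mact Q g x) h"
  proof (cases "h \<in> arcs Q")
    case True
    define m n where "m = \<gamma> (head Q h)" and "n = \<gamma> (tail Q h)"
    have G: "g (head Q h) \<in> GL m" "g (tail Q h) \<in> GL n" and xh: "x h \<in> carrier_mat m n"
      using g x True by (auto simp: mGL_def mreps_def m_def n_def PiE_def Pi_def)
    have "Mac (g (head Q h) * x h * minv (g (tail Q h))) = Mac (g (head Q h)) * Mac (x h) * minv (Mac (g (tail Q h)))"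
      by (simp only: Mac_mult[OF mult_carrier_mat[OF GL_carrier[OF G(1)] xh] minv(1)[OF G(2)]]
          Mac_mult[OF GL_carrier[OF G(1)] xh] Mac_minv[OF G(2)])
    then show ?thesis using True by (simp add: mact_def Mfam_def Mrep_def)
  qed (simp add: mact_def Mrep_def)
qed

lemma gl_act_Mrep:
  fixes g :: "'v \<Rightarrow> 'k :: {field, finite} mat"
  assumes g: "g \<in> mGL Q \<gamma>" and x: "x \<in> mreps Q \<gamma>"
  shows "gl_act Q \<gamma> (Mfam Q g) (Mrep Q x) = Mrep Q (mact Q g x)"
proof -
  have "Mac (g (tail Q h)) \<in> GL (\<gamma> (tail Q h))" if "h \<in> arcs Q" for h
    using g that by (auto simp: mGL_def Mac_GL)
  then have "gl_act Q \<gamma> (Mfam Q g) (Mrep Q x) = mact Q (Mfam Q g) (Mrep Q x)"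
    by (auto simp: gl_act_def mact_def Mfam_def ring_mat_inv intro!: restrict_ext)
  then show ?thesis using mact_Mrep[OF g x] by simp
qed

lemma Mrep_mLow: "x \<in> mreps Q (\<alpha> + \<beta>) \<Longrightarrow> Mrep Q x \<in> mLow Q \<alpha> \<beta> \<longleftrightarrow> x \<in> mLow Q \<alpha> \<beta>"
  for x :: "'h \<Rightarrow> 'k :: {field, finite} mat"
  by (auto simp: mreps_def mLow_def Mrep_def PiE_def Pi_def Mac_Low)

lemma Mrep_TL: "mTL Q \<alpha> (Mrep Q x) = Mrep Q (mTL Q \<alpha> x)"
  and Mrep_BR: "mBR Q \<alpha> \<beta> (Mrep Q x) = Mrep Q (mBR Q \<alpha> \<beta> x)"
  if x: "x \<in> mreps Q (\<alpha> + \<beta>)"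
  for x :: "'h \<Rightarrow> 'k :: {field, finite} mat"
proof -
  have "dim_row (x h) = \<alpha> (head Q h) + \<beta> (head Q h)" "dim_col (x h) = \<alpha> (tail Q h) + \<beta> (tail Q h)"
    if h: "h \<in> arcs Q" for h using PiE_mem[OF x[unfolded mreps_def] h] by auto
  then show "mTL Q \<alpha> (Mrep Q x) = Mrep Q (mTL Q \<alpha> x)" "mBR Q \<alpha> \<beta> (Mrep Q x) = Mrep Q (mBR Q \<alpha> \<beta> x)"
    by (auto simp: mTL_def mBR_def Mrep_def intro!: restrict_ext Mac_blk)
qed

definition Wfam :: "('v \<Rightarrow> nat) \<Rightarrow> ('v \<Rightarrow> nat) \<Rightarrow> ('v \<Rightarrow> 'a :: field mat) \<Rightarrow> 'v \<Rightarrow> 'a vec set" where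
  "Wfam \<alpha> \<beta> G = (\<lambda>i\<in>verts Q. Wg (\<alpha> i) (\<beta> i) (G i))"

definition rho1fam :: "('v \<Rightarrow> nat) \<Rightarrow> ('v \<Rightarrow> nat) \<Rightarrow> ('v \<Rightarrow> 'a :: field mat) \<Rightarrow> 'v \<Rightarrow> 'a vec set \<Rightarrow> 'a vec" where
  "rho1fam \<alpha> \<beta> G = (\<lambda>i\<in>verts Q. rho1 (\<alpha> i) (\<beta> i) (G i))"

definition rho2fam :: "('v \<Rightarrow> nat) \<Rightarrow> ('v \<Rightarrow> nat) \<Rightarrow> ('v \<Rightarrow> 'a :: field mat) \<Rightarrow> 'v \<Rightarrow> 'a vec \<Rightarrow> 'a vec" where
  "rho2fam \<alpha> \<beta> G = (\<lambda>i\<in>verts Q. rho2 (\<alpha> i) (\<beta> i) (G i))"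

lemma GLarrowI:
  assumes "G \<in> mGL Q (\<alpha> + \<beta>)" "x \<in> mreps Q (\<alpha> + \<beta>)" "h \<in> arcs Q"
  shows "GLarrow (\<alpha> (head Q h)) (\<beta> (head Q h)) (\<alpha> (tail Q h)) (\<beta> (tail Q h)) (G (head Q h)) (G (tail Q h)) (x h)"
  using assms by unfold_locales (auto simp: mGL_def mreps_def PiE_def Pi_def)

lemma stabilizes_iff:
  assumes G: "G \<in> mGL Q (\<alpha> + \<beta>)" and x: "x \<in> mreps Q (\<alpha> + \<beta>)"
  shows "stabilizes Q x (Wfam \<alpha> \<beta> G) \<longleftrightarrow> mact Q G x \<in> mLow Q \<alpha> \<beta>"
proof -
  have "(\<forall>v\<in>Wfam \<alpha> \<beta> G (tail Q h). x h *\<^sub>v v \<in> Wfam \<alpha> \<beta> G (head Q h)) \<longleftrightarrow>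
    mact Q G x h \<in> Low (\<alpha> (head Q h)) (\<beta> (head Q h)) (\<alpha> (tail Q h)) (\<beta> (tail Q h))" if h: "h \<in> arcs Q" for h
  proof -
    interpret GLarrow "\<alpha> (head Q h)" "\<beta> (head Q h)" "\<alpha> (tail Q h)" "\<beta> (tail Q h)" "G (head Q h)" "G (tail Q h)" "x h"
      by (rule GLarrowI[OF G x h])
    show ?thesis using stable_iff h by (simp add: Wfam_def mact_def y_def)
  qed
  then show ?thesis by (auto simp: stabilizes_def mLow_def PiE_def Pi_def mact_def)
qed

lemma quot_rep_eq:
  assumes G: "G \<in> mGL Q (\<alpha> + \<beta>)" and x: "x \<in> mreps Q (\<alpha> + \<beta>)" and L: "mact Q G x \<in> mLow Q \<alpha> \<beta>"
  shows "quot_rep Q (\<alpha> + \<beta>) \<alpha> x (Wfam \<alpha> \<beta> G) (rho1fam \<alpha> \<beta> G) = mTL Q \<alpha> (mact Q G x)"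
    "sub_rep Q \<beta> x (Wfam \<alpha> \<beta> G) (rho2fam \<alpha> \<beta> G) = mBR Q \<alpha> \<beta> (mact Q G x)"
proof -
  have *: "quot_rep Q (\<alpha> + \<beta>) \<alpha> x (Wfam \<alpha> \<beta> G) (rho1fam \<alpha> \<beta> G) h = mTL Q \<alpha> (mact Q G x) h \<and>
    sub_rep Q \<beta> x (Wfam \<alpha> \<beta> G) (rho2fam \<alpha> \<beta> G) h = mBR Q \<alpha> \<beta> (mact Q G x) h" if h: "h \<in> arcs Q" for h
  proof -
    interpret A: GLarrow "\<alpha> (head Q h)" "\<beta> (head Q h)" "\<alpha> (tail Q h)" "\<beta> (tail Q h)" "G (head Q h)" "G (tail Q h)" "x h"
      by (rule GLarrowI[OF G x h])
    have "mact Q G x h = A.y" using h by (simp add: mact_def A.y_def)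
    moreover have yL: "A.y \<in> Low (\<alpha> (head Q h)) (\<beta> (head Q h)) (\<alpha> (tail Q h)) (\<beta> (tail Q h))"
      using L h calculation by (auto simp: mLow_def PiE_def Pi_def)
    moreover have "mat_of_map (\<alpha> (tail Q h)) (\<alpha> (head Q h)) (\<lambda>u. rho1 (\<alpha> (head Q h)) (\<beta> (head Q h)) (G (head Q h))
        (\<Union>w\<in>the_inv_into (carrier (quot_module (kvec (\<alpha> (tail Q h) + \<beta> (tail Q h))) (Wg (\<alpha> (tail Q h)) (\<beta> (tail Q h)) (G (tail Q h)))))
          (rho1 (\<alpha> (tail Q h)) (\<beta> (tail Q h)) (G (tail Q h))) u.
          Wg (\<alpha> (head Q h)) (\<beta> (head Q h)) (G (head Q h)) +>\<^bsub>kvec (\<alpha> (head Q h) + \<beta> (head Q h))\<^esub> (x h *\<^sub>v w))) =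
      TL (\<alpha> (head Q h)) (\<alpha> (tail Q h)) A.y"
      by (rule mat_of_map_mult) (simp, rule A.quot_arrow[OF yL], simp)
    moreover have "mat_of_map (\<beta> (tail Q h)) (\<beta> (head Q h)) (\<lambda>u. rho2 (\<alpha> (head Q h)) (\<beta> (head Q h)) (G (head Q h))
        (x h *\<^sub>v the_inv_into (Wg (\<alpha> (tail Q h)) (\<beta> (tail Q h)) (G (tail Q h))) (rho2 (\<alpha> (tail Q h)) (\<beta> (tail Q h)) (G (tail Q h))) u)) =
      BR (\<alpha> (head Q h)) (\<beta> (head Q h)) (\<alpha> (tail Q h)) (\<beta> (tail Q h)) A.y"
      by (rule mat_of_map_mult) (simp, rule A.sub_arrow[OF yL], simp)
    ultimately show ?thesis
      using h by (simp add: quot_rep_def sub_rep_def mTL_def mBR_def Wfam_def rho1fam_def rho2fam_def)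
  qed
  show "quot_rep Q (\<alpha> + \<beta>) \<alpha> x (Wfam \<alpha> \<beta> G) (rho1fam \<alpha> \<beta> G) = mTL Q \<alpha> (mact Q G x)"
  proof
    fix h show "quot_rep Q (\<alpha> + \<beta>) \<alpha> x (Wfam \<alpha> \<beta> G) (rho1fam \<alpha> \<beta> G) h = mTL Q \<alpha> (mact Q G x) h"
      using * by (cases "h \<in> arcs Q") (auto simp: quot_rep_def mTL_def)
  qed
  show "sub_rep Q \<beta> x (Wfam \<alpha> \<beta> G) (rho2fam \<alpha> \<beta> G) = mBR Q \<alpha> \<beta> (mact Q G x)"
  proof
    fix h show "sub_rep Q \<beta> x (Wfam \<alpha> \<beta> G) (rho2fam \<alpha> \<beta> G) h = mBR Q \<alpha> \<beta> (mact Q G x) h"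
      using * by (cases "h \<in> arcs Q") (auto simp: sub_rep_def mBR_def)
  qed
qed

text \<open>The standard subspace and its identifications are those attached to the identity, so the general formulas for quotient and
  subrepresentation also compute \<open>kappa\<close>.\<close>

definition one_fam :: "('v \<Rightarrow> nat) \<Rightarrow> 'v \<Rightarrow> 'a :: field mat" where
  "one_fam \<gamma> = (\<lambda>i\<in>verts Q. 1\<^sub>m (\<gamma> i))"

lemma std_eq:
  "std_subspace Q \<alpha> \<beta> = Wfam \<alpha> \<beta> (one_fam (\<alpha> + \<beta>))"
  "std_quot_iso Q \<alpha> \<beta> = rho1fam \<alpha> \<beta> (one_fam (\<alpha> + \<beta>))"
  "std_sub_iso Q \<alpha> \<beta> = rho2fam \<alpha> \<beta> (one_fam (\<alpha> + \<beta>))"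
proof -
  have W: "{v \<in> carrier_vec (\<alpha> i + \<beta> i). vec_first v (\<alpha> i) = 0\<^sub>v (\<alpha> i)} = Wg (\<alpha> i) (\<beta> i) (1\<^sub>m (\<alpha> i + \<beta> i) :: 'd :: field mat)" for i
    by (auto simp: Wfib_def)
  show S: "std_subspace Q \<alpha> \<beta> = (Wfam \<alpha> \<beta> (one_fam (\<alpha> + \<beta>)) :: 'v \<Rightarrow> 'd :: field vec set)"
    by (auto simp: std_subspace_def Wfam_def one_fam_def W intro!: restrict_ext)
  show "std_sub_iso Q \<alpha> \<beta> = (rho2fam \<alpha> \<beta> (one_fam (\<alpha> + \<beta>)) :: 'v \<Rightarrow> 'd :: field vec \<Rightarrow> 'd vec)"
    unfolding std_sub_iso_def rho2fam_def S
    by (intro restrict_ext) (auto simp: rho2_def Wfam_def one_fam_def Wfib_def intro!: restrict_ext)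
  show "std_quot_iso Q \<alpha> \<beta> = (rho1fam \<alpha> \<beta> (one_fam (\<alpha> + \<beta>)) :: 'v \<Rightarrow> 'd :: field vec set \<Rightarrow> 'd vec)"
    unfolding std_quot_iso_def rho1fam_def S
  proof (intro restrict_ext)
    fix i assume i: "i \<in> verts Q"
    let ?G = "1\<^sub>m (\<alpha> i + \<beta> i) :: 'd mat"
    interpret D: GLdata "\<alpha> i" "\<beta> i" ?G by unfold_locales simp
    have "(\<lambda>A\<in>carrier (quot_module (kvec (\<alpha> i + \<beta> i)) (Wg (\<alpha> i) (\<beta> i) ?G)). the_elem ((\<lambda>v. vec_first v (\<alpha> i)) ` A)) =
      rho1 (\<alpha> i) (\<beta> i) ?G"
      unfolding rho1_def
    proof (intro restrict_ext)
      fix A assume "A \<in> carrier (quot_module (kvec (\<alpha> i + \<beta> i)) (Wg (\<alpha> i) (\<beta> i) ?G))"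
      then have "A \<subseteq> carrier_vec (\<alpha> i + \<beta> i)" unfolding D.quot_carrier by (auto simp: Wfib_def)
      then have "(\<lambda>v. vec_first v (\<alpha> i)) ` A = (\<lambda>v. vec_first (?G *\<^sub>v v) (\<alpha> i)) ` A"
        by (intro image_cong) auto
      then show "the_elem ((\<lambda>v. vec_first v (\<alpha> i)) ` A) = the_elem ((\<lambda>v. vec_first (?G *\<^sub>v v) (\<alpha> i)) ` A)" by simp
    qed
    then show "(\<lambda>A\<in>carrier (quot_module (kvec (\<alpha> i + \<beta> i)) (Wfam \<alpha> \<beta> (one_fam (\<alpha> + \<beta>)) i)). the_elem ((\<lambda>v. vec_first v (\<alpha> i)) ` A)) =
      rho1 (\<alpha> i) (\<beta> i) ((one_fam (\<alpha> + \<beta>) :: 'v \<Rightarrow> 'd mat) i)"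
      using i by (simp add: Wfam_def one_fam_def)
  qed
qed

lemma one_fam_mGL: "one_fam \<gamma> \<in> mGL Q \<gamma>" by (auto simp: one_fam_def mGL_def)

lemma mact_one: "x \<in> mreps Q \<gamma> \<Longrightarrow> mact Q (one_fam \<gamma>) x = x"
  by (auto simp: mact_def one_fam_def mreps_def PiE_def Pi_def extensional_def fun_eq_iff)

lemma stab_reps_F_eq:
  fixes x :: "'h \<Rightarrow> 'k :: {field, finite} mat"
  assumes x: "x \<in> mreps Q (\<alpha> + \<beta>)"
  shows "Mrep Q x \<in> stab_reps_F Q \<alpha> \<beta> \<longleftrightarrow> x \<in> mLow Q \<alpha> \<beta>"
    "x \<in> mLow Q \<alpha> \<beta> \<Longrightarrow> kappa Q \<alpha> \<beta> (Mrep Q x) = (Mrep Q (mTL Q \<alpha> x), Mrep Q (mBR Q \<alpha> \<beta> x))"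
proof -
  have X: "Mrep Q x \<in> mreps Q (\<alpha> + \<beta>)" by (rule Mrep_mreps[OF x])
  show "Mrep Q x \<in> stab_reps_F Q \<alpha> \<beta> \<longleftrightarrow> x \<in> mLow Q \<alpha> \<beta>"
    using Mrep_mem[OF x] X stabilizes_iff[OF one_fam_mGL X]
    by (simp add: stab_reps_F_def stab_reps_def std_eq rep_space_mreps mact_one[OF X] Mrep_mLow[OF x])
  assume "x \<in> mLow Q \<alpha> \<beta>"
  then have "mact Q (one_fam (\<alpha> + \<beta>)) (Mrep Q x) \<in> mLow Q \<alpha> \<beta>" by (simp add: mact_one[OF X] Mrep_mLow[OF x])
  from quot_rep_eq[OF one_fam_mGL X this]
  show "kappa Q \<alpha> \<beta> (Mrep Q x) = (Mrep Q (mTL Q \<alpha> x), Mrep Q (mBR Q \<alpha> \<beta> x))"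
    by (simp add: kappa_def std_eq mact_one[OF X] Mrep_TL[OF x] Mrep_BR[OF x])
qed

lemma comult_eq_kcomult:
  fixes f :: "('h, 'k :: {field, finite}) rep \<Rightarrow> 'c :: field_char_0"
  assumes u: "u \<in> mreps Q \<alpha>" and v: "v \<in> mreps Q \<beta>"
  shows "comult Q \<alpha> \<beta> f (Mrep Q u, Mrep Q v) = kcomult Q \<alpha> \<beta> (\<lambda>x. f (Mrep Q x)) u v"
proof -
  let ?S = "{x \<in> stab_reps_F Q \<alpha> \<beta>. kappa Q \<alpha> \<beta> x = (Mrep Q u, Mrep Q v)}"
  have "bij_betw (Mrep Q) (mfib Q \<alpha> \<beta> u v) ?S"
  proof (rule bij_betw_imageI)
    have sub: "mfib Q \<alpha> \<beta> u v \<subseteq> mreps Q (\<alpha> + \<beta>)" using mLow_mreps by (auto simp: mfib_def)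
    show "inj_on (Mrep Q) (mfib Q \<alpha> \<beta> u v)"
      by (rule inj_on_subset[OF bij_betw_imp_inj_on[OF Mrep_bij] sub])
    show "Mrep Q ` mfib Q \<alpha> \<beta> u v = ?S"
    proof (intro subset_antisym subsetI)
      fix z assume "z \<in> Mrep Q ` mfib Q \<alpha> \<beta> u v"
      then obtain x where x: "x \<in> mfib Q \<alpha> \<beta> u v" "z = Mrep Q x" by blast
      then show "z \<in> ?S" using stab_reps_F_eq[of x \<alpha> \<beta>] sub by (auto simp: mfib_def)
    next
      fix z assume z: "z \<in> ?S"
      then have "z \<in> rep_space_F Q (\<alpha> + \<beta>)" by (simp add: stab_reps_F_def)
      then obtain x where x: "x \<in> mreps Q (\<alpha> + \<beta>)" "z = Mrep Q x" using Mrep_bij[of "\<alpha> + \<beta>"] unfolding bij_betw_def by blast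
      then have L: "x \<in> mLow Q \<alpha> \<beta>" using z stab_reps_F_eq(1) by blast
      then have "Mrep Q (mTL Q \<alpha> x) = Mrep Q u" "Mrep Q (mBR Q \<alpha> \<beta> x) = Mrep Q v"
        using z stab_reps_F_eq(2)[OF x(1)] x(2) by auto
      then have "x \<in> mfib Q \<alpha> \<beta> u v"
        using L Mrep_eq_iff[OF mTL_mreps u] Mrep_eq_iff[OF mBR_mreps v] by (simp add: mfib_def)
      then show "z \<in> Mrep Q ` mfib Q \<alpha> \<beta> u v" using x(2) by blast
    qed
  qed
  then have s: "(\<Sum>z\<in>?S. f z) = (\<Sum>x\<in>mfib Q \<alpha> \<beta> u v. f (Mrep Q x))" by (rule sum.reindex_bij_betw[symmetric])
  have "comult_tilde Q \<alpha> \<beta> f (Mrep Q u, Mrep Q v) = (\<Sum>z\<in>?S. f z)"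
    using Mrep_mem[OF u] Mrep_mem[OF v] unfolding comult_tilde_def push_def pull_def
    by simp
  moreover have "(of_nat CARD('k) :: 'c) powi (- (\<Sum>i\<in>verts Q. int (\<alpha> i) * int (\<beta> i))) = inverse (of_nat (CARD('k) ^ vdim Q \<alpha> \<beta>))"
  proof -
    have "(\<Sum>i\<in>verts Q. int (\<alpha> i) * int (\<beta> i)) = int (vdim Q \<alpha> \<beta>)" by (simp add: vdim_def)
    then show ?thesis by (simp add: power_int_minus)
  qed
  ultimately show ?thesis using Mrep_mem[OF u] Mrep_mem[OF v] s by (simp add: comult_def kcomult_def)
qed

end

context quiver
begin

section \<open>The multiplication in terms of matrices over the finite field\<close>

lemma E1_F_iff:
  "(z, W, \<rho>1, \<rho>2) \<in> E1_F Q \<alpha> \<beta> \<longleftrightarrow> z \<in> rep_space_F Q (\<alpha> + \<beta>) \<and> stabilizes Q z W \<and>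
     W \<in> extensional (verts Q) \<and> \<rho>1 \<in> extensional (verts Q) \<and> \<rho>2 \<in> extensional (verts Q) \<and>
     (\<forall>i\<in>verts Q. (W i, \<rho>1 i, \<rho>2 i) \<in> locdata (\<alpha> i) (\<beta> i))"
  (is "?l \<longleftrightarrow> ?r")
proof
  assume ?l
  then show ?r
    by (simp add: E1_F_def E1_def E2_F_def E2_def graded_subspaces_def locdata_def PiE_def Pi_def)
next
  assume ?r
  then show ?l
    by (simp add: E1_F_def E1_def E2_F_def E2_def graded_subspaces_def locdata_def PiE_def Pi_def rep_space_F_def)
qed

text \<open>The point of \<open>E1_F\<close> over \<open>x\<close> that is encoded by \<open>g\<close>.\<close>

definition datum :: "('v \<Rightarrow> nat) \<Rightarrow> ('v \<Rightarrow> nat) \<Rightarrow> ('h \<Rightarrow> 'k :: {field, finite} mat) \<Rightarrow> ('v \<Rightarrow> 'k mat) \<Rightarrow>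
    ('h, 'k) rep \<times> ('v \<Rightarrow> 'k alg_closure vec set) \<times>
     ('v \<Rightarrow> 'k alg_closure vec set \<Rightarrow> 'k alg_closure vec) \<times> ('v \<Rightarrow> 'k alg_closure vec \<Rightarrow> 'k alg_closure vec)" where
  "datum \<alpha> \<beta> x g = (Mrep Q x, Wfam \<alpha> \<beta> (Mfam Q g), rho1fam \<alpha> \<beta> (Mfam Q g), rho2fam \<alpha> \<beta> (Mfam Q g))"

lemma datum_eq_iff:
  assumes "W \<in> extensional (verts Q)" "\<rho>1 \<in> extensional (verts Q)" "\<rho>2 \<in> extensional (verts Q)"
  shows "datum \<alpha> \<beta> x g = (Mrep Q x, W, \<rho>1, \<rho>2) \<longleftrightarrow> (\<forall>i\<in>verts Q. Psi (\<alpha> i) (\<beta> i) (g i) = (W i, \<rho>1 i, \<rho>2 i))"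
proof -
  have r: "restrict a (verts Q) = b \<longleftrightarrow> (\<forall>i\<in>verts Q. a i = b i)" if "b \<in> extensional (verts Q)" for a b :: "'v \<Rightarrow> 'z"
    using that by (metis extensionalityI restrict_apply restrict_extensional)
  show ?thesis
    unfolding datum_def prod.inject Wfam_def rho1fam_def rho2fam_def r[OF assms(1)] r[OF assms(2)] r[OF assms(3)]
    by (auto simp: Psi_def Mfam_def)
qed

lemma datum_mem:
  fixes x :: "'h \<Rightarrow> 'k :: {field, finite} mat"
  assumes x: "x \<in> mreps Q (\<alpha> + \<beta>)" and g: "g \<in> mGL Q (\<alpha> + \<beta>)"
  shows "datum \<alpha> \<beta> x g \<in> E1_F Q \<alpha> \<beta> \<longleftrightarrow> mact Q g x \<in> mLow Q \<alpha> \<beta>"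
proof -
  have st: "stabilizes Q (Mrep Q x) (Wfam \<alpha> \<beta> (Mfam Q g)) \<longleftrightarrow> mact Q g x \<in> mLow Q \<alpha> \<beta>"
    unfolding stabilizes_iff[OF Mfam_mGL[OF g] Mrep_mreps[OF x]] mact_Mrep[OF g x] by (rule Mrep_mLow[OF mact_closed[OF g x]])
  have loc: "(Wfam \<alpha> \<beta> (Mfam Q g) i, rho1fam \<alpha> \<beta> (Mfam Q g) i, rho2fam \<alpha> \<beta> (Mfam Q g) i) \<in> locdata (\<alpha> i) (\<beta> i)"
    if i: "i \<in> verts Q" for i
  proof -
    have "g i \<in> GL (\<alpha> i + \<beta> i)" using PiE_mem[OF g[unfolded mGL_def] i] by simp
    from Psi_locdata[OF this] show ?thesis using i by (simp add: Psi_def Wfam_def rho1fam_def rho2fam_def Mfam_def)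
  qed
  show ?thesis unfolding datum_def E1_F_iff st
    using loc Mrep_mem[OF x] by (simp add: Wfam_def rho1fam_def rho2fam_def)
qed

text \<open>The fibre is a product over the vertices, and \<open>card_Psi_fibre\<close> gives the factors. Stability of the subspace under \<open>x\<close> amounts, by
  \<open>datum_mem\<close>, to the condition on \<open>g\<close>, which therefore holds on the whole fibre of a point of \<open>E1_F\<close>.\<close>

lemma card_datum_fibre:
  fixes x :: "'h \<Rightarrow> 'k :: {field, finite} mat"
  assumes x: "x \<in> mreps Q (\<alpha> + \<beta>)" and e: "e \<in> E1_F Q \<alpha> \<beta>" "fst e = Mrep Q x"
  shows "card {g \<in> {g \<in> mGL Q (\<alpha> + \<beta>). mact Q g x \<in> mLow Q \<alpha> \<beta>}. datum \<alpha> \<beta> x g = e} = CARD('k) ^ vdim Q \<alpha> \<beta>"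
proof -
  obtain W \<rho>1 \<rho>2 where eq: "e = (Mrep Q x, W, \<rho>1, \<rho>2)" using e(2) by (metis prod.collapse)
  note m = e(1)[unfolded eq E1_F_iff]
  have ext: "W \<in> extensional (verts Q)" "\<rho>1 \<in> extensional (verts Q)" "\<rho>2 \<in> extensional (verts Q)" using m by simp_all
  let ?F = "\<lambda>i. {h \<in> GL (\<alpha> i + \<beta> i). Psi (\<alpha> i) (\<beta> i) h = (W i, \<rho>1 i, \<rho>2 i)} :: 'k mat set"
  have "{g \<in> {g \<in> mGL Q (\<alpha> + \<beta>). mact Q g x \<in> mLow Q \<alpha> \<beta>}. datum \<alpha> \<beta> x g = e} =
    {g \<in> mGL Q (\<alpha> + \<beta>). datum \<alpha> \<beta> x g = e}"
    using datum_mem[OF x] e(1) by blast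
  also have "\<dots> = {g \<in> mGL Q (\<alpha> + \<beta>). \<forall>i\<in>verts Q. Psi (\<alpha> i) (\<beta> i) (g i) = (W i, \<rho>1 i, \<rho>2 i)}"
    unfolding eq datum_eq_iff[OF ext] ..
  also have "\<dots> = PiE (verts Q) ?F"
    unfolding mGL_def by (auto simp: PiE_def Pi_def)
  finally have "card {g \<in> {g \<in> mGL Q (\<alpha> + \<beta>). mact Q g x \<in> mLow Q \<alpha> \<beta>}. datum \<alpha> \<beta> x g = e} = (\<Prod>i\<in>verts Q. card (?F i))"
    by (simp add: card_PiE)
  also have "\<dots> = (\<Prod>i\<in>verts Q. CARD('k) ^ (\<alpha> i * \<beta> i))"
    using m by (intro prod.cong refl card_Psi_fibre) blast
  finally show ?thesis by (simp add: vdim_def power_sum)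
qed

lemma p1_datum:
  fixes x :: "'h \<Rightarrow> 'k :: {field, finite} mat"
  assumes x: "x \<in> mreps Q (\<alpha> + \<beta>)" and g: "g \<in> mGL Q (\<alpha> + \<beta>)" and L: "mact Q g x \<in> mLow Q \<alpha> \<beta>"
  shows "p1 Q \<alpha> \<beta> (datum \<alpha> \<beta> x g) = (Mrep Q (mTL Q \<alpha> (mact Q g x)), Mrep Q (mBR Q \<alpha> \<beta> (mact Q g x)))"
proof -
  note gx = mact_closed[OF g x]
  have "mact Q (Mfam Q g) (Mrep Q x) \<in> mLow Q \<alpha> \<beta>" unfolding mact_Mrep[OF g x] Mrep_mLow[OF gx] by (rule L)
  from quot_rep_eq[OF Mfam_mGL[OF g] Mrep_mreps[OF x] this]
  show ?thesis unfolding p1_def datum_def by (simp add: mact_Mrep[OF g x] Mrep_TL[OF gx] Mrep_BR[OF gx])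
qed

text \<open>The two successive push-forwards merge into one sum only if the intermediate fibre is finite.\<close>

lemma finite_E2_F_fibre: "finite {e \<in> E2_F Q \<alpha> \<beta>. p3 e = (z :: ('h, 'k :: {field, finite}) rep)}"
proof (rule finite_subset)
  let ?S = "\<lambda>i. {W :: 'k alg_closure vec set. VectorSpace.subspace class_ring W (kvec (\<alpha> i + \<beta> i)) \<and> map_vec frob ` W = W}"
  show "{e \<in> E2_F Q \<alpha> \<beta>. p3 e = z} \<subseteq> Pair z ` PiE (verts Q) ?S"
    by (auto simp: E2_F_def E2_def p3_def graded_subspaces_def PiE_def Pi_def image_iff)
  show "finite (Pair z ` PiE (verts Q) ?S)"
    by (intro finite_imageI finite_PiE finQ finite_frob_stable)
qed

text \<open>By \<open>sum_by_fibres\<close> the sum over \<open>g\<close> is \<open>q ^ vdim Q \<alpha> \<beta>\<close> times the sum over the points of \<open>E1_F\<close> above \<open>x\<close>, and this factor is the quotient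
  of the order of the parabolic subgroup by that of \<open>GL \<alpha> \<times> GL \<beta>\<close>.\<close>

lemma mult_op_eq_kmult:
  fixes \<Phi> :: "('h, 'k :: {field, finite}) rep \<times> ('h, 'k) rep \<Rightarrow> 'c :: field_char_0"
  assumes x: "x \<in> mreps Q (\<alpha> + \<beta>)"
  shows "mult_op Q \<alpha> \<beta> \<Phi> (Mrep Q x) = kmult Q \<alpha> \<beta> (\<lambda>u v. \<Phi> (Mrep Q u, Mrep Q v)) x"
proof -
  let ?D = "{g \<in> mGL Q (\<alpha> + \<beta>). mact Q g x \<in> mLow Q \<alpha> \<beta>}"
  let ?E = "{e \<in> E1_F Q \<alpha> \<beta>. fst e = Mrep Q x}"
  let ?T = "{e \<in> E2_F Q \<alpha> \<beta>. p3 e = Mrep Q x}"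
  have q: "CARD('k) ^ n > 0" for n by simp
  have D: "finite ?D" using finite_mGL by (rule finite_subset[rotated]) blast
  have mem: "datum \<alpha> \<beta> x g \<in> ?E" if "g \<in> ?D" for g
    using that datum_mem[OF x, of g] by (simp add: datum_def)
  have fib: "card {g \<in> ?D. datum \<alpha> \<beta> x g = e} = CARD('k) ^ vdim Q \<alpha> \<beta>" if "e \<in> ?E" for e
    using that by (intro card_datum_fibre[OF x]) simp_all
  \<comment> \<open>every fibre is nonempty since its size is a power of \<open>q\<close>; this gives finiteness of the set of points above \<open>x\<close>\<close>
  have "?E \<subseteq> datum \<alpha> \<beta> x ` ?D"
  proof
    fix e assume e: "e \<in> ?E"
    have "{g \<in> ?D. datum \<alpha> \<beta> x g = e} \<noteq> {}"
    proof
      assume "{g \<in> ?D. datum \<alpha> \<beta> x g = e} = {}"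
      then show False using fib[OF e] q[of "vdim Q \<alpha> \<beta>"] by (metis card.empty less_irrefl)
    qed
    then show "e \<in> datum \<alpha> \<beta> x ` ?D" by blast
  qed
  then have E: "finite ?E" by (rule finite_subset[OF _ finite_imageI[OF D]])
  have "(\<Sum>g\<in>?D. \<Phi> (Mrep Q (mTL Q \<alpha> (mact Q g x)), Mrep Q (mBR Q \<alpha> \<beta> (mact Q g x)))) =
    (\<Sum>g\<in>?D. \<Phi> (p1 Q \<alpha> \<beta> (datum \<alpha> \<beta> x g)))"
    by (intro sum.cong refl) (simp add: p1_datum[OF x])
  also have "\<dots> = of_nat (CARD('k) ^ vdim Q \<alpha> \<beta>) * (\<Sum>e\<in>?E. \<Phi> (p1 Q \<alpha> \<beta> e))"
    by (rule sum_by_fibres[OF D E mem fib])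
  finally have s: "(\<Sum>g\<in>?D. \<Phi> (Mrep Q (mTL Q \<alpha> (mact Q g x)), Mrep Q (mBR Q \<alpha> \<beta> (mact Q g x)))) =
    of_nat (CARD('k) ^ vdim Q \<alpha> \<beta>) * (\<Sum>e\<in>?E. \<Phi> (p1 Q \<alpha> \<beta> e))" .
  have p2: "p2 e \<in> ?T" if "e \<in> ?E" for e
    using that by (cases e) (simp add: p2_def p3_def E1_F_def)
  have "push (E2_F Q \<alpha> \<beta>) (rep_space_F Q (\<alpha> + \<beta>)) p3
       (push (E1_F Q \<alpha> \<beta>) (E2_F Q \<alpha> \<beta>) p2 (pull (E1_F Q \<alpha> \<beta>) (p1 Q \<alpha> \<beta>) \<Phi>)) (Mrep Q x) =
    (\<Sum>e2\<in>?T. push (E1_F Q \<alpha> \<beta>) (E2_F Q \<alpha> \<beta>) p2 (pull (E1_F Q \<alpha> \<beta>) (p1 Q \<alpha> \<beta>) \<Phi>) e2)"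
    using Mrep_mem[OF x] by (simp add: push_def)
  also have "\<dots> = (\<Sum>e2\<in>?T. \<Sum>e\<in>{e \<in> ?E. p2 e = e2}. \<Phi> (p1 Q \<alpha> \<beta> e))"
  proof (rule sum.cong[OF refl])
    fix e2 assume e2: "e2 \<in> ?T"
    have "{e \<in> E1_F Q \<alpha> \<beta>. p2 e = e2} = {e \<in> ?E. p2 e = e2}"
      using e2 by (auto simp: p2_def p3_def)
    then show "push (E1_F Q \<alpha> \<beta>) (E2_F Q \<alpha> \<beta>) p2 (pull (E1_F Q \<alpha> \<beta>) (p1 Q \<alpha> \<beta>) \<Phi>) e2 =
      (\<Sum>e\<in>{e \<in> ?E. p2 e = e2}. \<Phi> (p1 Q \<alpha> \<beta> e))"
      using e2 unfolding push_def pull_def by simp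
  qed
  also have "\<dots> = (\<Sum>e\<in>?E. \<Phi> (p1 Q \<alpha> \<beta> e))"
    by (rule sum.group[OF E finite_E2_F_fibre]) (use p2 in blast)
  finally have "mult_op Q \<alpha> \<beta> \<Phi> (Mrep Q x) =
    inverse (of_nat (card (mGL Q \<alpha> :: ('v \<Rightarrow> 'k mat) set) * card (mGL Q \<beta> :: ('v \<Rightarrow> 'k mat) set))) * (\<Sum>e\<in>?E. \<Phi> (p1 Q \<alpha> \<beta> e))"
    using Mrep_mem[OF x] by (simp add: mult_op_def card_cartesian_product card_gl_F)
  moreover have "(of_nat (CARD('k) ^ vdim Q \<alpha> \<beta>) :: 'c) \<noteq> 0" by simp
  ultimately show ?thesis unfolding kmult_def s card_mPar of_nat_mult by (simp add: field_simps)
qed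

lemma CF_minvariant:
  fixes f :: "('h, 'k :: {field, finite}) rep \<Rightarrow> 'c"
  assumes f: "f \<in> CF Q \<alpha>"
  shows "minvariant \<alpha> (\<lambda>x. f (Mrep Q x))"
  unfolding minvariant_def
proof (intro ballI)
  fix g :: "'v \<Rightarrow> 'k mat" and x :: "'h \<Rightarrow> 'k mat" assume g: "g \<in> mGL Q \<alpha>" and x: "x \<in> mreps Q \<alpha>"
  have "Mfam Q g \<in> gl_F Q \<alpha>" using bij_betwE[OF Mfam_bij] g by blast
  then have "f (gl_act Q \<alpha> (Mfam Q g) (Mrep Q x)) = f (Mrep Q x)" using f Mrep_mem[OF x] by (simp add: CF_def)
  then show "f (Mrep Q (mact Q g x)) = f (Mrep Q x)" by (simp add: gl_act_Mrep[OF g x])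
qed

lemma kmult_cong:
  assumes "\<And>u v. u \<in> mreps Q \<alpha> \<Longrightarrow> v \<in> mreps Q \<beta> \<Longrightarrow> \<Phi> u v = \<Psi> u v"
  shows "kmult Q \<alpha> \<beta> \<Phi> x = kmult Q \<alpha> \<beta> \<Psi> x"
  unfolding kmult_def by (intro arg_cong2[of _ _ _ _ "(*)"] refl sum.cong assms mTL_mreps mBR_mreps)

text \<open>With all operations expressed over the finite field, this is the Mackey formula; the values can lie in any field of
  characteristic 0.\<close>

theorem comult_hall_mult:
  fixes f g :: "('h, 'k :: {field, finite}) rep \<Rightarrow> 'c :: field_char_0"
  assumes d: "\<alpha> \<in> dim_vectors Q" "\<beta> \<in> dim_vectors Q" "\<alpha>' \<in> dim_vectors Q" "\<beta>' \<in> dim_vectors Q"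
    and \<gamma>: "\<alpha> + \<beta> = \<alpha>' + \<beta>'" and f: "f \<in> CF Q \<alpha>" and g: "g \<in> CF Q \<beta>"
  shows "comult Q \<alpha>' \<beta>' (hall_mult Q \<alpha> \<beta> f g) =
    (\<lambda>y\<in>rep_space_F Q \<alpha>' \<times> rep_space_F Q \<beta>'.
       \<Sum>(\<alpha>1, \<alpha>2, \<beta>1, \<beta>2)\<in>refinements Q \<alpha> \<beta> \<alpha>' \<beta>'.
         of_nat CARD('k) powi (- euler_form Q \<alpha>1 \<beta>2) *
         tensor_op (mult_op Q \<alpha>1 \<beta>1) (mult_op Q \<alpha>2 \<beta>2)
           (swap23 (tensor (comult Q \<alpha>1 \<alpha>2 f) (comult Q \<beta>1 \<beta>2 g))) y)"
    (is "?l = restrict ?r ?Y")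
proof
  fix y
  show "?l y = restrict ?r ?Y y"
  proof (cases "y \<in> ?Y")
    case True
    then obtain y1 y2 where y: "y1 \<in> mreps Q \<alpha>'" "y2 \<in> mreps Q \<beta>'" "y = (Mrep Q y1, Mrep Q y2)"
      using Mrep_bij[of \<alpha>'] Mrep_bij[of \<beta>'] unfolding bij_betw_def by (cases y) blast
    define f1 f2 where "f1 x = f (Mrep Q x)" and "f2 x = g (Mrep Q x)" for x
    have "?l y = kcomult Q \<alpha>' \<beta>' (\<lambda>x. hall_mult Q \<alpha> \<beta> f g (Mrep Q x)) y1 y2"
      unfolding y(3) by (rule comult_eq_kcomult[OF y(1,2)])
    also have "\<dots> = kcomult Q \<alpha>' \<beta>' (kmult Q \<alpha> \<beta> (\<lambda>u v. f1 u * f2 v)) y1 y2"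
    proof -
      have "hall_mult Q \<alpha> \<beta> f g (Mrep Q x) = kmult Q \<alpha> \<beta> (\<lambda>u v. f1 u * f2 v) x" if "x \<in> mfib Q \<alpha>' \<beta>' y1 y2" for x
      proof -
        have "x \<in> mreps Q (\<alpha> + \<beta>)" using that mLow_mreps unfolding \<gamma> by (auto simp: mfib_def)
        then show ?thesis unfolding hall_mult_def by (subst mult_op_eq_kmult) (simp_all add: tensor_def f1_def f2_def)
      qed
      then show ?thesis unfolding kcomult_def by simp
    qed
    also have "\<dots> = (\<Sum>(\<alpha>1, \<alpha>2, \<beta>1, \<beta>2)\<in>refinements Q \<alpha> \<beta> \<alpha>' \<beta>'.
       of_nat CARD('k) powi (- euler_form Q \<alpha>1 \<beta>2) *
       kmult Q \<alpha>1 \<beta>1 (\<lambda>u1 u2. kmult Q \<alpha>2 \<beta>2 (\<lambda>v1 v2.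
         kcomult Q \<alpha>1 \<alpha>2 f1 u1 v1 * kcomult Q \<beta>1 \<beta>2 f2 u2 v2) y2) y1)"
      using CF_minvariant[OF f] CF_minvariant[OF g] unfolding f1_def f2_def by (rule kcomult_kmult[OF d \<gamma> _ _ y(1,2)])
    also have "\<dots> = ?r y"
    proof (rule sum.cong[OF refl], clarify)
      fix \<alpha>1 \<alpha>2 \<beta>1 \<beta>2 assume "(\<alpha>1, \<alpha>2, \<beta>1, \<beta>2) \<in> refinements Q \<alpha> \<beta> \<alpha>' \<beta>'"
      then have a: "\<alpha>' = \<alpha>1 + \<beta>1" "\<beta>' = \<alpha>2 + \<beta>2" by (simp_all add: refinements_def)
      let ?H = "swap23 (tensor (comult Q \<alpha>1 \<alpha>2 f) (comult Q \<beta>1 \<beta>2 g))"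
      have "tensor_op (mult_op Q \<alpha>1 \<beta>1) (mult_op Q \<alpha>2 \<beta>2) ?H y =
        mult_op Q \<alpha>1 \<beta>1 (\<lambda>u. mult_op Q \<alpha>2 \<beta>2 (\<lambda>v. ?H (u, v)) (Mrep Q y2)) (Mrep Q y1)"
        unfolding y(3) tensor_op_def by simp
      also have "\<dots> = kmult Q \<alpha>1 \<beta>1 (\<lambda>u1 u2. mult_op Q \<alpha>2 \<beta>2 (\<lambda>v. ?H ((Mrep Q u1, Mrep Q u2), v)) (Mrep Q y2)) y1"
        by (rule mult_op_eq_kmult[OF y(1)[unfolded a]])
      also have "\<dots> = kmult Q \<alpha>1 \<beta>1 (\<lambda>u1 u2. kmult Q \<alpha>2 \<beta>2 (\<lambda>v1 v2. ?H ((Mrep Q u1, Mrep Q u2), (Mrep Q v1, Mrep Q v2))) y2) y1"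
        unfolding mult_op_eq_kmult[OF y(2)[unfolded a]] ..
      also have "\<dots> = kmult Q \<alpha>1 \<beta>1 (\<lambda>u1 u2. kmult Q \<alpha>2 \<beta>2 (\<lambda>v1 v2.
         kcomult Q \<alpha>1 \<alpha>2 f1 u1 v1 * kcomult Q \<beta>1 \<beta>2 f2 u2 v2) y2) y1"
        by (intro kmult_cong) (simp add: swap23_def tensor_def comult_eq_kcomult f1_def[abs_def] f2_def[abs_def])
      finally show "of_nat CARD('k) powi (- euler_form Q \<alpha>1 \<beta>2) *
        kmult Q \<alpha>1 \<beta>1 (\<lambda>u1 u2. kmult Q \<alpha>2 \<beta>2 (\<lambda>v1 v2.
         kcomult Q \<alpha>1 \<alpha>2 f1 u1 v1 * kcomult Q \<beta>1 \<beta>2 f2 u2 v2) y2) y1 =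
        of_nat CARD('k) powi (- euler_form Q \<alpha>1 \<beta>2) * tensor_op (mult_op Q \<alpha>1 \<beta>1) (mult_op Q \<alpha>2 \<beta>2) ?H y" by simp
    qed
    finally show ?thesis using True by simp
  qed (simp add: comult_def)
qed

end

theorem theorem3p8:
  fixes Q :: "('v, 'h) pre_digraph"
    and \<alpha> \<beta> \<alpha>' \<beta>' :: "'v \<Rightarrow> nat"
    and f g :: "('h, 'k :: {field, finite}) rep \<Rightarrow> 'l :: prime_card qlbar"
  assumes "fin_digraph Q"
    and "CARD('l) \<noteq> CHAR('k)"
    and "\<alpha> \<in> dim_vectors Q" "\<beta> \<in> dim_vectors Q" "\<alpha>' \<in> dim_vectors Q" "\<beta>' \<in> dim_vectors Q"
    and "\<alpha> + \<beta> = \<alpha>' + \<beta>'"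
    and "f \<in> CF Q \<alpha>" "g \<in> CF Q \<beta>"
  shows "comult Q \<alpha>' \<beta>' (hall_mult Q \<alpha> \<beta> f g) =
    (\<lambda>y\<in>rep_space_F Q \<alpha>' \<times> rep_space_F Q \<beta>'.
       \<Sum>(\<alpha>1, \<alpha>2, \<beta>1, \<beta>2)\<in>refinements Q \<alpha> \<beta> \<alpha>' \<beta>'.
         of_nat CARD('k) powi (- euler_form Q \<alpha>1 \<beta>2) *
         tensor_op (mult_op Q \<alpha>1 \<beta>1) (mult_op Q \<alpha>2 \<beta>2)
           (swap23 (tensor (comult Q \<alpha>1 \<alpha>2 f) (comult Q \<beta>1 \<beta>2 g))) y)"
proof -
  interpret quiver Q by (rule quiver.intro[OF assms(1)])
  show ?thesis using assms(3-) by (rule comult_hall_mult)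
qed

end
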